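(* Let $R$ be an associative ring, let $M$ be an $R^\circ$-module and $N$ be an $R$-module. If $F\xrightarrow{\simeq}M$ is a flat resolution and $N\xrightarrow{\simeq}I$ is an injective resolution, then there are isomorphisms $$\overline{\mathrm{Tor}}{}^R_i(M,N)\cong\mathrm{H}_i(F\,\overline{\otimes}_R\,I)\quad\text{and}\quad \widetilde{\mathrm{Tor}}{}^R_i(M,N)\cong\mathrm{H}_{i+1}(F\,\widetilde{\otimes}_R\,I)$$ for every $i\in\mathbb{Z}$, and they are natural in either argument.
   Context: Rings are associative with unit and are algebras over a commutative ring $\Bbbk$ (e.g. $\Bbbk=\mathbb{Z}$). An $R$-module is a left $R$-module; $R^\circ$ is the opposite ring, so $R^\circ$-modules are right $R$-modules. Complexes are indexed homologically. For an $R^\circ$-complex $X$ and an $R$-complex $Y$, the unbounded tensor product $X\,\overline{\otimes}_R\,Y$ is the $\Bbbk$-complex with degree $n$ term $\prod_{i\in\mathbb{Z}} X_i\otimes_R Y_{n-i}$ and differential given on elementary tensors by $\partial(x\otimes y)=\partial^X(x)\otimes y+(-1)^{i}x\otimes\partial^Y(y)$ for $x\in X_i$. It contains the usual tensor product $X\otimes_R Y$ (with degree $n$ term $\coprod_{i} X_i\otimes_R Y_{n-i}$) as a subcomplex, and the stable tensor product is $X\,\widetilde{\otimes}_R\,Y=(X\,\overline{\otimes}_R\,Y)/(X\otimes_R Y)$. For an $R^\circ$-module $M$ with projective resolution $P\to M$ and an $R$-module $N$ with injective resolution $N\to I$, the unbounded homology modules are $\overline{\mathrm{Tor}}{}^R_i(M,N)=\mathrm{H}_i(P\,\overline{\otimes}_R\,I)$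 and the stable homology modules are $\widetilde{\mathrm{Tor}}{}^R_i(M,N)=\mathrm{H}_{i+1}(P\,\widetilde{\otimes}_R\,I)$, $i\in\mathbb{Z}$. Both are independent of the choice of (projective and injective) resolutions and functorial in both arguments. *)

theory Defs
  imports "HOL-Algebra.AbelCoset" "HOL-Algebra.Module" "HOL-Algebra.Free_Abelian_Groups"
begin

no_notation Sum_Type.Plus (infixr \<open><+>\<close> 65)

section \<open>Rings, modules and homomorphisms\<close>

text \<open>An algebra over a commutative ring \<open>K\<close> is a ring with a structure map from \<open>K\<close> to its centre.
  Every ring is an algebra over the integers in exactly one way.\<close>

definition k_algebra :: "'k ring \<Rightarrow> ('k \<Rightarrow> 'r) \<Rightarrow> 'r ring \<Rightarrow> bool" where
  "k_algebra K \<eta> R \<longleftrightarrow> cring K \<and> ring R \<and> \<eta> \<in> ring_hom K R \<and>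
     (\<forall>c\<in>carrier K. \<forall>r\<in>carrier R. \<eta> c \<otimes>\<^bsub>R\<^esub> r = r \<otimes>\<^bsub>R\<^esub> \<eta> c)"

definition opp_ring :: "'r ring \<Rightarrow> 'r ring" where
  "opp_ring R = R\<lparr>mult := \<lambda>x y. y \<otimes>\<^bsub>R\<^esub> x\<rparr>"

text \<open>The library's \<open>module\<close> locale asks for a commutative ring of scalars; this is the same
  notion over an arbitrary ring. A right \<open>R\<close>-module is a left module \<open>A\<close> over \<open>opp_ring R\<close>,
  with \<open>r \<odot>\<^bsub>A\<^esub> a\<close> standing for the product of \<open>a\<close> by \<open>r\<close> on the right.\<close>

locale left_module = R?: ring R + M?: abelian_group M
  for R :: "'r ring" (structure) and M :: "('r, 'a) module" (structure) +
  assumes smult_closed [simp, intro]: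
      "\<lbrakk>r \<in> carrier R; x \<in> carrier M\<rbrakk> \<Longrightarrow> r \<odot>\<^bsub>M\<^esub> x \<in> carrier M"
    and smult_l_distr:
      "\<lbrakk>r \<in> carrier R; s \<in> carrier R; x \<in> carrier M\<rbrakk> \<Longrightarrow>
        (r \<oplus> s) \<odot>\<^bsub>M\<^esub> x = r \<odot>\<^bsub>M\<^esub> x \<oplus>\<^bsub>M\<^esub> s \<odot>\<^bsub>M\<^esub> x"
    and smult_r_distr:
      "\<lbrakk>r \<in> carrier R; x \<in> carrier M; y \<in> carrier M\<rbrakk> \<Longrightarrow>
        r \<odot>\<^bsub>M\<^esub> (x \<oplus>\<^bsub>M\<^esub> y) = r \<odot>\<^bsub>M\<^esub> x \<oplus>\<^bsub>M\<^esub> r \<odot>\<^bsub>M\<^esub> y"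
    and smult_assoc1:
      "\<lbrakk>r \<in> carrier R; s \<in> carrier R; x \<in> carrier M\<rbrakk> \<Longrightarrow>
        (r \<otimes> s) \<odot>\<^bsub>M\<^esub> x = r \<odot>\<^bsub>M\<^esub> (s \<odot>\<^bsub>M\<^esub> x)"
    and smult_one [simp]: "x \<in> carrier M \<Longrightarrow> \<one> \<odot>\<^bsub>M\<^esub> x = x"

lemma module_iff_left_module: "module K A \<longleftrightarrow> cring K \<and> left_module K A"
  by (auto simp: module_def module_axioms_def left_module_def left_module_axioms_def cring.axioms)

definition mod_hom :: "'r ring \<Rightarrow> ('r, 'a) module \<Rightarrow> ('r, 'b) module \<Rightarrow> ('a \<Rightarrow> 'b) set" where
  "mod_hom R A B = {f \<in> carrier A \<rightarrow> carrier B.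
     (\<forall>x\<in>carrier A. \<forall>y\<in>carrier A. f (x \<oplus>\<^bsub>A\<^esub> y) = f x \<oplus>\<^bsub>B\<^esub> f y) \<and>
     (\<forall>r\<in>carrier R. \<forall>x\<in>carrier A. f (r \<odot>\<^bsub>A\<^esub> x) = r \<odot>\<^bsub>B\<^esub> f x)}"

definition mod_iso :: "'r ring \<Rightarrow> ('r, 'a) module \<Rightarrow> ('r, 'b) module \<Rightarrow> ('a \<Rightarrow> 'b) set" where
  "mod_iso R A B = {f \<in> mod_hom R A B. bij_betw f (carrier A) (carrier B)}"

text \<open>The quotient of \<open>A\<close> by a submodule with carrier \<open>H\<close>, and the map that a homomorphism \<open>f\<close>
  into \<open>B\<close> induces on cosets of a submodule that \<open>f\<close> sends into \<open>H\<close>.\<close>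

definition induced_map :: "('r, 'b) module \<Rightarrow> 'b set \<Rightarrow> ('a \<Rightarrow> 'b) \<Rightarrow> 'a set \<Rightarrow> 'b set" where
  "induced_map B H f C = (\<Union>x\<in>C. H +>\<^bsub>B\<^esub> f x)"

definition quot_module :: "('r, 'a) module \<Rightarrow> 'a set \<Rightarrow> ('r, 'a set) module" where
  "quot_module A H = \<lparr>carrier = a_rcosets\<^bsub>A\<^esub> H, mult = undefined, one = undefined,
     ring.zero = H, add = set_add A, smult = (\<lambda>r. induced_map A H (\<lambda>x. r \<odot>\<^bsub>A\<^esub> x))\<rparr>"

definition prod_module :: "('i \<Rightarrow> ('r, 'a) module) \<Rightarrow> ('r, 'i \<Rightarrow> 'a) module" where
  "prod_module A = \<lparr>carrier = {z. \<forall>i. z i \<in> carrier (A i)}, mult = undefined, one = undefined,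
     ring.zero = (\<lambda>i. \<zero>\<^bsub>A i\<^esub>), add = (\<lambda>z w i. z i \<oplus>\<^bsub>A i\<^esub> w i), smult = (\<lambda>r z i. r \<odot>\<^bsub>A i\<^esub> z i)\<rparr>"

section \<open>The tensor product\<close>

text \<open>\<open>A\<close> is a right and \<open>B\<close> a left \<open>R\<close>-module. The tensor product is the free abelian group on
  \<open>carrier A \<times> carrier B\<close> modulo the subgroup generated by the biadditivity and balancing relations.\<close>

definition tensor_relations ::
    "'r ring \<Rightarrow> ('r, 'a) module \<Rightarrow> ('r, 'b) module \<Rightarrow> ('a \<times> 'b \<Rightarrow>\<^sub>0 int) set" where
  "tensor_relations R A B =
     {frag_of (a \<oplus>\<^bsub>A\<^esub> a', b) - frag_of (a, b) - frag_of (a', b) | a a' b.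
        a \<in> carrier A \<and> a' \<in> carrier A \<and> b \<in> carrier B} \<union>
     {frag_of (a, b \<oplus>\<^bsub>B\<^esub> b') - frag_of (a, b) - frag_of (a, b') | a b b'.
        a \<in> carrier A \<and> b \<in> carrier B \<and> b' \<in> carrier B} \<union>
     {frag_of (r \<odot>\<^bsub>A\<^esub> a, b) - frag_of (a, r \<odot>\<^bsub>B\<^esub> b) | a r b.
        a \<in> carrier A \<and> r \<in> carrier R \<and> b \<in> carrier B}"

definition tensor_pairs :: "('r, 'a) module \<Rightarrow> ('r, 'b) module \<Rightarrow> ('a \<times> 'b \<Rightarrow>\<^sub>0 int) monoid" where
  "tensor_pairs A B = free_Abelian_group (carrier A \<times> carrier B)"

definition tensor_kernel ::
    "'r ring \<Rightarrow> ('r, 'a) module \<Rightarrow> ('r, 'b) module \<Rightarrow> ('a \<times> 'b \<Rightarrow>\<^sub>0 int) set" where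
  "tensor_kernel R A B = generate (tensor_pairs A B) (tensor_relations R A B)"

definition tensor_group ::
    "'r ring \<Rightarrow> ('r, 'a) module \<Rightarrow> ('r, 'b) module \<Rightarrow> ('a \<times> 'b \<Rightarrow>\<^sub>0 int) set monoid" where
  "tensor_group R A B = tensor_pairs A B Mod tensor_kernel R A B"

text \<open>The map \<open>f \<otimes> g\<close> into the tensor product of \<open>A'\<close> and \<open>B'\<close>.\<close>

definition tensor_map ::
    "'r ring \<Rightarrow> ('r, 'c) module \<Rightarrow> ('r, 'd) module \<Rightarrow> ('a \<Rightarrow> 'c) \<Rightarrow> ('b \<Rightarrow> 'd) \<Rightarrow>
      ('a \<times> 'b \<Rightarrow>\<^sub>0 int) set \<Rightarrow> ('c \<times> 'd \<Rightarrow>\<^sub>0 int) set" where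
  "tensor_map R A' B' f g t =
     (\<Union>x\<in>t. tensor_kernel R A' B' #>\<^bsub>tensor_pairs A' B'\<^esub>
        frag_extend (\<lambda>(a, b). frag_of (f a, g b)) x)"

text \<open>The tensor product as a \<open>K\<close>-module, when \<open>R\<close> is a \<open>K\<close>-algebra via \<open>\<eta>\<close>.\<close>

definition tensor ::
    "('k \<Rightarrow> 'r) \<Rightarrow> 'r ring \<Rightarrow> ('r, 'a) module \<Rightarrow> ('r, 'b) module \<Rightarrow>
      ('k, ('a \<times> 'b \<Rightarrow>\<^sub>0 int) set) module" where
  "tensor \<eta> R A B = \<lparr>carrier = carrier (tensor_group R A B), mult = undefined, one = undefined,
     ring.zero = one (tensor_group R A B), add = mult (tensor_group R A B),
     smult = (\<lambda>c. tensor_map R A B (\<lambda>a. \<eta> c \<odot>\<^bsub>A\<^esub> a) id)\<rparr>"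

section \<open>Projective, flat and injective modules\<close>

text \<open>A definition cannot quantify over types, so the test modules below range over a fixed type,
  chosen large enough for the property to hold with test modules of all types: see
  \<open>projective_module_lift\<close>, \<open>injective_module_extend\<close> and \<open>flat_module_inj\<close>.\<close>

text \<open>The free module on the set \<open>carrier P\<close> lives on the type \<open>'p \<Rightarrow> 'r\<close> of the test modules \<open>A\<close>.\<close>

definition projective_module :: "'r ring \<Rightarrow> ('r, 'p) module \<Rightarrow> bool" where
  "projective_module R P \<longleftrightarrow> left_module R P \<and>
     (\<forall>(A :: ('r, 'p \<Rightarrow> 'r) module) (B :: ('r, 'p) module) g f.
        left_module R A \<and> left_module R B \<and> g \<in> mod_hom R A B \<and> g ` carrier A = carrier B \<and>
        f \<in> mod_hom R P B \<longrightarrow>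
        (\<exists>h\<in>mod_hom R P A. \<forall>x\<in>carrier P. g (h x) = f x))"

text \<open>By Baer's criterion, \<open>A\<close> a left ideal and \<open>B\<close> the ring itself suffice, and both have
  carriers in \<open>'r\<close>.\<close>

definition injective_module :: "'r ring \<Rightarrow> ('r, 'e) module \<Rightarrow> bool" where
  "injective_module R E \<longleftrightarrow> left_module R E \<and>
     (\<forall>(A :: ('r, 'r) module) (B :: ('r, 'r) module) g f.
        left_module R A \<and> left_module R B \<and> g \<in> mod_hom R A B \<and> inj_on g (carrier A) \<and>
        f \<in> mod_hom R A E \<longrightarrow>
        (\<exists>h\<in>mod_hom R B E. \<forall>x\<in>carrier A. h (g x) = f x))"

text \<open>\<open>F\<close> is a right \<open>R\<close>-module. An element of a tensor product, and a proof that it vanishes,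
  involve only finitely generated submodules; those are quotients of some \<open>R\<^sup>n\<close>, hence have
  isomorphic copies on the type \<open>nat \<Rightarrow> 'r\<close>.\<close>

definition flat_module :: "'r ring \<Rightarrow> ('r, 'f) module \<Rightarrow> bool" where
  "flat_module R F \<longleftrightarrow> left_module (opp_ring R) F \<and>
     (\<forall>(A :: ('r, nat \<Rightarrow> 'r) module) (B :: ('r, nat \<Rightarrow> 'r) module) g.
        left_module R A \<and> left_module R B \<and> g \<in> mod_hom R A B \<and> inj_on g (carrier A) \<longrightarrow>
        inj_on (tensor_map R F B id g) (carrier (tensor_group R F A)))"

subsection \<open>Homomorphisms and submodules\<close>

lemma mod_homD:
  assumes "f \<in> mod_hom R A B"
  shows "x \<in> carrier A \<Longrightarrow> f x \<in> carrier B"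
    and "x \<in> carrier A \<Longrightarrow> y \<in> carrier A \<Longrightarrow> f (x \<oplus>\<^bsub>A\<^esub> y) = f x \<oplus>\<^bsub>B\<^esub> f y"
    and "r \<in> carrier R \<Longrightarrow> x \<in> carrier A \<Longrightarrow> f (r \<odot>\<^bsub>A\<^esub> x) = r \<odot>\<^bsub>B\<^esub> f x"
  using assms by (auto simp: mod_hom_def)

lemma (in left_module) smult_l_null [simp]: "x \<in> carrier M \<Longrightarrow> \<zero> \<odot>\<^bsub>M\<^esub> x = \<zero>\<^bsub>M\<^esub>"
  using smult_l_distr[of \<zero> \<zero> x] M.add.l_cancel_one'[of "\<zero> \<odot>\<^bsub>M\<^esub> x" "\<zero> \<odot>\<^bsub>M\<^esub> x"] by simp

lemma (in left_module) smult_r_null [simp]: "r \<in> carrier R \<Longrightarrow> r \<odot>\<^bsub>M\<^esub> \<zero>\<^bsub>M\<^esub> = \<zero>\<^bsub>M\<^esub>"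
  using smult_r_distr[of r "\<zero>\<^bsub>M\<^esub>" "\<zero>\<^bsub>M\<^esub>"]
    M.add.l_cancel_one'[of "r \<odot>\<^bsub>M\<^esub> \<zero>\<^bsub>M\<^esub>" "r \<odot>\<^bsub>M\<^esub> \<zero>\<^bsub>M\<^esub>"] by simp

lemma (in left_module) smult_l_minus:
  "r \<in> carrier R \<Longrightarrow> x \<in> carrier M \<Longrightarrow> (\<ominus> r) \<odot>\<^bsub>M\<^esub> x = \<ominus>\<^bsub>M\<^esub> (r \<odot>\<^bsub>M\<^esub> x)"
  using smult_l_distr[of "\<ominus> r" r x] by (intro M.minus_equality[symmetric]) (simp_all add: R.l_neg)

lemma mod_hom_zero:
  assumes "left_module R A" "left_module R B" "f \<in> mod_hom R A B"
  shows "f \<zero>\<^bsub>A\<^esub> = \<zero>\<^bsub>B\<^esub>"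
proof -
  interpret A: left_module R A by fact
  interpret B: left_module R B by fact
  show ?thesis
    using mod_homD(3)[OF assms(3), of "\<zero>\<^bsub>R\<^esub>" "\<zero>\<^bsub>A\<^esub>"] mod_homD(1)[OF assms(3), of "\<zero>\<^bsub>A\<^esub>"] by simp
qed

lemma mod_hom_comp:
  "f \<in> mod_hom R A B \<Longrightarrow> g \<in> mod_hom R B C \<Longrightarrow> (\<lambda>x. g (f x)) \<in> mod_hom R A C"
  by (auto simp: mod_hom_def Pi_iff)

lemma (in left_module) submodule_left_module:
  assumes "S \<subseteq> carrier M" "\<zero>\<^bsub>M\<^esub> \<in> S"
    and "\<And>x y. x \<in> S \<Longrightarrow> y \<in> S \<Longrightarrow> x \<oplus>\<^bsub>M\<^esub> y \<in> S"
    and "\<And>r x. r \<in> carrier R \<Longrightarrow> x \<in> S \<Longrightarrow> r \<odot>\<^bsub>M\<^esub> x \<in> S"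
  shows "left_module R (M\<lparr>carrier := S\<rparr>)"
proof -
  have sub: "\<And>x. x \<in> S \<Longrightarrow> x \<in> carrier M" using assms(1) by auto
  have neg: "\<ominus>\<^bsub>M\<^esub> x \<in> S" if "x \<in> S" for x
    using assms(4)[of "\<ominus> \<one>" x] that smult_l_minus[of \<one> x] sub by simp
  show ?thesis
  proof (intro left_module.intro left_module_axioms.intro abelian_groupI, simp_all add: assms sub)
    show "ring R" by (rule R.ring_axioms)
    show "\<exists>y\<in>S. y \<oplus>\<^bsub>M\<^esub> x = \<zero>\<^bsub>M\<^esub>" if "x \<in> S" for x
      using neg[OF that] M.l_neg[OF sub[OF that]] by blast
  qed (auto simp: sub M.a_ac smult_l_distr smult_r_distr smult_assoc1)
qed

lemma mod_hom_image_module: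
  assumes "left_module R A" "left_module R B" "f \<in> mod_hom R A B"
  shows "left_module R (B\<lparr>carrier := f ` carrier A\<rparr>)"
proof -
  interpret A: left_module R A by fact
  interpret B: left_module R B by fact
  note h = mod_homD[OF assms(3)]
  show ?thesis
  proof (rule B.submodule_left_module)
    show "\<zero>\<^bsub>B\<^esub> \<in> f ` carrier A"
      using mod_hom_zero[OF assms] by (metis A.M.zero_closed imageI)
  qed (auto simp: h simp flip: h(2,3))
qed

subsection \<open>Free modules\<close>

definition free_module :: "'r ring \<Rightarrow> 's set \<Rightarrow> ('r, 's \<Rightarrow> 'r) module" where
  "free_module R S = (prod_module (\<lambda>_. \<lparr>carrier = carrier R, mult = mult R, one = one R,
       ring.zero = \<zero>\<^bsub>R\<^esub>, add = add R, smult = mult R\<rparr>))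
     \<lparr>carrier := {v. (\<forall>s. v s \<in> carrier R) \<and> finite {s. v s \<noteq> \<zero>\<^bsub>R\<^esub>} \<and> {s. v s \<noteq> \<zero>\<^bsub>R\<^esub>} \<subseteq> S}\<rparr>"

lemma free_module_simps [simp]:
  "v \<in> carrier (free_module R S) \<longleftrightarrow>
     (\<forall>s. v s \<in> carrier R) \<and> finite {s. v s \<noteq> \<zero>\<^bsub>R\<^esub>} \<and> {s. v s \<noteq> \<zero>\<^bsub>R\<^esub>} \<subseteq> S"
  "\<zero>\<^bsub>free_module R S\<^esub> = (\<lambda>s. \<zero>\<^bsub>R\<^esub>)"
  "v \<oplus>\<^bsub>free_module R S\<^esub> w = (\<lambda>s. v s \<oplus>\<^bsub>R\<^esub> w s)"
  "r \<odot>\<^bsub>free_module R S\<^esub> v = (\<lambda>s. r \<otimes>\<^bsub>R\<^esub> v s)"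
  by (simp_all add: free_module_def prod_module_def)

lemma free_module_left_module:
  assumes "ring R"
  shows "left_module R (free_module R S)"
proof -
  interpret ring R by fact
  have sup: "{s. v s \<oplus>\<^bsub>R\<^esub> w s \<noteq> \<zero>\<^bsub>R\<^esub>} \<subseteq> {s. v s \<noteq> \<zero>\<^bsub>R\<^esub>} \<union> {s. w s \<noteq> \<zero>\<^bsub>R\<^esub>}"
    for v w :: "'b \<Rightarrow> 'a" by auto
  have fin: "finite {s. v s \<oplus>\<^bsub>R\<^esub> w s \<noteq> \<zero>\<^bsub>R\<^esub>}"
    if "finite {s. v s \<noteq> \<zero>\<^bsub>R\<^esub>}" "finite {s. w s \<noteq> \<zero>\<^bsub>R\<^esub>}" for v w :: "'b \<Rightarrow> 'a"
    by (rule finite_subset[OF sup finite_UnI[OF that]])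
  have fin': "finite {s. f (v s) \<noteq> \<zero>\<^bsub>R\<^esub>}" if "finite {s. v s \<noteq> \<zero>\<^bsub>R\<^esub>}" "f \<zero>\<^bsub>R\<^esub> = \<zero>\<^bsub>R\<^esub>"
    for v :: "'b \<Rightarrow> 'a" and f
    by (rule finite_subset[OF _ that(1)]) (use that(2) in auto)
  show ?thesis
  proof (intro left_module.intro left_module_axioms.intro abelian_groupI)
    fix x assume "x \<in> carrier (free_module R S)"
    then show "\<exists>y\<in>carrier (free_module R S). y \<oplus>\<^bsub>free_module R S\<^esub> x = \<zero>\<^bsub>free_module R S\<^esub>"
      using fin'[of x "\<lambda>a. \<ominus>\<^bsub>R\<^esub> a"]
      by (intro bexI[of _ "\<lambda>s. \<ominus>\<^bsub>R\<^esub> x s"]) (auto simp: l_neg)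
  next
    fix x y assume "x \<in> carrier (free_module R S)" "y \<in> carrier (free_module R S)"
    then show "x \<oplus>\<^bsub>free_module R S\<^esub> y \<in> carrier (free_module R S)"
      using fin[of x y] sup[of x y] by simp blast
  next
    fix r x assume "r \<in> carrier R" "x \<in> carrier (free_module R S)"
    then show "r \<odot>\<^bsub>free_module R S\<^esub> x \<in> carrier (free_module R S)"
      using fin'[of x "\<lambda>a. r \<otimes>\<^bsub>R\<^esub> a"] by auto
  qed (auto simp: assms a_ac l_distr r_distr m_assoc)
qed

definition lincomb :: "'r ring \<Rightarrow> ('r, 'a) module \<Rightarrow> ('s \<Rightarrow> 'a) \<Rightarrow> ('s \<Rightarrow> 'r) \<Rightarrow> 'a" where
  "lincomb R A a v = finsum A (\<lambda>s. v s \<odot>\<^bsub>A\<^esub> a s) {s. v s \<noteq> \<zero>\<^bsub>R\<^esub>}"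

lemma lincomb_superset:
  assumes "left_module R A" "a \<in> S \<rightarrow> carrier A" "v \<in> carrier (free_module R S)"
    and "finite T" "{s. v s \<noteq> \<zero>\<^bsub>R\<^esub>} \<subseteq> T" "T \<subseteq> S"
  shows "lincomb R A a v = finsum A (\<lambda>s. v s \<odot>\<^bsub>A\<^esub> a s) T"
proof -
  interpret left_module R A by fact
  show ?thesis unfolding lincomb_def
    by (rule M.add.finprod_mono_neutral_cong_left) (use assms in \<open>auto simp: Pi_iff\<close>)
qed

lemma lincomb_hom:
  assumes "left_module R A" "a \<in> S \<rightarrow> carrier A"
  shows "lincomb R A a \<in> mod_hom R (free_module R S) A"
proof -
  interpret left_module R A by fact
  have cl: "(\<lambda>s. v s \<odot>\<^bsub>A\<^esub> a s) \<in> T \<rightarrow> carrier A"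
    if "v \<in> carrier (free_module R S)" "T \<subseteq> S" for v T
    using that assms(2) by auto
  interpret L: left_module R "free_module R S"
    by (rule free_module_left_module) (rule R.ring_axioms)
  show ?thesis unfolding mod_hom_def
  proof (intro CollectI conjI ballI Pi_I)
    fix v assume "v \<in> carrier (free_module R S)"
    then show "lincomb R A a v \<in> carrier A"
      unfolding lincomb_def by (intro M.finsum_closed cl) auto
  next
    fix v w assume v: "v \<in> carrier (free_module R S)" and w: "w \<in> carrier (free_module R S)"
    let ?T = "{s. v s \<noteq> \<zero>\<^bsub>R\<^esub>} \<union> {s. w s \<noteq> \<zero>\<^bsub>R\<^esub>}"
    have T: "finite ?T" "?T \<subseteq> S" using v w by auto
    have vw: "v \<oplus>\<^bsub>free_module R S\<^esub> w \<in> carrier (free_module R S)" using v w by (rule L.M.add.m_closed)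
    have "lincomb R A a (v \<oplus>\<^bsub>free_module R S\<^esub> w)
        = finsum A (\<lambda>s. v s \<odot>\<^bsub>A\<^esub> a s \<oplus>\<^bsub>A\<^esub> w s \<odot>\<^bsub>A\<^esub> a s) ?T"
      apply (subst lincomb_superset[OF assms vw T(1) _ T(2)])
       apply (auto)[1]
      apply (rule M.finsum_cong')
      using cl[OF v T(2)] cl[OF w T(2)] v w assms(2) T(2) by (auto simp: Pi_iff subset_iff intro!: smult_l_distr)
    also have "\<dots> = lincomb R A a v \<oplus>\<^bsub>A\<^esub> lincomb R A a w"
      using cl[OF v T(2)] cl[OF w T(2)]
      by (simp add: lincomb_superset[OF assms v T(1) _ T(2)] lincomb_superset[OF assms w T(1) _ T(2)]
          M.finsum_addf)
    finally show "lincomb R A a (v \<oplus>\<^bsub>free_module R S\<^esub> w) = lincomb R A a v \<oplus>\<^bsub>A\<^esub> lincomb R A a w" .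
  next
    fix r v assume r: "r \<in> carrier R" and v: "v \<in> carrier (free_module R S)"
    let ?T = "{s. v s \<noteq> \<zero>\<^bsub>R\<^esub>}"
    have T: "finite ?T" "?T \<subseteq> S" using v by auto
    have rv: "r \<odot>\<^bsub>free_module R S\<^esub> v \<in> carrier (free_module R S)" using r v by (rule L.smult_closed)
    have sum: "finsum A (\<lambda>s. r \<odot>\<^bsub>A\<^esub> (v s \<odot>\<^bsub>A\<^esub> a s)) U = r \<odot>\<^bsub>A\<^esub> finsum A (\<lambda>s. v s \<odot>\<^bsub>A\<^esub> a s) U"
      if "finite U" "U \<subseteq> S" for U
      using that
    proof (induction U rule: finite_induct)
      case (insert u U)
      have c: "(\<lambda>s. v s \<odot>\<^bsub>A\<^esub> a s) \<in> U \<rightarrow> carrier A" "v u \<odot>\<^bsub>A\<^esub> a u \<in> carrier A"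
        using cl[OF v, of "insert u U"] insert.prems by auto
      then have "(\<lambda>s. r \<odot>\<^bsub>A\<^esub> (v s \<odot>\<^bsub>A\<^esub> a s)) \<in> U \<rightarrow> carrier A" using r by auto
      with c insert r show ?case by (simp add: M.finsum_insert smult_r_distr M.finsum_closed)
    qed (use r in simp)
    have "lincomb R A a (r \<odot>\<^bsub>free_module R S\<^esub> v) = finsum A (\<lambda>s. r \<odot>\<^bsub>A\<^esub> (v s \<odot>\<^bsub>A\<^esub> a s)) ?T"
      apply (subst lincomb_superset[OF assms rv T(1) _ T(2)])
      using r apply (auto)[1]
      apply (rule M.finsum_cong')
      using cl[OF v T(2)] v r assms(2) T(2) by (auto simp: Pi_iff subset_iff intro!: smult_assoc1)
    then show "lincomb R A a (r \<odot>\<^bsub>free_module R S\<^esub> v) = r \<odot>\<^bsub>A\<^esub> lincomb R A a v"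
      using sum[OF T] by (simp add: lincomb_def)
  qed
qed

lemma lincomb_unit:
  assumes "left_module R A" "a \<in> S \<rightarrow> carrier A" "s \<in> S"
  shows "\<exists>v\<in>carrier (free_module R S). lincomb R A a v = a s"
proof -
  interpret left_module R A by fact
  let ?v = "\<lambda>t. if t = s then \<one>\<^bsub>R\<^esub> else \<zero>\<^bsub>R\<^esub>"
  have v: "?v \<in> carrier (free_module R S)" using assms(3) by auto
  have "lincomb R A a ?v = finsum A (\<lambda>t. ?v t \<odot>\<^bsub>A\<^esub> a t) {s}"
    by (rule lincomb_superset[OF assms(1,2) v]) (use assms(3) in auto)
  also have "\<dots> = a s" using assms by (auto simp: Pi_iff)
  finally show ?thesis using v by blast
qed

lemma hom_lincomb:
  assumes "left_module R A" "left_module R B" "f \<in> mod_hom R A B"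
    and "a \<in> S \<rightarrow> carrier A" "v \<in> carrier (free_module R S)"
  shows "f (lincomb R A a v) = lincomb R B (\<lambda>s. f (a s)) v"
proof -
  interpret A: left_module R A by fact
  interpret B: left_module R B by fact
  note h = mod_homD[OF assms(3)]
  have "f (finsum A (\<lambda>s. v s \<odot>\<^bsub>A\<^esub> a s) U) = finsum B (\<lambda>s. v s \<odot>\<^bsub>B\<^esub> f (a s)) U"
    if "finite U" "U \<subseteq> S" for U
    using that
  proof (induction U rule: finite_induct)
    case empty then show ?case using mod_hom_zero[OF assms(1-3)] by simp
  next
    case (insert u U)
    have "(\<lambda>s. v s \<odot>\<^bsub>A\<^esub> a s) \<in> U \<rightarrow> carrier A" "v u \<odot>\<^bsub>A\<^esub> a u \<in> carrier A"
      "(\<lambda>s. v s \<odot>\<^bsub>B\<^esub> f (a s)) \<in> U \<rightarrow> carrier B" "v u \<odot>\<^bsub>B\<^esub> f (a u) \<in> carrier B"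
      using insert.prems assms(4,5) h(1) by (auto simp: Pi_iff)
    moreover have "f (v u \<odot>\<^bsub>A\<^esub> a u) = v u \<odot>\<^bsub>B\<^esub> f (a u)"
      using insert.prems assms(4,5) h(3) by (auto simp: Pi_iff)
    ultimately show ?case using insert h(2) by (simp add: A.M.finsum_closed)
  qed
  then show ?thesis using assms(5) unfolding lincomb_def by simp
qed

subsection \<open>Lifting along arbitrary surjections\<close>

lemma projective_module_lift:
  assumes "projective_module R P" "left_module R A" "left_module R B"
    and g: "g \<in> mod_hom R A B" "g ` carrier A = carrier B" and f: "f \<in> mod_hom R P B"
  shows "\<exists>h\<in>mod_hom R P A. \<forall>x\<in>carrier P. g (h x) = f x"
proof -
  from assms(1) have P: "left_module R P" by (simp add: projective_module_def)
  then interpret P: left_module R P .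
  let ?L = "free_module R (carrier P)"
  let ?\<pi> = "lincomb R P (\<lambda>x. x)"
  have L: "left_module R ?L" by (rule free_module_left_module) (rule P.R.ring_axioms)
  have \<pi>: "?\<pi> \<in> mod_hom R ?L P" by (rule lincomb_hom[OF P]) auto
  have "?\<pi> ` carrier ?L = carrier P"
    using lincomb_unit[OF P, of "\<lambda>x. x" "carrier P"] mod_homD(1)[OF \<pi>]
    by (auto simp: image_iff simp del: free_module_simps)
  moreover have "(\<lambda>x. x) \<in> mod_hom R P P" by (auto simp: mod_hom_def)
  ultimately obtain s where s: "s \<in> mod_hom R P ?L" "\<And>x. x \<in> carrier P \<Longrightarrow> ?\<pi> (s x) = x"
    using assms(1) L P \<pi> unfolding projective_module_def by meson
  define a where "a x = (SOME y. y \<in> carrier A \<and> g y = f x)" for x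
  have a: "a x \<in> carrier A" "g (a x) = f x" if "x \<in> carrier P" for x
  proof -
    have "\<exists>y. y \<in> carrier A \<and> g y = f x" using g(2) mod_homD(1)[OF f that] by (metis imageE)
    from someI_ex[OF this] show "a x \<in> carrier A" "g (a x) = f x" by (auto simp: a_def)
  qed
  have aP: "a \<in> carrier P \<rightarrow> carrier A" using a by auto
  have "g (lincomb R A a (s x)) = f x" if x: "x \<in> carrier P" for x
  proof -
    have v: "s x \<in> carrier ?L" using mod_homD(1)[OF s(1) x] .
    have "g (lincomb R A a (s x)) = lincomb R B (\<lambda>s. g (a s)) (s x)"
      by (rule hom_lincomb[OF assms(2,3) g(1) aP v])
    also have "\<dots> = lincomb R B f (s x)"
    proof -
      interpret B: left_module R B by fact
      show ?thesis unfolding lincomb_def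
        by (rule B.M.finsum_cong') (use v a mod_homD(1)[OF f] in \<open>auto simp: subset_iff\<close>)
    qed
    also have "\<dots> = f (?\<pi> (s x))"
      using hom_lincomb[OF P assms(3) f _ v, of "\<lambda>x. x"] by simp
    finally show ?thesis using s(2)[OF x] by simp
  qed
  then show ?thesis using mod_hom_comp[OF s(1) lincomb_hom[OF assms(2) aP]] by (intro bexI) auto
qed

subsection \<open>Baer's criterion: extension along arbitrary injections\<close>

definition regular_module :: "'r ring \<Rightarrow> ('r, 'r) module" where
  "regular_module R = \<lparr>carrier = carrier R, mult = mult R, one = one R,
     ring.zero = \<zero>\<^bsub>R\<^esub>, add = add R, smult = mult R\<rparr>"

lemma regular_module_simps [simp]:
  "carrier (regular_module R) = carrier R" "\<zero>\<^bsub>regular_module R\<^esub> = \<zero>\<^bsub>R\<^esub>"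
  "x \<oplus>\<^bsub>regular_module R\<^esub> y = x \<oplus>\<^bsub>R\<^esub> y" "r \<odot>\<^bsub>regular_module R\<^esub> x = r \<otimes>\<^bsub>R\<^esub> x"
  by (simp_all add: regular_module_def)

lemma regular_module_left_module:
  assumes "ring R"
  shows "left_module R (regular_module R)"
proof -
  interpret ring R by fact
  show ?thesis
  proof (intro left_module.intro left_module_axioms.intro abelian_groupI)
    show "\<exists>y\<in>carrier (regular_module R). y \<oplus>\<^bsub>regular_module R\<^esub> x = \<zero>\<^bsub>regular_module R\<^esub>"
      if "x \<in> carrier (regular_module R)" for x
      using that by (intro bexI[of _ "\<ominus>\<^bsub>R\<^esub> x"]) (auto simp: l_neg)
  qed (auto simp: assms a_ac l_distr r_distr m_assoc)
qed

definition partial_extensions ::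
    "'r ring \<Rightarrow> ('r, 'b) module \<Rightarrow> ('r, 'e) module \<Rightarrow> ('b \<times> 'e) set \<Rightarrow> ('b \<times> 'e) set set" where
  "partial_extensions R B E G\<^sub>0 = {G. G\<^sub>0 \<subseteq> G \<and> G \<subseteq> carrier B \<times> carrier E \<and>
     (\<forall>x e y d. (x, e) \<in> G \<longrightarrow> (y, d) \<in> G \<longrightarrow> (x \<oplus>\<^bsub>B\<^esub> y, e \<oplus>\<^bsub>E\<^esub> d) \<in> G) \<and>
     (\<forall>r x e. r \<in> carrier R \<longrightarrow> (x, e) \<in> G \<longrightarrow> (r \<odot>\<^bsub>B\<^esub> x, r \<odot>\<^bsub>E\<^esub> e) \<in> G) \<and>
     (\<forall>e. (\<zero>\<^bsub>B\<^esub>, e) \<in> G \<longrightarrow> e = \<zero>\<^bsub>E\<^esub>)}"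

lemma partial_extensionsD:
  assumes "G \<in> partial_extensions R B E G\<^sub>0"
  shows "G\<^sub>0 \<subseteq> G" and "G \<subseteq> carrier B \<times> carrier E"
    and "(x, e) \<in> G \<Longrightarrow> (y, d) \<in> G \<Longrightarrow> (x \<oplus>\<^bsub>B\<^esub> y, e \<oplus>\<^bsub>E\<^esub> d) \<in> G"
    and "r \<in> carrier R \<Longrightarrow> (x, e) \<in> G \<Longrightarrow> (r \<odot>\<^bsub>B\<^esub> x, r \<odot>\<^bsub>E\<^esub> e) \<in> G"
    and "(\<zero>\<^bsub>B\<^esub>, e) \<in> G \<Longrightarrow> e = \<zero>\<^bsub>E\<^esub>"
  using assms by (simp_all add: partial_extensions_def)

lemma injective_module_extend:
  assumes "injective_module R E" and A: "left_module R A" and B: "left_module R B"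
    and g: "g \<in> mod_hom R A B" "inj_on g (carrier A)" and f: "f \<in> mod_hom R A E"
  shows "\<exists>h\<in>mod_hom R B E. \<forall>x\<in>carrier A. h (g x) = f x"
proof -
  from assms(1) have E: "left_module R E" by (simp add: injective_module_def)
  interpret A: left_module R A by fact
  interpret B: left_module R B by fact
  interpret E: left_module R E by fact
  note gD = mod_homD[OF g(1)] and fD = mod_homD[OF f]
  define G\<^sub>0 where "G\<^sub>0 = (\<lambda>a. (g a, f a)) ` carrier A"
  let ?Q = "partial_extensions R B E G\<^sub>0"
  have g0: "g x = \<zero>\<^bsub>B\<^esub> \<longleftrightarrow> x = \<zero>\<^bsub>A\<^esub>" if "x \<in> carrier A" for x
    using that g(2) mod_hom_zero[OF A B g(1)] by (metis A.M.zero_closed inj_on_def)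
  have "G\<^sub>0 \<in> ?Q"
    unfolding partial_extensions_def G\<^sub>0_def
    using gD fD g0 mod_hom_zero[OF A E f]
    by (auto simp: image_iff) (metis A.M.add.m_closed, metis A.smult_closed, metis)
  moreover have "\<Union>C \<in> ?Q" if C: "C \<noteq> {}" "subset.chain ?Q C" for C
  proof -
    have m: "G \<in> ?Q" if "G \<in> C" for G using C(2) that by (auto simp: subset.chain_def)
    have chain: "G \<subseteq> H \<or> H \<subseteq> G" if "G \<in> C" "H \<in> C" for G H
      using C(2) that by (auto simp: subset_chain_def)
    have add: "(x \<oplus>\<^bsub>B\<^esub> y, e \<oplus>\<^bsub>E\<^esub> d) \<in> \<Union>C" if xe: "(x, e) \<in> \<Union>C" and yd: "(y, d) \<in> \<Union>C" for x e y d
    proof -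
      obtain H where "H \<in> C" "(x, e) \<in> H" "(y, d) \<in> H" using xe yd chain by blast
      then show ?thesis using partial_extensionsD(3)[OF m] by blast
    qed
    show ?thesis unfolding partial_extensions_def mem_Collect_eq
    proof (intro conjI allI impI)
      show "G\<^sub>0 \<subseteq> \<Union>C" using C(1) partial_extensionsD(1)[OF m] by blast
      show "\<Union>C \<subseteq> carrier B \<times> carrier E" using partial_extensionsD(2)[OF m] by blast
      fix r x e assume "r \<in> carrier R" "(x, e) \<in> \<Union>C"
      then show "(r \<odot>\<^bsub>B\<^esub> x, r \<odot>\<^bsub>E\<^esub> e) \<in> \<Union>C" using partial_extensionsD(4)[OF m] by blast
    next
      fix e assume "(\<zero>\<^bsub>B\<^esub>, e) \<in> \<Union>C"
      then show "e = \<zero>\<^bsub>E\<^esub>" using partial_extensionsD(5)[OF m] by blast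
    qed (use add in blast)
  qed
  ultimately obtain G where G: "G \<in> ?Q" and max: "\<And>H. H \<in> ?Q \<Longrightarrow> G \<subseteq> H \<Longrightarrow> H = G"
    using subset_Zorn_nonempty[of ?Q] by blast
  have sub: "G\<^sub>0 \<subseteq> G" and car: "\<And>x e. (x, e) \<in> G \<Longrightarrow> x \<in> carrier B \<and> e \<in> carrier E"
    and add: "\<And>x e y d. (x, e) \<in> G \<Longrightarrow> (y, d) \<in> G \<Longrightarrow> (x \<oplus>\<^bsub>B\<^esub> y, e \<oplus>\<^bsub>E\<^esub> d) \<in> G"
    and sm: "\<And>r x e. r \<in> carrier R \<Longrightarrow> (x, e) \<in> G \<Longrightarrow> (r \<odot>\<^bsub>B\<^esub> x, r \<odot>\<^bsub>E\<^esub> e) \<in> G"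
    and z: "\<And>e. (\<zero>\<^bsub>B\<^esub>, e) \<in> G \<Longrightarrow> e = \<zero>\<^bsub>E\<^esub>"
    using partial_extensionsD[OF G] by auto
  have neg: "(\<ominus>\<^bsub>B\<^esub> x, \<ominus>\<^bsub>E\<^esub> e) \<in> G" if "(x, e) \<in> G" for x e
    using sm[of "\<ominus>\<^bsub>R\<^esub> \<one>\<^bsub>R\<^esub>", OF _ that] car[OF that] by (simp add: B.smult_l_minus E.smult_l_minus)
  have fn: "e = d" if "(x, e) \<in> G" "(x, d) \<in> G" for x e d
    using z[of "e \<oplus>\<^bsub>E\<^esub> \<ominus>\<^bsub>E\<^esub> d"] add[OF that(1) neg[OF that(2)]] car[OF that(1)] car[OF that(2)]
    by (metis B.M.r_neg E.M.add.inv_closed E.M.add.inv_equality E.M.minus_minus)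
  have zero: "(\<zero>\<^bsub>B\<^esub>, \<zero>\<^bsub>E\<^esub>) \<in> G"
    using sub mod_hom_zero[OF A B g(1)] mod_hom_zero[OF A E f] A.M.zero_closed
    unfolding G\<^sub>0_def by force
  have total: "\<exists>e. (b, e) \<in> G" if b: "b \<in> carrier B" for b
  proof -
    define I where "I = {r \<in> carrier R. \<exists>e. (r \<odot>\<^bsub>B\<^esub> b, e) \<in> G}"
    define \<phi> where "\<phi> r = (SOME e. (r \<odot>\<^bsub>B\<^esub> b, e) \<in> G)" for r
    have \<phi>: "(r \<odot>\<^bsub>B\<^esub> b, \<phi> r) \<in> G" if "r \<in> I" for r
      using that unfolding I_def \<phi>_def by (auto intro: someI_ex)
    let ?R = "regular_module R" and ?I = "regular_module R\<lparr>carrier := I\<rparr>"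
    have R: "left_module R ?R" by (rule regular_module_left_module) (rule A.R.ring_axioms)
    interpret RR: left_module R ?R by fact
    have Iadd: "r \<oplus>\<^bsub>R\<^esub> s \<in> I" "\<phi> (r \<oplus>\<^bsub>R\<^esub> s) = \<phi> r \<oplus>\<^bsub>E\<^esub> \<phi> s" if "r \<in> I" "s \<in> I" for r s
    proof -
      have "((r \<oplus>\<^bsub>R\<^esub> s) \<odot>\<^bsub>B\<^esub> b, \<phi> r \<oplus>\<^bsub>E\<^esub> \<phi> s) \<in> G"
        using add[OF \<phi>[OF that(1)] \<phi>[OF that(2)]] that b
        by (simp add: I_def B.smult_l_distr)
      moreover from this show "r \<oplus>\<^bsub>R\<^esub> s \<in> I" using that by (auto simp: I_def)
      ultimately show "\<phi> (r \<oplus>\<^bsub>R\<^esub> s) = \<phi> r \<oplus>\<^bsub>E\<^esub> \<phi> s" using fn \<phi> by blast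
    qed
    have Ism: "r \<otimes>\<^bsub>R\<^esub> s \<in> I" "\<phi> (r \<otimes>\<^bsub>R\<^esub> s) = r \<odot>\<^bsub>E\<^esub> \<phi> s" if "r \<in> carrier R" "s \<in> I" for r s
    proof -
      have "((r \<otimes>\<^bsub>R\<^esub> s) \<odot>\<^bsub>B\<^esub> b, r \<odot>\<^bsub>E\<^esub> \<phi> s) \<in> G"
        using sm[OF that(1) \<phi>[OF that(2)]] that b by (simp add: I_def B.smult_assoc1)
      moreover from this show "r \<otimes>\<^bsub>R\<^esub> s \<in> I" using that by (auto simp: I_def)
      ultimately show "\<phi> (r \<otimes>\<^bsub>R\<^esub> s) = r \<odot>\<^bsub>E\<^esub> \<phi> s" using fn \<phi> by blast
    qed
    have "\<zero>\<^bsub>R\<^esub> \<in> I" using zero b by (auto simp: I_def)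
    then have I: "left_module R ?I"
      by (intro RR.submodule_left_module) (auto simp: Iadd Ism, auto simp: I_def)
    have \<phi>I: "\<phi> \<in> mod_hom R ?I E"
      using \<phi> car by (auto simp: mod_hom_def Iadd Ism)
    have incl: "(\<lambda>x. x) \<in> mod_hom R ?I ?R" by (auto simp: mod_hom_def I_def)
    have "\<exists>h\<in>mod_hom R ?R E. \<forall>x\<in>carrier ?I. h x = \<phi> x"
      by (rule assms(1)[unfolded injective_module_def, THEN conjunct2, rule_format,
            of ?I ?R "\<lambda>x. x" \<phi>]) (simp add: I R incl \<phi>I)
    then obtain h where h: "h \<in> mod_hom R ?R E" "\<And>r. r \<in> I \<Longrightarrow> h r = \<phi> r" by auto
    define d where "d = h \<one>\<^bsub>R\<^esub>"
    have d: "d \<in> carrier E" unfolding d_def using mod_homD(1)[OF h(1)] by simp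
    have hr: "h r = r \<odot>\<^bsub>E\<^esub> d" if "r \<in> carrier R" for r
      using mod_homD(3)[OF h(1), of r "\<one>\<^bsub>R\<^esub>"] that by (simp add: d_def)
    define H where "H = {(x \<oplus>\<^bsub>B\<^esub> r \<odot>\<^bsub>B\<^esub> b, e \<oplus>\<^bsub>E\<^esub> r \<odot>\<^bsub>E\<^esub> d) | x e r. (x, e) \<in> G \<and> r \<in> carrier R}"
    have HI: "(y, c) \<in> H" if "(x, e) \<in> G" "r \<in> carrier R" "y = x \<oplus>\<^bsub>B\<^esub> r \<odot>\<^bsub>B\<^esub> b" "c = e \<oplus>\<^bsub>E\<^esub> r \<odot>\<^bsub>E\<^esub> d"
      for x e r y c using that unfolding H_def by blast
    have GH: "G \<subseteq> H"
    proof (rule subrelI)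
      fix x e assume "(x, e) \<in> G"
      then show "(x, e) \<in> H" by (rule HI[of x e "\<zero>\<^bsub>R\<^esub>"]) (use \<open>(x, e) \<in> G\<close> car b d in auto)
    qed
    have "H \<in> ?Q" unfolding partial_extensions_def mem_Collect_eq
    proof (intro conjI allI impI)
      show "G\<^sub>0 \<subseteq> H" using sub GH by blast
      show "H \<subseteq> carrier B \<times> carrier E" using car b d unfolding H_def by auto
    next
      fix x e y c assume "(x, e) \<in> H" "(y, c) \<in> H"
      then obtain x' e' r y' c' s where *: "(x', e') \<in> G" "r \<in> carrier R" "(y', c') \<in> G" "s \<in> carrier R"
        "x = x' \<oplus>\<^bsub>B\<^esub> r \<odot>\<^bsub>B\<^esub> b" "e = e' \<oplus>\<^bsub>E\<^esub> r \<odot>\<^bsub>E\<^esub> d" "y = y' \<oplus>\<^bsub>B\<^esub> s \<odot>\<^bsub>B\<^esub> b" "c = c' \<oplus>\<^bsub>E\<^esub> s \<odot>\<^bsub>E\<^esub> d"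
        unfolding H_def by blast
      show "(x \<oplus>\<^bsub>B\<^esub> y, e \<oplus>\<^bsub>E\<^esub> c) \<in> H"
        by (rule HI[OF add[OF *(1,3)], of "r \<oplus>\<^bsub>R\<^esub> s"])
          (use * car[OF *(1)] car[OF *(3)] b d in
            \<open>auto simp: B.smult_l_distr E.smult_l_distr B.M.a_ac E.M.a_ac\<close>)
    next
      fix r x e assume r: "r \<in> carrier R" and "(x, e) \<in> H"
      then obtain x' e' s where *: "(x', e') \<in> G" "s \<in> carrier R"
        "x = x' \<oplus>\<^bsub>B\<^esub> s \<odot>\<^bsub>B\<^esub> b" "e = e' \<oplus>\<^bsub>E\<^esub> s \<odot>\<^bsub>E\<^esub> d"
        unfolding H_def by blast
      show "(r \<odot>\<^bsub>B\<^esub> x, r \<odot>\<^bsub>E\<^esub> e) \<in> H"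
        by (rule HI[OF sm[OF r *(1)], of "r \<otimes>\<^bsub>R\<^esub> s"])
          (use * r car[OF *(1)] b d in
            \<open>auto simp: B.smult_r_distr E.smult_r_distr B.smult_assoc1 E.smult_assoc1\<close>)
    next
      fix e assume "(\<zero>\<^bsub>B\<^esub>, e) \<in> H"
      then obtain x' e' r where *: "(x', e') \<in> G" "r \<in> carrier R"
        "\<zero>\<^bsub>B\<^esub> = x' \<oplus>\<^bsub>B\<^esub> r \<odot>\<^bsub>B\<^esub> b" "e = e' \<oplus>\<^bsub>E\<^esub> r \<odot>\<^bsub>E\<^esub> d"
        unfolding H_def by blast
      have x': "x' \<in> carrier B" "e' \<in> carrier E" using car[OF *(1)] by auto
      have "r \<odot>\<^bsub>B\<^esub> b = \<ominus>\<^bsub>B\<^esub> x'"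
        using *(2,3) x' b by (metis B.M.add.inv_equality B.M.a_comm B.smult_closed)
      then have rG: "(r \<odot>\<^bsub>B\<^esub> b, \<ominus>\<^bsub>E\<^esub> e') \<in> G" using neg[OF *(1)] by simp
      then have "r \<in> I" using *(2) by (auto simp: I_def)
      then have "r \<odot>\<^bsub>E\<^esub> d = \<ominus>\<^bsub>E\<^esub> e'" using h(2) hr[OF *(2)] fn[OF \<phi> rG] by metis
      then show "e = \<zero>\<^bsub>E\<^esub>" using *(4) x' by (simp add: E.M.r_neg)
    qed
    then have "H = G" using max GH by blast
    moreover have "(b, d) \<in> H" by (rule HI[OF zero, of "\<one>\<^bsub>R\<^esub>"]) (use b d in auto)
    ultimately show ?thesis by blast
  qed
  define h where "h x = (THE e. (x, e) \<in> G)" for x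
  have hI: "h x = e" if "(x, e) \<in> G" for x e unfolding h_def using that fn by blast
  have hG: "(x, h x) \<in> G" if "x \<in> carrier B" for x using total[OF that] hI by metis
  have "h \<in> mod_hom R B E"
    unfolding mod_hom_def using hG car by (auto intro!: hI add sm)
  moreover have "h (g x) = f x" if "x \<in> carrier A" for x
    using that sub by (intro hI) (auto simp: G\<^sub>0_def)
  ultimately show ?thesis by blast
qed

subsection \<open>Flatness and arbitrary injections\<close>

abbreviation right_map :: "('b \<Rightarrow> 'c) \<Rightarrow> ('a \<times> 'b \<Rightarrow>\<^sub>0 int) \<Rightarrow> ('a \<times> 'c \<Rightarrow>\<^sub>0 int)" where
  "right_map g \<equiv> frag_extend (\<lambda>(a, b). frag_of (a, g b))"

lemma right_map_diff: "right_map g (x - y) = right_map g x - right_map g y"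
  by (rule frag_extend_diff)

lemma right_map_right_map: "right_map h (right_map g x) = right_map (\<lambda>b. h (g b)) x"
proof -
  let ?G = "\<lambda>p. (fst p, g (snd p))"
  have 1: "right_map g x = frag_extend (frag_of \<circ> ?G) x"
    by (rule frag_extend_eq) (simp add: case_prod_unfold)
  have "right_map h (right_map g x) = frag_extend ((\<lambda>(a, b). frag_of (a, h b)) \<circ> ?G) x"
    unfolding 1 by (rule frag_extend_compose)
  also have "\<dots> = right_map (\<lambda>b. h (g b)) x"
    by (rule frag_extend_eq) (simp add: case_prod_unfold)
  finally show ?thesis .
qed

lemma keys_right_map: "Poly_Mapping.keys (right_map g x) \<subseteq> (\<lambda>(a, b). (a, g b)) ` Poly_Mapping.keys x"
  by (rule order_trans[OF keys_frag_extend]) auto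

lemma tensor_relations_cases:
  assumes "x \<in> tensor_relations R A B"
  obtains (add_left) a a' b where "x = frag_of (a \<oplus>\<^bsub>A\<^esub> a', b) - frag_of (a, b) - frag_of (a', b)"
      "a \<in> carrier A" "a' \<in> carrier A" "b \<in> carrier B"
    | (add_right) a b b' where "x = frag_of (a, b \<oplus>\<^bsub>B\<^esub> b') - frag_of (a, b) - frag_of (a, b')"
      "a \<in> carrier A" "b \<in> carrier B" "b' \<in> carrier B"
    | (balanced) a r b where "x = frag_of (r \<odot>\<^bsub>A\<^esub> a, b) - frag_of (a, r \<odot>\<^bsub>B\<^esub> b)"
      "a \<in> carrier A" "r \<in> carrier R" "b \<in> carrier B"
  using assms unfolding tensor_relations_def
  by (elim UnE CollectE exE conjE) (erule (3) that(1), erule (3) that(2), erule (3) that(3))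

lemma tensor_relationsI:
  "a \<in> carrier A \<Longrightarrow> a' \<in> carrier A \<Longrightarrow> b \<in> carrier B \<Longrightarrow>
    frag_of (a \<oplus>\<^bsub>A\<^esub> a', b) - frag_of (a, b) - frag_of (a', b) \<in> tensor_relations R A B"
  "a \<in> carrier A \<Longrightarrow> b \<in> carrier B \<Longrightarrow> b' \<in> carrier B \<Longrightarrow>
    frag_of (a, b \<oplus>\<^bsub>B\<^esub> b') - frag_of (a, b) - frag_of (a, b') \<in> tensor_relations R A B"
  "a \<in> carrier A \<Longrightarrow> r \<in> carrier R \<Longrightarrow> b \<in> carrier B \<Longrightarrow>
    frag_of (r \<odot>\<^bsub>A\<^esub> a, b) - frag_of (a, r \<odot>\<^bsub>B\<^esub> b) \<in> tensor_relations R A B"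
  unfolding tensor_relations_def
  by (rule UnI1, rule UnI1, rule CollectI, intro exI conjI, rule refl, assumption+)
    (rule UnI1, rule UnI2, rule CollectI, intro exI conjI, rule refl, assumption+,
     rule UnI2, rule CollectI, intro exI conjI, rule refl, assumption+)

lemma tensor_relations_incl:
  assumes "left_module (opp_ring R) A" "left_module R B"
  shows "tensor_relations R A B \<subseteq> carrier (tensor_pairs A B)"
proof
  interpret A: left_module "opp_ring R" A by fact
  interpret B: left_module R B by fact
  have *: "r \<odot>\<^bsub>A\<^esub> a \<in> carrier A" if "r \<in> carrier R" "a \<in> carrier A" for r a
    using A.smult_closed[of r a] that by (simp add: opp_ring_def)
  let ?S = "carrier A \<times> carrier B"
  have d: "Poly_Mapping.keys (x - y) \<subseteq> ?S" if "Poly_Mapping.keys x \<subseteq> ?S" "Poly_Mapping.keys y \<subseteq> ?S"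
    for x y :: "'b \<times> 'c \<Rightarrow>\<^sub>0 int"
    using keys_diff[of x y] that by blast
  have f: "Poly_Mapping.keys (frag_of (a, b)) \<subseteq> ?S" if "a \<in> carrier A" "b \<in> carrier B" for a b
    using that by simp
  fix x assume "x \<in> tensor_relations R A B"
  then have "Poly_Mapping.keys x \<subseteq> ?S"
  proof (cases rule: tensor_relations_cases)
    case (add_left a a' b)
    show ?thesis unfolding add_left(1)
      by (intro d f A.M.a_closed) (fact add_left)+
  next
    case (add_right a b b')
    show ?thesis unfolding add_right(1)
      by (intro d f B.M.a_closed) (fact add_right)+
  next
    case (balanced a r b)
    show ?thesis unfolding balanced(1)
      by (intro d f * B.smult_closed) (fact balanced)+
  qed
  then show "x \<in> carrier (tensor_pairs A B)" by (simp add: tensor_pairs_def)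
qed

lemma tensor_kernel_induct [consumes 3, case_names zero rel diff]:
  assumes AB: "left_module (opp_ring R) A" "left_module R B"
    and x: "x \<in> tensor_kernel R A B"
    and "P 0" "\<And>x. x \<in> tensor_relations R A B \<Longrightarrow> P x"
    and d: "\<And>x y. x \<in> tensor_kernel R A B \<Longrightarrow> y \<in> tensor_kernel R A B \<Longrightarrow> P x \<Longrightarrow> P y \<Longrightarrow> P (x - y)"
  shows "P x"
proof -
  note incl = tensor_relations_incl[OF AB, unfolded tensor_pairs_def]
  have n: "inv\<^bsub>free_Abelian_group (carrier A \<times> carrier B)\<^esub> h = - h" if "h \<in> tensor_relations R A B" for h
    by (rule inv_free_Abelian_group) (rule subsetD[OF incl that, unfolded carrier_free_Abelian_group_iff])
  have zero: "0 \<in> tensor_kernel R A B"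
    using generate.one[of "tensor_pairs A B"] by (simp add: tensor_kernel_def tensor_pairs_def)
  have neg: "- h \<in> tensor_kernel R A B" "P (- h)" if "h \<in> tensor_kernel R A B" "P h" for h
  proof -
    have "- h \<in> tensor_kernel R A B"
      using group.generate_m_inv_closed[OF group_free_Abelian_group incl, of h] that
        group.generate_in_carrier[OF group_free_Abelian_group incl, of h]
      by (simp add: tensor_kernel_def tensor_pairs_def)
    then show "- h \<in> tensor_kernel R A B" "P (- h)"
      using d[OF zero that(1) assms(4) that(2)] by auto
  qed
  show ?thesis
    using x unfolding tensor_kernel_def tensor_pairs_def
  proof (induction rule: generate.induct)
    case (inv h)
    then have "h \<in> tensor_kernel R A B" by (simp add: tensor_kernel_def generate.incl)
    with inv show ?case using n neg assms(5) by simp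
  next
    case (eng h k)
    then have "h \<in> tensor_kernel R A B" "k \<in> tensor_kernel R A B"
      by (simp_all add: tensor_kernel_def tensor_pairs_def)
    then show ?case using d[of h "- k"] neg[of k] eng by simp
  qed (use assms in auto)
qed

lemma tensor_kernel_subgroup:
  assumes AB: "left_module (opp_ring R) A" "left_module R B"
  shows "subgroup (tensor_kernel R A B) (free_Abelian_group (carrier A \<times> carrier B))"
  using tensor_relations_incl[OF AB]
  unfolding tensor_kernel_def tensor_pairs_def
  by (intro group.generate_is_subgroup) auto

lemma tensor_kernelD:
  assumes AB: "left_module (opp_ring R) A" "left_module R B"
  shows "x \<in> tensor_kernel R A B \<Longrightarrow> Poly_Mapping.keys x \<subseteq> carrier A \<times> carrier B"
    and "0 \<in> tensor_kernel R A B"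
    and "x \<in> tensor_kernel R A B \<Longrightarrow> y \<in> tensor_kernel R A B \<Longrightarrow> x - y \<in> tensor_kernel R A B"
    and "x \<in> tensor_kernel R A B \<Longrightarrow> y \<in> tensor_kernel R A B \<Longrightarrow> x + y \<in> tensor_kernel R A B"
proof -
  note s = tensor_kernel_subgroup[OF AB]
  have k: "Poly_Mapping.keys x \<subseteq> carrier A \<times> carrier B" if "x \<in> tensor_kernel R A B" for x
    by (rule subsetD[OF subgroup.subset[OF s] that, unfolded carrier_free_Abelian_group_iff])
  from k show "x \<in> tensor_kernel R A B \<Longrightarrow> Poly_Mapping.keys x \<subseteq> carrier A \<times> carrier B" .
  show "0 \<in> tensor_kernel R A B" using subgroup.one_closed[OF s] by simp
  show p: "x + y \<in> tensor_kernel R A B" if "x \<in> tensor_kernel R A B" "y \<in> tensor_kernel R A B" for x y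
    using subgroup.m_closed[OF s that] by simp
  show "x - y \<in> tensor_kernel R A B" if "x \<in> tensor_kernel R A B" "y \<in> tensor_kernel R A B"
    using p[OF that(1), of "- y"] subgroup.m_inv_closed[OF s that(2)] k[OF that(2)] by simp
qed

lemma tensor_kernel_rel: "x \<in> tensor_relations R A B \<Longrightarrow> x \<in> tensor_kernel R A B"
  by (simp add: tensor_kernel_def generate.incl)

lemma tensor_kernel_right_map:
  assumes F: "left_module (opp_ring R) F" and A: "left_module R A" and B: "left_module R B"
    and g: "g \<in> mod_hom R A B" and x: "x \<in> tensor_kernel R F A"
  shows "right_map g x \<in> tensor_kernel R F B"
  using F A x
proof (induction rule: tensor_kernel_induct)
  case (rel x)
  note h = mod_homD[OF g]
  from rel have "right_map g x \<in> tensor_relations R F B"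
  proof (cases rule: tensor_relations_cases)
    case (add_left a a' b)
    then show ?thesis using h(1) by (simp add: frag_extend_diff tensor_relationsI)
  next
    case (add_right a b b')
    then show ?thesis using h(1,2) by (simp add: frag_extend_diff tensor_relationsI)
  next
    case (balanced a r b)
    then show ?thesis using h(1,3) by (simp add: frag_extend_diff tensor_relationsI)
  qed
  then show ?case by (rule tensor_kernel_rel)
next
  case (diff x y)
  then show ?case by (simp add: frag_extend_diff tensor_kernelD(3)[OF F B])
qed (simp add: tensor_kernelD(2)[OF F B])

text \<open>Only finitely many elements of \<open>B\<close> are involved in the vanishing of an element.\<close>

lemma tensor_kernel_finite:
  assumes F: "left_module (opp_ring R) F" and B: "left_module R B" and x: "x \<in> tensor_kernel R F B"
  shows "\<exists>Y. finite Y \<and> Y \<subseteq> carrier B \<and>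
    (\<forall>S. Y \<subseteq> S \<and> S \<subseteq> carrier B \<and> left_module R (B\<lparr>carrier := S\<rparr>) \<longrightarrow> x \<in> tensor_kernel R F (B\<lparr>carrier := S\<rparr>))"
  using F B x
proof (induction rule: tensor_kernel_induct)
  case zero
  show ?case using tensor_kernelD(2)[OF F] by (intro exI[of _ "{}"]) auto
next
  case (diff x y)
  from diff(3) obtain Y where Y: "finite Y" "Y \<subseteq> carrier B"
    "\<forall>S. Y \<subseteq> S \<and> S \<subseteq> carrier B \<and> left_module R (B\<lparr>carrier := S\<rparr>) \<longrightarrow> x \<in> tensor_kernel R F (B\<lparr>carrier := S\<rparr>)"
    by (elim exE conjE)
  from diff(4) obtain Z where Z: "finite Z" "Z \<subseteq> carrier B"
    "\<forall>S. Z \<subseteq> S \<and> S \<subseteq> carrier B \<and> left_module R (B\<lparr>carrier := S\<rparr>) \<longrightarrow> y \<in> tensor_kernel R F (B\<lparr>carrier := S\<rparr>)"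
    by (elim exE conjE)
  have "x - y \<in> tensor_kernel R F (B\<lparr>carrier := S\<rparr>)"
    if S: "Y \<union> Z \<subseteq> S" "S \<subseteq> carrier B" "left_module R (B\<lparr>carrier := S\<rparr>)" for S
    using S by (intro tensor_kernelD(3)[OF F] Y(3)[rule_format] Z(3)[rule_format]) simp_all
  then show ?case using Y(1,2) Z(1,2) by (intro exI[of _ "Y \<union> Z"]) simp
next
  case (rel x)
  have "\<exists>Y. finite Y \<and> Y \<subseteq> carrier B \<and> (\<forall>S. Y \<subseteq> S \<longrightarrow> x \<in> tensor_relations R F (B\<lparr>carrier := S\<rparr>))"
  proof -
    from rel show ?thesis
    proof (cases rule: tensor_relations_cases)
      case (add_left a a' b)
      then show ?thesis
        by (intro exI[of _ "{b}"]) (simp add: tensor_relationsI)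
    next
      case (add_right a b b')
      then show ?thesis
        using tensor_relationsI(2)[of a F b "B\<lparr>carrier := _\<rparr>" b']
        by (intro exI[of _ "{b, b'}"]) simp
    next
      case (balanced a r b)
      then show ?thesis
        using tensor_relationsI(3)[of a F r R b "B\<lparr>carrier := _\<rparr>"]
        by (intro exI[of _ "{b}"]) simp
    qed
  qed
  then obtain Y where "finite Y" "Y \<subseteq> carrier B" "\<forall>S. Y \<subseteq> S \<longrightarrow> x \<in> tensor_relations R F (B\<lparr>carrier := S\<rparr>)"
    by (elim exE conjE)
  then show ?case by (intro exI[of _ Y]) (simp add: tensor_kernel_rel)
qed

lemma tensor_kernel_mono:
  assumes F: "left_module (opp_ring R) F" and A: "left_module R A"
    and S: "left_module R (A\<lparr>carrier := S\<rparr>)" "S \<subseteq> carrier A"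
    and x: "x \<in> tensor_kernel R F (A\<lparr>carrier := S\<rparr>)"
  shows "x \<in> tensor_kernel R F A"
proof -
  have "(\<lambda>b. b) \<in> mod_hom R (A\<lparr>carrier := S\<rparr>) A" using S(2) by (auto simp: mod_hom_def)
  from tensor_kernel_right_map[OF F S(1) A this x] show ?thesis
    using frag_expansion[of x] by (simp add: case_prod_unfold)
qed

lemma rcos_eq_iff:
  assumes G: "group G" and H: "subgroup H G" and x: "x \<in> carrier G" and y: "y \<in> carrier G"
  shows "H #>\<^bsub>G\<^esub> x = H #>\<^bsub>G\<^esub> y \<longleftrightarrow> x \<otimes>\<^bsub>G\<^esub> inv\<^bsub>G\<^esub> y \<in> H"
  using subgroup.rcos_module[OF H G y x] group.rcos_self[OF G x H]
    group.repr_independence[OF G _ y H, of x] by blast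

lemma inj_on_tensor_map_iff:
  assumes F: "left_module (opp_ring R) F" and A: "left_module R A" and B: "left_module R B"
    and g: "g \<in> mod_hom R A B"
  shows "inj_on (tensor_map R F B id g) (carrier (tensor_group R F A)) \<longleftrightarrow>
    (\<forall>x. Poly_Mapping.keys x \<subseteq> carrier F \<times> carrier A \<and> right_map g x \<in> tensor_kernel R F B \<longrightarrow>
         x \<in> tensor_kernel R F A)"
proof -
  let ?GA = "free_Abelian_group (carrier F \<times> carrier A)" and ?GB = "free_Abelian_group (carrier F \<times> carrier B)"
  let ?KA = "tensor_kernel R F A" and ?KB = "tensor_kernel R F B"
  note GA = group_free_Abelian_group[of "carrier F \<times> carrier A"]
    and GB = group_free_Abelian_group[of "carrier F \<times> carrier B"]
    and KA = tensor_kernel_subgroup[OF F A] and KB = tensor_kernel_subgroup[OF F B]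
  have gk: "Poly_Mapping.keys (right_map g x) \<subseteq> carrier F \<times> carrier B"
    if "Poly_Mapping.keys x \<subseteq> carrier F \<times> carrier A" for x
    using keys_right_map[of g x] that mod_homD(1)[OF g] by fastforce
  have cosetA: "?KA #>\<^bsub>?GA\<^esub> x = ?KA #>\<^bsub>?GA\<^esub> y \<longleftrightarrow> x - y \<in> ?KA"
    if "Poly_Mapping.keys x \<subseteq> carrier F \<times> carrier A" "Poly_Mapping.keys y \<subseteq> carrier F \<times> carrier A" for x y
    using that by (subst rcos_eq_iff[OF GA KA]) simp_all
  have cosetB: "?KB #>\<^bsub>?GB\<^esub> x = ?KB #>\<^bsub>?GB\<^esub> y \<longleftrightarrow> x - y \<in> ?KB"
    if "Poly_Mapping.keys x \<subseteq> carrier F \<times> carrier B" "Poly_Mapping.keys y \<subseteq> carrier F \<times> carrier B" for x y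
    using that by (subst rcos_eq_iff[OF GB KB]) simp_all
  have tm: "tensor_map R F B id g (?KA #>\<^bsub>?GA\<^esub> x) = ?KB #>\<^bsub>?GB\<^esub> right_map g x"
    if x: "Poly_Mapping.keys x \<subseteq> carrier F \<times> carrier A" for x
  proof -
    have "?KB #>\<^bsub>?GB\<^esub> right_map g y = ?KB #>\<^bsub>?GB\<^esub> right_map g x" if y: "y \<in> ?KA #>\<^bsub>?GA\<^esub> x" for y
    proof -
      obtain k where k: "k \<in> ?KA" "y = k + x" using y by (auto simp: r_coset_def)
      then have ky: "Poly_Mapping.keys y \<subseteq> carrier F \<times> carrier A"
        using keys_add[of k x] tensor_kernelD(1)[OF F A k(1)] x by blast
      have "right_map g y - right_map g x \<in> ?KB"
        using tensor_kernel_right_map[OF F A B g k(1)] k(2) by (simp flip: right_map_diff)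
      then show ?thesis using cosetB gk x ky by blast
    qed
    moreover have "x \<in> ?KA #>\<^bsub>?GA\<^esub> x" using group.rcos_self[OF GA _ KA] x by simp
    ultimately show ?thesis unfolding tensor_map_def tensor_pairs_def id_def by blast
  qed
  have carr: "carrier (tensor_group R F A) = (\<lambda>x. ?KA #>\<^bsub>?GA\<^esub> x) ` {x. Poly_Mapping.keys x \<subseteq> carrier F \<times> carrier A}"
    by (auto simp: tensor_group_def tensor_pairs_def FactGroup_def RCOSETS_def)
  have "inj_on (tensor_map R F B id g) (carrier (tensor_group R F A)) \<longleftrightarrow>
    (\<forall>x y. Poly_Mapping.keys x \<subseteq> carrier F \<times> carrier A \<longrightarrow> Poly_Mapping.keys y \<subseteq> carrier F \<times> carrier A \<longrightarrow>
       right_map g (x - y) \<in> ?KB \<longrightarrow> x - y \<in> ?KA)"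
    unfolding carr inj_on_def using cosetA cosetB gk tm by (simp add: right_map_diff)
  also have "\<dots> \<longleftrightarrow> (\<forall>x. Poly_Mapping.keys x \<subseteq> carrier F \<times> carrier A \<and> right_map g x \<in> ?KB \<longrightarrow> x \<in> ?KA)"
    (is "?l \<longleftrightarrow> ?r")
  proof
    show ?r if ?l using that[rule_format, of _ 0] by auto
    show ?l if ?r
    proof (intro allI impI)
      fix x y assume "Poly_Mapping.keys x \<subseteq> carrier F \<times> carrier A" "Poly_Mapping.keys y \<subseteq> carrier F \<times> carrier A"
        "right_map g (x - y) \<in> ?KB"
      moreover have "Poly_Mapping.keys (x - y) \<subseteq> carrier F \<times> carrier A"
        using calculation keys_diff[of x y] by blast
      ultimately show "x - y \<in> ?KA" using that by blast
    qed
  qed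
  finally show ?thesis .
qed

definition transport_module :: "('r, 'a) module \<Rightarrow> ('a \<Rightarrow> 'b) \<Rightarrow> ('r, 'b) module" where
  "transport_module A \<theta> = (let \<theta>' = inv_into (carrier A) \<theta> in
     \<lparr>carrier = \<theta> ` carrier A, mult = undefined, one = undefined, ring.zero = \<theta> \<zero>\<^bsub>A\<^esub>,
      add = (\<lambda>x y. \<theta> (\<theta>' x \<oplus>\<^bsub>A\<^esub> \<theta>' y)), smult = (\<lambda>r x. \<theta> (r \<odot>\<^bsub>A\<^esub> \<theta>' x))\<rparr>)"

lemma transport_module:
  assumes A: "left_module R A" and \<theta>: "inj_on \<theta> (carrier A)"
  shows "left_module R (transport_module A \<theta>)" "\<theta> \<in> mod_hom R A (transport_module A \<theta>)"
    and "inv_into (carrier A) \<theta> \<in> mod_hom R (transport_module A \<theta>) A"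
    and "carrier (transport_module A \<theta>) = \<theta> ` carrier A"
proof -
  interpret left_module R A by fact
  show "left_module R (transport_module A \<theta>)"
  proof (intro left_module.intro left_module_axioms.intro abelian_groupI)
    fix x assume "x \<in> carrier (transport_module A \<theta>)"
    then show "\<exists>y\<in>carrier (transport_module A \<theta>). y \<oplus>\<^bsub>transport_module A \<theta>\<^esub> x = \<zero>\<^bsub>transport_module A \<theta>\<^esub>"
      by (auto simp: transport_module_def Let_def \<theta> M.l_neg intro!: bexI[of _ "\<ominus>\<^bsub>A\<^esub> _"])
  qed (auto simp: transport_module_def Let_def \<theta> R.ring_axioms M.a_ac smult_l_distr smult_r_distr smult_assoc1)
  show "\<theta> \<in> mod_hom R A (transport_module A \<theta>)" "inv_into (carrier A) \<theta> \<in> mod_hom R (transport_module A \<theta>) A"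
    by (auto simp: transport_module_def Let_def mod_hom_def \<theta>)
  show "carrier (transport_module A \<theta>) = \<theta> ` carrier A" by (simp add: transport_module_def Let_def)
qed

lemma finitely_generated_inj:
  fixes M :: "('r, 'a) module"
  assumes M: "left_module R M" and X: "finite X" "X \<subseteq> carrier M"
  obtains S and \<theta> :: "'a \<Rightarrow> nat \<Rightarrow> 'r"
  where "X \<subseteq> S" "S \<subseteq> carrier M" "left_module R (M\<lparr>carrier := S\<rparr>)" "inj_on \<theta> S"
proof -
  obtain n :: nat and e where e: "X = e ` {..<n}"
    using X(1) by (metis finite_imp_nat_seg_image_inj_on lessThan_def)
  have eM: "e \<in> {..<n} \<rightarrow> carrier M" using X(2) e by auto
  let ?L = "free_module R {..<n}"
  have L: "left_module R ?L" using M by (intro free_module_left_module) (simp add: left_module_def)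
  note h = lincomb_hom[OF M eM]
  let ?S = "lincomb R M e ` carrier ?L"
  have "X \<subseteq> ?S" using lincomb_unit[OF M eM] unfolding e by force
  moreover have "?S \<subseteq> carrier M" using mod_homD(1)[OF h] by blast
  moreover have "inj_on (inv_into (carrier ?L) (lincomb R M e)) ?S" by (rule inj_on_inv_into) simp
  ultimately show ?thesis using mod_hom_image_module[OF L M h] that by blast
qed

lemma flat_module_inj:
  fixes R :: "'r ring" and F :: "('r, 'f) module" and A :: "('r, 'a) module" and B :: "('r, 'b) module"
  assumes "flat_module R F" and A: "left_module R A" and B: "left_module R B"
    and g: "g \<in> mod_hom R A B" "inj_on g (carrier A)"
  shows "inj_on (tensor_map R F B id g) (carrier (tensor_group R F A))"
proof -
  from assms(1) have F: "left_module (opp_ring R) F" by (simp add: flat_module_def)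
  have "x \<in> tensor_kernel R F A"
    if x: "Poly_Mapping.keys x \<subseteq> carrier F \<times> carrier A" and gx: "right_map g x \<in> tensor_kernel R F B" for x
  proof -
    let ?X = "snd ` Poly_Mapping.keys x"
    obtain Y where Y: "finite Y" "Y \<subseteq> carrier B" and
      YS: "\<forall>S. Y \<subseteq> S \<and> S \<subseteq> carrier B \<and> left_module R (B\<lparr>carrier := S\<rparr>) \<longrightarrow>
        right_map g x \<in> tensor_kernel R F (B\<lparr>carrier := S\<rparr>)"
      using tensor_kernel_finite[OF F B gx] by (elim exE conjE)
    have XA: "finite ?X" "?X \<subseteq> carrier A" using x by auto
    then have "finite (g ` ?X \<union> Y)" "g ` ?X \<union> Y \<subseteq> carrier B" using Y mod_homD(1)[OF g(1)] by auto
    from finitely_generated_inj[OF B this] obtain T and \<theta> :: "'b \<Rightarrow> nat \<Rightarrow> 'r" where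
      T: "g ` ?X \<union> Y \<subseteq> T" "T \<subseteq> carrier B" "left_module R (B\<lparr>carrier := T\<rparr>)" "inj_on \<theta> T" by blast
    let ?B = "B\<lparr>carrier := T\<rparr>"
    define S where "S = {a \<in> carrier A. g a \<in> T}"
    let ?A = "A\<lparr>carrier := S\<rparr>"
    interpret A: left_module R A by fact
    interpret B': left_module R ?B by fact
    have S: "left_module R ?A"
    proof (rule A.submodule_left_module)
      show "\<zero>\<^bsub>A\<^esub> \<in> S" using mod_hom_zero[OF A B g(1)] B'.M.zero_closed by (simp add: S_def)
      show "x \<oplus>\<^bsub>A\<^esub> y \<in> S" if "x \<in> S" "y \<in> S" for x y
        using that B'.M.a_closed[of "g x" "g y"] mod_homD(2)[OF g(1)] by (simp add: S_def)
      show "r \<odot>\<^bsub>A\<^esub> x \<in> S" if "r \<in> carrier R" "x \<in> S" for r x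
        using that B'.smult_closed[of r "g x"] mod_homD(3)[OF g(1)] by (simp add: S_def)
    qed (auto simp: S_def)
    have gS: "g \<in> mod_hom R ?A ?B" using g(1) by (auto simp: mod_hom_def S_def)
    define \<zeta> where "\<zeta> a = \<theta> (g a)" for a
    have gi: "inj_on g S" using g(2) by (auto simp: inj_on_def S_def)
    have \<zeta>: "inj_on \<zeta> (carrier ?A)"
      using gi T(4) by (auto simp: inj_on_def \<zeta>_def S_def)
    have \<theta>: "inj_on \<theta> (carrier ?B)" using T(4) by simp
    note tA = transport_module[OF S \<zeta>] and tB = transport_module[OF T(3) \<theta>]
    let ?A' = "transport_module ?A \<zeta>" and ?B' = "transport_module ?B \<theta>"
    let ?g = "\<lambda>y. \<theta> (g (inv_into (carrier ?A) \<zeta> y))"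
    have g': "?g \<in> mod_hom R ?A' ?B'"
      using mod_hom_comp[OF mod_hom_comp[OF tA(3) gS] tB(2)] .
    have g'\<zeta>: "?g (\<zeta> a) = \<theta> (g a)" if "a \<in> S" for a
      using inv_into_f_f[OF \<zeta>, of a] that by simp
    have "inj_on ?g (carrier ?A')"
      unfolding tA(4) using \<zeta> by (auto simp: inj_on_def) (simp add: \<zeta>_def)
    then have inj: "\<And>x. Poly_Mapping.keys x \<subseteq> carrier F \<times> carrier ?A' \<Longrightarrow>
        right_map ?g x \<in> tensor_kernel R F ?B' \<Longrightarrow> x \<in> tensor_kernel R F ?A'"
      using assms(1) tA(1) tB(1) g' inj_on_tensor_map_iff[OF F tA(1) tB(1) g']
      unfolding flat_module_def by blast
    have xS: "Poly_Mapping.keys x \<subseteq> carrier F \<times> S" using x T(1) by (force simp: S_def)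
    have cong: "right_map h x = right_map k x" if "\<And>a. a \<in> S \<Longrightarrow> h a = k a" for h k :: "'a \<Rightarrow> 'z"
      by (rule frag_extend_eq) (use xS that in force)
    have "right_map \<zeta> x \<in> tensor_kernel R F ?A'"
    proof (rule inj)
      show "Poly_Mapping.keys (right_map \<zeta> x) \<subseteq> carrier F \<times> carrier ?A'"
        using keys_right_map[of \<zeta> x] xS unfolding tA(4) by fastforce
      have "right_map g x \<in> tensor_kernel R F ?B" using YS T by blast
      then have "right_map \<theta> (right_map g x) \<in> tensor_kernel R F ?B'"
        by (rule tensor_kernel_right_map[OF F T(3) tB(1) tB(2)])
      then show "right_map ?g (right_map \<zeta> x) \<in> tensor_kernel R F ?B'"
        unfolding right_map_right_map using cong[of "\<lambda>b. ?g (\<zeta> b)" "\<lambda>b. \<theta> (g b)"] g'\<zeta> by simp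
    qed
    then have "right_map (inv_into (carrier ?A) \<zeta>) (right_map \<zeta> x) \<in> tensor_kernel R F ?A"
      by (rule tensor_kernel_right_map[OF F tA(1) S tA(3)])
    moreover have "right_map (inv_into (carrier ?A) \<zeta>) (right_map \<zeta> x) = right_map (\<lambda>a. a) x"
      unfolding right_map_right_map by (rule cong) (use inv_into_f_f[OF \<zeta>] in simp)
    moreover have "right_map (\<lambda>a. a) x = x"
      using frag_expansion[of x] by (simp add: case_prod_unfold)
    ultimately have "x \<in> tensor_kernel R F ?A" by simp
    then show ?thesis by (rule tensor_kernel_mono[OF F A S, rotated]) (auto simp: S_def)
  qed
  then show ?thesis unfolding inj_on_tensor_map_iff[OF F A B g(1)] by blast
qed

section \<open>Complexes\<close>

text \<open>Complexes are graded homologically: \<open>diff X n\<close> maps degree \<open>n\<close> to degree \<open>n - 1\<close>.\<close>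

record ('r, 'a) cplx =
  obj :: "int \<Rightarrow> ('r, 'a) module"
  diff :: "int \<Rightarrow> 'a \<Rightarrow> 'a"

definition is_complex :: "'r ring \<Rightarrow> ('r, 'a) cplx \<Rightarrow> bool" where
  "is_complex R X \<longleftrightarrow> (\<forall>n. left_module R (obj X n) \<and>
     diff X n \<in> mod_hom R (obj X n) (obj X (n - 1)) \<and>
     (\<forall>x\<in>carrier (obj X n). diff X (n - 1) (diff X n x) = \<zero>\<^bsub>obj X (n - 2)\<^esub>))"

definition chain_map ::
    "'r ring \<Rightarrow> ('r, 'a) cplx \<Rightarrow> ('r, 'b) cplx \<Rightarrow> (int \<Rightarrow> 'a \<Rightarrow> 'b) \<Rightarrow> bool" where
  "chain_map R X Y f \<longleftrightarrow> (\<forall>n. f n \<in> mod_hom R (obj X n) (obj Y n) \<and>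
     (\<forall>x\<in>carrier (obj X n). f (n - 1) (diff X n x) = diff Y n (f n x)))"

definition cycles :: "('r, 'a) cplx \<Rightarrow> int \<Rightarrow> 'a set" where
  "cycles X n = {x \<in> carrier (obj X n). diff X n x = \<zero>\<^bsub>obj X (n - 1)\<^esub>}"

definition boundaries :: "('r, 'a) cplx \<Rightarrow> int \<Rightarrow> 'a set" where
  "boundaries X n = diff X (n + 1) ` carrier (obj X (n + 1))"

definition homology :: "('r, 'a) cplx \<Rightarrow> int \<Rightarrow> ('r, 'a set) module" where
  "homology X n = quot_module ((obj X n)\<lparr>carrier := cycles X n\<rparr>) (boundaries X n)"

text \<open>The map in homology induced by the degree \<open>n\<close> component \<open>f\<close> of a chain map into \<open>Y\<close>.\<close>

definition homology_map :: "('r, 'b) cplx \<Rightarrow> int \<Rightarrow> ('a \<Rightarrow> 'b) \<Rightarrow> 'a set \<Rightarrow> 'b set" where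
  "homology_map Y n f = induced_map (obj Y n) (boundaries Y n) f"

section \<open>Resolutions\<close>

definition left_resolution ::
    "'r ring \<Rightarrow> ('r, 'm) module \<Rightarrow> ('r, 'a) cplx \<Rightarrow> ('a \<Rightarrow> 'm) \<Rightarrow> bool" where
  "left_resolution R M X \<epsilon> \<longleftrightarrow> left_module R M \<and> is_complex R X \<and>
     (\<forall>n<0. carrier (obj X n) = {\<zero>\<^bsub>obj X n\<^esub>}) \<and>
     \<epsilon> \<in> mod_hom R (obj X 0) M \<and> \<epsilon> ` carrier (obj X 0) = carrier M \<and>
     {x \<in> carrier (obj X 0). \<epsilon> x = \<zero>\<^bsub>M\<^esub>} = boundaries X 0 \<and>
     (\<forall>n>0. cycles X n = boundaries X n)"

definition projective_resolution ::
    "'r ring \<Rightarrow> ('r, 'm) module \<Rightarrow> ('r, 'p) cplx \<Rightarrow> ('p \<Rightarrow> 'm) \<Rightarrow> bool" where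
  "projective_resolution R M P \<pi> \<longleftrightarrow>
     left_resolution R M P \<pi> \<and> (\<forall>n. projective_module R (obj P n))"

text \<open>A flat resolution of a right \<open>R\<close>-module \<open>M\<close>.\<close>

definition flat_resolution ::
    "'r ring \<Rightarrow> ('r, 'm) module \<Rightarrow> ('r, 'f) cplx \<Rightarrow> ('f \<Rightarrow> 'm) \<Rightarrow> bool" where
  "flat_resolution R M F \<epsilon> \<longleftrightarrow>
     left_resolution (opp_ring R) M F \<epsilon> \<and> (\<forall>n. flat_module R (obj F n))"

definition injective_resolution ::
    "'r ring \<Rightarrow> ('r, 'n) module \<Rightarrow> ('r, 'e) cplx \<Rightarrow> ('n \<Rightarrow> 'e) \<Rightarrow> bool" where
  "injective_resolution R N I \<iota> \<longleftrightarrow> left_module R N \<and> is_complex R I \<and>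
     (\<forall>n>0. carrier (obj I n) = {\<zero>\<^bsub>obj I n\<^esub>}) \<and>
     \<iota> \<in> mod_hom R N (obj I 0) \<and> inj_on \<iota> (carrier N) \<and> \<iota> ` carrier N = cycles I 0 \<and>
     (\<forall>n<0. cycles I n = boundaries I n) \<and> (\<forall>n. injective_module R (obj I n))"

text \<open>\<open>f\<close> is a chain map over a homomorphism \<open>\<alpha>\<close> of the modules resolved.\<close>

definition left_lift ::
    "'r ring \<Rightarrow> ('r, 'a) cplx \<Rightarrow> ('a \<Rightarrow> 'm) \<Rightarrow> ('r, 'b) cplx \<Rightarrow> ('b \<Rightarrow> 'n) \<Rightarrow>
      ('m \<Rightarrow> 'n) \<Rightarrow> (int \<Rightarrow> 'a \<Rightarrow> 'b) \<Rightarrow> bool" where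
  "left_lift R X \<epsilon> X' \<epsilon>' \<alpha> f \<longleftrightarrow>
     chain_map R X X' f \<and> (\<forall>x\<in>carrier (obj X 0). \<epsilon>' (f 0 x) = \<alpha> (\<epsilon> x))"

definition right_lift ::
    "'r ring \<Rightarrow> ('r, 'm) module \<Rightarrow> ('r, 'a) cplx \<Rightarrow> ('m \<Rightarrow> 'a) \<Rightarrow> ('r, 'b) cplx \<Rightarrow> ('n \<Rightarrow> 'b) \<Rightarrow>
      ('m \<Rightarrow> 'n) \<Rightarrow> (int \<Rightarrow> 'a \<Rightarrow> 'b) \<Rightarrow> bool" where
  "right_lift R N I \<iota> I' \<iota>' \<beta> g \<longleftrightarrow>
     chain_map R I I' g \<and> (\<forall>x\<in>carrier N. g 0 (\<iota> x) = \<iota>' (\<beta> x))"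

section \<open>Unbounded and stable tensor products of complexes\<close>

text \<open>The component of index \<open>i\<close> in degree \<open>n\<close> is \<open>X\<^sub>i \<otimes> Y\<^bsub>n-i\<^esub>\<close>. The component of index \<open>i\<close> of the
  differential of \<open>z\<close> in degree \<open>n\<close> lies in \<open>X\<^sub>i \<otimes> Y\<^bsub>n-1-i\<^esub>\<close>, so it collects the image of
  \<open>z (i + 1)\<close> under \<open>diff X \<otimes> id\<close> and that of \<open>z i\<close> under \<open>id \<otimes> diff Y\<close>, the latter with sign \<open>(-1)\<^sup>i\<close>.\<close>

definition unbounded_tensor ::
    "('k \<Rightarrow> 'r) \<Rightarrow> 'r ring \<Rightarrow> ('r, 'a) cplx \<Rightarrow> ('r, 'b) cplx \<Rightarrow>
      ('k, int \<Rightarrow> ('a \<times> 'b \<Rightarrow>\<^sub>0 int) set) cplx" where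
  "unbounded_tensor \<eta> R X Y = \<lparr>
     obj = (\<lambda>n. prod_module (\<lambda>i. tensor \<eta> R (obj X i) (obj Y (n - i)))),
     diff = (\<lambda>n z i.
       let T = (tensor \<eta> R (obj X i) (obj Y (n - 1 - i)) :: ('k, _) module);
           u = tensor_map R (obj X i) (obj Y (n - 1 - i)) (diff X (i + 1)) id (z (i + 1));
           v = tensor_map R (obj X i) (obj Y (n - 1 - i)) id (diff Y (n - i)) (z i)
       in u \<oplus>\<^bsub>T\<^esub> (if even i then v else \<ominus>\<^bsub>T\<^esub> v))\<rparr>"

text \<open>The usual tensor product, as a subcomplex: finitely many nonzero components.\<close>

definition tensor_complex ::
    "('k \<Rightarrow> 'r) \<Rightarrow> 'r ring \<Rightarrow> ('r, 'a) cplx \<Rightarrow> ('r, 'b) cplx \<Rightarrow>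
      ('k, int \<Rightarrow> ('a \<times> 'b \<Rightarrow>\<^sub>0 int) set) cplx" where
  "tensor_complex \<eta> R X Y = (unbounded_tensor \<eta> R X Y)\<lparr>
     obj := (\<lambda>n. (obj (unbounded_tensor \<eta> R X Y) n)\<lparr>
       carrier := {z \<in> carrier (obj (unbounded_tensor \<eta> R X Y) n).
         finite {i. z i \<noteq> \<zero>\<^bsub>obj (unbounded_tensor \<eta> R X Y) n\<^esub> i}}\<rparr>)\<rparr>"

definition stable_tensor ::
    "('k \<Rightarrow> 'r) \<Rightarrow> 'r ring \<Rightarrow> ('r, 'a) cplx \<Rightarrow> ('r, 'b) cplx \<Rightarrow>
      ('k, (int \<Rightarrow> ('a \<times> 'b \<Rightarrow>\<^sub>0 int) set) set) cplx" where
  "stable_tensor \<eta> R X Y = \<lparr>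
     obj = (\<lambda>n. quot_module (obj (unbounded_tensor \<eta> R X Y) n)
       (carrier (obj (tensor_complex \<eta> R X Y) n))),
     diff = (\<lambda>n. induced_map (obj (unbounded_tensor \<eta> R X Y) (n - 1))
       (carrier (obj (tensor_complex \<eta> R X Y) (n - 1)))
       (diff (unbounded_tensor \<eta> R X Y) n))\<rparr>"

text \<open>The degree \<open>n\<close> components of the chain maps that \<open>f\<close> and \<open>g\<close> induce into the unbounded and
  into the stable tensor product of \<open>X'\<close> and \<open>Y'\<close>.\<close>

definition unbounded_tensor_map ::
    "'r ring \<Rightarrow> ('r, 'c) cplx \<Rightarrow> ('r, 'd) cplx \<Rightarrow>
      (int \<Rightarrow> 'a \<Rightarrow> 'c) \<Rightarrow> (int \<Rightarrow> 'b \<Rightarrow> 'd) \<Rightarrow> int \<Rightarrow>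
      (int \<Rightarrow> ('a \<times> 'b \<Rightarrow>\<^sub>0 int) set) \<Rightarrow> int \<Rightarrow> ('c \<times> 'd \<Rightarrow>\<^sub>0 int) set" where
  "unbounded_tensor_map R X' Y' f g n z =
     (\<lambda>i. tensor_map R (obj X' i) (obj Y' (n - i)) (f i) (g (n - i)) (z i))"

definition stable_tensor_map ::
    "('k \<Rightarrow> 'r) \<Rightarrow> 'r ring \<Rightarrow> ('r, 'c) cplx \<Rightarrow> ('r, 'd) cplx \<Rightarrow>
      (int \<Rightarrow> 'a \<Rightarrow> 'c) \<Rightarrow> (int \<Rightarrow> 'b \<Rightarrow> 'd) \<Rightarrow> int \<Rightarrow>
      (int \<Rightarrow> ('a \<times> 'b \<Rightarrow>\<^sub>0 int) set) set \<Rightarrow> (int \<Rightarrow> ('c \<times> 'd \<Rightarrow>\<^sub>0 int) set) set" where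
  "stable_tensor_map \<eta> R X' Y' f g n =
     induced_map (obj (unbounded_tensor \<eta> R X' Y') n) (carrier (obj (tensor_complex \<eta> R X' Y') n))
       (unbounded_tensor_map R X' Y' f g n)"

section \<open>Unbounded and stable homology\<close>

text \<open>\<open>P\<close> and \<open>J\<close> are to be a projective resolution of the first and an injective resolution of
  the second argument of \<open>Tor\<close>. On homomorphisms \<open>\<alpha>\<close> and \<open>\<beta>\<close> of these arguments, \<open>Tor\<close> acts by
  the maps below for any chain maps \<open>p\<close> over \<open>\<alpha>\<close> and \<open>j\<close> over \<open>\<beta>\<close>; here \<open>P'\<close> and \<open>J'\<close> are the
  resolutions of the targets.\<close>

definition unbounded_Tor ::
    "('k \<Rightarrow> 'r) \<Rightarrow> 'r ring \<Rightarrow> ('r, 'p) cplx \<Rightarrow> ('r, 'e) cplx \<Rightarrow> int \<Rightarrow>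
      ('k, (int \<Rightarrow> ('p \<times> 'e \<Rightarrow>\<^sub>0 int) set) set) module" where
  "unbounded_Tor \<eta> R P J i = homology (unbounded_tensor \<eta> R P J) i"

definition stable_Tor ::
    "('k \<Rightarrow> 'r) \<Rightarrow> 'r ring \<Rightarrow> ('r, 'p) cplx \<Rightarrow> ('r, 'e) cplx \<Rightarrow> int \<Rightarrow>
      ('k, (int \<Rightarrow> ('p \<times> 'e \<Rightarrow>\<^sub>0 int) set) set set) module" where
  "stable_Tor \<eta> R P J i = homology (stable_tensor \<eta> R P J) (i + 1)"

definition unbounded_Tor_map where
  "unbounded_Tor_map \<eta> R P' J' p j i =
     homology_map (unbounded_tensor \<eta> R P' J') i (unbounded_tensor_map R P' J' p j i)"

definition stable_Tor_map where
  "stable_Tor_map \<eta> R P' J' p j i =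
     homology_map (stable_tensor \<eta> R P' J') (i + 1) (stable_tensor_map \<eta> R P' J' p j (i + 1))"

end

theory Submission
  imports Defs
begin

text \<open>Let \<open>q: P \<rightarrow> F\<close> lift the identity of \<open>M\<close> and \<open>u: J \<rightarrow> I\<close> the identity of \<open>N\<close>; the isomorphisms
  are induced by \<open>q \<otimes> u\<close>. Since \<open>u\<close> is a homotopy equivalence, only \<open>q \<otimes> J\<close> matters. The mapping
  cone \<open>C\<close> of \<open>q\<close> is an acyclic, bounded below complex of flat modules, so all its cycle modules are
  flat and \<open>C \<otimes> Y\<close> is acyclic for every module \<open>Y\<close>. Hence a cycle of the unbounded tensor product
  of \<open>C\<close> and \<open>J\<close> is bounded by solving for its components one after the other, starting at the
  bottom degree of \<open>C\<close>. Flatness even provides, for \<open>d: Y \<rightarrow> Y'\<close>, bounding elements that \<open>d\<close>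
  annihilates whenever it annihilates the cycle; so for a cycle with finitely many components the
  process can be made to stop, and the usual tensor product is acyclic too. The stable case
  follows by passing to quotients. Naturality holds since lifts are unique up to homotopy.\<close>

section \<open>Formal sums representing tensors\<close>

text \<open>Only one mapping cone is ever formed, that of \<open>q\<close> itself. For the totalized
  tensor products, acyclicity of the cone is expressed by elements, relative to a pair of subsets:
  the same recursion then yields it for all families and for the finitely supported ones, and the
  two statements together give it for the quotients. The cycle modules of \<open>C\<close> are flat
  because they are successive kernels of surjections between flat modules; this, and the purity of
  such kernels, is proved by a chase along a free cover in place of a theory of derived functors.
  Everything about tensors is done with formal sums modulo \<open>tensor_kernel\<close>, where
  elements can be lifted and functions that are not homomorphisms can be applied before passing to
  classes. The terms of \<open>J\<close> and \<open>I\<close> need not be flat, so \<open>u\<close>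
  requires another argument: homotopies are tensored with the other factor, and since they act
  componentwise up to a shift, they preserve finite support and descend to the stable tensor
  product.\<close>

definition tensor_chains :: "('r, 'a) module \<Rightarrow> ('r, 'b) module \<Rightarrow> ('a \<times> 'b \<Rightarrow>\<^sub>0 int) set" where
  "tensor_chains A B = {x. Poly_Mapping.keys x \<subseteq> carrier A \<times> carrier B}"

text \<open>Acts on representatives and for arbitrary functions: it is also applied to set-theoretic
  sections and to functions that agree only on the carriers. For f the identity it is
  \<open>right_map\<close>.\<close>

definition bi_map :: "('a \<Rightarrow> 'c) \<Rightarrow> ('b \<Rightarrow> 'd) \<Rightarrow> ('a \<times> 'b \<Rightarrow>\<^sub>0 int) \<Rightarrow> ('c \<times> 'd \<Rightarrow>\<^sub>0 int)" where
  "bi_map f g = frag_extend (\<lambda>(a, b). frag_of (f a, g b))"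

text \<open>Carries a tensor over R to one over \<open>opp_ring R\<close>, so that statements about
  one factor give those about the other.\<close>

definition swap_map :: "('a \<times> 'b \<Rightarrow>\<^sub>0 int) \<Rightarrow> ('b \<times> 'a \<Rightarrow>\<^sub>0 int)" where
  "swap_map = frag_extend (\<lambda>(a, b). frag_of (b, a))"

lemma tensor_chains_simps [simp]:
  "0 \<in> tensor_chains A B"
  "frag_of (a, b) \<in> tensor_chains A B \<longleftrightarrow> a \<in> carrier A \<and> b \<in> carrier B"
  by (auto simp: tensor_chains_def)

lemma tensor_chains_diff [simp]:
  "x \<in> tensor_chains A B \<Longrightarrow> y \<in> tensor_chains A B \<Longrightarrow> x - y \<in> tensor_chains A B"
  using keys_diff[of x y] by (auto simp: tensor_chains_def)

lemma tensor_chains_add [simp]: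
  "x \<in> tensor_chains A B \<Longrightarrow> y \<in> tensor_chains A B \<Longrightarrow> x + y \<in> tensor_chains A B"
  using keys_add[of x y] by (auto simp: tensor_chains_def)

lemma tensor_chains_minus [simp]:
  "x \<in> tensor_chains A B \<Longrightarrow> - x \<in> tensor_chains A B"
  by (auto simp: tensor_chains_def)

lemma tensor_chains_induct [consumes 1, case_names zero one diff]:
  assumes "x \<in> tensor_chains A B" "P 0"
    and "\<And>a b. a \<in> carrier A \<Longrightarrow> b \<in> carrier B \<Longrightarrow> P (frag_of (a, b))"
    and "\<And>x y. x \<in> tensor_chains A B \<Longrightarrow> y \<in> tensor_chains A B \<Longrightarrow> P x \<Longrightarrow> P y \<Longrightarrow> P (x - y)"
  shows "P x"
proof -
  have "Poly_Mapping.keys x \<subseteq> carrier A \<times> carrier B" using assms(1) by (simp add: tensor_chains_def)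
  then have "x \<in> tensor_chains A B \<and> P x"
  proof (induction rule: frag_induction)
    case (one y)
    then show ?case using assms(3) by (cases y) auto
  qed (use assms in auto)
  then show ?thesis ..
qed

lemma bi_map_simps [simp]:
  "bi_map f g 0 = 0"
  "bi_map f g (frag_of (a, b)) = frag_of (f a, g b)"
  "bi_map f g (x + y) = bi_map f g x + bi_map f g y"
  "bi_map f g (x - y) = bi_map f g x - bi_map f g y"
  "bi_map f g (- x) = - bi_map f g x"
  by (simp_all add: bi_map_def frag_extend_add frag_extend_diff frag_extend_minus)

lemma swap_map_simps [simp]:
  "swap_map 0 = 0"
  "swap_map (frag_of (a, b)) = frag_of (b, a)"
  "swap_map (x + y) = swap_map x + swap_map y"
  "swap_map (x - y) = swap_map x - swap_map y"
  by (simp_all add: swap_map_def frag_extend_add frag_extend_diff)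

lemma frag_pair_induct [case_names zero one diff]:
  assumes "P 0" "\<And>a b. P (frag_of (a, b))" "\<And>x y. P x \<Longrightarrow> P y \<Longrightarrow> P (x - y)"
  shows "P x"
  by (rule frag_induction[of x UNIV]) (use assms in auto)

lemma bi_map_bi_map [simp]:
  "bi_map f g (bi_map f' g' x) = bi_map (\<lambda>a. f (f' a)) (\<lambda>b. g (g' b)) x"
  by (induction x rule: frag_pair_induct) auto

lemma bi_map_ident [simp]: "bi_map (\<lambda>a. a) (\<lambda>b. b) x = x"
  by (induction x rule: frag_pair_induct) auto

lemma swap_map_swap_map [simp]: "swap_map (swap_map x) = x"
  by (induction x rule: frag_pair_induct) auto

lemma swap_map_bi_map: "swap_map (bi_map f g x) = bi_map g f (swap_map x)"
  by (induction x rule: frag_pair_induct) auto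

lemma bi_map_cong:
  assumes "x \<in> tensor_chains A B" "\<And>a. a \<in> carrier A \<Longrightarrow> f a = f' a" "\<And>b. b \<in> carrier B \<Longrightarrow> g b = g' b"
  shows "bi_map f g x = bi_map f' g' x"
  using assms(1) by (induction rule: tensor_chains_induct) (use assms in auto)

lemma bi_map_chains:
  assumes "x \<in> tensor_chains A B" "\<And>a. a \<in> carrier A \<Longrightarrow> f a \<in> carrier A'"
    "\<And>b. b \<in> carrier B \<Longrightarrow> g b \<in> carrier B'"
  shows "bi_map f g x \<in> tensor_chains A' B'"
  using assms(1) by (induction rule: tensor_chains_induct) (use assms in auto)

lemma swap_map_chains: "x \<in> tensor_chains A B \<Longrightarrow> swap_map x \<in> tensor_chains B A"
  by (induction rule: tensor_chains_induct) auto

lemma tensor_chains_surj: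
  assumes "y \<in> tensor_chains A' B'" "f ` carrier A = carrier A'" "g ` carrier B = carrier B'"
  shows "\<exists>x\<in>tensor_chains A B. bi_map f g x = y"
  using assms(1)
proof (induction rule: tensor_chains_induct)
  case zero
  show ?case by (rule bexI[of _ 0]) auto
next
  case (one a b)
  then obtain a' b' where "a' \<in> carrier A" "f a' = a" "b' \<in> carrier B" "g b' = b"
    using assms(2,3) by (metis imageE)
  then show ?case by (intro bexI[of _ "frag_of (a', b')"]) auto
next
  case (diff x y)
  then show ?case by (metis bi_map_simps(4) tensor_chains_diff)
qed

lemma opp_ring_opp_ring [simp]: "opp_ring (opp_ring R) = (R :: 'r ring)"
  by (cases R) (simp add: opp_ring_def)

lemma opp_ring_simps [simp]:
  "carrier (opp_ring R) = carrier R" "\<zero>\<^bsub>opp_ring R\<^esub> = \<zero>\<^bsub>R\<^esub>" "\<one>\<^bsub>opp_ring R\<^esub> = \<one>\<^bsub>R\<^esub>"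
  "x \<oplus>\<^bsub>opp_ring R\<^esub> y = x \<oplus>\<^bsub>R\<^esub> y" "x \<otimes>\<^bsub>opp_ring R\<^esub> y = y \<otimes>\<^bsub>R\<^esub> x"
  by (simp_all add: opp_ring_def)

section \<open>The tensor relations under swapping, maps and sums of maps\<close>

lemma tensor_kernel_chains:
  assumes "left_module (opp_ring R) A" "left_module R B" "x \<in> tensor_kernel R A B"
  shows "x \<in> tensor_chains A B"
  using tensor_kernelD(1)[OF assms] by (simp add: tensor_chains_def)

lemma tensor_kernel_minus:
  assumes "left_module (opp_ring R) A" "left_module R B" "x \<in> tensor_kernel R A B"
  shows "- x \<in> tensor_kernel R A B"
  using tensor_kernelD(2,3)[OF assms(1,2)] assms(3) by (metis diff_0)

lemma tensor_kernel_swap: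
  assumes A: "left_module (opp_ring R) A" and B: "left_module R B" and x: "x \<in> tensor_kernel R A B"
  shows "swap_map x \<in> tensor_kernel (opp_ring R) B A"
  using A B x
proof (induction rule: tensor_kernel_induct)
  case zero
  then show ?case using tensor_kernelD(2)[of "opp_ring R" B A] A B by simp
next
  case (diff x y)
  then show ?case using tensor_kernelD(3)[of "opp_ring R" B A] A B by simp
next
  case (rel x)
  then show ?case
  proof (cases rule: tensor_relations_cases)
    case (add_left a a' b)
    then show ?thesis using tensor_kernel_rel[OF tensor_relationsI(2)[of b B a A a']] by simp
  next
    case (add_right a b b')
    then show ?thesis using tensor_kernel_rel[OF tensor_relationsI(1)[of b B b' a A]] by simp
  next
    case (balanced a r b)
    \<comment> \<open>The swap exchanges the two terms of the relation, which is therefore met up to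
      sign.\<close>
    then have "- (frag_of (r \<odot>\<^bsub>B\<^esub> b, a) - frag_of (b, r \<odot>\<^bsub>A\<^esub> a)) \<in> tensor_kernel (opp_ring R) B A"
      using A B by (intro tensor_kernel_minus tensor_kernel_rel tensor_relationsI(3)) auto
    then show ?thesis using balanced by simp
  qed
qed

lemma tensor_kernel_swap_iff:
  assumes A: "left_module (opp_ring R) A" and B: "left_module R B"
  shows "swap_map x \<in> tensor_kernel (opp_ring R) B A \<longleftrightarrow> x \<in> tensor_kernel R A B"
  using tensor_kernel_swap[of R A B x] tensor_kernel_swap[of "opp_ring R" B A "swap_map x"] A B by auto

lemma mod_hom_ident [simp]: "(\<lambda>x. x) \<in> mod_hom R A A"
  by (auto simp: mod_hom_def)

text \<open>The map is split into f \<otimes> id followed by id \<otimes> g; the first becomes a map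
  of the second factor after swapping, where \<open>tensor_kernel_right_map\<close> applies.\<close>

lemma tensor_kernel_bi_map:
  assumes A: "left_module (opp_ring R) A" "left_module (opp_ring R) A'"
    and B: "left_module R B" "left_module R B'"
    and f: "f \<in> mod_hom (opp_ring R) A A'" and g: "g \<in> mod_hom R B B'"
    and x: "x \<in> tensor_kernel R A B"
  shows "bi_map f g x \<in> tensor_kernel R A' B'"
proof -
  \<comment> \<open>Stated for a fresh ring and fresh modules, as it is used over
    \<open>opp_ring R\<close> for f and over R for g.\<close>
  have r: "bi_map (\<lambda>a. a) h y \<in> tensor_kernel S C D'"
    if "left_module (opp_ring S) C" "left_module S D" "left_module S D'" "h \<in> mod_hom S D D'"
      "y \<in> tensor_kernel S C D" for S :: "'z ring" and C :: "('z, 'y) module"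
      and D :: "('z, 'x) module" and D' :: "('z, 'w) module" and h y
    using tensor_kernel_right_map[OF that(1-5)] unfolding bi_map_def by simp
  have "swap_map x \<in> tensor_kernel (opp_ring R) B A"
    by (rule tensor_kernel_swap[OF A(1) B(1) x])
  then have "bi_map (\<lambda>a. a) f (swap_map x) \<in> tensor_kernel (opp_ring R) B A'"
    using A B f by (intro r[of "opp_ring R" B A A' f]) auto
  then have "bi_map f (\<lambda>b. b) x \<in> tensor_kernel R A' B"
    using tensor_kernel_swap_iff[OF A(2) B(1), of "bi_map f (\<lambda>b. b) x"] by (simp add: swap_map_bi_map)
  from r[OF A(2) B g this] show ?thesis by simp
qed

lemma tensor_kernel_trans:
  assumes "left_module (opp_ring R) A" "left_module R B"
    "x - y \<in> tensor_kernel R A B" "y - z \<in> tensor_kernel R A B"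
  shows "x - z \<in> tensor_kernel R A B"
  using tensor_kernelD(4)[OF assms] by simp

lemma tensor_kernel_cong:
  assumes "left_module (opp_ring R) A" "left_module R B" "x - y \<in> tensor_kernel R A B"
  shows "x \<in> tensor_kernel R A B \<longleftrightarrow> y \<in> tensor_kernel R A B"
  using tensor_kernelD(3)[OF assms(1,2) _ assms(3), of x] tensor_kernelD(4)[OF assms(1,2,3), of y] by auto

text \<open>Additivity of f \<otimes> g in f. It is checked on generators only, so f, f' and h may
  be arbitrary functions into the module.\<close>

lemma tensor_kernel_add_left:
  assumes A: "left_module (opp_ring R) A'" and B: "left_module R B'"
    and f: "\<And>a. a \<in> carrier A \<Longrightarrow> f a \<in> carrier A'" "\<And>a. a \<in> carrier A \<Longrightarrow> f' a \<in> carrier A'"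
      "\<And>a. a \<in> carrier A \<Longrightarrow> h a = f a \<oplus>\<^bsub>A'\<^esub> f' a"
    and g: "\<And>b. b \<in> carrier B \<Longrightarrow> g b \<in> carrier B'" and x: "x \<in> tensor_chains A B"
  shows "bi_map h g x - bi_map f g x - bi_map f' g x \<in> tensor_kernel R A' B'"
  using x
proof (induction rule: tensor_chains_induct)
  case zero then show ?case using tensor_kernelD(2)[OF A B] by simp
next
  case (one a b)
  then show ?case using f g by (simp, intro tensor_kernel_rel tensor_relationsI(1)) auto
next
  case (diff x y)
  from tensor_kernelD(3)[OF A B diff(3,4)] show ?case by (simp add: algebra_simps)
qed

lemma tensor_kernel_add_right:
  assumes A: "left_module (opp_ring R) A'" and B: "left_module R B'"
    and g: "\<And>b. b \<in> carrier B \<Longrightarrow> g b \<in> carrier B'" "\<And>b. b \<in> carrier B \<Longrightarrow> g' b \<in> carrier B'"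
      "\<And>b. b \<in> carrier B \<Longrightarrow> h b = g b \<oplus>\<^bsub>B'\<^esub> g' b"
    and f: "\<And>a. a \<in> carrier A \<Longrightarrow> f a \<in> carrier A'" and x: "x \<in> tensor_chains A B"
  shows "bi_map f h x - bi_map f g x - bi_map f g' x \<in> tensor_kernel R A' B'"
  using x
proof (induction rule: tensor_chains_induct)
  case zero then show ?case using tensor_kernelD(2)[OF A B] by simp
next
  case (one a b)
  then show ?case using f g by (simp, intro tensor_kernel_rel tensor_relationsI(2)) auto
next
  case (diff x y)
  from tensor_kernelD(3)[OF A B diff(3,4)] show ?case by (simp add: algebra_simps)
qed

text \<open>Since 0 = 0 + 0, additivity puts minus the sum itself into the kernel.\<close>

lemma tensor_kernel_zero_left:
  assumes A: "left_module (opp_ring R) A'" and B: "left_module R B'"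
    and g: "\<And>b. b \<in> carrier B \<Longrightarrow> g b \<in> carrier B'" and x: "x \<in> tensor_chains A B"
  shows "bi_map (\<lambda>a. \<zero>\<^bsub>A'\<^esub>) g x \<in> tensor_kernel R A' B'"
proof -
  interpret A': left_module "opp_ring R" A' by fact
  have "bi_map (\<lambda>a. \<zero>\<^bsub>A'\<^esub>) g x - bi_map (\<lambda>a. \<zero>\<^bsub>A'\<^esub>) g x - bi_map (\<lambda>a. \<zero>\<^bsub>A'\<^esub>) g x \<in> tensor_kernel R A' B'"
    by (rule tensor_kernel_add_left[OF A B _ _ _ g x]) auto
  from tensor_kernel_minus[OF A B this] show ?thesis by simp
qed

lemma tensor_kernel_zero_right:
  assumes A: "left_module (opp_ring R) A'" and B: "left_module R B'"
    and f: "\<And>a. a \<in> carrier A \<Longrightarrow> f a \<in> carrier A'" and x: "x \<in> tensor_chains A B"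
  shows "bi_map f (\<lambda>b. \<zero>\<^bsub>B'\<^esub>) x \<in> tensor_kernel R A' B'"
proof -
  interpret B': left_module R B' by fact
  have "bi_map f (\<lambda>b. \<zero>\<^bsub>B'\<^esub>) x - bi_map f (\<lambda>b. \<zero>\<^bsub>B'\<^esub>) x - bi_map f (\<lambda>b. \<zero>\<^bsub>B'\<^esub>) x \<in> tensor_kernel R A' B'"
    by (rule tensor_kernel_add_right[OF A B _ _ _ f x]) auto
  from tensor_kernel_minus[OF A B this] show ?thesis by simp
qed

section \<open>Exactness of the tensor product\<close>

context abelian_group
begin

lemma a_inv_zero: "\<ominus> \<zero> = \<zero>"
  by (rule minus_equality) auto

lemma minus_self: "x \<in> carrier G \<Longrightarrow> x \<ominus> x = \<zero>"
  by (simp add: minus_eq r_neg)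

lemma minus_zero: "x \<in> carrier G \<Longrightarrow> x \<ominus> \<zero> = x"
  by (simp add: minus_eq a_inv_zero)

lemma minus_add_cancel: "x \<in> carrier G \<Longrightarrow> y \<in> carrier G \<Longrightarrow> x \<ominus> y \<oplus> y = x"
  by (simp add: minus_eq a_assoc l_neg)

lemma add_minus_cancel: "x \<in> carrier G \<Longrightarrow> y \<in> carrier G \<Longrightarrow> x \<oplus> y \<ominus> y = x"
  by (simp add: minus_eq a_assoc r_neg)

lemma minus_eq_zero_iff: "x \<in> carrier G \<Longrightarrow> y \<in> carrier G \<Longrightarrow> x \<ominus> y = \<zero> \<longleftrightarrow> x = y"
  by (metis minus_add_cancel minus_self l_zero)

end

lemma mod_hom_minus:
  assumes "left_module R A" "left_module R B" "f \<in> mod_hom R A B" "x \<in> carrier A" "y \<in> carrier A"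
  shows "f (x \<ominus>\<^bsub>A\<^esub> y) = f x \<ominus>\<^bsub>B\<^esub> f y"
proof -
  interpret A: left_module R A by fact
  interpret B: left_module R B by fact
  note fD = mod_homD[OF assms(3)]
  have "f (x \<ominus>\<^bsub>A\<^esub> y) \<oplus>\<^bsub>B\<^esub> f y = f x"
    using fD(2)[of "x \<ominus>\<^bsub>A\<^esub> y" y] assms by (simp add: A.M.minus_eq A.M.a_assoc A.M.l_neg)
  then show ?thesis using fD(1) assms
    by (metis A.M.minus_closed B.M.a_assoc B.M.a_inv_closed B.M.minus_eq B.M.r_neg B.M.r_zero)
qed

text \<open>An inverse of the map from (B / im f) \<otimes> X to C \<otimes> X is built from a
  set-theoretic section \<open>s\<close> of g. Modulo \<open>H\<close>, the sums that come from A up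
  to relations, \<open>s\<close> respects the tensor relations, and every x agrees with its image
  under g followed by \<open>s\<close>. If the image under g is a relation, x therefore lies in
  \<open>H\<close>.\<close>

lemma tensor_right_exact_left:
  fixes f :: "'a \<Rightarrow> 'b" and g :: "'b \<Rightarrow> 'c"
  assumes A: "left_module (opp_ring R) A" and B: "left_module (opp_ring R) B"
    and C: "left_module (opp_ring R) C" and X: "left_module R X"
    and f: "f \<in> mod_hom (opp_ring R) A B" and g: "g \<in> mod_hom (opp_ring R) B C" "g ` carrier B = carrier C"
    and exact: "{b \<in> carrier B. g b = \<zero>\<^bsub>C\<^esub>} \<subseteq> f ` carrier A"
    and x: "x \<in> tensor_chains B X" and gx: "bi_map g (\<lambda>b. b) x \<in> tensor_kernel R C X"
  shows "\<exists>y\<in>tensor_chains A X. x - bi_map f (\<lambda>b. b) y \<in> tensor_kernel R B X"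
proof -
  interpret A: left_module "opp_ring R" A by fact
  interpret B: left_module "opp_ring R" B by fact
  interpret C: left_module "opp_ring R" C by fact
  interpret X: left_module R X by fact
  note fD = mod_homD[OF f] and gD = mod_homD[OF g(1)]
  define H where "H = {x. \<exists>y\<in>tensor_chains A X. x - bi_map f (\<lambda>b. b) y \<in> tensor_kernel R B X}"
  have Hdiff: "x - y \<in> H" if "x \<in> H" "y \<in> H" for x y
  proof -
    from that obtain x' y' where *: "x' \<in> tensor_chains A X" "y' \<in> tensor_chains A X"
      "x - bi_map f (\<lambda>b. b) x' \<in> tensor_kernel R B X" "y - bi_map f (\<lambda>b. b) y' \<in> tensor_kernel R B X"
      by (auto simp: H_def)
    from tensor_kernelD(3)[OF B X *(3,4)] have "x - y - bi_map f (\<lambda>b. b) (x' - y') \<in> tensor_kernel R B X"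
      by (simp add: algebra_simps)
    then show ?thesis using *(1,2) by (auto simp: H_def intro!: bexI[of _ "x' - y'"])
  qed
  have Hker: "x \<in> H" if "x \<in> tensor_kernel R B X" for x
    using that by (auto simp: H_def intro!: bexI[of _ 0])
  have Hadd: "x + y \<in> H" if "x \<in> H" "y \<in> H" for x y
    using Hdiff[OF that(1) Hdiff[OF Hker[OF tensor_kernelD(2)[OF B X]] that(2)]] by simp
  have Hone: "frag_of (b, c) \<in> H" if "b \<in> carrier B" "g b = \<zero>\<^bsub>C\<^esub>" "c \<in> carrier X" for b c
  proof -
    from exact that obtain a where "a \<in> carrier A" "b = f a" by blast
    then show ?thesis using that tensor_kernelD(2)[OF B X]
      by (auto simp: H_def intro!: bexI[of _ "frag_of (a, c)"])
  qed
  \<comment> \<open>The difference of b and b' is killed by g, hence comes from A.\<close>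
  have Hcong: "frag_of (b, c) - frag_of (b', c) \<in> H"
    if "b \<in> carrier B" "b' \<in> carrier B" "g b = g b'" "c \<in> carrier X" for b b' c
  proof -
    have "frag_of (b \<ominus>\<^bsub>B\<^esub> b', c) \<in> H"
      using that mod_hom_minus[OF B C g(1), of b b'] gD(1)[of b'] by (intro Hone) (auto simp: C.M.minus_eq C.M.r_neg)
    moreover have "frag_of ((b \<ominus>\<^bsub>B\<^esub> b') \<oplus>\<^bsub>B\<^esub> b', c) - frag_of (b \<ominus>\<^bsub>B\<^esub> b', c) - frag_of (b', c) \<in> tensor_kernel R B X"
      using that by (intro tensor_kernel_rel tensor_relationsI(1)) auto
    moreover have "(b \<ominus>\<^bsub>B\<^esub> b') \<oplus>\<^bsub>B\<^esub> b' = b" using that by (simp add: B.M.minus_eq B.M.a_assoc B.M.l_neg)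
    ultimately have "frag_of (b, c) - frag_of (b \<ominus>\<^bsub>B\<^esub> b', c) - frag_of (b', c) \<in> H"
      using Hker by simp
    from Hadd[OF this \<open>frag_of (b \<ominus>\<^bsub>B\<^esub> b', c) \<in> H\<close>] show ?thesis by simp
  qed
  define s where "s = inv_into (carrier B) g"
  have s: "s c \<in> carrier B" "g (s c) = c" if "c \<in> carrier C" for c
    using that g(2) by (auto simp: s_def inv_into_into f_inv_into_f)
  \<comment> \<open>The set-theoretic section \<open>s\<close> of \<open>g\<close> is a homomorphism modulo the image of \<open>f\<close>.\<close>
  have sker: "bi_map s (\<lambda>b. b) w \<in> H" if "w \<in> tensor_kernel R C X" for w
    using C X that
  proof (induction rule: tensor_kernel_induct)
    case zero then show ?case using Hker tensor_kernelD(2)[OF B X] by simp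
  next
    case (diff x y) then show ?case using Hdiff by simp
  next
    case (rel w)
    then show ?case
    proof (cases rule: tensor_relations_cases)
      case (add_left a a' b)
      have "frag_of (s (a \<oplus>\<^bsub>C\<^esub> a'), b) - frag_of (s a \<oplus>\<^bsub>B\<^esub> s a', b) \<in> H"
        using add_left s gD(2) by (intro Hcong) auto
      moreover have "frag_of (s a \<oplus>\<^bsub>B\<^esub> s a', b) - frag_of (s a, b) - frag_of (s a', b) \<in> H"
        using add_left s by (intro Hker tensor_kernel_rel tensor_relationsI(1)) auto
      ultimately have "frag_of (s (a \<oplus>\<^bsub>C\<^esub> a'), b) - frag_of (s a \<oplus>\<^bsub>B\<^esub> s a', b) +
          (frag_of (s a \<oplus>\<^bsub>B\<^esub> s a', b) - frag_of (s a, b) - frag_of (s a', b)) \<in> H" by (rule Hadd)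
      then show ?thesis unfolding add_left(1) by (simp add: algebra_simps)
    next
      case (add_right a b b')
      then show ?thesis using s by (auto intro!: Hker tensor_kernel_rel tensor_relationsI(2))
    next
      case (balanced a r b)
      have "frag_of (s (r \<odot>\<^bsub>C\<^esub> a), b) - frag_of (r \<odot>\<^bsub>B\<^esub> s a, b) \<in> H"
        using balanced s gD(3) C.smult_closed[of r a] B.smult_closed[of r "s a"] by (intro Hcong) auto
      moreover have "frag_of (r \<odot>\<^bsub>B\<^esub> s a, b) - frag_of (s a, r \<odot>\<^bsub>X\<^esub> b) \<in> H"
        using balanced s by (intro Hker tensor_kernel_rel tensor_relationsI(3)) auto
      ultimately have "frag_of (s (r \<odot>\<^bsub>C\<^esub> a), b) - frag_of (r \<odot>\<^bsub>B\<^esub> s a, b) +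
          (frag_of (r \<odot>\<^bsub>B\<^esub> s a, b) - frag_of (s a, r \<odot>\<^bsub>X\<^esub> b)) \<in> H" by (rule Hadd)
      then show ?thesis unfolding balanced(1) by simp
    qed
  qed
  \<comment> \<open>On generators, b and \<open>s (g b)\<close> have the same image under g, so
    \<open>Hcong\<close> applies.\<close>
  have "x - bi_map (\<lambda>b. s (g b)) (\<lambda>b. b) x \<in> H"
    using x
  proof (induction rule: tensor_chains_induct)
    case zero then show ?case using Hker tensor_kernelD(2)[OF B X] by simp
  next
    case (one b c)
    then show ?case using s gD(1) by (auto intro!: Hcong)
  next
    case (diff x y)
    from Hdiff[OF diff(3,4)] show ?case by (simp add: algebra_simps)
  qed
  from Hadd[OF this sker[OF gx]] show ?thesis by (simp add: H_def)
qed

text \<open>The mirror image over \<open>opp_ring R\<close>, by swapping.\<close>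

lemma tensor_right_exact_right:
  assumes X: "left_module (opp_ring R) X" and A: "left_module R A" and B: "left_module R B"
    and C: "left_module R C"
    and f: "f \<in> mod_hom R A B" and g: "g \<in> mod_hom R B C" "g ` carrier B = carrier C"
    and exact: "{b \<in> carrier B. g b = \<zero>\<^bsub>C\<^esub>} \<subseteq> f ` carrier A"
    and x: "x \<in> tensor_chains X B" and gx: "bi_map (\<lambda>b. b) g x \<in> tensor_kernel R X C"
  shows "\<exists>y\<in>tensor_chains X A. x - bi_map (\<lambda>b. b) f y \<in> tensor_kernel R X B"
proof -
  have "\<exists>y\<in>tensor_chains A X. swap_map x - bi_map f (\<lambda>b. b) y \<in> tensor_kernel (opp_ring R) B X"
    by (rule tensor_right_exact_left[of "opp_ring R" A B C X f g])
      (use assms swap_map_chains tensor_kernel_swap[OF X C gx] in \<open>auto simp: swap_map_bi_map\<close>)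
  then obtain y where y: "y \<in> tensor_chains A X" "swap_map x - bi_map f (\<lambda>b. b) y \<in> tensor_kernel (opp_ring R) B X"
    by blast
  have "swap_map (x - bi_map (\<lambda>b. b) f (swap_map y)) \<in> tensor_kernel (opp_ring R) B X"
    using y(2) by (simp add: swap_map_bi_map)
  then show ?thesis using tensor_kernel_swap_iff[OF X B] swap_map_chains[OF y(1)] by blast
qed

text \<open>The map out of the tensor product is left on formal sums: vanishing on
  \<open>tensor_kernel\<close> takes the place of passing to classes. The balanced map has values in
  an abelian group, so the scalars of G may be of any type.\<close>

lemma tensor_universal:
  fixes G :: "('q, 'g) module"
  assumes A: "left_module (opp_ring R) A" and B: "left_module R B" and G: "abelian_group G"
    and c: "\<And>a b. a \<in> carrier A \<Longrightarrow> b \<in> carrier B \<Longrightarrow> \<phi> a b \<in> carrier G"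
    and l: "\<And>a a' b. a \<in> carrier A \<Longrightarrow> a' \<in> carrier A \<Longrightarrow> b \<in> carrier B \<Longrightarrow>
      \<phi> (a \<oplus>\<^bsub>A\<^esub> a') b = \<phi> a b \<oplus>\<^bsub>G\<^esub> \<phi> a' b"
    and r: "\<And>a b b'. a \<in> carrier A \<Longrightarrow> b \<in> carrier B \<Longrightarrow> b' \<in> carrier B \<Longrightarrow>
      \<phi> a (b \<oplus>\<^bsub>B\<^esub> b') = \<phi> a b \<oplus>\<^bsub>G\<^esub> \<phi> a b'"
    and bal: "\<And>a r b. a \<in> carrier A \<Longrightarrow> r \<in> carrier R \<Longrightarrow> b \<in> carrier B \<Longrightarrow>
      \<phi> (r \<odot>\<^bsub>A\<^esub> a) b = \<phi> a (r \<odot>\<^bsub>B\<^esub> b)"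
  shows "\<exists>h. (\<forall>a\<in>carrier A. \<forall>b\<in>carrier B. h (frag_of (a, b)) = \<phi> a b) \<and>
    (\<forall>x\<in>tensor_chains A B. h x \<in> carrier G) \<and> h 0 = \<zero>\<^bsub>G\<^esub> \<and>
    (\<forall>x\<in>tensor_chains A B. \<forall>y\<in>tensor_chains A B. h (x - y) = h x \<ominus>\<^bsub>G\<^esub> h y) \<and>
    (\<forall>x\<in>tensor_kernel R A B. h x = \<zero>\<^bsub>G\<^esub>)"
proof -
  interpret A: left_module "opp_ring R" A by fact
  interpret B: left_module R B by fact
  interpret G: abelian_group G by fact
  let ?S = "carrier A \<times> carrier B"
  obtain h where h: "h \<in> hom (free_Abelian_group ?S) (add_monoid G)"
    and hf: "\<And>x. x \<in> ?S \<Longrightarrow> h (frag_of x) = case_prod \<phi> x"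
    proof (rule comm_group.free_Abelian_group_universal[OF G.a_comm_group, of "case_prod \<phi>" ?S])
    show "case_prod \<phi> ` ?S \<subseteq> carrier (add_monoid G)" using c by auto
  qed (rule that)
  have hadd: "h (x + y) = h x \<oplus>\<^bsub>G\<^esub> h y" if "x \<in> tensor_chains A B" "y \<in> tensor_chains A B" for x y
    using h that by (auto simp: hom_def tensor_chains_def)
  have hc: "h x \<in> carrier G" if "x \<in> tensor_chains A B" for x
    using h that by (auto simp: hom_def tensor_chains_def)
  have h0: "h 0 = \<zero>\<^bsub>G\<^esub>" using hadd[of 0 0] hc[of 0] by simp
  have hdiff: "h (x - y) = h x \<ominus>\<^bsub>G\<^esub> h y" if "x \<in> tensor_chains A B" "y \<in> tensor_chains A B" for x y
    using hadd[of "x - y" y] hc[of "x - y"] hc[of y] that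
    by (simp add: G.minus_eq G.a_assoc G.r_neg)
  have hk: "h x = \<zero>\<^bsub>G\<^esub>" if "x \<in> tensor_kernel R A B" for x
    using A B that
  proof (induction rule: tensor_kernel_induct)
    case (rel x)
    then show ?case
    proof (cases rule: tensor_relations_cases)
      case (add_left a a' b)
      then show ?thesis using c by (simp add: hdiff hf l G.minus_eq G.minus_add G.a_ac G.r_neg G.r_neg1 G.r_neg2)
    next
      case (add_right a b b')
      then show ?thesis using c by (simp add: hdiff hf r G.minus_eq G.minus_add G.a_ac G.r_neg G.r_neg1 G.r_neg2)
    next
      case (balanced a r b)
      then show ?thesis using c A.smult_closed[of r a] by (simp add: hdiff hf bal G.minus_eq G.r_neg)
    qed
  next
    case (diff x y)
    then show ?case using tensor_kernel_chains[OF A B] hdiff by (simp add: G.minus_eq)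
  qed (rule h0)
  show ?thesis using hf hc hdiff hk h0 by (intro exI[of _ h]) auto
qed

lemma tensor_kernel_frag_zero:
  assumes A: "left_module (opp_ring R) A" and B: "left_module R B"
  shows "b \<in> carrier B \<Longrightarrow> frag_of (\<zero>\<^bsub>A\<^esub>, b) \<in> tensor_kernel R A B"
    and "a \<in> carrier A \<Longrightarrow> frag_of (a, \<zero>\<^bsub>B\<^esub>) \<in> tensor_kernel R A B"
proof -
  interpret A: left_module "opp_ring R" A by fact
  interpret B: left_module R B by fact
  show "frag_of (\<zero>\<^bsub>A\<^esub>, b) \<in> tensor_kernel R A B" if "b \<in> carrier B"
    using tensor_kernel_zero_left[OF A B, of B "\<lambda>b. b" "frag_of (\<zero>\<^bsub>A\<^esub>, b)" A] that by simp
  show "frag_of (a, \<zero>\<^bsub>B\<^esub>) \<in> tensor_kernel R A B" if "a \<in> carrier A"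
    using tensor_kernel_zero_right[OF A B, of A "\<lambda>a. a" "frag_of (a, \<zero>\<^bsub>B\<^esub>)" B] that by simp
qed

lemma tensor_kernel_sum:
  assumes "left_module (opp_ring R) A" "left_module R B" "\<And>s. s \<in> T \<Longrightarrow> x s \<in> tensor_kernel R A B"
  shows "(\<Sum>s\<in>T. x s) \<in> tensor_kernel R A B"
  using assms(3) by (induction T rule: infinite_finite_induct)
    (auto simp: tensor_kernelD(2,4)[OF assms(1,2)])

subsection \<open>Free modules\<close>

text \<open>Expands v into unit vectors and moves the coefficients over to a. The index set T may
  exceed the support of v, which allows several tensors to be expanded over a common set.\<close>

lemma tensor_free_frag_of:
  fixes A :: "('r, 'a) module" and S :: "'s set"
  assumes A: "left_module (opp_ring R) A" and R: "ring R"
    and a: "a \<in> carrier A" and v: "v \<in> carrier (free_module R S)"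
    and T: "finite T" "{s. v s \<noteq> \<zero>\<^bsub>R\<^esub>} \<subseteq> T" "T \<subseteq> S"
  defines "e \<equiv> \<lambda>s t. if t = s then \<one>\<^bsub>R\<^esub> else \<zero>\<^bsub>R\<^esub>"
  shows "frag_of (a, v) - (\<Sum>s\<in>T. frag_of (v s \<odot>\<^bsub>A\<^esub> a, e s)) \<in> tensor_kernel R A (free_module R S)"
proof -
  let ?L = "free_module R S" and ?K = "tensor_kernel R A (free_module R S)"
  have L: "left_module R ?L" by (rule free_module_left_module[OF R])
  interpret A: left_module "opp_ring R" A by fact
  interpret L: left_module R ?L by fact
  have vR: "v s \<in> carrier R" for s using v by simp
  \<comment> \<open>The vector is truncated to U, so that the induction can add one coordinate at a
    time.\<close>
  have main: "frag_of (a, \<lambda>s. if s \<in> U then v s else \<zero>\<^bsub>R\<^esub>) - (\<Sum>s\<in>U. frag_of (v s \<odot>\<^bsub>A\<^esub> a, e s)) \<in> ?K"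
    if "finite U" "U \<subseteq> S" for U
    using that
  proof (induction U rule: finite_induct)
    case empty
    show ?case using tensor_kernel_frag_zero(2)[OF A L a] by simp
  next
    case (insert u U)
    let ?r = "\<lambda>U s. if s \<in> U then v s else \<zero>\<^bsub>R\<^esub>"
    have rc: "?r U \<in> carrier ?L" "e u \<in> carrier ?L"
      using insert vR by (auto simp: e_def rev_finite_subset)
    have eq: "?r (insert u U) = ?r U \<oplus>\<^bsub>?L\<^esub> (v u \<odot>\<^bsub>?L\<^esub> e u)"
      using insert vR by (auto simp: e_def fun_eq_iff)
    have 1: "frag_of (a, ?r U \<oplus>\<^bsub>?L\<^esub> (v u \<odot>\<^bsub>?L\<^esub> e u)) - frag_of (a, ?r U) - frag_of (a, v u \<odot>\<^bsub>?L\<^esub> e u) \<in> ?K"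
      using a rc vR by (intro tensor_kernel_rel tensor_relationsI(2) L.smult_closed) auto
    have 2: "frag_of (v u \<odot>\<^bsub>A\<^esub> a, e u) - frag_of (a, v u \<odot>\<^bsub>?L\<^esub> e u) \<in> ?K"
      using a rc vR by (intro tensor_kernel_rel tensor_relationsI(3)) auto
    have 3: "frag_of (a, ?r U) - (\<Sum>s\<in>U. frag_of (v s \<odot>\<^bsub>A\<^esub> a, e s)) \<in> ?K"
      using insert by simp
    from tensor_kernelD(4)[OF A L tensor_kernelD(3)[OF A L 1 2] 3] show ?case
      unfolding eq using insert by (simp add: algebra_simps del: free_module_simps)
  qed
  have "(\<lambda>s. if s \<in> T then v s else \<zero>\<^bsub>R\<^esub>) = v"
  proof
    fix s show "(if s \<in> T then v s else \<zero>\<^bsub>R\<^esub>) = v s" using subsetD[OF T(2), of s] by (cases "v s = \<zero>\<^bsub>R\<^esub>") simp_all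
  qed
  then show ?thesis using main[OF T(1,3)] by (simp del: free_module_simps)
qed

text \<open>The tensor product of A with the free module is a direct sum of copies of A, one for
  each s in S, and f acts on each copy separately. So all coordinates of x vanish as soon as those
  of its image do, and x is determined by its coordinates.\<close>

lemma tensor_free_inj:
  fixes A :: "('r, 'a) module" and B :: "('r, 'b) module" and S :: "'s set"
  assumes A: "left_module (opp_ring R) A" and B: "left_module (opp_ring R) B" and R: "ring R"
    and f: "f \<in> mod_hom (opp_ring R) A B" "inj_on f (carrier A)"
    and x: "x \<in> tensor_chains A (free_module R S)"
    and fx: "bi_map f (\<lambda>b. b) x \<in> tensor_kernel R B (free_module R S)"
  shows "x \<in> tensor_kernel R A (free_module R S)"
proof -
  let ?L = "free_module R S" and ?K = "tensor_kernel R A (free_module R S)"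
  define e where "e = (\<lambda>(s::'s) t. if t = s then \<one>\<^bsub>R\<^esub> else \<zero>\<^bsub>R\<^esub>)"
  have L: "left_module R ?L" by (rule free_module_left_module[OF R])
  interpret A: left_module "opp_ring R" A by fact
  interpret B: left_module "opp_ring R" B by fact
  interpret L: left_module R ?L by fact
  note fD = mod_homD[OF f(1)]
  have f0: "f \<zero>\<^bsub>A\<^esub> = \<zero>\<^bsub>B\<^esub>" by (rule mod_hom_zero[OF A B f(1)])
  \<comment> \<open>The coordinate at s, induced by the balanced map that sends (a, v) to
    \<open>v s\<close> times a.\<close>
  have coord: "\<forall>s. \<exists>h. (\<forall>a\<in>carrier C. \<forall>v\<in>carrier ?L. h (frag_of (a, v)) = v s \<odot>\<^bsub>C\<^esub> a) \<and>
    (\<forall>x\<in>tensor_chains C ?L. h x \<in> carrier C) \<and> h 0 = \<zero>\<^bsub>C\<^esub> \<and>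
    (\<forall>x\<in>tensor_chains C ?L. \<forall>y\<in>tensor_chains C ?L. h (x - y) = h x \<ominus>\<^bsub>C\<^esub> h y) \<and>
    (\<forall>x\<in>tensor_kernel R C ?L. h x = \<zero>\<^bsub>C\<^esub>)"
    if C: "left_module (opp_ring R) C" for C :: "('r, 'c) module"
  proof
    fix s
    interpret C: left_module "opp_ring R" C by fact
    show "\<exists>h. (\<forall>a\<in>carrier C. \<forall>v\<in>carrier ?L. h (frag_of (a, v)) = v s \<odot>\<^bsub>C\<^esub> a) \<and>
      (\<forall>x\<in>tensor_chains C ?L. h x \<in> carrier C) \<and> h 0 = \<zero>\<^bsub>C\<^esub> \<and>
      (\<forall>x\<in>tensor_chains C ?L. \<forall>y\<in>tensor_chains C ?L. h (x - y) = h x \<ominus>\<^bsub>C\<^esub> h y) \<and>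
      (\<forall>x\<in>tensor_kernel R C ?L. h x = \<zero>\<^bsub>C\<^esub>)"
    proof (rule tensor_universal[OF C L C.M.abelian_group_axioms])
      fix a r b assume "a \<in> carrier C" "r \<in> carrier R" "b \<in> carrier ?L"
      then show "b s \<odot>\<^bsub>C\<^esub> (r \<odot>\<^bsub>C\<^esub> a) = (r \<odot>\<^bsub>?L\<^esub> b) s \<odot>\<^bsub>C\<^esub> a"
        using C.smult_assoc1[of "b s" r a] by simp
    next
      fix a b b' assume "a \<in> carrier C" "b \<in> carrier ?L" "b' \<in> carrier ?L"
      then show "(b \<oplus>\<^bsub>?L\<^esub> b') s \<odot>\<^bsub>C\<^esub> a = b s \<odot>\<^bsub>C\<^esub> a \<oplus>\<^bsub>C\<^esub> b' s \<odot>\<^bsub>C\<^esub> a"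
        using C.smult_l_distr[of "b s" "b' s" a] by simp
    next
      fix a b assume "a \<in> carrier C" "b \<in> carrier ?L"
      then show "b s \<odot>\<^bsub>C\<^esub> a \<in> carrier C" using C.smult_closed[of "b s" a] by simp
    next
      fix a a' b assume "a \<in> carrier C" "a' \<in> carrier C" "b \<in> carrier ?L"
      then show "b s \<odot>\<^bsub>C\<^esub> (a \<oplus>\<^bsub>C\<^esub> a') = b s \<odot>\<^bsub>C\<^esub> a \<oplus>\<^bsub>C\<^esub> b s \<odot>\<^bsub>C\<^esub> a'"
        using C.smult_r_distr[of "b s" a a'] by simp
    qed
  qed
  obtain h where h: "\<And>s a v. a \<in> carrier A \<Longrightarrow> v \<in> carrier ?L \<Longrightarrow> h s (frag_of (a, v)) = v s \<odot>\<^bsub>A\<^esub> a"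
    "\<And>s x. x \<in> tensor_chains A ?L \<Longrightarrow> h s x \<in> carrier A" "\<And>s. h s 0 = \<zero>\<^bsub>A\<^esub>"
    "\<And>s x y. x \<in> tensor_chains A ?L \<Longrightarrow> y \<in> tensor_chains A ?L \<Longrightarrow> h s (x - y) = h s x \<ominus>\<^bsub>A\<^esub> h s y"
    using choice[OF coord[OF A]] by blast
  obtain k where k: "\<And>s a v. a \<in> carrier B \<Longrightarrow> v \<in> carrier ?L \<Longrightarrow> k s (frag_of (a, v)) = v s \<odot>\<^bsub>B\<^esub> a"
    "\<And>s x. x \<in> tensor_chains B ?L \<Longrightarrow> k s x \<in> carrier B" "\<And>s. k s 0 = \<zero>\<^bsub>B\<^esub>"
    "\<And>s x y. x \<in> tensor_chains B ?L \<Longrightarrow> y \<in> tensor_chains B ?L \<Longrightarrow> k s (x - y) = k s x \<ominus>\<^bsub>B\<^esub> k s y"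
    "\<And>s x. x \<in> tensor_kernel R B ?L \<Longrightarrow> k s x = \<zero>\<^bsub>B\<^esub>"
    using choice[OF coord[OF B]] by blast
  have kf: "k s (bi_map f (\<lambda>b. b) x) = f (h s x)" if "x \<in> tensor_chains A ?L" for s x
    using that
  proof (induction rule: tensor_chains_induct)
    case zero then show ?case using h k f0 by simp
  next
    case (one a v)
    then show ?case using h k fD(1,3) by simp
  next
    case (diff x y)
    then show ?case using h k mod_hom_minus[OF A B f(1)] bi_map_chains[of _ A ?L f B "\<lambda>b. b" ?L] fD(1) by simp
  qed
  \<comment> \<open>The expansion is claimed for every large enough finite U, because the difference
    step has to expand both terms over one and the same set.\<close>
  have "\<exists>T. finite T \<and> T \<subseteq> S \<and> (\<forall>U. finite U \<longrightarrow> T \<subseteq> U \<longrightarrow> U \<subseteq> S \<longrightarrow> x - (\<Sum>s\<in>U. frag_of (h s x, e s)) \<in> ?K)"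
    using x
  proof (induction rule: tensor_chains_induct)
    case zero
    have "frag_of (\<zero>\<^bsub>A\<^esub>, e s) \<in> ?K" if "s \<in> S" for s
      using that by (intro tensor_kernel_frag_zero(1)[OF A L]) (auto simp: e_def)
    then have "(\<Sum>s\<in>U. frag_of (\<zero>\<^bsub>A\<^esub>, e s)) \<in> ?K" if "U \<subseteq> S" for U
      using that by (intro tensor_kernel_sum[OF A L]) auto
    then show ?case using tensor_kernel_minus[OF A L] by (intro exI[of _ "{}"]) (auto simp: h)
  next
    case (one a v)
    then show ?case using tensor_free_frag_of[OF A R one(1,2)] unfolding e_def
      by (intro exI[of _ "{s. v s \<noteq> \<zero>\<^bsub>R\<^esub>}"]) (auto simp: h)
  next
    case (diff x y)
    from diff(3) obtain T where T: "finite T" "T \<subseteq> S"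
      "\<And>U. finite U \<Longrightarrow> T \<subseteq> U \<Longrightarrow> U \<subseteq> S \<Longrightarrow> x - (\<Sum>s\<in>U. frag_of (h s x, e s)) \<in> ?K" by blast
    from diff(4) obtain T' where T': "finite T'" "T' \<subseteq> S"
      "\<And>U. finite U \<Longrightarrow> T' \<subseteq> U \<Longrightarrow> U \<subseteq> S \<Longrightarrow> y - (\<Sum>s\<in>U. frag_of (h s y, e s)) \<in> ?K" by blast
    have "x - y - (\<Sum>s\<in>U. frag_of (h s (x - y), e s)) \<in> ?K"
      if U: "finite U" "T \<union> T' \<subseteq> U" "U \<subseteq> S" for U
    proof -
      have 1: "frag_of (h s x, e s) - frag_of (h s (x - y), e s) - frag_of (h s y, e s) \<in> ?K" if "s \<in> S" for s
      proof -
        have *: "h s x \<ominus>\<^bsub>A\<^esub> h s y \<oplus>\<^bsub>A\<^esub> h s y = h s x" "h s x \<in> carrier A" "h s y \<in> carrier A"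
          using h(2)[OF diff(1)] h(2)[OF diff(2)] by (auto simp: A.M.minus_eq A.M.a_assoc A.M.l_neg)
        have "frag_of (h s x \<ominus>\<^bsub>A\<^esub> h s y \<oplus>\<^bsub>A\<^esub> h s y, e s) - frag_of (h s x \<ominus>\<^bsub>A\<^esub> h s y, e s) - frag_of (h s y, e s) \<in> ?K"
          using * that by (intro tensor_kernel_rel tensor_relationsI(1)) (auto simp: e_def)
        then show ?thesis using * h(4)[OF diff(1,2)] by simp
      qed
      have "(\<Sum>s\<in>U. frag_of (h s x, e s) - frag_of (h s (x - y), e s) - frag_of (h s y, e s)) \<in> ?K"
        using 1 U by (intro tensor_kernel_sum[OF A L]) auto
      moreover have "(x - (\<Sum>s\<in>U. frag_of (h s x, e s))) - (y - (\<Sum>s\<in>U. frag_of (h s y, e s))) \<in> ?K"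
        using U by (intro tensor_kernelD(3)[OF A L] T T') auto
      ultimately have "(\<Sum>s\<in>U. frag_of (h s x, e s) - frag_of (h s (x - y), e s) - frag_of (h s y, e s)) +
          ((x - (\<Sum>s\<in>U. frag_of (h s x, e s))) - (y - (\<Sum>s\<in>U. frag_of (h s y, e s)))) \<in> ?K"
        by (rule tensor_kernelD(4)[OF A L])
      then show ?thesis by (simp add: sum_subtractf sum.distrib algebra_simps)
    qed
    then show ?case using T T' by (intro exI[of _ "T \<union> T'"]) auto
  qed
  then obtain T where T: "finite T" "T \<subseteq> S" "x - (\<Sum>s\<in>T. frag_of (h s x, e s)) \<in> ?K" by blast
  have "h s x = \<zero>\<^bsub>A\<^esub>" for s
  proof -
    have "f (h s x) = f \<zero>\<^bsub>A\<^esub>" using kf[OF x] k(5)[OF fx] f0 by metis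
    then show ?thesis using f(2) h(2)[OF x] by (auto simp: inj_on_def)
  qed
  moreover have "frag_of (\<zero>\<^bsub>A\<^esub>, e s) \<in> ?K" if "s \<in> S" for s
    using that by (intro tensor_kernel_frag_zero(1)[OF A L]) (auto simp: e_def)
  then have "(\<Sum>s\<in>T. frag_of (\<zero>\<^bsub>A\<^esub>, e s)) \<in> ?K"
    using T(2) by (intro tensor_kernel_sum[OF A L]) auto
  ultimately show ?thesis using tensor_kernelD(4)[OF A L T(3), of "\<Sum>s\<in>T. frag_of (\<zero>\<^bsub>A\<^esub>, e s)"] by simp
qed

subsection \<open>Flat modules\<close>

text \<open>Here A and B may live on any types, thanks to \<open>flat_module_inj\<close>; to prove
  flatness, \<open>flat_moduleI\<close> asks only for the test modules of the definition.\<close>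

lemma flat_moduleD:
  assumes "flat_module R F" "left_module R A" "left_module R B"
    and "g \<in> mod_hom R A B" "inj_on g (carrier A)"
    and "x \<in> tensor_chains F A" "bi_map (\<lambda>a. a) g x \<in> tensor_kernel R F B"
  shows "x \<in> tensor_kernel R F A"
proof -
  have F: "left_module (opp_ring R) F" using assms(1) by (simp add: flat_module_def)
  show ?thesis
    using flat_module_inj[OF assms(1-5)] assms(6,7)
    unfolding inj_on_tensor_map_iff[OF F assms(2-4)] tensor_chains_def bi_map_def by blast
qed

lemma flat_moduleI:
  fixes R :: "'r ring"
  assumes F: "left_module (opp_ring R) F"
    and "\<And>(A :: ('r, nat \<Rightarrow> 'r) module) (B :: ('r, nat \<Rightarrow> 'r) module) g x.
      left_module R A \<Longrightarrow> left_module R B \<Longrightarrow> g \<in> mod_hom R A B \<Longrightarrow> inj_on g (carrier A) \<Longrightarrow>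
      x \<in> tensor_chains F A \<Longrightarrow> bi_map (\<lambda>a. a) g x \<in> tensor_kernel R F B \<Longrightarrow> x \<in> tensor_kernel R F A"
  shows "flat_module R F"
  unfolding flat_module_def
proof (intro conjI allI impI F, elim conjE)
  fix A B :: "('r, nat \<Rightarrow> 'r) module" and g
  assume *: "left_module R A" "left_module R B" "g \<in> mod_hom R A B" "inj_on g (carrier A)"
  show "inj_on (tensor_map R F B id g) (carrier (tensor_group R F A))"
    unfolding inj_on_tensor_map_iff[OF F *(1-3)]
    using assms(2)[OF *] unfolding tensor_chains_def bi_map_def by blast
qed

lemma lincomb_surj:
  assumes "left_module R A"
  shows "lincomb R A (\<lambda>x. x) ` carrier (free_module R (carrier A)) = carrier A"
  using lincomb_unit[OF assms, of "\<lambda>x. x" "carrier A"]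
    mod_homD(1)[OF lincomb_hom[OF assms, of "\<lambda>x. x" "carrier A"]]
  by (auto simp: image_iff simp del: free_module_simps)

text \<open>P is a retract of a free module L. An element of P \<otimes> A that dies in P \<otimes>
  B also dies in L \<otimes> B, hence is zero in L \<otimes> A, and the retraction takes this back
  to P \<otimes> A. The swaps occur because \<open>tensor_free_inj\<close> has the free module on
  the right.\<close>

lemma projective_module_flat:
  assumes "projective_module (opp_ring R) P"
  shows "flat_module R P"
proof (rule flat_moduleI)
  show P: "left_module (opp_ring R) P" using assms by (simp add: projective_module_def)
  then interpret P: left_module "opp_ring R" P .
  let ?L = "free_module (opp_ring R) (carrier P)" and ?\<pi> = "lincomb (opp_ring R) P (\<lambda>x. x)"
  have L: "left_module (opp_ring R) ?L" by (rule free_module_left_module) (rule P.R.ring_axioms)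
  have \<pi>: "?\<pi> \<in> mod_hom (opp_ring R) ?L P" by (rule lincomb_hom[OF P]) auto
  obtain s where s: "s \<in> mod_hom (opp_ring R) P ?L" "\<And>x. x \<in> carrier P \<Longrightarrow> ?\<pi> (s x) = x"
    using projective_module_lift[OF assms L P \<pi> lincomb_surj[OF P] mod_hom_ident] by blast
  fix A B :: "('a, nat \<Rightarrow> 'a) module" and g x
  assume A: "left_module R A" and B: "left_module R B" and g: "g \<in> mod_hom R A B" "inj_on g (carrier A)"
    and x: "x \<in> tensor_chains P A" and gx: "bi_map (\<lambda>a. a) g x \<in> tensor_kernel R P B"
  have R': "left_module (opp_ring (opp_ring R)) A" "left_module (opp_ring (opp_ring R)) B" using A B by simp_all
  have sx: "swap_map x \<in> tensor_chains A P" by (rule swap_map_chains[OF x])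
  have "bi_map s (\<lambda>b. b) (bi_map (\<lambda>a. a) g x) \<in> tensor_kernel R ?L B"
    by (rule tensor_kernel_bi_map[OF P L B B s(1) mod_hom_ident gx])
  from tensor_kernel_swap[OF L B this]
  have "bi_map g (\<lambda>b. b) (bi_map (\<lambda>b. b) s (swap_map x)) \<in> tensor_kernel (opp_ring R) B ?L"
    by (simp add: swap_map_bi_map)
  moreover have "bi_map (\<lambda>b. b) s (swap_map x) \<in> tensor_chains A ?L"
    using mod_homD(1)[OF s(1)] by (intro bi_map_chains[OF sx]) blast+
  ultimately have "bi_map (\<lambda>b. b) s (swap_map x) \<in> tensor_kernel (opp_ring R) A ?L"
    using g by (intro tensor_free_inj[OF R' P.R.ring_axioms]) auto
  from tensor_kernel_bi_map[OF R'(1) R'(1) L P mod_hom_ident \<pi> this]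
  have "bi_map (\<lambda>b. b) (\<lambda>a. ?\<pi> (s a)) (swap_map x) \<in> tensor_kernel (opp_ring R) A P" by simp
  also have "bi_map (\<lambda>b. b) (\<lambda>a. ?\<pi> (s a)) (swap_map x) = bi_map (\<lambda>b. b) (\<lambda>a. a) (swap_map x)"
    using s(2) by (intro bi_map_cong[OF sx]) auto
  finally show "x \<in> tensor_kernel R P A" using tensor_kernel_swap_iff[OF P A] by simp
qed

section \<open>Kernels of surjections onto flat modules\<close>

lemma kernel_left_module:
  assumes A: "left_module R A" and B: "left_module R B" and g: "g \<in> mod_hom R A B"
  shows "left_module R (A\<lparr>carrier := {a \<in> carrier A. g a = \<zero>\<^bsub>B\<^esub>}\<rparr>)"
proof -
  interpret A: left_module R A by fact
  interpret B: left_module R B by fact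
  show ?thesis
    by (rule A.submodule_left_module) (use mod_homD[OF g] mod_hom_zero[OF A B g] in auto)
qed

lemma incl_mod_hom: "S \<subseteq> carrier A \<Longrightarrow> (\<lambda>x. x) \<in> mod_hom R (A\<lparr>carrier := S\<rparr>) A"
  by (auto simp: mod_hom_def)

lemma tensor_chains_mono: "x \<in> tensor_chains A (B\<lparr>carrier := S\<rparr>) \<Longrightarrow> S \<subseteq> carrier B \<Longrightarrow> x \<in> tensor_chains A B"
  "x \<in> tensor_chains (A\<lparr>carrier := U\<rparr>) B \<Longrightarrow> U \<subseteq> carrier A \<Longrightarrow> x \<in> tensor_chains A B"
  unfolding tensor_chains_def by auto

text \<open>This is the vanishing of Tor in degree one for C and X, obtained by a chase along 0
  \<rightarrow> K \<rightarrow> L \<rightarrow> X \<rightarrow> 0 with L free on the elements of X.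
  Flatness of C serves the inclusion of K into L, freeness of L the injection f.\<close>

lemma tensor_flat_pure:
  fixes A :: "('r, 'a) module" and B :: "('r, 'b) module" and C :: "('r, 'c) module" and X :: "('r, 'x) module"
  assumes A: "left_module (opp_ring R) A" and B: "left_module (opp_ring R) B" and X: "left_module R X"
    and f: "f \<in> mod_hom (opp_ring R) A B" "inj_on f (carrier A)"
    and g: "g \<in> mod_hom (opp_ring R) B C" "g ` carrier B = carrier C"
    and exact: "{b \<in> carrier B. g b = \<zero>\<^bsub>C\<^esub>} = f ` carrier A"
    and flat: "flat_module R C"
    and x: "x \<in> tensor_chains A X" and fx: "bi_map f (\<lambda>b. b) x \<in> tensor_kernel R B X"
  shows "x \<in> tensor_kernel R A X"
proof -
  have C: "left_module (opp_ring R) C" using flat by (simp add: flat_module_def)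
  interpret X: left_module R X by fact
  let ?L = "free_module R (carrier X)" and ?\<pi> = "lincomb R X (\<lambda>x. x)"
  let ?S = "{v \<in> carrier ?L. ?\<pi> v = \<zero>\<^bsub>X\<^esub>}"
  let ?K = "?L\<lparr>carrier := ?S\<rparr>"
  have L: "left_module R ?L" by (rule free_module_left_module) (rule X.R.ring_axioms)
  have \<pi>: "?\<pi> \<in> mod_hom R ?L X" by (rule lincomb_hom[OF X]) auto
  have K: "left_module R ?K" by (rule kernel_left_module[OF L X \<pi>])
  have i: "(\<lambda>x. x) \<in> mod_hom R ?K ?L" by (rule incl_mod_hom) blast
  obtain y where y: "y \<in> tensor_chains A ?L" "bi_map (\<lambda>a. a) ?\<pi> y = x"
    using tensor_chains_surj[OF x, of "\<lambda>a. a" A ?\<pi> ?L] lincomb_surj[OF X] by auto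
  have fy: "bi_map f (\<lambda>b. b) y \<in> tensor_chains B ?L"
    using mod_homD(1)[OF f(1)] by (intro bi_map_chains[OF y(1)]) blast+
  have "bi_map (\<lambda>a. a) ?\<pi> (bi_map f (\<lambda>b. b) y) = bi_map f (\<lambda>b. b) (bi_map (\<lambda>a. a) ?\<pi> y)" by simp
  also have "\<dots> \<in> tensor_kernel R B X" using y(2) fx by simp
  finally have "bi_map (\<lambda>a. a) ?\<pi> (bi_map f (\<lambda>b. b) y) \<in> tensor_kernel R B X" .
  \<comment> \<open>The image of y in B \<otimes> L vanishes in B \<otimes> X, so it comes from
    K.\<close>
  then obtain k where k: "k \<in> tensor_chains B ?K"
    "bi_map f (\<lambda>b. b) y - bi_map (\<lambda>b. b) (\<lambda>b. b) k \<in> tensor_kernel R B ?L"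
    using tensor_right_exact_right[OF B K L X i \<pi> lincomb_surj[OF X] _ fy] by (auto simp del: free_module_simps)
  from tensor_kernel_bi_map[OF B C L L g(1) mod_hom_ident k(2)]
  have 1: "bi_map (\<lambda>a. g (f a)) (\<lambda>b. b) y - bi_map g (\<lambda>b. b) k \<in> tensor_kernel R C ?L" by simp
  have "bi_map (\<lambda>a. g (f a)) (\<lambda>b. b) y = bi_map (\<lambda>a. \<zero>\<^bsub>C\<^esub>) (\<lambda>b. b) y"
    using exact by (intro bi_map_cong[OF y(1)]) auto
  also have "\<dots> \<in> tensor_kernel R C ?L" by (rule tensor_kernel_zero_left[OF C L _ y(1)])
  finally have "bi_map (\<lambda>a. a) (\<lambda>b. b) (bi_map g (\<lambda>b. b) k) \<in> tensor_kernel R C ?L"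
    using tensor_kernel_cong[OF C L 1] by simp
  moreover have "bi_map g (\<lambda>b. b) k \<in> tensor_chains C ?K"
    using mod_homD(1)[OF g(1)] by (intro bi_map_chains[OF k(1)]) blast+
  \<comment> \<open>The image of k dies in C \<otimes> L because g after f is zero; as C is flat, it
    is already zero in C \<otimes> K.\<close>
  ultimately have "bi_map g (\<lambda>b. b) k \<in> tensor_kernel R C ?K"
    by (intro flat_moduleD[OF flat K L i]) auto
  then obtain a where a: "a \<in> tensor_chains A ?K" "k - bi_map f (\<lambda>b. b) a \<in> tensor_kernel R B ?K"
    using tensor_right_exact_left[OF A B C K f(1) g equalityD1[OF exact] k(1)] by blast
  have aL: "a \<in> tensor_chains A ?L" using a(1) by (rule tensor_chains_mono) blast
  from tensor_kernel_bi_map[OF B B K L mod_hom_ident i a(2)]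
  have "k - bi_map f (\<lambda>b. b) a \<in> tensor_kernel R B ?L" by simp
  then have "bi_map f (\<lambda>b. b) y - bi_map f (\<lambda>b. b) a \<in> tensor_kernel R B ?L"
    using k(2) tensor_kernel_trans[OF B L] by simp
  then have "bi_map f (\<lambda>b. b) (y - a) \<in> tensor_kernel R B ?L" by simp
  \<comment> \<open>Since L is free, f is injective on A \<otimes> L, so y and a agree there. But a
    vanishes in A \<otimes> X, because its entries from L lie in K.\<close>
  then have "y - a \<in> tensor_kernel R A ?L"
    using y(1) aL by (intro tensor_free_inj[OF A B X.R.ring_axioms f]) auto
  from tensor_kernel_bi_map[OF A A L X mod_hom_ident \<pi> this]
  have 2: "x - bi_map (\<lambda>a. a) ?\<pi> a \<in> tensor_kernel R A X" using y(2) by simp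
  have "bi_map (\<lambda>a. a) ?\<pi> a = bi_map (\<lambda>a. a) (\<lambda>b. \<zero>\<^bsub>X\<^esub>) a"
    by (intro bi_map_cong[OF a(1)]) auto
  also have "\<dots> \<in> tensor_kernel R A X" by (rule tensor_kernel_zero_right[OF A X _ a(1)])
  finally show ?thesis using tensor_kernel_cong[OF A X 2] by simp
qed

text \<open>An element of A \<otimes> X that dies in A \<otimes> Y dies in B \<otimes> Y, hence in B
  \<otimes> X as B is flat; purity of A in B makes it zero.\<close>

lemma flat_module_kernel:
  fixes A :: "('r, 'a) module" and B :: "('r, 'b) module" and C :: "('r, 'c) module"
  assumes A: "left_module (opp_ring R) A"
    and f: "f \<in> mod_hom (opp_ring R) A B" "inj_on f (carrier A)"
    and g: "g \<in> mod_hom (opp_ring R) B C" "g ` carrier B = carrier C"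
    and exact: "{b \<in> carrier B. g b = \<zero>\<^bsub>C\<^esub>} = f ` carrier A"
    and flat: "flat_module R B" "flat_module R C"
  shows "flat_module R A"
proof (rule flat_moduleI[OF A])
  fix X Y :: "('r, nat \<Rightarrow> 'r) module" and h x
  assume X: "left_module R X" and Y: "left_module R Y" and h: "h \<in> mod_hom R X Y" "inj_on h (carrier X)"
    and x: "x \<in> tensor_chains A X" and hx: "bi_map (\<lambda>a. a) h x \<in> tensor_kernel R A Y"
  have B: "left_module (opp_ring R) B" using flat by (simp add: flat_module_def)
  have "bi_map (\<lambda>a. a) h (bi_map f (\<lambda>b. b) x) \<in> tensor_kernel R B Y"
    using tensor_kernel_bi_map[OF A B Y Y f(1) mod_hom_ident hx] by simp
  moreover have "bi_map f (\<lambda>b. b) x \<in> tensor_chains B X"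
    using mod_homD(1)[OF f(1)] by (intro bi_map_chains[OF x]) blast+
  ultimately have "bi_map f (\<lambda>b. b) x \<in> tensor_kernel R B X"
    by (intro flat_moduleD[OF flat(1) X Y h]) auto
  then show "x \<in> tensor_kernel R A X" by (rule tensor_flat_pure[OF A B X f g exact flat(2) x])
qed

section \<open>Acyclic complexes of flat modules\<close>

lemma mod_hom_a_inv:
  assumes "left_module R A" "left_module R B" "f \<in> mod_hom R A B" "x \<in> carrier A"
  shows "f (\<ominus>\<^bsub>A\<^esub> x) = \<ominus>\<^bsub>B\<^esub> f x"
proof -
  interpret A: left_module R A by fact
  interpret B: left_module R B by fact
  show ?thesis
    using mod_hom_minus[OF assms(1-3), of "\<zero>\<^bsub>A\<^esub>" x] assms(4) mod_hom_zero[OF assms(1-3)]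
      mod_homD(1)[OF assms(3,4)] by (simp add: A.M.minus_eq B.M.minus_eq)
qed

lemma is_complexD:
  assumes "is_complex R X"
  shows "left_module R (obj X n)" "diff X n \<in> mod_hom R (obj X n) (obj X (n - 1))"
    "x \<in> carrier (obj X n) \<Longrightarrow> diff X (n - 1) (diff X n x) = \<zero>\<^bsub>obj X (n - 2)\<^esub>"
    "x \<in> carrier (obj X (n + 1)) \<Longrightarrow> diff X n (diff X (n + 1) x) = \<zero>\<^bsub>obj X (n - 1)\<^esub>"
proof -
  have 1: "diff X (n - 1) (diff X n x) = \<zero>\<^bsub>obj X (n - 2)\<^esub>" if "x \<in> carrier (obj X n)" for n x
    using assms that by (auto simp: is_complex_def)
  show "left_module R (obj X n)" "diff X n \<in> mod_hom R (obj X n) (obj X (n - 1))"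
    using assms by (auto simp: is_complex_def)
  show "x \<in> carrier (obj X n) \<Longrightarrow> diff X (n - 1) (diff X n x) = \<zero>\<^bsub>obj X (n - 2)\<^esub>" by (rule 1)
  show "x \<in> carrier (obj X (n + 1)) \<Longrightarrow> diff X n (diff X (n + 1) x) = \<zero>\<^bsub>obj X (n - 1)\<^esub>"
    using 1[of x "n + 1"] by simp
qed

lemma diff_succ_mod_hom:
  assumes "is_complex R X"
  shows "diff X (n + 1) \<in> mod_hom R (obj X (n + 1)) (obj X n)"
  using is_complexD(2)[OF assms, of "n + 1"] by simp

lemma boundaries_subset_cycles:
  assumes "is_complex R X"
  shows "boundaries X n \<subseteq> cycles X n"
  using mod_homD(1)[OF diff_succ_mod_hom[OF assms, of n]] is_complexD(4)[OF assms, of _ n]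
  by (auto simp: boundaries_def cycles_def)

lemma cycles_left_module:
  assumes "is_complex R X"
  shows "left_module R (obj X n\<lparr>carrier := cycles X n\<rparr>)"
  unfolding cycles_def
  by (rule kernel_left_module[OF is_complexD(1)[OF assms] is_complexD(1)[OF assms] is_complexD(2)[OF assms]])

text \<open>Induction upwards from the degrees where X vanishes: by exactness, the differential maps
  degree n onto the cycles of degree n - 1, and its kernel consists of the cycles of degree
  n.\<close>

lemma flat_cycles:
  assumes X: "is_complex (opp_ring R) X" and exact: "\<And>n. cycles X n = boundaries X n"
    and flat: "\<And>n. flat_module R (obj X n)" and bounded: "\<And>n. n < 0 \<Longrightarrow> carrier (obj X n) = {\<zero>\<^bsub>obj X n\<^esub>}"
  shows "flat_module R (obj X n\<lparr>carrier := cycles X n\<rparr>)"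
proof -
  note L = is_complexD(1)[OF X] and D = is_complexD(2)[OF X]
  have neg: "flat_module R (obj X n\<lparr>carrier := cycles X n\<rparr>)" if "n < 0" for n
  proof -
    have "cycles X n = carrier (obj X n)"
      using bounded[OF that] mod_hom_zero[OF L L D] by (auto simp: cycles_def)
    then show ?thesis using flat[of n] by simp
  qed
  have up: "flat_module R (obj X n\<lparr>carrier := cycles X n\<rparr>)"
    if "flat_module R (obj X (n - 1)\<lparr>carrier := cycles X (n - 1)\<rparr>)" for n
  proof (rule flat_module_kernel[OF cycles_left_module[OF X] _ _ _ _ _ flat that])
    show "(\<lambda>x. x) \<in> mod_hom (opp_ring R) (obj X n\<lparr>carrier := cycles X n\<rparr>) (obj X n)"
      by (rule incl_mod_hom) (auto simp: cycles_def)
    have im: "diff X n ` carrier (obj X n) = cycles X (n - 1)"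
      using exact[of "n - 1"] by (simp add: boundaries_def)
    then show "diff X n \<in> mod_hom (opp_ring R) (obj X n) (obj X (n - 1)\<lparr>carrier := cycles X (n - 1)\<rparr>)"
      using D[of n] by (auto simp: mod_hom_def)
    show "diff X n ` carrier (obj X n) = carrier (obj X (n - 1)\<lparr>carrier := cycles X (n - 1)\<rparr>)"
      using im by simp
  qed (auto simp: cycles_def)
  show ?thesis
  proof (cases "n < 0")
    case False
    then have "n \<ge> -1" by simp
    then show ?thesis
    proof (induction n rule: int_ge_induct)
      case base show ?case by (rule neg) simp
    next
      case (step i) then show ?case using up[of "i + 1"] by simp
    qed
  qed (rule neg)
qed

text \<open>The differential of X factors through the cycles of degree n - 1. These are pure in X
  because the quotient, the cycles of degree n - 2, is flat; so the image of x vanishes already over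
  the cycles, and right exactness of degree n + 1, degree n and these cycles finishes.\<close>

lemma tensor_acyclic:
  assumes X: "is_complex (opp_ring R) X" and exact: "\<And>n. cycles X n = boundaries X n"
    and flat: "\<And>n. flat_module R (obj X n)" and bounded: "\<And>n. n < 0 \<Longrightarrow> carrier (obj X n) = {\<zero>\<^bsub>obj X n\<^esub>}"
    and Y: "left_module R Y" and x: "x \<in> tensor_chains (obj X n) Y"
    and dx: "bi_map (diff X n) (\<lambda>b. b) x \<in> tensor_kernel R (obj X (n - 1)) Y"
  shows "\<exists>y\<in>tensor_chains (obj X (n + 1)) Y. x - bi_map (diff X (n + 1)) (\<lambda>b. b) y \<in> tensor_kernel R (obj X n) Y"
proof -
  note L = is_complexD(1)[OF X] and D = is_complexD(2)[OF X]
  let ?Z = "\<lambda>n. obj X n\<lparr>carrier := cycles X n\<rparr>"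
  have im: "diff X n ` carrier (obj X n) = cycles X (n - 1)" for n
    using exact[of "n - 1"] by (simp add: boundaries_def)
  have DZ: "diff X n \<in> mod_hom (opp_ring R) (obj X n) (?Z (n - 1))" for n
    using D[of n] im[of n] by (auto simp: mod_hom_def)
  have dZ: "bi_map (diff X n) (\<lambda>b. b) x \<in> tensor_chains (?Z (n - 1)) Y"
    using mod_homD(1)[OF DZ] by (intro bi_map_chains[OF x]) blast+
  have "bi_map (diff X n) (\<lambda>b. b) x \<in> tensor_kernel R (?Z (n - 1)) Y"
  proof (rule tensor_flat_pure[OF cycles_left_module[OF X] L Y _ _ DZ _ _ flat_cycles[OF X exact flat bounded] dZ])
    show "(\<lambda>x. x) \<in> mod_hom (opp_ring R) (?Z (n - 1)) (obj X (n - 1))"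
      by (rule incl_mod_hom) (auto simp: cycles_def)
  qed (use dx im[of "n - 1"] in \<open>auto simp: cycles_def\<close>)
  moreover have "{b \<in> carrier (obj X n). diff X n b = \<zero>\<^bsub>?Z (n - 1)\<^esub>} \<subseteq> diff X (n + 1) ` carrier (obj X (n + 1))"
    using exact[of n] by (simp add: cycles_def boundaries_def)
  moreover have "diff X n ` carrier (obj X n) = carrier (?Z (n - 1))" using im by simp
  ultimately show ?thesis
    using tensor_right_exact_left[OF L L cycles_left_module[OF X] Y diff_succ_mod_hom[OF X] DZ _ _ x] by blast
qed

text \<open>Tensoring with F preserves kernels: d is factored through its image, whose inclusion
  into Y' stays injective by flatness, and right exactness deals with the surjection onto the
  image.\<close>

lemma tensor_flat_kernel:
  assumes flat: "flat_module R F" and Y: "left_module R Y" and Y': "left_module R Y'"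
    and d: "d \<in> mod_hom R Y Y'" and x: "x \<in> tensor_chains F Y" and dx: "bi_map (\<lambda>a. a) d x \<in> tensor_kernel R F Y'"
  shows "\<exists>z\<in>tensor_chains F (Y\<lparr>carrier := {y \<in> carrier Y. d y = \<zero>\<^bsub>Y'\<^esub>}\<rparr>). x - z \<in> tensor_kernel R F Y"
proof -
  have F: "left_module (opp_ring R) F" using flat by (simp add: flat_module_def)
  let ?D = "Y'\<lparr>carrier := d ` carrier Y\<rparr>" and ?K = "Y\<lparr>carrier := {y \<in> carrier Y. d y = \<zero>\<^bsub>Y'\<^esub>}\<rparr>"
  have D: "left_module R ?D" by (rule mod_hom_image_module[OF Y Y' d])
  have K: "left_module R ?K" by (rule kernel_left_module[OF Y Y' d])
  have dD: "d \<in> mod_hom R Y ?D" using d by (auto simp: mod_hom_def)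
  have i: "(\<lambda>x. x) \<in> mod_hom R ?D Y'" by (rule incl_mod_hom) (use mod_homD(1)[OF d] in auto)
  have k: "(\<lambda>x. x) \<in> mod_hom R ?K Y" by (rule incl_mod_hom) auto
  have "bi_map (\<lambda>a. a) d x \<in> tensor_chains F ?D"
    by (rule bi_map_chains[OF x]) auto
  then have "bi_map (\<lambda>a. a) d x \<in> tensor_kernel R F ?D"
    using dx by (intro flat_moduleD[OF flat D Y' i]) auto
  then show ?thesis
    using tensor_right_exact_right[OF F K Y D k dD _ _ x] by simp
qed

text \<open>The element x is first represented over the kernel of d and then bounded there, so that
  the bounding element is annihilated by d as well.\<close>

lemma tensor_acyclic_joint:
  assumes X: "is_complex (opp_ring R) X" and exact: "\<And>n. cycles X n = boundaries X n"
    and flat: "\<And>n. flat_module R (obj X n)" and bounded: "\<And>n. n < 0 \<Longrightarrow> carrier (obj X n) = {\<zero>\<^bsub>obj X n\<^esub>}"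
    and Y: "left_module R Y" and Y': "left_module R Y'" and d: "d \<in> mod_hom R Y Y'"
    and x: "x \<in> tensor_chains (obj X n) Y"
    and dx: "bi_map (diff X n) (\<lambda>b. b) x \<in> tensor_kernel R (obj X (n - 1)) Y"
    and dx': "bi_map (\<lambda>a. a) d x \<in> tensor_kernel R (obj X n) Y'"
  shows "\<exists>y\<in>tensor_chains (obj X (n + 1)) Y. x - bi_map (diff X (n + 1)) (\<lambda>b. b) y \<in> tensor_kernel R (obj X n) Y \<and>
    bi_map (\<lambda>a. a) d y \<in> tensor_kernel R (obj X (n + 1)) Y'"
proof -
  note L = is_complexD(1)[OF X] and D = is_complexD(2)[OF X]
  let ?K = "Y\<lparr>carrier := {y \<in> carrier Y. d y = \<zero>\<^bsub>Y'\<^esub>}\<rparr>"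
  have K: "left_module R ?K" by (rule kernel_left_module[OF Y Y' d])
  have k: "(\<lambda>x. x) \<in> mod_hom R ?K Y" by (rule incl_mod_hom) auto
  obtain z where z: "z \<in> tensor_chains (obj X n) ?K" "x - z \<in> tensor_kernel R (obj X n) Y"
    using tensor_flat_kernel[OF flat Y Y' d x dx'] by blast
  have "bi_map (diff X n) (\<lambda>b. b) x - bi_map (diff X n) (\<lambda>b. b) z \<in> tensor_kernel R (obj X (n - 1)) Y"
    using tensor_kernel_bi_map[OF L L Y Y D mod_hom_ident z(2)] by simp
  then have "bi_map (diff X n) (\<lambda>b. b) z \<in> tensor_kernel R (obj X (n - 1)) Y"
    using dx tensor_kernel_cong[OF L Y] by blast
  moreover have "bi_map (diff X n) (\<lambda>b. b) z \<in> tensor_chains (obj X (n - 1)) ?K"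
    using mod_homD(1)[OF D] by (intro bi_map_chains[OF z(1)]) blast+
  \<comment> \<open>The image of z vanishes over Y; flatness of X in degree n - 1 makes it vanish
    over the kernel of d, so z is a cycle there.\<close>
  ultimately have "bi_map (diff X n) (\<lambda>b. b) z \<in> tensor_kernel R (obj X (n - 1)) ?K"
    by (intro flat_moduleD[OF flat K Y k]) auto
  then obtain y where y: "y \<in> tensor_chains (obj X (n + 1)) ?K"
    "z - bi_map (diff X (n + 1)) (\<lambda>b. b) y \<in> tensor_kernel R (obj X n) ?K"
    using tensor_acyclic[OF X exact flat bounded K z(1)] by blast
  have "z - bi_map (diff X (n + 1)) (\<lambda>b. b) y \<in> tensor_kernel R (obj X n) Y"
    using tensor_kernel_bi_map[OF L L K Y mod_hom_ident k y(2)] by simp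
  then have "x - bi_map (diff X (n + 1)) (\<lambda>b. b) y \<in> tensor_kernel R (obj X n) Y"
    using z(2) tensor_kernel_trans[OF L Y] by blast
  moreover have "bi_map (\<lambda>a. a) d y = bi_map (\<lambda>a. a) (\<lambda>b. \<zero>\<^bsub>Y'\<^esub>) y"
    by (rule bi_map_cong[OF y(1)]) auto
  moreover have "bi_map (\<lambda>a. a) (\<lambda>b. \<zero>\<^bsub>Y'\<^esub>) y \<in> tensor_kernel R (obj X (n + 1)) Y'"
    by (rule tensor_kernel_zero_right[OF L Y' _ y(1)])
  moreover have "y \<in> tensor_chains (obj X (n + 1)) Y" using y(1) by (rule tensor_chains_mono) blast
  ultimately show ?thesis by auto
qed

section \<open>Mapping cones\<close>

text \<open>The mapping cone of \<open>f\<close> being acyclic, in terms of elements, and relative to subsets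
  \<open>A\<close> of \<open>X\<close> and \<open>B\<close> of \<open>Y\<close>.\<close>

definition cone_acyclic ::
    "('r, 'a) cplx \<Rightarrow> ('r, 'b) cplx \<Rightarrow> (int \<Rightarrow> 'a \<Rightarrow> 'b) \<Rightarrow> (int \<Rightarrow> 'a set) \<Rightarrow> (int \<Rightarrow> 'b set) \<Rightarrow> bool" where
  "cone_acyclic X Y f A B \<longleftrightarrow> (\<forall>n. \<forall>a\<in>A n. \<forall>b\<in>B (n + 1).
     diff X n a = \<zero>\<^bsub>obj X (n - 1)\<^esub> \<and> f n a = diff Y (n + 1) b \<longrightarrow>
     (\<exists>a'\<in>A (n + 1). \<exists>b'\<in>B (n + 2). diff X (n + 1) a' = a \<and>
        f (n + 1) a' = b \<oplus>\<^bsub>obj Y (n + 1)\<^esub> diff Y (n + 2) b'))"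

section \<open>Direct sums of modules and their flatness\<close>

definition dsum_module :: "('r, 'a) module \<Rightarrow> ('r, 'b) module \<Rightarrow> ('r, 'a \<times> 'b) module" where
  "dsum_module A B = \<lparr>carrier = carrier A \<times> carrier B, mult = undefined, one = undefined,
     ring.zero = (\<zero>\<^bsub>A\<^esub>, \<zero>\<^bsub>B\<^esub>), add = (\<lambda>x y. (fst x \<oplus>\<^bsub>A\<^esub> fst y, snd x \<oplus>\<^bsub>B\<^esub> snd y)),
     smult = (\<lambda>r x. (r \<odot>\<^bsub>A\<^esub> fst x, r \<odot>\<^bsub>B\<^esub> snd x))\<rparr>"

lemma dsum_module_simps [simp]:
  "carrier (dsum_module A B) = carrier A \<times> carrier B"
  "\<zero>\<^bsub>dsum_module A B\<^esub> = (\<zero>\<^bsub>A\<^esub>, \<zero>\<^bsub>B\<^esub>)"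
  "x \<oplus>\<^bsub>dsum_module A B\<^esub> y = (fst x \<oplus>\<^bsub>A\<^esub> fst y, snd x \<oplus>\<^bsub>B\<^esub> snd y)"
  "r \<odot>\<^bsub>dsum_module A B\<^esub> x = (r \<odot>\<^bsub>A\<^esub> fst x, r \<odot>\<^bsub>B\<^esub> snd x)"
  by (simp_all add: dsum_module_def)

lemma dsum_module_left_module:
  assumes "left_module R A" "left_module R B"
  shows "left_module R (dsum_module A B)"
proof -
  interpret A: left_module R A by fact
  interpret B: left_module R B by fact
  show ?thesis
  proof (intro left_module.intro left_module_axioms.intro abelian_groupI)
    show "\<exists>y\<in>carrier (dsum_module A B). y \<oplus>\<^bsub>dsum_module A B\<^esub> x = \<zero>\<^bsub>dsum_module A B\<^esub>"
      if "x \<in> carrier (dsum_module A B)" for x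
      using that by (intro bexI[of _ "(\<ominus>\<^bsub>A\<^esub> fst x, \<ominus>\<^bsub>B\<^esub> snd x)"]) (auto simp: A.M.l_neg B.M.l_neg)
  qed (auto simp: A.R.ring_axioms A.M.a_ac B.M.a_ac A.smult_l_distr B.smult_l_distr
      A.smult_r_distr B.smult_r_distr A.smult_assoc1 B.smult_assoc1)
qed

lemma dsum_module_homs:
  assumes "left_module R A" "left_module R B"
  shows "fst \<in> mod_hom R (dsum_module A B) A" "snd \<in> mod_hom R (dsum_module A B) B"
    "(\<lambda>a. (a, \<zero>\<^bsub>B\<^esub>)) \<in> mod_hom R A (dsum_module A B)"
    "(\<lambda>b. (\<zero>\<^bsub>A\<^esub>, b)) \<in> mod_hom R B (dsum_module A B)"
proof -
  interpret A: left_module R A by fact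
  interpret B: left_module R B by fact
  show "fst \<in> mod_hom R (dsum_module A B) A" "snd \<in> mod_hom R (dsum_module A B) B"
    "(\<lambda>a. (a, \<zero>\<^bsub>B\<^esub>)) \<in> mod_hom R A (dsum_module A B)"
    "(\<lambda>b. (\<zero>\<^bsub>A\<^esub>, b)) \<in> mod_hom R B (dsum_module A B)"
    by (auto simp: mod_hom_def)
qed

text \<open>The identity of the direct sum is the sum of the two composites of projection and
  inclusion, so a tensor vanishes once both of its projections do.\<close>

lemma flat_dsum_module:
  assumes A: "flat_module R A" and B: "flat_module R B"
  shows "flat_module R (dsum_module A B)"
proof -
  let ?S = "dsum_module A B"
  have L: "left_module (opp_ring R) A" "left_module (opp_ring R) B"
    using assms by (simp_all add: flat_module_def)
  have S: "left_module (opp_ring R) ?S" by (rule dsum_module_left_module[OF L])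
  interpret A: left_module "opp_ring R" A by fact
  interpret B: left_module "opp_ring R" B by fact
  note h = dsum_module_homs[OF L]
  show ?thesis
  proof (rule flat_moduleI[OF S])
    fix X Y :: "('a, nat \<Rightarrow> 'a) module" and g x
    assume X: "left_module R X" and Y: "left_module R Y" and g: "g \<in> mod_hom R X Y" "inj_on g (carrier X)"
      and x: "x \<in> tensor_chains ?S X" and gx: "bi_map (\<lambda>a. a) g x \<in> tensor_kernel R ?S Y"
    have "bi_map fst (\<lambda>b. b) x \<in> tensor_chains A X" "bi_map snd (\<lambda>b. b) x \<in> tensor_chains B X"
      by (rule bi_map_chains[OF x]; auto)+
    moreover have "bi_map (\<lambda>a. a) g (bi_map fst (\<lambda>b. b) x) \<in> tensor_kernel R A Y"
      using tensor_kernel_bi_map[OF S L(1) Y Y h(1) mod_hom_ident gx] by simp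
    moreover have "bi_map (\<lambda>a. a) g (bi_map snd (\<lambda>b. b) x) \<in> tensor_kernel R B Y"
      using tensor_kernel_bi_map[OF S L(2) Y Y h(2) mod_hom_ident gx] by simp
    ultimately have f: "bi_map fst (\<lambda>b. b) x \<in> tensor_kernel R A X" and s: "bi_map snd (\<lambda>b. b) x \<in> tensor_kernel R B X"
      using flat_moduleD[OF A X Y g] flat_moduleD[OF B X Y g] by blast+
    have 1: "bi_map (\<lambda>x. x) (\<lambda>b. b) x - bi_map (\<lambda>x. (fst x, \<zero>\<^bsub>B\<^esub>)) (\<lambda>b. b) x - bi_map (\<lambda>x. (\<zero>\<^bsub>A\<^esub>, snd x)) (\<lambda>b. b) x
        \<in> tensor_kernel R ?S X"
      by (rule tensor_kernel_add_left[OF S X _ _ _ _ x]) auto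
    have 2: "bi_map (\<lambda>x. (fst x, \<zero>\<^bsub>B\<^esub>)) (\<lambda>b. b) x \<in> tensor_kernel R ?S X"
      using tensor_kernel_bi_map[OF L(1) S X X h(3) mod_hom_ident f] by simp
    have 3: "bi_map (\<lambda>x. (\<zero>\<^bsub>A\<^esub>, snd x)) (\<lambda>b. b) x \<in> tensor_kernel R ?S X"
      using tensor_kernel_bi_map[OF L(2) S X X h(4) mod_hom_ident s] by simp
    from tensor_kernelD(4)[OF S X tensor_kernelD(4)[OF S X 1 2] 3] show "x \<in> tensor_kernel R ?S X" by simp
  qed
qed

text \<open>The sign sits on the differential of Y, so that a pair (a, b) is a cycle when d a = 0
  and f a = d b, which is the form used in \<open>cone_acyclic\<close>.\<close>

definition cone :: "('r, 'a) cplx \<Rightarrow> ('r, 'b) cplx \<Rightarrow> (int \<Rightarrow> 'a \<Rightarrow> 'b) \<Rightarrow> ('r, 'a \<times> 'b) cplx" where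
  "cone X Y f = \<lparr>obj = \<lambda>n. dsum_module (obj X (n - 1)) (obj Y n),
     diff = \<lambda>n x. (diff X (n - 1) (fst x), f (n - 1) (fst x) \<ominus>\<^bsub>obj Y (n - 1)\<^esub> diff Y n (snd x))\<rparr>"

lemma cone_simps [simp]:
  "obj (cone X Y f) n = dsum_module (obj X (n - 1)) (obj Y n)"
  "diff (cone X Y f) n x = (diff X (n - 1) (fst x), f (n - 1) (fst x) \<ominus>\<^bsub>obj Y (n - 1)\<^esub> diff Y n (snd x))"
  by (simp_all add: cone_def)

lemma chain_mapD:
  assumes "chain_map R X Y f"
  shows "f n \<in> mod_hom R (obj X n) (obj Y n)"
    "x \<in> carrier (obj X n) \<Longrightarrow> f (n - 1) (diff X n x) = diff Y n (f n x)"
    "x \<in> carrier (obj X (n + 1)) \<Longrightarrow> f n (diff X (n + 1) x) = diff Y (n + 1) (f (n + 1) x)"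
proof -
  have 1: "f (n - 1) (diff X n x) = diff Y n (f n x)" if "x \<in> carrier (obj X n)" for n x
    using assms that by (auto simp: chain_map_def)
  show "f n \<in> mod_hom R (obj X n) (obj Y n)" using assms by (auto simp: chain_map_def)
  show "x \<in> carrier (obj X n) \<Longrightarrow> f (n - 1) (diff X n x) = diff Y n (f n x)" by (rule 1)
  show "x \<in> carrier (obj X (n + 1)) \<Longrightarrow> f n (diff X (n + 1) x) = diff Y (n + 1) (f (n + 1) x)"
    using 1[of x "n + 1"] by simp
qed

lemma cone_is_complex:
  assumes X: "is_complex R X" and Y: "is_complex R Y" and f: "chain_map R X Y f"
  shows "is_complex R (cone X Y f)"
proof -
  note LX = is_complexD(1)[OF X] and LY = is_complexD(1)[OF Y]
    and DX = is_complexD(2)[OF X] and DY = is_complexD(2)[OF Y] and F = chain_mapD(1)[OF f]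
  note X1 = mod_homD[OF DX] and Y1 = mod_homD[OF DY] and f1 = mod_homD[OF F]
  have "diff (cone X Y f) n \<in> mod_hom R (obj (cone X Y f) n) (obj (cone X Y f) (n - 1))" for n
  proof -
    note X1 = mod_homD[OF DX[of "n - 1"]] and Y1 = mod_homD[OF DY[of n]] and f1 = mod_homD[OF F[of "n - 1"]]
    interpret Y: left_module R "obj Y (n - 1)" by (rule LY)
    have sm: "r \<odot>\<^bsub>obj Y (n - 1)\<^esub> a \<ominus>\<^bsub>obj Y (n - 1)\<^esub> r \<odot>\<^bsub>obj Y (n - 1)\<^esub> b = r \<odot>\<^bsub>obj Y (n - 1)\<^esub> (a \<ominus>\<^bsub>obj Y (n - 1)\<^esub> b)"
      if "r \<in> carrier R" "a \<in> carrier (obj Y (n - 1))" "b \<in> carrier (obj Y (n - 1))" for r a b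
    proof -
      have "(\<lambda>x. r \<odot>\<^bsub>obj Y (n - 1)\<^esub> x) b \<oplus>\<^bsub>obj Y (n - 1)\<^esub> r \<odot>\<^bsub>obj Y (n - 1)\<^esub> (\<ominus>\<^bsub>obj Y (n - 1)\<^esub> b) = \<zero>\<^bsub>obj Y (n - 1)\<^esub>"
        using that Y.smult_r_distr[of r b "\<ominus>\<^bsub>obj Y (n - 1)\<^esub> b"] by (simp add: Y.M.r_neg)
      then have "\<ominus>\<^bsub>obj Y (n - 1)\<^esub> (r \<odot>\<^bsub>obj Y (n - 1)\<^esub> b) = r \<odot>\<^bsub>obj Y (n - 1)\<^esub> (\<ominus>\<^bsub>obj Y (n - 1)\<^esub> b)"
        using that by (intro Y.M.minus_equality) (auto simp: Y.M.a_comm)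
      then show ?thesis using that by (simp add: Y.M.minus_eq Y.smult_r_distr)
    qed
    show ?thesis
      unfolding mod_hom_def
    proof (intro CollectI conjI ballI Pi_I)
      fix x assume "x \<in> carrier (obj (cone X Y f) n)"
      then show "diff (cone X Y f) n x \<in> carrier (obj (cone X Y f) (n - 1))"
        using X1(1) Y1(1) f1(1) by auto
    next
      fix x y assume "x \<in> carrier (obj (cone X Y f) n)" "y \<in> carrier (obj (cone X Y f) n)"
      then show "diff (cone X Y f) n (x \<oplus>\<^bsub>obj (cone X Y f) n\<^esub> y) =
          diff (cone X Y f) n x \<oplus>\<^bsub>obj (cone X Y f) (n - 1)\<^esub> diff (cone X Y f) n y"
        using X1(1,2) Y1(1,2) f1(1,2)
        by (auto simp: Y.M.minus_eq Y.M.minus_add Y.M.a_ac)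
    next
      fix r x assume "r \<in> carrier R" "x \<in> carrier (obj (cone X Y f) n)"
      then show "diff (cone X Y f) n (r \<odot>\<^bsub>obj (cone X Y f) n\<^esub> x) =
          r \<odot>\<^bsub>obj (cone X Y f) (n - 1)\<^esub> diff (cone X Y f) n x"
        using X1(1,3) Y1(1,3) f1(1,3) by (auto simp: sm)
    qed
  qed
  moreover have "diff (cone X Y f) (n - 1) (diff (cone X Y f) n x) = \<zero>\<^bsub>obj (cone X Y f) (n - 2)\<^esub>"
    if x: "x \<in> carrier (obj (cone X Y f) n)" for n x
  proof -
    obtain a b where ab: "x = (a, b)" "a \<in> carrier (obj X (n - 1))" "b \<in> carrier (obj Y n)" using x by auto
    interpret Y: left_module R "obj Y (n - 1)" by (rule LY)
    interpret Y2: left_module R "obj Y (n - 2)" by (rule LY)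
    have "diff Y (n - 1) (f (n - 1) a \<ominus>\<^bsub>obj Y (n - 1)\<^esub> diff Y n b) =
        diff Y (n - 1) (f (n - 1) a) \<ominus>\<^bsub>obj Y (n - 2)\<^esub> diff Y (n - 1) (diff Y n b)"
      using mod_hom_minus[OF LY LY DY, of "f (n - 1) a" "n - 1" "diff Y n b"] ab Y1(1) f1(1) by simp
    then show ?thesis
      using ab is_complexD(3)[OF X, of a "n - 1"] is_complexD(3)[OF Y, of b n] chain_mapD(2)[OF f, of a "n - 1"]
        Y1(1)[of "f (n - 1) a" "n - 1"] f1(1)[of a "n - 1"]
      by (simp add: Y2.M.minus_self Y2.M.minus_zero)
  qed
  ultimately show ?thesis
    using dsum_module_left_module[OF LX LY] by (simp add: is_complex_def)
qed

text \<open>Since X is shifted by one in the cone, exactness in degree n is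
  \<open>cone_acyclic\<close> in degree n - 1.\<close>

lemma cone_exact:
  assumes X: "is_complex R X" and Y: "is_complex R Y" and f: "chain_map R X Y f"
    and ac: "cone_acyclic X Y f (\<lambda>n. carrier (obj X n)) (\<lambda>n. carrier (obj Y n))"
  shows "cycles (cone X Y f) n = boundaries (cone X Y f) n"
proof
  show "boundaries (cone X Y f) n \<subseteq> cycles (cone X Y f) n"
    by (rule boundaries_subset_cycles[OF cone_is_complex[OF X Y f]])
  show "cycles (cone X Y f) n \<subseteq> boundaries (cone X Y f) n"
  proof
    fix x assume "x \<in> cycles (cone X Y f) n"
    then obtain a b where x: "x = (a, b)" "a \<in> carrier (obj X (n - 1))" "b \<in> carrier (obj Y n)"
      and da: "diff X (n - 1) a = \<zero>\<^bsub>obj X (n - 1 - 1)\<^esub>"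
      and db: "f (n - 1) a \<ominus>\<^bsub>obj Y (n - 1)\<^esub> diff Y n b = \<zero>\<^bsub>obj Y (n - 1)\<^esub>"
      by (cases x) (auto simp: cycles_def)
    interpret Y: left_module R "obj Y (n - 1)" by (rule is_complexD(1)[OF Y])
    interpret Yn: left_module R "obj Y n" by (rule is_complexD(1)[OF Y])
    have n1: "n - 1 + 1 = n" "n - 1 + 2 = n + 1" by simp_all
    have "f (n - 1) a = diff Y n b"
      using db x mod_homD(1)[OF chain_mapD(1)[OF f]] mod_homD(1)[OF is_complexD(2)[OF Y]]
      by (metis Y.M.a_inv_closed Y.M.minus_equality Y.M.minus_minus Y.M.minus_eq)
    then obtain a' b' where *: "a' \<in> carrier (obj X n)" "b' \<in> carrier (obj Y (n + 1))"
      "diff X n a' = a" "f n a' = b \<oplus>\<^bsub>obj Y n\<^esub> diff Y (n + 1) b'"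
      using ac[unfolded cone_acyclic_def, rule_format, of a "n - 1" b, unfolded n1] x da by auto
    have "diff Y (n + 1) b' \<in> carrier (obj Y n)"
      by (rule mod_homD(1)[OF diff_succ_mod_hom[OF Y] *(2)])
    then have "f n a' \<ominus>\<^bsub>obj Y n\<^esub> diff Y (n + 1) b' = b"
      using *(4) x by (simp add: Yn.M.minus_eq Yn.M.a_assoc Yn.M.r_neg)
    then have "x = diff (cone X Y f) (n + 1) (a', b')" using x * by simp
    moreover have "(a', b') \<in> carrier (obj (cone X Y f) (n + 1))" using * by simp
    ultimately show "x \<in> boundaries (cone X Y f) n" unfolding boundaries_def by (rule image_eqI)
  qed
qed

text \<open>Additivity applied to 0 = f + (- f).\<close>

lemma tensor_kernel_neg_left:
  assumes A: "left_module (opp_ring R) A'" and B: "left_module R B'"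
    and f: "\<And>a. a \<in> carrier A \<Longrightarrow> f a \<in> carrier A'" and g: "\<And>b. b \<in> carrier B \<Longrightarrow> g b \<in> carrier B'"
    and x: "x \<in> tensor_chains A B"
  shows "bi_map (\<lambda>a. \<ominus>\<^bsub>A'\<^esub> f a) g x + bi_map f g x \<in> tensor_kernel R A' B'"
proof -
  interpret A': left_module "opp_ring R" A' by fact
  have 1: "bi_map (\<lambda>a. \<zero>\<^bsub>A'\<^esub>) g x - bi_map f g x - bi_map (\<lambda>a. \<ominus>\<^bsub>A'\<^esub> f a) g x \<in> tensor_kernel R A' B'"
    by (rule tensor_kernel_add_left[OF A B _ _ _ g x]) (auto simp: f A'.M.r_neg)
  have 2: "bi_map (\<lambda>a. \<zero>\<^bsub>A'\<^esub>) g x \<in> tensor_kernel R A' B'"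
    by (rule tensor_kernel_zero_left[OF A B g x])
  from tensor_kernelD(3)[OF A B 2 1] show ?thesis by (simp add: algebra_simps)
qed

text \<open>\<open>tensor_acyclic_joint\<close> for the cone of f, taken apart: a and b form a cycle
  \<open>u\<close> of the cone tensored with B in degree n + 1, and the projections of a bounding
  element \<open>w\<close> are a' and b'. By the sign in the cone, b is f a' - d b' up to relations,
  hence the sum in the second congruence.\<close>

lemma tensor_row_acyclic:
  assumes X: "is_complex (opp_ring R) X" and Y: "is_complex (opp_ring R) Y" and f: "chain_map (opp_ring R) X Y f"
    and ac: "cone_acyclic X Y f (\<lambda>n. carrier (obj X n)) (\<lambda>n. carrier (obj Y n))"
    and flat: "\<And>n. flat_module R (obj X n)" "\<And>n. flat_module R (obj Y n)"
    and bounded: "\<And>n. n < 0 \<Longrightarrow> carrier (obj X n) = {\<zero>\<^bsub>obj X n\<^esub>}" "\<And>n. n < 0 \<Longrightarrow> carrier (obj Y n) = {\<zero>\<^bsub>obj Y n\<^esub>}"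
    and B: "left_module R B" and B': "left_module R B'" and d: "d \<in> mod_hom R B B'"
    and a: "a \<in> tensor_chains (obj X n) B" and b: "b \<in> tensor_chains (obj Y (n + 1)) B"
    and da: "bi_map (diff X n) (\<lambda>b. b) a \<in> tensor_kernel R (obj X (n - 1)) B"
    and fa: "bi_map (f n) (\<lambda>b. b) a - bi_map (diff Y (n + 1)) (\<lambda>b. b) b \<in> tensor_kernel R (obj Y n) B"
    and da': "bi_map (\<lambda>a. a) d a \<in> tensor_kernel R (obj X n) B'"
    and db': "bi_map (\<lambda>a. a) d b \<in> tensor_kernel R (obj Y (n + 1)) B'"
  shows "\<exists>a'\<in>tensor_chains (obj X (n + 1)) B. \<exists>b'\<in>tensor_chains (obj Y (n + 2)) B.
    bi_map (diff X (n + 1)) (\<lambda>b. b) a' - a \<in> tensor_kernel R (obj X n) B \<and>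
    bi_map (f (n + 1)) (\<lambda>b. b) a' - (b + bi_map (diff Y (n + 2)) (\<lambda>b. b) b') \<in> tensor_kernel R (obj Y (n + 1)) B \<and>
    bi_map (\<lambda>a. a) d a' \<in> tensor_kernel R (obj X (n + 1)) B' \<and>
    bi_map (\<lambda>a. a) d b' \<in> tensor_kernel R (obj Y (n + 2)) B'"
proof -
  note LX = is_complexD(1)[OF X] and LY = is_complexD(1)[OF Y]
    and DX = is_complexD(2)[OF X] and DY = is_complexD(2)[OF Y] and F = chain_mapD(1)[OF f]
  note X1 = mod_homD[OF DX] and Y1 = mod_homD[OF DY] and f1 = mod_homD[OF F]
  let ?C = "cone X Y f"
  have C: "is_complex (opp_ring R) ?C" by (rule cone_is_complex[OF X Y f])
  note LC = is_complexD(1)[OF C] and DC = is_complexD(2)[OF C]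
  have Cf: "flat_module R (obj ?C n)" for n using flat by (simp add: flat_dsum_module)
  have Cb: "carrier (obj ?C n) = {\<zero>\<^bsub>obj ?C n\<^esub>}" if "n < 0" for n using bounded that by simp
  let ?i = "\<lambda>a. (a, \<zero>\<^bsub>obj Y (n + 1)\<^esub>)" and ?j = "\<lambda>b. (\<zero>\<^bsub>obj X n\<^esub>, b)"
  let ?inb = "\<lambda>a. (a, \<zero>\<^bsub>obj Y n\<^esub>)" and ?jnb = "\<lambda>b. (\<zero>\<^bsub>obj X (n - 1)\<^esub>, b)"
  have obj1: "obj ?C (n + 1) = dsum_module (obj X n) (obj Y (n + 1))" by simp
  have obj0: "obj ?C n = dsum_module (obj X (n - 1)) (obj Y n)" by simp
  have n2: "n + 2 - 1 = n + 1" by simp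
  have obj2: "obj ?C (n + 2) = dsum_module (obj X (n + 1)) (obj Y (n + 2))" unfolding cone_simps n2 ..
  note h1 = dsum_module_homs[OF LX[of n] LY[of "n + 1"], folded obj1]
    and h0 = dsum_module_homs[OF LX[of "n - 1"] LY[of n], folded obj0]
    and h2 = dsum_module_homs[OF LX[of "n + 1"] LY[of "n + 2"], folded obj2]
  define u where "u = bi_map ?i (\<lambda>b. b) a + bi_map ?j (\<lambda>b. b) b"
  interpret X0: left_module "opp_ring R" "obj X (n - 1)" by (rule LX)
  interpret X1: left_module "opp_ring R" "obj X n" by (rule LX)
  interpret Y0: left_module "opp_ring R" "obj Y n" by (rule LY)
  interpret Y1: left_module "opp_ring R" "obj Y (n + 1)" by (rule LY)
  have u: "u \<in> tensor_chains (obj ?C (n + 1)) B"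
    unfolding u_def
    by (intro tensor_chains_add bi_map_chains[OF a] bi_map_chains[OF b]) auto
  have dn1: "x \<in> carrier (obj Y (n + 1)) \<Longrightarrow> diff Y (n + 1) x \<in> carrier (obj Y n)" for x
    using Y1(1)[of x "n + 1"] by simp
  have dy0: "diff Y (n + 1) \<zero>\<^bsub>obj Y (n + 1)\<^esub> = \<zero>\<^bsub>obj Y n\<^esub>"
    using mod_hom_zero[OF LY LY DY, of "n + 1"] by simp
  have dx0: "diff X n \<zero>\<^bsub>obj X n\<^esub> = \<zero>\<^bsub>obj X (n - 1)\<^esub>" "f n \<zero>\<^bsub>obj X n\<^esub> = \<zero>\<^bsub>obj Y n\<^esub>"
    using mod_hom_zero[OF LX LX DX] mod_hom_zero[OF LX LY F] by simp_all
  \<comment> \<open>Fact \<open>1\<close> splits the boundary of the part from a, \<open>2\<close>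
    gives that of the part from b up to sign, \<open>3\<close> and \<open>4\<close> insert the
    assumptions on a and b; their sum is the claim.\<close>
  have "bi_map (diff ?C (n + 1)) (\<lambda>b. b) u \<in> tensor_kernel R (obj ?C n) B"
  proof -
    have 1: "bi_map (\<lambda>a. diff ?C (n + 1) (?i a)) (\<lambda>b. b) a - bi_map (\<lambda>a. ?inb (diff X n a)) (\<lambda>b. b) a
        - bi_map (\<lambda>a. ?jnb (f n a)) (\<lambda>b. b) a \<in> tensor_kernel R (obj ?C n) B"
      by (rule tensor_kernel_add_left[OF LC B _ _ _ _ a])
        (auto simp: X1 f1 dy0 Y0.M.minus_eq)
    have "bi_map (\<lambda>b. diff ?C (n + 1) (?j b)) (\<lambda>b. b) b = bi_map (\<lambda>b. \<ominus>\<^bsub>obj ?C n\<^esub> ?jnb (diff Y (n + 1) b)) (\<lambda>b. b) b"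
    proof (rule bi_map_cong[OF b])
      fix y assume y: "y \<in> carrier (obj Y (n + 1))"
      interpret Cn: left_module "opp_ring R" "obj ?C n" by (rule LC)
      have "\<ominus>\<^bsub>obj ?C n\<^esub> ?jnb (diff Y (n + 1) y) = ?jnb (\<ominus>\<^bsub>obj Y n\<^esub> diff Y (n + 1) y)"
        using y dn1 by (intro Cn.M.minus_equality) (auto simp: Y0.M.l_neg)
      then show "diff ?C (n + 1) (?j y) = \<ominus>\<^bsub>obj ?C n\<^esub> ?jnb (diff Y (n + 1) y)"
        using y dn1 by (simp add: dx0 Y0.M.minus_eq)
    qed simp
    moreover have "bi_map (\<lambda>b. \<ominus>\<^bsub>obj ?C n\<^esub> ?jnb (diff Y (n + 1) b)) (\<lambda>b. b) b + bi_map (\<lambda>b. ?jnb (diff Y (n + 1) b)) (\<lambda>b. b) b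
        \<in> tensor_kernel R (obj ?C n) B"
      by (rule tensor_kernel_neg_left[OF LC B _ _ b]) (auto simp: dn1)
    ultimately have 2: "bi_map (\<lambda>b. diff ?C (n + 1) (?j b)) (\<lambda>b. b) b + bi_map (\<lambda>b. ?jnb (diff Y (n + 1) b)) (\<lambda>b. b) b
        \<in> tensor_kernel R (obj ?C n) B" by simp
    have 3: "bi_map (\<lambda>a. ?inb (diff X n a)) (\<lambda>b. b) a \<in> tensor_kernel R (obj ?C n) B"
      using tensor_kernel_bi_map[OF LX LC B B h0(3) mod_hom_ident da] by simp
    have 4: "bi_map (\<lambda>a. ?jnb (f n a)) (\<lambda>b. b) a - bi_map (\<lambda>b. ?jnb (diff Y (n + 1) b)) (\<lambda>b. b) b \<in> tensor_kernel R (obj ?C n) B"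
      using tensor_kernel_bi_map[OF LY LC B B h0(4) mod_hom_ident fa] by simp
    note add = tensor_kernelD(4)[OF LC B]
    from add[OF add[OF 1 2] add[OF 3 4]] show ?thesis unfolding u_def by (simp add: algebra_simps del: cone_simps)
  qed
  then have dC: "bi_map (diff ?C (n + 1)) (\<lambda>b. b) u \<in> tensor_kernel R (obj ?C (n + 1 - 1)) B" by simp
  have du: "bi_map (\<lambda>a. a) d u \<in> tensor_kernel R (obj ?C (n + 1)) B'"
    unfolding u_def bi_map_simps
  proof (rule tensor_kernelD(4)[OF LC B'])
    show "bi_map (\<lambda>a. a) d (bi_map ?i (\<lambda>b. b) a) \<in> tensor_kernel R (obj ?C (n + 1)) B'"
      using tensor_kernel_bi_map[OF LX LC B' B' h1(3) mod_hom_ident da'] by simp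
    show "bi_map (\<lambda>a. a) d (bi_map ?j (\<lambda>b. b) b) \<in> tensor_kernel R (obj ?C (n + 1)) B'"
      using tensor_kernel_bi_map[OF LY LC B' B' h1(4) mod_hom_ident db'] by simp
  qed
  obtain w where w: "w \<in> tensor_chains (obj ?C (n + 2)) B"
    "u - bi_map (diff ?C (n + 2)) (\<lambda>b. b) w \<in> tensor_kernel R (obj ?C (n + 1)) B"
    "bi_map (\<lambda>a. a) d w \<in> tensor_kernel R (obj ?C (n + 2)) B'"
    using tensor_acyclic_joint[OF C cone_exact[OF X Y f ac] Cf Cb B B' d u dC du]
    unfolding add.assoc one_add_one by blast
  define a' where "a' = bi_map fst (\<lambda>b. b) w"
  define b' where "b' = bi_map snd (\<lambda>b. b) w"
  have w1: "w \<in> tensor_chains (dsum_module (obj X (n + 1)) (obj Y (n + 2))) B" using w(1) unfolding obj2 .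
  have a'c: "a' \<in> tensor_chains (obj X (n + 1)) B" unfolding a'_def by (rule bi_map_chains[OF w1]) auto
  have b'c: "b' \<in> tensor_chains (obj Y (n + 2)) B" unfolding b'_def by (rule bi_map_chains[OF w1]) auto
  have "bi_map fst (\<lambda>b. b) (u - bi_map (diff ?C (n + 2)) (\<lambda>b. b) w) \<in> tensor_kernel R (obj X n) B"
    by (rule tensor_kernel_bi_map[OF LC LX B B h1(1) mod_hom_ident w(2)])
  then have 1: "a + bi_map (\<lambda>b. \<zero>\<^bsub>obj X n\<^esub>) (\<lambda>b. b) b - bi_map (diff X (n + 1)) (\<lambda>b. b) a' \<in> tensor_kernel R (obj X n) B"
    by (simp add: u_def a'_def add.commute[of 1 n])
  have 2: "bi_map (\<lambda>b. \<zero>\<^bsub>obj X n\<^esub>) (\<lambda>b. b) b \<in> tensor_kernel R (obj X n) B"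
    by (rule tensor_kernel_zero_left[OF LX B _ b])
  from tensor_kernelD(3)[OF LX B 2 1]
  have A1: "bi_map (diff X (n + 1)) (\<lambda>b. b) a' - a \<in> tensor_kernel R (obj X n) B" by (simp add: algebra_simps)
  have "bi_map snd (\<lambda>b. b) (u - bi_map (diff ?C (n + 2)) (\<lambda>b. b) w) \<in> tensor_kernel R (obj Y (n + 1)) B"
    by (rule tensor_kernel_bi_map[OF LC LY B B h1(2) mod_hom_ident w(2)])
  then have 1: "bi_map (\<lambda>a. \<zero>\<^bsub>obj Y (n + 1)\<^esub>) (\<lambda>b. b) a + b -
      bi_map (\<lambda>w. f (n + 1) (fst w) \<ominus>\<^bsub>obj Y (n + 1)\<^esub> diff Y (n + 2) (snd w)) (\<lambda>b. b) w \<in> tensor_kernel R (obj Y (n + 1)) B"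
    by (simp add: u_def add.commute[of 1 n])
  have Fc: "x \<in> carrier (obj Y (n + 2)) \<Longrightarrow> diff Y (n + 2) x \<in> carrier (obj Y (n + 1))" for x
    using Y1(1)[of x "n + 2"] unfolding n2 .
  have 2: "bi_map (\<lambda>w. f (n + 1) (fst w) \<ominus>\<^bsub>obj Y (n + 1)\<^esub> diff Y (n + 2) (snd w)) (\<lambda>b. b) w
     - bi_map (\<lambda>w. f (n + 1) (fst w)) (\<lambda>b. b) w - bi_map (\<lambda>w. \<ominus>\<^bsub>obj Y (n + 1)\<^esub> diff Y (n + 2) (snd w)) (\<lambda>b. b) w
      \<in> tensor_kernel R (obj Y (n + 1)) B"
    by (rule tensor_kernel_add_left[OF LY B _ _ _ _ w1]) (auto simp: Y1.M.minus_eq f1 Fc)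
  have 3: "bi_map (\<lambda>w. \<ominus>\<^bsub>obj Y (n + 1)\<^esub> diff Y (n + 2) (snd w)) (\<lambda>b. b) w + bi_map (\<lambda>w. diff Y (n + 2) (snd w)) (\<lambda>b. b) w
      \<in> tensor_kernel R (obj Y (n + 1)) B"
    by (rule tensor_kernel_neg_left[OF LY B _ _ w1]) (auto simp: Fc)
  have 4: "bi_map (\<lambda>a. \<zero>\<^bsub>obj Y (n + 1)\<^esub>) (\<lambda>b. b) a \<in> tensor_kernel R (obj Y (n + 1)) B"
    by (rule tensor_kernel_zero_left[OF LY B _ a])
  note add = tensor_kernelD(4)[OF LY B] and sub = tensor_kernelD(3)[OF LY B]
  from sub[OF 4 add[OF 1 add[OF 2 3]]]
  have A2: "bi_map (f (n + 1)) (\<lambda>b. b) a' - (b + bi_map (diff Y (n + 2)) (\<lambda>b. b) b') \<in> tensor_kernel R (obj Y (n + 1)) B"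
    by (simp add: a'_def b'_def algebra_simps)
  have "bi_map fst (\<lambda>b. b) (bi_map (\<lambda>a. a) d w) \<in> tensor_kernel R (obj X (n + 1)) B'"
    by (rule tensor_kernel_bi_map[OF LC LX B' B' h2(1) mod_hom_ident w(3)])
  then have A3: "bi_map (\<lambda>a. a) d a' \<in> tensor_kernel R (obj X (n + 1)) B'" by (simp add: a'_def)
  have "bi_map snd (\<lambda>b. b) (bi_map (\<lambda>a. a) d w) \<in> tensor_kernel R (obj Y (n + 2)) B'"
    by (rule tensor_kernel_bi_map[OF LC LY B' B' h2(2) mod_hom_ident w(3)])
  then have A4: "bi_map (\<lambda>a. a) d b' \<in> tensor_kernel R (obj Y (n + 2)) B'" by (simp add: b'_def)
  show ?thesis using a'c b'c A1 A2 A3 A4 by blast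
qed

text \<open>Both augmentations identify homology with M, and f respects them. For a in degree 0 this
  shows that \<pi> a = 0; for b in degree 0, surjectivity of \<pi> supplies an element with the same
  augmentation as b; elsewhere exactness or vanishing of the complexes is enough.\<close>

lemma left_lift_cone_acyclic:
  assumes X: "left_resolution R M X \<pi>" and Y: "left_resolution R M Y \<epsilon>"
    and f: "left_lift R X \<pi> Y \<epsilon> (\<lambda>x. x) f"
  shows "cone_acyclic X Y f (\<lambda>n. carrier (obj X n)) (\<lambda>n. carrier (obj Y n))"
  unfolding cone_acyclic_def
proof (intro allI ballI impI, elim conjE)
  fix n a b
  assume a: "a \<in> carrier (obj X n)" and b: "b \<in> carrier (obj Y (n + 1))"
    and da: "diff X n a = \<zero>\<^bsub>obj X (n - 1)\<^esub>" and fa: "f n a = diff Y (n + 1) b"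
  have cX: "is_complex R X" and cY: "is_complex R Y" and M: "left_module R M"
    and \<pi>: "\<pi> \<in> mod_hom R (obj X 0) M" and \<epsilon>: "\<epsilon> \<in> mod_hom R (obj Y 0) M"
    and Xb: "\<And>n. n < 0 \<Longrightarrow> carrier (obj X n) = {\<zero>\<^bsub>obj X n\<^esub>}"
    and Yb: "\<And>n. n < 0 \<Longrightarrow> carrier (obj Y n) = {\<zero>\<^bsub>obj Y n\<^esub>}"
    and X0: "{x \<in> carrier (obj X 0). \<pi> x = \<zero>\<^bsub>M\<^esub>} = boundaries X 0"
    and Y0: "{x \<in> carrier (obj Y 0). \<epsilon> x = \<zero>\<^bsub>M\<^esub>} = boundaries Y 0"
    and Xs: "\<pi> ` carrier (obj X 0) = carrier M"
    and Xe: "\<And>n. n > 0 \<Longrightarrow> cycles X n = boundaries X n" and Ye: "\<And>n. n > 0 \<Longrightarrow> cycles Y n = boundaries Y n"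
    using X Y by (auto simp: left_resolution_def)
  have fc: "chain_map R X Y f" and f0: "\<And>x. x \<in> carrier (obj X 0) \<Longrightarrow> \<epsilon> (f 0 x) = \<pi> x"
    using f by (auto simp: left_lift_def)
  note LX = is_complexD(1)[OF cX] and LY = is_complexD(1)[OF cY]
    and DX = is_complexD(2)[OF cX] and DY = is_complexD(2)[OF cY]
  interpret Yn: left_module R "obj Y (n + 1)" by (rule LY)
  interpret M: left_module R M by (rule M)
  have n2: "n + 1 + 1 = n + 2" by simp
  \<comment> \<open>All that remains is to find a' above a for which f a' - b is a boundary.\<close>
  have fin: "\<exists>a'\<in>carrier (obj X (n + 1)). \<exists>b'\<in>carrier (obj Y (n + 2)). diff X (n + 1) a' = a \<and>
      f (n + 1) a' = b \<oplus>\<^bsub>obj Y (n + 1)\<^esub> diff Y (n + 2) b'"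
    if a': "a' \<in> carrier (obj X (n + 1))" "diff X (n + 1) a' = a" and
      *: "f (n + 1) a' \<ominus>\<^bsub>obj Y (n + 1)\<^esub> b \<in> boundaries Y (n + 1)" for a'
  proof -
    have c: "f (n + 1) a' \<in> carrier (obj Y (n + 1))" by (rule mod_homD(1)[OF chain_mapD(1)[OF fc] a'(1)])
    from * obtain b' where "b' \<in> carrier (obj Y (n + 2))" "f (n + 1) a' \<ominus>\<^bsub>obj Y (n + 1)\<^esub> b = diff Y (n + 2) b'"
      unfolding boundaries_def n2 by blast
    moreover have "b \<oplus>\<^bsub>obj Y (n + 1)\<^esub> (f (n + 1) a' \<ominus>\<^bsub>obj Y (n + 1)\<^esub> b) = f (n + 1) a'"
      using c b by (simp add: Yn.M.minus_eq Yn.M.a_lcomm[of b] Yn.M.r_neg)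
    ultimately show ?thesis using a' by metis
  qed
  have X2: "a \<in> boundaries X n"
  proof -
    consider "n > 0" | "n = 0" | "n < 0" by linarith
    then show ?thesis
    proof cases
      case 1
      then show ?thesis using a da Xe[of n] by (auto simp: cycles_def)
    next
      case 2
      have "f 0 a \<in> boundaries Y 0" using fa b 2 by (auto simp: boundaries_def)
      then have "\<epsilon> (f 0 a) = \<zero>\<^bsub>M\<^esub>" using Y0 by auto
      then show ?thesis using f0 a 2 X0 by auto
    next
      case 3
      have "diff X (n + 1) \<zero>\<^bsub>obj X (n + 1)\<^esub> = a"
        using mod_hom_zero[OF LX LX diff_succ_mod_hom[OF cX]] Xb[OF 3] a by auto
      moreover have "\<zero>\<^bsub>obj X (n + 1)\<^esub> \<in> carrier (obj X (n + 1))"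
        using LX[of "n + 1"] by (simp add: left_module_def abelian_group_def abelian_monoid.zero_closed)
      ultimately show ?thesis by (auto simp: boundaries_def)
    qed
  qed
  show "\<exists>a'\<in>carrier (obj X (n + 1)). \<exists>b'\<in>carrier (obj Y (n + 2)). diff X (n + 1) a' = a \<and>
      f (n + 1) a' = b \<oplus>\<^bsub>obj Y (n + 1)\<^esub> diff Y (n + 2) b'"
  proof (cases "n + 1 = 0")
    case True
    \<comment> \<open>Here a lies in degree -1 and is zero, so a' has to be adapted to b
      only.\<close>
    have bY: "b \<in> carrier (obj Y 0)" using b True by simp
    then have "\<epsilon> b \<in> \<pi> ` carrier (obj X 0)" using Xs mod_homD(1)[OF \<epsilon>] by auto
    then obtain a' where a': "a' \<in> carrier (obj X 0)" "\<pi> a' = \<epsilon> b" by auto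
    have c: "f 0 a' \<in> carrier (obj Y 0)" by (rule mod_homD(1)[OF chain_mapD(1)[OF fc] a'(1)])
    have "\<epsilon> (f 0 a' \<ominus>\<^bsub>obj Y 0\<^esub> b) = \<epsilon> (f 0 a') \<ominus>\<^bsub>M\<^esub> \<epsilon> b"
      by (rule mod_hom_minus[OF LY M \<epsilon> c bY])
    then have "\<epsilon> (f 0 a' \<ominus>\<^bsub>obj Y 0\<^esub> b) = \<zero>\<^bsub>M\<^esub>"
      using f0 a' mod_homD(1)[OF \<epsilon> bY] by (simp add: M.M.minus_eq M.M.r_neg)
    moreover have "f 0 a' \<ominus>\<^bsub>obj Y 0\<^esub> b \<in> carrier (obj Y 0)"
      using Yn.M.minus_closed c bY True by simp
    ultimately have "f 0 a' \<ominus>\<^bsub>obj Y 0\<^esub> b \<in> boundaries Y 0" using Y0 by blast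
    moreover have "diff X (n + 1) a' = a"
      using mod_homD(1)[OF DX a'(1)] True Xb[of n] a by simp (smt (verit) singletonD)
    ultimately show ?thesis using fin[of a'] a' True by simp
  next
    case False
    from X2 obtain a' where a': "a' \<in> carrier (obj X (n + 1))" "diff X (n + 1) a' = a"
      by (auto simp: boundaries_def)
    have c: "f (n + 1) a' \<in> carrier (obj Y (n + 1))" by (rule mod_homD(1)[OF chain_mapD(1)[OF fc] a'(1)])
    have cc: "f (n + 1) a' \<ominus>\<^bsub>obj Y (n + 1)\<^esub> b \<in> carrier (obj Y (n + 1))" using c b by simp
    interpret Y0: left_module R "obj Y n" by (rule LY)
    have dc: "diff Y (n + 1) (f (n + 1) a' \<ominus>\<^bsub>obj Y (n + 1)\<^esub> b) = \<zero>\<^bsub>obj Y n\<^esub>"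
      using mod_hom_minus[OF LY LY diff_succ_mod_hom[OF cY] c b] chain_mapD(3)[OF fc a'(1)] a' fa
        mod_homD(1)[OF diff_succ_mod_hom[OF cY] b] by (simp add: Y0.M.minus_eq Y0.M.r_neg)
    show ?thesis
    proof (rule fin[OF a'])
      show "f (n + 1) a' \<ominus>\<^bsub>obj Y (n + 1)\<^esub> b \<in> boundaries Y (n + 1)"
      proof (cases "n + 1 > 0")
        case True
        then show ?thesis using Ye[OF True] cc dc by (auto simp: cycles_def)
      next
        case neg: False
        have n21: "n + 2 - 1 = n + 1" by simp
        have "diff Y (n + 2) \<zero>\<^bsub>obj Y (n + 2)\<^esub> = \<zero>\<^bsub>obj Y (n + 1)\<^esub>"
          using mod_hom_zero[OF LY LY DY, of "n + 2"] unfolding n21 .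
        moreover have "\<zero>\<^bsub>obj Y (n + 2)\<^esub> \<in> carrier (obj Y (n + 2))"
          using LY[of "n + 2"] by (simp add: left_module_def abelian_group_def abelian_monoid.zero_closed)
        ultimately show ?thesis using cc Yb[of "n + 1"] neg False unfolding boundaries_def n2 by (force simp: image_iff)
      qed
    qed
  qed
qed

section \<open>Quotients and homology\<close>

context abelian_group
begin

text \<open>Once a sum is sorted, an element and its negative may be separated by other summands.
  These laws remove such a pair across one or two of them; collected in \<open>ab_simps\<close>,
  they settle the identities between differences met below.\<close>

lemma cancel1:
  assumes "x \<in> carrier G" "y \<in> carrier G"
  shows "x \<oplus> (y \<oplus> \<ominus> x) = y" "\<ominus> x \<oplus> (y \<oplus> x) = y"
  using assms a_lcomm[of x y "\<ominus> x"] a_lcomm[of "\<ominus> x" y x] by (simp_all add: r_neg l_neg)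

lemma cancel2:
  assumes "x \<in> carrier G" "y \<in> carrier G" "z \<in> carrier G"
  shows "x \<oplus> (y \<oplus> (\<ominus> x \<oplus> z)) = y \<oplus> z" "\<ominus> x \<oplus> (y \<oplus> (x \<oplus> z)) = y \<oplus> z"
    "x \<oplus> (y \<oplus> (z \<oplus> \<ominus> x)) = y \<oplus> z" "\<ominus> x \<oplus> (y \<oplus> (z \<oplus> x)) = y \<oplus> z"
  using assms a_lcomm[of x y "\<ominus> x \<oplus> z"] a_lcomm[of "\<ominus> x" y "x \<oplus> z"]
    cancel1[of x "y \<oplus> z"] by (simp_all add: r_neg1 r_neg2 a_assoc)

lemma cancel3:
  assumes "x \<in> carrier G" "y \<in> carrier G" "z \<in> carrier G" "w \<in> carrier G"
  shows "x \<oplus> (y \<oplus> (z \<oplus> (\<ominus> x \<oplus> w))) = y \<oplus> (z \<oplus> w)"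
    "\<ominus> x \<oplus> (y \<oplus> (z \<oplus> (x \<oplus> w))) = y \<oplus> (z \<oplus> w)"
  using assms cancel2(1,2)[of x "y \<oplus> z" w] by (simp_all add: a_assoc)

lemmas ab_simps = minus_eq minus_add minus_minus a_ac r_neg l_neg r_neg1 r_neg2 a_inv_zero cancel1 cancel2 cancel3

end

section \<open>Submodules, cosets and quotient modules\<close>

definition is_submodule :: "'r ring \<Rightarrow> ('r, 'a) module \<Rightarrow> 'a set \<Rightarrow> bool" where
  "is_submodule R M H \<longleftrightarrow> H \<subseteq> carrier M \<and> \<zero>\<^bsub>M\<^esub> \<in> H \<and> (\<forall>x\<in>H. \<forall>y\<in>H. x \<oplus>\<^bsub>M\<^esub> y \<in> H) \<and>
     (\<forall>r\<in>carrier R. \<forall>x\<in>H. r \<odot>\<^bsub>M\<^esub> x \<in> H)"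

text \<open>Closure under negatives comes from the scalar -1.\<close>

lemma is_submoduleD:
  assumes "left_module R M" "is_submodule R M H"
  shows "x \<in> H \<Longrightarrow> x \<in> carrier M" "\<zero>\<^bsub>M\<^esub> \<in> H" "x \<in> H \<Longrightarrow> y \<in> H \<Longrightarrow> x \<oplus>\<^bsub>M\<^esub> y \<in> H"
    "r \<in> carrier R \<Longrightarrow> x \<in> H \<Longrightarrow> r \<odot>\<^bsub>M\<^esub> x \<in> H" "x \<in> H \<Longrightarrow> \<ominus>\<^bsub>M\<^esub> x \<in> H"
    "x \<in> H \<Longrightarrow> y \<in> H \<Longrightarrow> x \<ominus>\<^bsub>M\<^esub> y \<in> H"
proof -
  interpret left_module R M by fact
  show c: "x \<in> H \<Longrightarrow> x \<in> carrier M" for x using assms(2) by (auto simp: is_submodule_def)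
  show "\<zero>\<^bsub>M\<^esub> \<in> H" using assms(2) by (auto simp: is_submodule_def)
  show a: "x \<in> H \<Longrightarrow> y \<in> H \<Longrightarrow> x \<oplus>\<^bsub>M\<^esub> y \<in> H" for x y using assms(2) by (auto simp: is_submodule_def)
  show s: "r \<in> carrier R \<Longrightarrow> x \<in> H \<Longrightarrow> r \<odot>\<^bsub>M\<^esub> x \<in> H" for r x using assms(2) by (auto simp: is_submodule_def)
  show n: "x \<in> H \<Longrightarrow> \<ominus>\<^bsub>M\<^esub> x \<in> H" for x
    using s[of "\<ominus>\<^bsub>R\<^esub> \<one>\<^bsub>R\<^esub>" x] smult_l_minus[of "\<one>\<^bsub>R\<^esub>" x] c[of x] by simp
  show "x \<in> H \<Longrightarrow> y \<in> H \<Longrightarrow> x \<ominus>\<^bsub>M\<^esub> y \<in> H" using a n by (simp add: M.minus_eq)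
qed

lemma submodule_abelian_subgroup:
  assumes M: "left_module R M" and H: "is_submodule R M H"
  shows "abelian_subgroup H M"
proof -
  interpret left_module R M by fact
  note h = is_submoduleD[OF M H]
  show ?thesis
  proof (rule abelian_subgroupI3)
    show "additive_subgroup H M"
      by (rule additive_subgroup.intro, rule subgroup.intro)
        (auto simp: h simp flip: a_inv_def)
  qed (rule M.abelian_group_axioms)
qed

lemma coset_eq_iff:
  assumes M: "left_module R M" and H: "is_submodule R M H" and "x \<in> carrier M" "y \<in> carrier M"
  shows "H +>\<^bsub>M\<^esub> x = H +>\<^bsub>M\<^esub> y \<longleftrightarrow> x \<ominus>\<^bsub>M\<^esub> y \<in> H"
proof -
  interpret left_module R M by fact
  interpret abelian_subgroup H M by (rule submodule_abelian_subgroup[OF M H])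
  show ?thesis
    using rcos_eq_iff[OF M.a_group a_subgroup, of x y] assms(3,4)
    by (simp add: a_r_coset_def M.minus_eq a_inv_def)
qed

lemma coset_self:
  assumes M: "left_module R M" and H: "is_submodule R M H" and "x \<in> carrier M"
  shows "x \<in> H +>\<^bsub>M\<^esub> x"
proof -
  interpret abelian_subgroup H M by (rule submodule_abelian_subgroup[OF M H])
  show ?thesis by (rule a_rcos_self) fact
qed

text \<open>All members of a coset have the same image coset, so the union in
  \<open>induced_map\<close> is a single coset. Additivity of f is assumed in place of linearity,
  because this is also applied to multiplication by a scalar, which need not be linear over a
  noncommutative ring.\<close>

lemma induced_map_coset:
  assumes M: "left_module R M" and H: "is_submodule R M H"
    and M': "left_module R M'" and H': "is_submodule R M' H'"
    and f: "\<And>x. x \<in> carrier M \<Longrightarrow> f x \<in> carrier M'"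
      "\<And>x y. x \<in> carrier M \<Longrightarrow> y \<in> carrier M \<Longrightarrow> f (x \<oplus>\<^bsub>M\<^esub> y) = f x \<oplus>\<^bsub>M'\<^esub> f y"
      "\<And>x. x \<in> H \<Longrightarrow> f x \<in> H'"
    and x: "x \<in> carrier M"
  shows "induced_map M' H' f (H +>\<^bsub>M\<^esub> x) = H' +>\<^bsub>M'\<^esub> f x"
proof -
  interpret left_module R M by fact
  interpret M': left_module R M' by fact
  have "H' +>\<^bsub>M'\<^esub> f y = H' +>\<^bsub>M'\<^esub> f x" if y: "y \<in> H +>\<^bsub>M\<^esub> x" for y
  proof -
    obtain h where h: "h \<in> H" "y = h \<oplus>\<^bsub>M\<^esub> x" using y by (auto simp: a_r_coset_def')
    have hM: "h \<in> carrier M" by (rule is_submoduleD(1)[OF M H h(1)])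
    have "f y \<ominus>\<^bsub>M'\<^esub> f x = f h" using h hM f x by (simp add: M'.M.add_minus_cancel)
    then show ?thesis using coset_eq_iff[OF M' H', of "f y" "f x"] f x h hM by simp
  qed
  then show ?thesis unfolding induced_map_def using coset_self[OF M H x] by blast
qed

lemma carrier_quot_module: "carrier (quot_module M H) = (\<lambda>x. H +>\<^bsub>M\<^esub> x) ` carrier M"
  by (auto simp: quot_module_def A_RCOSETS_def')

lemma zero_quot_module:
  assumes M: "left_module R M" and H: "is_submodule R M H"
  shows "\<zero>\<^bsub>quot_module M H\<^esub> = H +>\<^bsub>M\<^esub> \<zero>\<^bsub>M\<^esub>"
proof -
  interpret left_module R M by fact
  show ?thesis using is_submoduleD(1)[OF M H] by (simp add: quot_module_def subset_iff)
qed

lemma add_quot_module: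
  assumes M: "left_module R M" and H: "is_submodule R M H" and "x \<in> carrier M" "y \<in> carrier M"
  shows "(H +>\<^bsub>M\<^esub> x) \<oplus>\<^bsub>quot_module M H\<^esub> (H +>\<^bsub>M\<^esub> y) = H +>\<^bsub>M\<^esub> (x \<oplus>\<^bsub>M\<^esub> y)"
proof -
  interpret abelian_subgroup H M by (rule submodule_abelian_subgroup[OF M H])
  show ?thesis using a_rcos_sum[OF assms(3,4)] by (simp add: quot_module_def)
qed

lemma smult_quot_module:
  assumes M: "left_module R M" and H: "is_submodule R M H" and "r \<in> carrier R" "x \<in> carrier M"
  shows "r \<odot>\<^bsub>quot_module M H\<^esub> (H +>\<^bsub>M\<^esub> x) = H +>\<^bsub>M\<^esub> (r \<odot>\<^bsub>M\<^esub> x)"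
proof -
  interpret left_module R M by fact
  show ?thesis unfolding quot_module_def
    using induced_map_coset[OF M H M H, of "\<lambda>x. r \<odot>\<^bsub>M\<^esub> x" x] is_submoduleD[OF M H] assms(3,4)
    by (simp add: smult_r_distr)
qed

lemmas quot_module_simps = carrier_quot_module zero_quot_module add_quot_module smult_quot_module

lemma quot_module_left_module:
  assumes M: "left_module R M" and H: "is_submodule R M H"
  shows "left_module R (quot_module M H)"
proof -
  interpret left_module R M by fact
  note q = quot_module_simps(2-4)[OF M H] 
  show ?thesis
  proof (intro left_module.intro left_module_axioms.intro abelian_groupI)
    show "\<exists>y\<in>carrier (quot_module M H). y \<oplus>\<^bsub>quot_module M H\<^esub> x = \<zero>\<^bsub>quot_module M H\<^esub>"
      if "x \<in> carrier (quot_module M H)" for x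
    proof -
      from that obtain a where "a \<in> carrier M" "x = H +>\<^bsub>M\<^esub> a" by (auto simp: carrier_quot_module)
      then show ?thesis
        by (intro bexI[of _ "H +>\<^bsub>M\<^esub> (\<ominus>\<^bsub>M\<^esub> a)"]) (auto simp: q M.l_neg carrier_quot_module)
    qed
  qed (auto simp: carrier_quot_module q R.ring_axioms M.a_ac smult_l_distr smult_r_distr smult_assoc1)
qed

lemma quot_module_mod_hom:
  assumes M: "left_module R M" and H: "is_submodule R M H"
    and M': "left_module R M'" and H': "is_submodule R M' H'"
    and f: "f \<in> mod_hom R M M'" "\<And>x. x \<in> H \<Longrightarrow> f x \<in> H'"
  shows "induced_map M' H' f \<in> mod_hom R (quot_module M H) (quot_module M' H')"
proof -
  interpret left_module R M by fact
  interpret M': left_module R M' by fact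
  note fD = mod_homD[OF f(1)]
  have *: "induced_map M' H' f (H +>\<^bsub>M\<^esub> x) = H' +>\<^bsub>M'\<^esub> f x" if "x \<in> carrier M" for x
    by (rule induced_map_coset[OF M H M' H' fD(1,2) f(2) that])
  show ?thesis unfolding mod_hom_def
    by (auto simp: carrier_quot_module quot_module_simps(3,4)[OF M H] quot_module_simps(3,4)[OF M' H'] * fD)
qed

section \<open>Homology classes and induced maps in homology\<close>

definition hclass :: "('r, 'a) cplx \<Rightarrow> int \<Rightarrow> 'a \<Rightarrow> 'a set" where
  "hclass X n x = boundaries X n +>\<^bsub>obj X n\<^esub> x"

lemma cyclesD:
  "x \<in> cycles X n \<Longrightarrow> x \<in> carrier (obj X n)" "x \<in> cycles X n \<Longrightarrow> diff X n x = \<zero>\<^bsub>obj X (n - 1)\<^esub>"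
  by (auto simp: cycles_def)

lemma boundaries_submodule:
  assumes "is_complex R X"
  shows "is_submodule R (obj X n) (boundaries X n)"
    and "is_submodule R (obj X n\<lparr>carrier := cycles X n\<rparr>) (boundaries X n)"
proof -
  note D = mod_homD[OF diff_succ_mod_hom[OF assms, of n]] and L = is_complexD(1)[OF assms]
  interpret X: left_module R "obj X (n + 1)" by (rule L)
  have z: "diff X (n + 1) \<zero>\<^bsub>obj X (n + 1)\<^esub> = \<zero>\<^bsub>obj X n\<^esub>"
    by (rule mod_hom_zero[OF L L diff_succ_mod_hom[OF assms]])
  show 1: "is_submodule R (obj X n) (boundaries X n)"
    unfolding is_submodule_def boundaries_def
    using D z by (auto simp flip: D(2,3) intro: rev_image_eqI[OF X.M.zero_closed])
  then show "is_submodule R (obj X n\<lparr>carrier := cycles X n\<rparr>) (boundaries X n)"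
    using boundaries_subset_cycles[OF assms, of n] by (simp add: is_submodule_def)
qed

lemma coset_restrict [simp]: "H +>\<^bsub>M\<lparr>carrier := S\<rparr>\<^esub> x = H +>\<^bsub>M\<^esub> x"
  by (simp add: a_r_coset_def')

lemma hclass_eq_iff:
  assumes X: "is_complex R X" and "x \<in> carrier (obj X n)" "y \<in> carrier (obj X n)"
  shows "hclass X n x = hclass X n y \<longleftrightarrow> x \<ominus>\<^bsub>obj X n\<^esub> y \<in> boundaries X n"
  unfolding hclass_def by (rule coset_eq_iff[OF is_complexD(1)[OF X] boundaries_submodule(1)[OF X] assms(2,3)])

lemma carrier_homology: "carrier (homology X n) = hclass X n ` cycles X n"
  by (simp add: homology_def carrier_quot_module hclass_def)

lemma chain_map_cycles:
  assumes "is_complex R X" "is_complex R Y" "chain_map R X Y f" "x \<in> cycles X n"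
  shows "f n x \<in> cycles Y n"
  using chain_mapD(2)[OF assms(3), of x n] mod_homD(1)[OF chain_mapD(1)[OF assms(3)]] cyclesD[OF assms(4)]
    mod_hom_zero[OF is_complexD(1)[OF assms(1)] is_complexD(1)[OF assms(2)] chain_mapD(1)[OF assms(3)]]
  by (auto simp: cycles_def)

lemma chain_map_boundaries:
  assumes "chain_map R X Y f" "x \<in> boundaries X n"
  shows "f n x \<in> boundaries Y n"
proof -
  from assms(2) obtain y where "y \<in> carrier (obj X (n + 1))" "x = diff X (n + 1) y"
    by (auto simp: boundaries_def)
  then show ?thesis
    using chain_mapD(3)[OF assms(1), of y n] mod_homD(1)[OF chain_mapD(1)[OF assms(1)], of y "n + 1"]
    by (auto simp: boundaries_def)
qed

lemma homology_map_hclass: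
  assumes X: "is_complex R X" and Y: "is_complex R Y" and f: "chain_map R X Y f" and x: "x \<in> carrier (obj X n)"
  shows "homology_map Y n (f n) (hclass X n x) = hclass Y n (f n x)"
  unfolding homology_map_def hclass_def
  by (rule induced_map_coset[OF is_complexD(1)[OF X] boundaries_submodule(1)[OF X]
        is_complexD(1)[OF Y] boundaries_submodule(1)[OF Y] _ _ _ x])
    (use mod_homD[OF chain_mapD(1)[OF f]] chain_map_boundaries[OF f] in auto)

lemma homology_map_mod_hom:
  assumes X: "is_complex R X" and Y: "is_complex R Y" and f: "chain_map R X Y f"
  shows "homology_map Y n (f n) \<in> mod_hom R (homology X n) (homology Y n)"
proof -
  let ?X = "obj X n\<lparr>carrier := cycles X n\<rparr>" and ?Y = "obj Y n\<lparr>carrier := cycles Y n\<rparr>"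
  have fh: "f n \<in> mod_hom R ?X ?Y"
    using chain_map_cycles[OF X Y f] mod_homD[OF chain_mapD(1)[OF f]]
    by (auto simp: mod_hom_def cyclesD(1))
  \<comment> \<open>\<open>homology\<close> is a quotient of the module of cycles, while
    \<open>homology_map\<close> forms cosets in the whole module; they are the same sets.\<close>
  have "homology_map Y n (f n) = induced_map ?Y (boundaries Y n) (f n)"
    by (simp add: homology_map_def induced_map_def fun_eq_iff)
  then show ?thesis unfolding homology_def
    using quot_module_mod_hom[OF cycles_left_module[OF X] boundaries_submodule(2)[OF X]
        cycles_left_module[OF Y] boundaries_submodule(2)[OF Y] fh chain_map_boundaries[OF f]] by simp
qed

subsection \<open>Quasi-isomorphisms\<close>

definition quasi_iso :: "('r, 'a) cplx \<Rightarrow> ('r, 'b) cplx \<Rightarrow> (int \<Rightarrow> 'a \<Rightarrow> 'b) \<Rightarrow> bool" where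
  "quasi_iso X Y f \<longleftrightarrow> (\<forall>n. (\<forall>x\<in>cycles X n. f n x \<in> boundaries Y n \<longrightarrow> x \<in> boundaries X n) \<and>
     (\<forall>y\<in>cycles Y n. \<exists>x\<in>cycles X n. hclass Y n (f n x) = hclass Y n y))"

lemma quasi_iso_mod_iso:
  assumes X: "is_complex R X" and Y: "is_complex R Y" and f: "chain_map R X Y f" and q: "quasi_iso X Y f"
  shows "homology_map Y n (f n) \<in> mod_iso R (homology X n) (homology Y n)"
proof -
  note h = homology_map_hclass[OF X Y f cyclesD(1)] and fc = chain_map_cycles[OF X Y f]
    and F = chain_mapD(1)[OF f]
  interpret Xm: left_module R "obj X n\<lparr>carrier := cycles X n\<rparr>" by (rule cycles_left_module[OF X])
  interpret Xn: left_module R "obj X n" by (rule is_complexD(1)[OF X])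
  have "inj_on (homology_map Y n (f n)) (carrier (homology X n))"
    unfolding carrier_homology inj_on_def
  proof (intro ballI impI, elim imageE)
    fix A B x y assume *: "homology_map Y n (f n) A = homology_map Y n (f n) B"
      and x: "A = hclass X n x" "x \<in> cycles X n" and y: "B = hclass X n y" "y \<in> cycles X n"
    have "x \<ominus>\<^bsub>obj X n\<^esub> y \<in> cycles X n"
      using is_submoduleD(6)[OF Xn.left_module_axioms, of "cycles X n" x y] x y
        Xm.M.a_closed Xm.M.zero_closed Xm.smult_closed
      by (simp add: is_submodule_def subset_iff cyclesD(1))
    moreover have "f n (x \<ominus>\<^bsub>obj X n\<^esub> y) \<in> boundaries Y n"
      using * x y h fc hclass_eq_iff[OF Y] cyclesD(1)
        mod_hom_minus[OF is_complexD(1)[OF X] is_complexD(1)[OF Y] F] by metis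
    ultimately have "x \<ominus>\<^bsub>obj X n\<^esub> y \<in> boundaries X n" using q unfolding quasi_iso_def by blast
    then show "A = B" using hclass_eq_iff[OF X] x y cyclesD(1) by metis
  qed
  moreover have "homology_map Y n (f n) ` carrier (homology X n) = carrier (homology Y n)"
  proof
    show "homology_map Y n (f n) ` carrier (homology X n) \<subseteq> carrier (homology Y n)"
      using h fc by (auto simp: carrier_homology)
    show "carrier (homology Y n) \<subseteq> homology_map Y n (f n) ` carrier (homology X n)"
    proof
      fix A assume "A \<in> carrier (homology Y n)"
      then obtain y where y: "y \<in> cycles Y n" "A = hclass Y n y" by (auto simp: carrier_homology)
      then obtain x where "x \<in> cycles X n" "hclass Y n (f n x) = hclass Y n y"
        using q unfolding quasi_iso_def by blast
      then show "A \<in> homology_map Y n (f n) ` carrier (homology X n)"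
        using y h[of x n] by (auto simp: carrier_homology intro!: rev_image_eqI)
    qed
  qed
  ultimately show ?thesis
    using homology_map_mod_hom[OF X Y f] by (simp add: mod_iso_def bij_betw_def)
qed

lemma boundaries_hclass_iff:
  assumes X: "is_complex R X" and "x \<in> carrier (obj X n)"
  shows "x \<in> boundaries X n \<longleftrightarrow> hclass X n x = hclass X n \<zero>\<^bsub>obj X n\<^esub>"
proof -
  interpret left_module R "obj X n" by (rule is_complexD(1)[OF X])
  show ?thesis using hclass_eq_iff[OF X assms(2), of "\<zero>\<^bsub>obj X n\<^esub>"] assms(2) by (simp add: M.minus_zero)
qed

lemma quasi_iso_comp:
  assumes X: "is_complex R X" and Y: "is_complex R Y" and Z: "is_complex R Z"
    and f: "chain_map R X Y f" and g: "chain_map R Y Z g"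
    and qf: "quasi_iso X Y f" and qg: "quasi_iso Y Z g"
    and h: "\<And>n x. x \<in> carrier (obj X n) \<Longrightarrow> h n x = g n (f n x)"
  shows "quasi_iso X Z h"
  unfolding quasi_iso_def
proof (intro allI conjI ballI impI)
  fix n x assume x: "x \<in> cycles X n" "h n x \<in> boundaries Z n"
  then show "x \<in> boundaries X n"
    using h cyclesD(1)[OF x(1)] chain_map_cycles[OF X Y f x(1)] qf qg unfolding quasi_iso_def by metis
next
  fix n z assume z: "z \<in> cycles Z n"
  then obtain y where y: "y \<in> cycles Y n" "hclass Z n (g n y) = hclass Z n z"
    using qg unfolding quasi_iso_def by blast
  obtain x where x: "x \<in> cycles X n" "hclass Y n (f n x) = hclass Y n y"
    using y qf unfolding quasi_iso_def by blast
  have "hclass Z n (g n (f n x)) = homology_map Z n (g n) (hclass Y n (f n x))"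
    using homology_map_hclass[OF Y Z g] chain_map_cycles[OF X Y f x(1)] cyclesD(1) by metis
  also have "\<dots> = hclass Z n (g n y)"
    using homology_map_hclass[OF Y Z g] y(1) x(2) cyclesD(1) by metis
  finally show "\<exists>x\<in>cycles X n. hclass Z n (h n x) = hclass Z n z"
    using x y h cyclesD(1) by metis
qed

text \<open>Applied to a pair (x, b) with f x = d b, acyclicity gives injectivity in homology;
  applied to (0, y) with y a cycle, surjectivity.\<close>

lemma cone_acyclic_quasi_iso:
  assumes X: "is_complex R X" and Y: "is_complex R Y" and f: "chain_map R X Y f"
    and ac: "cone_acyclic X Y f (\<lambda>n. carrier (obj X n)) (\<lambda>n. carrier (obj Y n))"
  shows "quasi_iso X Y f"
  unfolding quasi_iso_def
proof (intro allI conjI ballI impI)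
  fix n x assume x: "x \<in> cycles X n" "f n x \<in> boundaries Y n"
  then obtain b where "b \<in> carrier (obj Y (n + 1))" "f n x = diff Y (n + 1) b" by (auto simp: boundaries_def)
  then show "x \<in> boundaries X n"
    using ac[unfolded cone_acyclic_def, rule_format, of x n b] x by (auto simp: cycles_def boundaries_def)
next
  fix n y assume y: "y \<in> cycles Y n"
  interpret X: left_module R "obj X (n - 1)" by (rule is_complexD(1)[OF X])
  interpret Y: left_module R "obj Y n" by (rule is_complexD(1)[OF Y])
  have n: "n - 1 + 1 = n" "n - 1 + 2 = n + 1" by simp_all
  have "diff X (n - 1) \<zero>\<^bsub>obj X (n - 1)\<^esub> = \<zero>\<^bsub>obj X (n - 1 - 1)\<^esub>"
    by (rule mod_hom_zero[OF is_complexD(1)[OF X] is_complexD(1)[OF X] is_complexD(2)[OF X]])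
  moreover have "f (n - 1) \<zero>\<^bsub>obj X (n - 1)\<^esub> = diff Y n y"
    using mod_hom_zero[OF is_complexD(1)[OF X] is_complexD(1)[OF Y] chain_mapD(1)[OF f]] cyclesD(2)[OF y] by simp
  ultimately obtain a b where ab: "a \<in> carrier (obj X n)" "b \<in> carrier (obj Y (n + 1))"
    "diff X n a = \<zero>\<^bsub>obj X (n - 1)\<^esub>" "f n a = y \<oplus>\<^bsub>obj Y n\<^esub> diff Y (n + 1) b"
    using ac[unfolded cone_acyclic_def, rule_format, of "\<zero>\<^bsub>obj X (n - 1)\<^esub>" "n - 1" y, unfolded n]
      cyclesD(1)[OF y] X.M.zero_closed by blast
  have d: "diff Y (n + 1) b \<in> carrier (obj Y n)" by (rule mod_homD(1)[OF diff_succ_mod_hom[OF Y] ab(2)])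
  have "f n a \<ominus>\<^bsub>obj Y n\<^esub> y = diff Y (n + 1) b"
    using ab d cyclesD(1)[OF y] by (simp add: Y.M.a_comm[of y] Y.M.add_minus_cancel)
  then have "f n a \<ominus>\<^bsub>obj Y n\<^esub> y \<in> boundaries Y n" using ab(2) by (simp add: boundaries_def)
  then have "hclass Y n (f n a) = hclass Y n y"
    using hclass_eq_iff[OF Y] cyclesD(1)[OF y] mod_homD(1)[OF chain_mapD(1)[OF f] ab(1)] by blast
  moreover have "a \<in> cycles X n" using ab by (simp add: cycles_def)
  ultimately show "\<exists>x\<in>cycles X n. hclass Y n (f n x) = hclass Y n y" by blast
qed

section \<open>Chain homotopies\<close>

definition homotopy ::
    "'r ring \<Rightarrow> ('r, 'a) cplx \<Rightarrow> ('r, 'b) cplx \<Rightarrow> (int \<Rightarrow> 'a \<Rightarrow> 'b) \<Rightarrow> (int \<Rightarrow> 'a \<Rightarrow> 'b) \<Rightarrow>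
      (int \<Rightarrow> 'a \<Rightarrow> 'b) \<Rightarrow> bool" where
  "homotopy R X Y f g s \<longleftrightarrow> (\<forall>n. s n \<in> mod_hom R (obj X n) (obj Y (n + 1)) \<and>
     (\<forall>x\<in>carrier (obj X n). g n x =
        f n x \<oplus>\<^bsub>obj Y n\<^esub> (diff Y (n + 1) (s n x) \<oplus>\<^bsub>obj Y n\<^esub> s (n - 1) (diff X n x))))"

lemma homotopy_hclass:
  assumes X: "is_complex R X" and Y: "is_complex R Y" and f: "chain_map R X Y f"
    and s: "homotopy R X Y f g s" and x: "x \<in> cycles X n"
  shows "hclass Y n (g n x) = hclass Y n (f n x)"
proof -
  interpret Y: left_module R "obj Y n" by (rule is_complexD(1)[OF Y])
  have sh: "s n \<in> mod_hom R (obj X n) (obj Y (n + 1))" for n using s by (auto simp: homotopy_def)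
  have g: "g n x = f n x \<oplus>\<^bsub>obj Y n\<^esub> (diff Y (n + 1) (s n x) \<oplus>\<^bsub>obj Y n\<^esub> s (n - 1) (diff X n x))"
    using s cyclesD(1)[OF x] by (auto simp: homotopy_def)
  have "s (n - 1) (diff X n x) = \<zero>\<^bsub>obj Y n\<^esub>"
    using mod_hom_zero[OF is_complexD(1)[OF X] is_complexD(1)[OF Y] sh, of "n - 1"] cyclesD(2)[OF x] by simp
  moreover have sx: "s n x \<in> carrier (obj Y (n + 1))" by (rule mod_homD(1)[OF sh cyclesD(1)[OF x]])
  moreover have dc: "diff Y (n + 1) (s n x) \<in> carrier (obj Y n)"
    by (rule mod_homD(1)[OF diff_succ_mod_hom[OF Y] sx])
  moreover have fc: "f n x \<in> carrier (obj Y n)" by (rule mod_homD(1)[OF chain_mapD(1)[OF f] cyclesD(1)[OF x]])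
  ultimately have gx: "g n x = diff Y (n + 1) (s n x) \<oplus>\<^bsub>obj Y n\<^esub> f n x" using g by (simp add: Y.M.a_comm)
  then have "g n x \<ominus>\<^bsub>obj Y n\<^esub> f n x \<in> boundaries Y n"
    using dc fc sx by (simp add: Y.M.add_minus_cancel boundaries_def)
  then show ?thesis using hclass_eq_iff[OF Y, of "g n x" n "f n x"] gx dc fc by simp
qed

text \<open>A homotopy inverse enters only through its effect on homology classes, which is the form
  in which \<open>tensor_map_homotopic_hclass\<close> provides it.\<close>

lemma homotopy_inverse_quasi_iso:
  assumes X: "is_complex R X" and Y: "is_complex R Y"
    and f: "chain_map R X Y f" and g: "chain_map R Y X g"
    and gf: "\<And>n x. x \<in> cycles X n \<Longrightarrow> hclass X n (g n (f n x)) = hclass X n x"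
    and fg: "\<And>n y. y \<in> cycles Y n \<Longrightarrow> hclass Y n (f n (g n y)) = hclass Y n y"
  shows "quasi_iso X Y f"
  unfolding quasi_iso_def
proof (intro allI conjI ballI impI)
  fix n x assume x: "x \<in> cycles X n" "f n x \<in> boundaries Y n"
  note c = cyclesD(1)[OF x(1)] cyclesD(1)[OF chain_map_cycles[OF X Y f x(1)]]
    cyclesD(1)[OF chain_map_cycles[OF Y X g chain_map_cycles[OF X Y f x(1)]]]
  have "g n (f n x) \<in> boundaries X n" by (rule chain_map_boundaries[OF g x(2)])
  then show "x \<in> boundaries X n" using boundaries_hclass_iff[OF X] c gf[OF x(1)] by metis
qed (use fg chain_map_cycles[OF Y X g] in blast)

subsection \<open>Quotients by subcomplexes\<close>

definition subcomplex :: "'r ring \<Rightarrow> ('r, 'a) cplx \<Rightarrow> (int \<Rightarrow> 'a set) \<Rightarrow> bool" where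
  "subcomplex R X A \<longleftrightarrow> (\<forall>n. is_submodule R (obj X n) (A n) \<and> diff X n ` A n \<subseteq> A (n - 1))"

definition quot_complex :: "('r, 'a) cplx \<Rightarrow> (int \<Rightarrow> 'a set) \<Rightarrow> ('r, 'a set) cplx" where
  "quot_complex X A = \<lparr>obj = \<lambda>n. quot_module (obj X n) (A n),
     diff = \<lambda>n. induced_map (obj X (n - 1)) (A (n - 1)) (diff X n)\<rparr>"

definition quot_map :: "('r, 'b) cplx \<Rightarrow> (int \<Rightarrow> 'b set) \<Rightarrow> (int \<Rightarrow> 'a \<Rightarrow> 'b) \<Rightarrow> int \<Rightarrow> 'a set \<Rightarrow> 'b set" where
  "quot_map Y B f n = induced_map (obj Y n) (B n) (f n)"

lemma obj_quot_complex [simp]: "obj (quot_complex X A) n = quot_module (obj X n) (A n)"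
  by (simp add: quot_complex_def)

lemma diff_quot_complex:
  assumes X: "is_complex R X" and A: "subcomplex R X A" and x: "x \<in> carrier (obj X n)"
  shows "diff (quot_complex X A) n (A n +>\<^bsub>obj X n\<^esub> x) = A (n - 1) +>\<^bsub>obj X (n - 1)\<^esub> diff X n x"
  unfolding quot_complex_def cplx.simps
  by (rule induced_map_coset[OF is_complexD(1)[OF X] _ is_complexD(1)[OF X] _ _ _ _ x])
    (use A mod_homD[OF is_complexD(2)[OF X]] in \<open>auto simp: subcomplex_def\<close>)

lemma diff_succ_quot_complex:
  assumes X: "is_complex R X" and A: "subcomplex R X A" and x: "x \<in> carrier (obj X (n + 1))"
  shows "diff (quot_complex X A) (n + 1) (A (n + 1) +>\<^bsub>obj X (n + 1)\<^esub> x) = A n +>\<^bsub>obj X n\<^esub> diff X (n + 1) x"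
  using diff_quot_complex[OF X A x] by simp

lemma quot_complex_is_complex:
  assumes X: "is_complex R X" and A: "subcomplex R X A"
  shows "is_complex R (quot_complex X A)"
proof -
  have S: "is_submodule R (obj X n) (A n)" and D: "\<And>x. x \<in> A n \<Longrightarrow> diff X n x \<in> A (n - 1)" for n
    using A by (auto simp: subcomplex_def)
  note L = is_complexD(1)[OF X] and DX = is_complexD(2)[OF X]
  have "diff (quot_complex X A) n \<in> mod_hom R (obj (quot_complex X A) n) (obj (quot_complex X A) (n - 1))" for n
    unfolding quot_complex_def cplx.simps by (rule quot_module_mod_hom[OF L S L S DX D])
  moreover have "diff (quot_complex X A) (n - 1) (diff (quot_complex X A) n x) = \<zero>\<^bsub>obj (quot_complex X A) (n - 2)\<^esub>"
    if x: "x \<in> carrier (obj (quot_complex X A) n)" for n x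
  proof -
    obtain a where a: "a \<in> carrier (obj X n)" "x = A n +>\<^bsub>obj X n\<^esub> a"
      using x by (auto simp: carrier_quot_module)
    show ?thesis
      using a diff_quot_complex[OF X A] mod_homD(1)[OF DX, of a n] is_complexD(3)[OF X a(1)]
        zero_quot_module[OF L S, of "n - 2"] by simp
  qed
  ultimately show ?thesis using quot_module_left_module[OF L S] by (simp add: is_complex_def)
qed

lemma quot_map_coset:
  assumes X: "is_complex R X" and Y: "is_complex R Y" and A: "subcomplex R X A" and B: "subcomplex R Y B"
    and f: "chain_map R X Y f" "\<And>n x. x \<in> A n \<Longrightarrow> f n x \<in> B n" and x: "x \<in> carrier (obj X n)"
  shows "quot_map Y B f n (A n +>\<^bsub>obj X n\<^esub> x) = B n +>\<^bsub>obj Y n\<^esub> f n x"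
  unfolding quot_map_def
  by (rule induced_map_coset[OF is_complexD(1)[OF X] _ is_complexD(1)[OF Y] _ _ _ _ x])
    (use A B f mod_homD[OF chain_mapD(1)[OF f(1)]] in \<open>auto simp: subcomplex_def\<close>)

lemma quot_map_chain_map:
  assumes X: "is_complex R X" and Y: "is_complex R Y" and A: "subcomplex R X A" and B: "subcomplex R Y B"
    and f: "chain_map R X Y f" "\<And>n x. x \<in> A n \<Longrightarrow> f n x \<in> B n"
  shows "chain_map R (quot_complex X A) (quot_complex Y B) (quot_map Y B f)"
  unfolding chain_map_def
proof (intro allI conjI ballI)
  fix n
  have S: "is_submodule R (obj X n) (A n)" "is_submodule R (obj Y n) (B n)"
    using A B by (auto simp: subcomplex_def)
  show "quot_map Y B f n \<in> mod_hom R (obj (quot_complex X A) n) (obj (quot_complex Y B) n)"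
    unfolding quot_map_def obj_quot_complex
    by (rule quot_module_mod_hom[OF is_complexD(1)[OF X] S(1) is_complexD(1)[OF Y] S(2) chain_mapD(1)[OF f(1)] f(2)])
  fix x assume "x \<in> carrier (obj (quot_complex X A) n)"
  then obtain a where a: "a \<in> carrier (obj X n)" "x = A n +>\<^bsub>obj X n\<^esub> a" by (auto simp: carrier_quot_module)
  show "quot_map Y B f (n - 1) (diff (quot_complex X A) n x) = diff (quot_complex Y B) n (quot_map Y B f n x)"
    using a diff_quot_complex[OF X A] diff_quot_complex[OF Y B] quot_map_coset[OF X Y A B f]
      mod_homD(1)[OF is_complexD(2)[OF X], of a n] mod_homD(1)[OF chain_mapD(1)[OF f(1)], of a n]
      chain_mapD(2)[OF f(1) a(1)] by simp
qed

lemma quot_homotopy: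
  assumes X: "is_complex R X" and Y: "is_complex R Y" and A: "subcomplex R X A" and B: "subcomplex R Y B"
    and f: "chain_map R X Y f" "\<And>n x. x \<in> A n \<Longrightarrow> f n x \<in> B n"
    and g: "chain_map R X Y g" "\<And>n x. x \<in> A n \<Longrightarrow> g n x \<in> B n"
    and s: "homotopy R X Y f g s" "\<And>n x. x \<in> A n \<Longrightarrow> s n x \<in> B (n + 1)"
  shows "\<exists>t. homotopy R (quot_complex X A) (quot_complex Y B) (quot_map Y B f) (quot_map Y B g) t"
proof -
  note LX = is_complexD(1)[OF X] and LY = is_complexD(1)[OF Y]
  have SX: "is_submodule R (obj X n) (A n)" and SY: "is_submodule R (obj Y n) (B n)" for n
    using A B by (auto simp: subcomplex_def)
  have sh: "s n \<in> mod_hom R (obj X n) (obj Y (n + 1))" for n using s(1) by (auto simp: homotopy_def)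
  define t where "t n = induced_map (obj Y (n + 1)) (B (n + 1)) (s n)" for n
  have th: "t n \<in> mod_hom R (quot_module (obj X n) (A n)) (quot_module (obj Y (n + 1)) (B (n + 1)))" for n
    unfolding t_def by (rule quot_module_mod_hom[OF LX SX LY SY sh s(2)])
  have tc: "t n (A n +>\<^bsub>obj X n\<^esub> x) = B (n + 1) +>\<^bsub>obj Y (n + 1)\<^esub> s n x" if "x \<in> carrier (obj X n)" for n x
    unfolding t_def by (rule induced_map_coset[OF LX SX LY SY _ _ _ that])
      (use mod_homD[OF sh] s(2) in auto)
  have "homotopy R (quot_complex X A) (quot_complex Y B) (quot_map Y B f) (quot_map Y B g) t"
    unfolding homotopy_def obj_quot_complex
  proof (intro allI conjI ballI th)
    fix n C assume "C \<in> carrier (quot_module (obj X n) (A n))"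
    then obtain x where x: "x \<in> carrier (obj X n)" "C = A n +>\<^bsub>obj X n\<^esub> x" by (auto simp: carrier_quot_module)
    interpret Y: left_module R "obj Y n" by (rule LY)
    have dx: "diff X n x \<in> carrier (obj X (n - 1))" by (rule mod_homD(1)[OF is_complexD(2)[OF X] x(1)])
    have 1: "f n x \<in> carrier (obj Y n)" by (rule mod_homD(1)[OF chain_mapD(1)[OF f(1)] x(1)])
    have 2: "s n x \<in> carrier (obj Y (n + 1))" by (rule mod_homD(1)[OF sh x(1)])
    have 3: "diff Y (n + 1) (s n x) \<in> carrier (obj Y n)" by (rule mod_homD(1)[OF diff_succ_mod_hom[OF Y] 2])
    have 4: "s (n - 1) (diff X n x) \<in> carrier (obj Y n)" using mod_homD(1)[OF sh dx] by simp
    have "g n x = f n x \<oplus>\<^bsub>obj Y n\<^esub> (diff Y (n + 1) (s n x) \<oplus>\<^bsub>obj Y n\<^esub> s (n - 1) (diff X n x))"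
      using s(1) x(1) by (auto simp: homotopy_def)
    then show "quot_map Y B g n C = quot_map Y B f n C \<oplus>\<^bsub>quot_module (obj Y n) (B n)\<^esub>
        (diff (quot_complex Y B) (n + 1) (t n C) \<oplus>\<^bsub>quot_module (obj Y n) (B n)\<^esub>
         t (n - 1) (diff (quot_complex X A) n C))"
      using x tc[OF x(1)] tc[OF dx] diff_quot_complex[OF X A x(1)] diff_succ_quot_complex[OF Y B 2]
        quot_map_coset[OF X Y A B f x(1)]
        quot_map_coset[OF X Y A B g x(1)] 1 3 4
      by (simp add: add_quot_module[OF LY SY])
  qed
  then show ?thesis by blast
qed

text \<open>The cone of the quotient map is the quotient of the full cone by the cone of the
  restricted map. As the latter two are acyclic, so is the quotient; the argument of the long exact
  sequence is carried out with elements.\<close>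

lemma quot_cone_acyclic:
  assumes X: "is_complex R X" and Y: "is_complex R Y" and A: "subcomplex R X A" and B: "subcomplex R Y B"
    and f: "chain_map R X Y f" "\<And>n x. x \<in> A n \<Longrightarrow> f n x \<in> B n"
    and ac: "cone_acyclic X Y f (\<lambda>n. carrier (obj X n)) (\<lambda>n. carrier (obj Y n))"
    and acAB: "cone_acyclic X Y f A B"
  shows "cone_acyclic (quot_complex X A) (quot_complex Y B) (quot_map Y B f)
    (\<lambda>n. carrier (obj (quot_complex X A) n)) (\<lambda>n. carrier (obj (quot_complex Y B) n))"
  unfolding cone_acyclic_def
proof (intro allI ballI impI, elim conjE)
  note LX = is_complexD(1)[OF X] and LY = is_complexD(1)[OF Y]
    and DX = is_complexD(2)[OF X] and DY = is_complexD(2)[OF Y] and F = chain_mapD(1)[OF f(1)]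
  have SX: "is_submodule R (obj X n) (A n)" and SY: "is_submodule R (obj Y n) (B n)" for n
    using A B by (auto simp: subcomplex_def)
  fix n \<alpha> \<beta>
  assume "\<alpha> \<in> carrier (obj (quot_complex X A) n)" "\<beta> \<in> carrier (obj (quot_complex Y B) (n + 1))"
    and d\<alpha>: "diff (quot_complex X A) n \<alpha> = \<zero>\<^bsub>obj (quot_complex X A) (n - 1)\<^esub>"
    and f\<alpha>: "quot_map Y B f n \<alpha> = diff (quot_complex Y B) (n + 1) \<beta>"
  then obtain a b where a: "a \<in> carrier (obj X n)" "\<alpha> = A n +>\<^bsub>obj X n\<^esub> a"
    and b: "b \<in> carrier (obj Y (n + 1))" "\<beta> = B (n + 1) +>\<^bsub>obj Y (n + 1)\<^esub> b"
    by (auto simp: carrier_quot_module)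
  interpret X0: left_module R "obj X (n - 1)" by (rule LX)
  interpret Xn: left_module R "obj X n" by (rule LX)
  interpret Yn: left_module R "obj Y n" by (rule LY)
  interpret Y1: left_module R "obj Y (n + 1)" by (rule LY)
  have da: "diff X n a \<in> carrier (obj X (n - 1))" by (rule mod_homD(1)[OF DX a(1)])
  have fa: "f n a \<in> carrier (obj Y n)" by (rule mod_homD(1)[OF F a(1)])
  have db: "diff Y (n + 1) b \<in> carrier (obj Y n)" by (rule mod_homD(1)[OF diff_succ_mod_hom[OF Y] b(1)])
  \<comment> \<open>A cycle of the quotient cone lifts to a pair (a, b) whose boundary lies in the
    subcomplexes.\<close>
  have daA: "diff X n a \<in> A (n - 1)"
    using d\<alpha> a diff_quot_complex[OF X A a(1)] zero_quot_module[OF LX SX, of "n - 1"]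
      coset_eq_iff[OF LX SX da, of "\<zero>\<^bsub>obj X (n - 1)\<^esub>"] da by (simp add: X0.M.minus_zero)
  have fabB: "f n a \<ominus>\<^bsub>obj Y n\<^esub> diff Y (n + 1) b \<in> B n"
    using f\<alpha> a b quot_map_coset[OF X Y A B f a(1)] diff_succ_quot_complex[OF Y B b(1)]
      coset_eq_iff[OF LY SY fa db] by simp
  have 1: "diff X (n - 1) (diff X n a) = \<zero>\<^bsub>obj X (n - 1 - 1)\<^esub>" using is_complexD(3)[OF X a(1)] by simp
  interpret Ym: left_module R "obj Y (n - 1)" by (rule LY)
  have "diff Y n (f n a \<ominus>\<^bsub>obj Y n\<^esub> diff Y (n + 1) b) = diff Y n (f n a)"
    using mod_hom_minus[OF LY LY DY fa db] is_complexD(4)[OF Y b(1)] mod_homD(1)[OF DY fa]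
    by (simp add: Ym.M.minus_zero)
  then have 2: "f (n - 1) (diff X n a) = diff Y n (f n a \<ominus>\<^bsub>obj Y n\<^esub> diff Y (n + 1) b)"
    using chain_mapD(2)[OF f(1) a(1)] by simp
  have n: "n - 1 + 1 = n" "n - 1 + 2 = n + 1" by simp_all
  \<comment> \<open>That boundary is a cycle of the restricted cone, one degree lower. A pair (a'',
    b'') in the subcomplexes that bounds it corrects (a, b) to a true cycle.\<close>
  obtain a'' b'' where ab'': "a'' \<in> A n" "b'' \<in> B (n + 1)" "diff X n a'' = diff X n a"
    "f n a'' = (f n a \<ominus>\<^bsub>obj Y n\<^esub> diff Y (n + 1) b) \<oplus>\<^bsub>obj Y n\<^esub> diff Y (n + 1) b''"
    using acAB[unfolded cone_acyclic_def, rule_format, of "diff X n a" "n - 1"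
        "f n a \<ominus>\<^bsub>obj Y n\<^esub> diff Y (n + 1) b", unfolded n] daA fabB 1 2 by blast
  have a'': "a'' \<in> carrier (obj X n)" and b'': "b'' \<in> carrier (obj Y (n + 1))"
    using ab'' is_submoduleD(1)[OF LX SX] is_submoduleD(1)[OF LY SY] by blast+
  have db'': "diff Y (n + 1) b'' \<in> carrier (obj Y n)" by (rule mod_homD(1)[OF diff_succ_mod_hom[OF Y] b''])
  have 3: "diff X n (a \<ominus>\<^bsub>obj X n\<^esub> a'') = \<zero>\<^bsub>obj X (n - 1)\<^esub>"
    using mod_hom_minus[OF LX LX DX a(1) a''] ab''(3) da by (simp add: X0.M.minus_self)
  have "f n (a \<ominus>\<^bsub>obj X n\<^esub> a'') = f n a \<ominus>\<^bsub>obj Y n\<^esub> ((f n a \<ominus>\<^bsub>obj Y n\<^esub> diff Y (n + 1) b) \<oplus>\<^bsub>obj Y n\<^esub> diff Y (n + 1) b'')"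
    using mod_hom_minus[OF LX LY F a(1) a''] ab''(4) by simp
  also have "\<dots> = diff Y (n + 1) b \<ominus>\<^bsub>obj Y n\<^esub> diff Y (n + 1) b''"
    using fa db db'' by (simp add: Yn.M.ab_simps)
  also have "\<dots> = diff Y (n + 1) (b \<ominus>\<^bsub>obj Y (n + 1)\<^esub> b'')"
    using mod_hom_minus[OF LY LY diff_succ_mod_hom[OF Y] b(1) b''] by simp
  finally have 4: "f n (a \<ominus>\<^bsub>obj X n\<^esub> a'') = diff Y (n + 1) (b \<ominus>\<^bsub>obj Y (n + 1)\<^esub> b'')" .
  \<comment> \<open>The corrected pair (a - a'', b - b'') has the same cosets as (a, b) and is
    bounded in the full cone.\<close>
  obtain a' b' where ab': "a' \<in> carrier (obj X (n + 1))" "b' \<in> carrier (obj Y (n + 2))"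
    "diff X (n + 1) a' = a \<ominus>\<^bsub>obj X n\<^esub> a''"
    "f (n + 1) a' = (b \<ominus>\<^bsub>obj Y (n + 1)\<^esub> b'') \<oplus>\<^bsub>obj Y (n + 1)\<^esub> diff Y (n + 2) b'"
    using ac[unfolded cone_acyclic_def, rule_format, of "a \<ominus>\<^bsub>obj X n\<^esub> a''" n "b \<ominus>\<^bsub>obj Y (n + 1)\<^esub> b''"]
      3 4 a a'' b b'' by auto
  have db': "diff Y (n + 2) b' \<in> carrier (obj Y (n + 1))"
    using mod_homD(1)[OF diff_succ_mod_hom[OF Y, of "n + 1"], of b'] ab'(2) by (simp add: add.assoc)
  have 5: "(a \<ominus>\<^bsub>obj X n\<^esub> a'') \<ominus>\<^bsub>obj X n\<^esub> a \<in> A n"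
  proof -
    have "(a \<ominus>\<^bsub>obj X n\<^esub> a'') \<ominus>\<^bsub>obj X n\<^esub> a = \<ominus>\<^bsub>obj X n\<^esub> a''"
      using a a'' by (simp add: Xn.M.ab_simps)
    then show ?thesis using is_submoduleD(5)[OF LX SX ab''(1)] by simp
  qed
  have 6: "f (n + 1) a' \<ominus>\<^bsub>obj Y (n + 1)\<^esub> (b \<oplus>\<^bsub>obj Y (n + 1)\<^esub> diff Y (n + 2) b') \<in> B (n + 1)"
  proof -
    have "f (n + 1) a' \<ominus>\<^bsub>obj Y (n + 1)\<^esub> (b \<oplus>\<^bsub>obj Y (n + 1)\<^esub> diff Y (n + 2) b') = \<ominus>\<^bsub>obj Y (n + 1)\<^esub> b''"
      using b b'' db' unfolding ab'(4)
      by (simp add: Y1.M.ab_simps)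
    then show ?thesis using is_submoduleD(5)[OF LY SY ab''(2)] by simp
  qed
  have fa': "f (n + 1) a' \<in> carrier (obj Y (n + 1))" by (rule mod_homD(1)[OF F ab'(1)])
  have "diff (quot_complex X A) (n + 1) (A (n + 1) +>\<^bsub>obj X (n + 1)\<^esub> a') = \<alpha>"
    using diff_succ_quot_complex[OF X A ab'(1)] ab'(3) a a'' coset_eq_iff[OF LX SX _ a(1)] 5 by simp
  moreover have "diff (quot_complex Y B) (n + 2) (B (n + 2) +>\<^bsub>obj Y (n + 2)\<^esub> b') =
      B (n + 1) +>\<^bsub>obj Y (n + 1)\<^esub> diff Y (n + 2) b'"
    using diff_succ_quot_complex[OF Y B, of b' "n + 1"] ab'(2) by (simp add: add.assoc)
  then have "quot_map Y B f (n + 1) (A (n + 1) +>\<^bsub>obj X (n + 1)\<^esub> a') = \<beta> \<oplus>\<^bsub>obj (quot_complex Y B) (n + 1)\<^esub>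
      diff (quot_complex Y B) (n + 2) (B (n + 2) +>\<^bsub>obj Y (n + 2)\<^esub> b')"
    using quot_map_coset[OF X Y A B f ab'(1)] b db' add_quot_module[OF LY SY b(1) db']
      coset_eq_iff[OF LY SY fa', of "b \<oplus>\<^bsub>obj Y (n + 1)\<^esub> diff Y (n + 2) b'"] 6 by simp
  ultimately show "\<exists>a'\<in>carrier (obj (quot_complex X A) (n + 1)). \<exists>b'\<in>carrier (obj (quot_complex Y B) (n + 2)).
      diff (quot_complex X A) (n + 1) a' = \<alpha> \<and> quot_map Y B f (n + 1) a' =
      \<beta> \<oplus>\<^bsub>obj (quot_complex Y B) (n + 1)\<^esub> diff (quot_complex Y B) (n + 2) b'"
    using ab'(1,2) by (auto simp: carrier_quot_module)
qed

section \<open>Product totalizations of double complexes\<close>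

lemma prod_module_simps [simp]:
  "z \<in> carrier (prod_module A) \<longleftrightarrow> (\<forall>i. z i \<in> carrier (A i))"
  "\<zero>\<^bsub>prod_module A\<^esub> = (\<lambda>i. \<zero>\<^bsub>A i\<^esub>)"
  "z \<oplus>\<^bsub>prod_module A\<^esub> w = (\<lambda>i. z i \<oplus>\<^bsub>A i\<^esub> w i)"
  "r \<odot>\<^bsub>prod_module A\<^esub> z = (\<lambda>i. r \<odot>\<^bsub>A i\<^esub> z i)"
  by (simp_all add: prod_module_def)

lemma prod_module_left_module:
  assumes "\<And>i. left_module R (A i)"
  shows "left_module R (prod_module A)"
proof -
  interpret A: left_module R "A i" for i by (rule assms)
  show ?thesis
  proof (intro left_module.intro left_module_axioms.intro abelian_groupI)
    show "\<exists>y\<in>carrier (prod_module A). y \<oplus>\<^bsub>prod_module A\<^esub> x = \<zero>\<^bsub>prod_module A\<^esub>"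
      if "x \<in> carrier (prod_module A)" for x
      using that by (intro bexI[of _ "\<lambda>i. \<ominus>\<^bsub>A i\<^esub> x i"]) (auto simp: A.M.l_neg)
  qed (auto simp: A.R.ring_axioms A.M.a_ac A.smult_l_distr A.smult_r_distr A.smult_assoc1)
qed

definition parity_sign :: "('r, 'a) module \<Rightarrow> int \<Rightarrow> 'a \<Rightarrow> 'a" where
  "parity_sign M i x = (if even i then x else \<ominus>\<^bsub>M\<^esub> x)"

text \<open>The tensor product is abstracted to a family of modules with commuting differentials,
  and the sign that makes them a single differential is added here. Horizontal maps change the index
  i, vertical ones keep it.\<close>

definition tot ::
    "(int \<Rightarrow> int \<Rightarrow> ('k, 't) module) \<Rightarrow> (int \<Rightarrow> int \<Rightarrow> 't \<Rightarrow> 't) \<Rightarrow> (int \<Rightarrow> int \<Rightarrow> 't \<Rightarrow> 't) \<Rightarrow> ('k, int \<Rightarrow> 't) cplx" where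
  "tot D dh dv = \<lparr>obj = \<lambda>n. prod_module (\<lambda>i. D i (n - i)),
     diff = \<lambda>n z i. dh (i + 1) (n - 1 - i) (z (i + 1)) \<oplus>\<^bsub>D i (n - 1 - i)\<^esub>
       parity_sign (D i (n - 1 - i)) i (dv i (n - i) (z i))\<rparr>"

text \<open>For tensor products this is the carrier of the usual tensor product inside the unbounded
  one.\<close>

definition fin_supp :: "(int \<Rightarrow> int \<Rightarrow> ('k, 't) module) \<Rightarrow> int \<Rightarrow> (int \<Rightarrow> 't) set" where
  "fin_supp D n = {z. (\<forall>i. z i \<in> carrier (D i (n - i))) \<and> finite {i. z i \<noteq> \<zero>\<^bsub>D i (n - i)\<^esub>}}"

definition tot_map :: "(int \<Rightarrow> int \<Rightarrow> 't \<Rightarrow> 'u) \<Rightarrow> int \<Rightarrow> (int \<Rightarrow> 't) \<Rightarrow> int \<Rightarrow> 'u" where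
  "tot_map \<phi> n z = (\<lambda>i. \<phi> i (n - i) (z i))"

lemma carrier_tot [simp]: "z \<in> carrier (obj (tot D dh dv) n) \<longleftrightarrow> (\<forall>i. z i \<in> carrier (D i (n - i)))"
  by (simp add: tot_def)

lemma obj_tot: "obj (tot D dh dv) n = prod_module (\<lambda>i. D i (n - i))"
  by (simp add: tot_def)

lemma diff_tot:
  "diff (tot D dh dv) n z i = dh (i + 1) (n - 1 - i) (z (i + 1)) \<oplus>\<^bsub>D i (n - 1 - i)\<^esub>
     parity_sign (D i (n - 1 - i)) i (dv i (n - i) (z i))"
  by (simp add: tot_def)

context left_module
begin

lemma parity_sign_closed [simp]: "x \<in> carrier M \<Longrightarrow> parity_sign M i x \<in> carrier M"
  by (simp add: parity_sign_def)

lemma parity_sign_zero [simp]: "parity_sign M i \<zero>\<^bsub>M\<^esub> = \<zero>\<^bsub>M\<^esub>"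
  by (simp add: parity_sign_def M.a_inv_zero)

lemma parity_sign_add: "x \<in> carrier M \<Longrightarrow> y \<in> carrier M \<Longrightarrow>
    parity_sign M i (x \<oplus>\<^bsub>M\<^esub> y) = parity_sign M i x \<oplus>\<^bsub>M\<^esub> parity_sign M i y"
  by (simp add: parity_sign_def M.minus_add)

lemma smult_r_minus: "r \<in> carrier R \<Longrightarrow> x \<in> carrier M \<Longrightarrow> r \<odot>\<^bsub>M\<^esub> (\<ominus>\<^bsub>M\<^esub> x) = \<ominus>\<^bsub>M\<^esub> (r \<odot>\<^bsub>M\<^esub> x)"
  using smult_r_distr[of r "\<ominus>\<^bsub>M\<^esub> x" x] by (intro M.minus_equality[symmetric]) (simp_all add: M.l_neg)

lemma parity_sign_smult: "r \<in> carrier R \<Longrightarrow> x \<in> carrier M \<Longrightarrow>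
    parity_sign M i (r \<odot>\<^bsub>M\<^esub> x) = r \<odot>\<^bsub>M\<^esub> parity_sign M i x"
  by (simp add: parity_sign_def smult_r_minus)

lemma parity_sign_succ: "x \<in> carrier M \<Longrightarrow> parity_sign M (i + 1) x = \<ominus>\<^bsub>M\<^esub> parity_sign M i x"
  by (simp add: parity_sign_def)

lemma parity_sign_pred: "x \<in> carrier M \<Longrightarrow> parity_sign M (i - 1) x = \<ominus>\<^bsub>M\<^esub> parity_sign M i x"
  by (simp add: parity_sign_def)

lemma parity_sign_parity_sign [simp]: "x \<in> carrier M \<Longrightarrow> parity_sign M i (parity_sign M i x) = x"
  by (simp add: parity_sign_def)

end

lemma mod_hom_parity_sign:
  assumes "left_module R A" "left_module R B" "f \<in> mod_hom R A B" "x \<in> carrier A"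
  shows "f (parity_sign A i x) = parity_sign B i (f x)"
  using mod_hom_a_inv[OF assms] by (simp add: parity_sign_def)

section \<open>Double complexes with commuting differentials\<close>

locale double_complex =
  fixes K :: "'k ring" and D :: "int \<Rightarrow> int \<Rightarrow> ('k, 't) module" and dh dv :: "int \<Rightarrow> int \<Rightarrow> 't \<Rightarrow> 't"
  assumes left_module: "left_module K (D i j)"
    and dh_hom: "dh i j \<in> mod_hom K (D i j) (D (i - 1) j)"
    and dv_hom: "dv i j \<in> mod_hom K (D i j) (D i (j - 1))"
    and dh_dh: "x \<in> carrier (D i j) \<Longrightarrow> dh (i - 1) j (dh i j x) = \<zero>\<^bsub>D (i - 2) j\<^esub>"
    and dv_dv: "x \<in> carrier (D i j) \<Longrightarrow> dv i (j - 1) (dv i j x) = \<zero>\<^bsub>D i (j - 2)\<^esub>"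
    and dh_dv: "x \<in> carrier (D i j) \<Longrightarrow> dh i (j - 1) (dv i j x) = dv (i - 1) j (dh i j x)"
begin

sublocale D: left_module K "D i j" for i j by (rule left_module)

text \<open>In the primed variants the target carries a plain index; with i + 1 - 1 in its place the
  rules would not match the terms to be rewritten.\<close>

lemma dh_hom': "dh (i + 1) j \<in> mod_hom K (D (i + 1) j) (D i j)"
  using dh_hom[of "i + 1" j] by simp

lemma dv_hom': "dv i (j + 1) \<in> mod_hom K (D i (j + 1)) (D i j)"
  using dv_hom[of i "j + 1"] by simp

lemmas dhD = mod_homD[OF dh_hom] and dvD = mod_homD[OF dv_hom]
  and dhD' = mod_homD[OF dh_hom'] and dvD' = mod_homD[OF dv_hom']

lemmas dh_zero [simp] = mod_hom_zero[OF left_module left_module dh_hom]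
  and dv_zero [simp] = mod_hom_zero[OF left_module left_module dv_hom]
  and dh_zero' [simp] = mod_hom_zero[OF left_module left_module dh_hom']
  and dv_zero' [simp] = mod_hom_zero[OF left_module left_module dv_hom']

lemma dh_dh': "x \<in> carrier (D (i + 2) j) \<Longrightarrow> dh (i + 1) j (dh (i + 2) j x) = \<zero>\<^bsub>D i j\<^esub>"
  using dh_dh[of x "i + 2" j] by (simp add: add.commute)

lemma dv_dv': "x \<in> carrier (D i (j + 2)) \<Longrightarrow> dv i (j + 1) (dv i (j + 2) x) = \<zero>\<^bsub>D i j\<^esub>"
  using dv_dv[of x i "j + 2"] by (simp add: add.commute)

lemma dh_dv': "x \<in> carrier (D (i + 1) (j + 1)) \<Longrightarrow> dh (i + 1) j (dv (i + 1) (j + 1) x) = dv i (j + 1) (dh (i + 1) (j + 1) x)"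
  using dh_dv[of x "i + 1" "j + 1"] by simp

lemma diff_tot_hom: "diff (tot D dh dv) n \<in> mod_hom K (obj (tot D dh dv) n) (obj (tot D dh dv) (n - 1))"
proof -
  have c: "dh (i + 1) (n - 1 - i) (z (i + 1)) \<in> carrier (D i (n - 1 - i))"
      "dv i (n - i) (z i) \<in> carrier (D i (n - 1 - i))"
      "z (i + 1) \<in> carrier (D (i + 1) (n - 1 - i))"
    if "\<forall>i. z i \<in> carrier (D i (n - i))" for z i
  proof -
    have eq: "n - (i + 1) = n - 1 - i" "n - i - 1 = n - 1 - i" by simp_all
    show "z (i + 1) \<in> carrier (D (i + 1) (n - 1 - i))" using that[rule_format, of "i + 1"] unfolding eq .
    then show "dh (i + 1) (n - 1 - i) (z (i + 1)) \<in> carrier (D i (n - 1 - i))" by (rule dhD')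
    show "dv i (n - i) (z i) \<in> carrier (D i (n - 1 - i))"
      using dvD(1)[of "z i" i "n - i"] that unfolding eq by blast
  qed
  have d: "dv i (n - i) (z i \<oplus>\<^bsub>D i (n - i)\<^esub> w i) = dv i (n - i) (z i) \<oplus>\<^bsub>D i (n - 1 - i)\<^esub> dv i (n - i) (w i)"
      "r \<in> carrier K \<Longrightarrow> dv i (n - i) (r \<odot>\<^bsub>D i (n - i)\<^esub> z i) = r \<odot>\<^bsub>D i (n - 1 - i)\<^esub> dv i (n - i) (z i)"
    if "\<forall>i. z i \<in> carrier (D i (n - i))" "\<forall>i. w i \<in> carrier (D i (n - i))" for z w i r
  proof -
    have eq: "n - i - 1 = n - 1 - i" by simp
    show "dv i (n - i) (z i \<oplus>\<^bsub>D i (n - i)\<^esub> w i) = dv i (n - i) (z i) \<oplus>\<^bsub>D i (n - 1 - i)\<^esub> dv i (n - i) (w i)"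
      "r \<in> carrier K \<Longrightarrow> dv i (n - i) (r \<odot>\<^bsub>D i (n - i)\<^esub> z i) = r \<odot>\<^bsub>D i (n - 1 - i)\<^esub> dv i (n - i) (z i)"
      using dvD(2)[of "z i" i "n - i" "w i"] dvD(3)[of r "z i" i "n - i"] that unfolding eq by blast+
  qed
  have eq: "n - (i + 1) = n - 1 - i" for i by simp
  show ?thesis
    unfolding mod_hom_def
  proof (intro CollectI conjI ballI Pi_I)
    fix z assume "z \<in> carrier (obj (tot D dh dv) n)"
    then show "diff (tot D dh dv) n z \<in> carrier (obj (tot D dh dv) (n - 1))"
      using c by (simp add: diff_tot del: diff_diff_eq)
  next
    fix z w assume z: "z \<in> carrier (obj (tot D dh dv) n)" and w: "w \<in> carrier (obj (tot D dh dv) n)"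
    show "diff (tot D dh dv) n (z \<oplus>\<^bsub>obj (tot D dh dv) n\<^esub> w) =
        diff (tot D dh dv) n z \<oplus>\<^bsub>obj (tot D dh dv) (n - 1)\<^esub> diff (tot D dh dv) n w"
    proof
      fix i
      show "diff (tot D dh dv) n (z \<oplus>\<^bsub>obj (tot D dh dv) n\<^esub> w) i =
        (diff (tot D dh dv) n z \<oplus>\<^bsub>obj (tot D dh dv) (n - 1)\<^esub> diff (tot D dh dv) n w) i"
        using c[of z i] c[of w i] d(1)[of z w i] z w
        by (simp add: diff_tot obj_tot eq dhD' D.parity_sign_add D.M.a_ac del: diff_diff_eq)
    qed
  next
    fix r z assume r: "r \<in> carrier K" and z: "z \<in> carrier (obj (tot D dh dv) n)"
    show "diff (tot D dh dv) n (r \<odot>\<^bsub>obj (tot D dh dv) n\<^esub> z) = r \<odot>\<^bsub>obj (tot D dh dv) (n - 1)\<^esub> diff (tot D dh dv) n z"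
    proof
      fix i
      show "diff (tot D dh dv) n (r \<odot>\<^bsub>obj (tot D dh dv) n\<^esub> z) i =
        (r \<odot>\<^bsub>obj (tot D dh dv) (n - 1)\<^esub> diff (tot D dh dv) n z) i"
        using c[of z i] d(2)[of z z r i] r z
        by (simp add: diff_tot obj_tot eq dhD' D.parity_sign_smult D.smult_r_distr del: diff_diff_eq)
    qed
  qed
qed

lemma diff_tot_succ:
  "diff (tot D dh dv) (i + j + 1) z i = dh (i + 1) j (z (i + 1)) \<oplus>\<^bsub>D i j\<^esub> parity_sign (D i j) i (dv i (j + 1) (z i))"
  by (simp add: diff_tot algebra_simps)

lemma tot_is_complex: "is_complex K (tot D dh dv)"
  unfolding is_complex_def
proof (intro allI conjI ballI)
  fix n
  show "left_module K (obj (tot D dh dv) n)"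
    unfolding obj_tot by (rule prod_module_left_module) (rule left_module)
  show "diff (tot D dh dv) n \<in> mod_hom K (obj (tot D dh dv) n) (obj (tot D dh dv) (n - 1))" by (rule diff_tot_hom)
  fix z assume z: "z \<in> carrier (obj (tot D dh dv) n)"
  show "diff (tot D dh dv) (n - 1) (diff (tot D dh dv) n z) = \<zero>\<^bsub>obj (tot D dh dv) (n - 2)\<^esub>"
  proof
    fix i
    \<comment> \<open>With n = i + j + 2 all bidegrees are sums with i and j, and no subtraction is
      left in them.\<close>
    obtain j where n: "n = i + j + 2" by (metis add.commute diff_add_cancel)
    have z2: "z (i + 2) \<in> carrier (D (i + 2) j)" "z (i + 1) \<in> carrier (D (i + 1) (j + 1))" "z i \<in> carrier (D i (j + 2))"
      using z[unfolded carrier_tot, rule_format, of "i + 2"] z[unfolded carrier_tot, rule_format, of "i + 1"]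
        z[unfolded carrier_tot, rule_format, of i] by (simp_all add: n add.commute)
    have e: "diff (tot D dh dv) n z (i + 1) = dh (i + 2) j (z (i + 2)) \<oplus>\<^bsub>D (i + 1) j\<^esub>
        parity_sign (D (i + 1) j) (i + 1) (dv (i + 1) (j + 1) (z (i + 1)))"
      "diff (tot D dh dv) n z i = dh (i + 1) (j + 1) (z (i + 1)) \<oplus>\<^bsub>D i (j + 1)\<^esub>
        parity_sign (D i (j + 1)) i (dv i (j + 2) (z i))"
      by (simp_all add: diff_tot n algebra_simps)
    have c: "dh (i + 2) j (z (i + 2)) \<in> carrier (D (i + 1) j)" "dv (i + 1) (j + 1) (z (i + 1)) \<in> carrier (D (i + 1) j)"
      "dh (i + 1) (j + 1) (z (i + 1)) \<in> carrier (D i (j + 1))" "dv i (j + 2) (z i) \<in> carrier (D i (j + 1))"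
      using dhD'(1)[of "z (i + 2)" "i + 1" j] dvD'(1)[OF z2(2)] dhD'(1)[OF z2(2)] dvD'(1)[of "z i" i "j + 1"] z2
      by (simp_all add: add.assoc)
    have n1: "n - 1 = i + j + 1" by (simp add: n)
    have "diff (tot D dh dv) (n - 1) (diff (tot D dh dv) n z) i =
        dh (i + 1) j (diff (tot D dh dv) n z (i + 1)) \<oplus>\<^bsub>D i j\<^esub>
        parity_sign (D i j) i (dv i (j + 1) (diff (tot D dh dv) n z i))"
      unfolding n1 by (rule diff_tot_succ)
    \<comment> \<open>The two mixed terms carry the signs of i + 1 and of i, which are
      opposite.\<close>
    also have "\<dots> = \<zero>\<^bsub>D i j\<^esub>"
      unfolding e
      using c dh_dh'[OF z2(1)] dv_dv'[OF z2(3)] dh_dv'[OF z2(2)] dvD'(1)[OF c(3)]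
      by (simp add: dhD'(2) dvD'(2) mod_hom_parity_sign[OF left_module left_module dh_hom']
          mod_hom_parity_sign[OF left_module left_module dv_hom'] D.parity_sign_succ D.parity_sign_add D.M.l_neg
          mod_hom_a_inv[OF left_module left_module dh_hom'])
    also have "\<zero>\<^bsub>D i j\<^esub> = \<zero>\<^bsub>obj (tot D dh dv) (n - 2)\<^esub> i" by (simp add: obj_tot n)
    finally show "diff (tot D dh dv) (n - 1) (diff (tot D dh dv) n z) i = \<zero>\<^bsub>obj (tot D dh dv) (n - 2)\<^esub> i" .
  qed
qed

lemma fin_supp_subcomplex: "subcomplex K (tot D dh dv) (fin_supp D)"
  unfolding subcomplex_def
proof (intro allI conjI)
  fix n
  have "finite {i. z i \<oplus>\<^bsub>D i (n - i)\<^esub> w i \<noteq> \<zero>\<^bsub>D i (n - i)\<^esub>}"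
    if "finite {i. z i \<noteq> \<zero>\<^bsub>D i (n - i)\<^esub>}" "finite {i. w i \<noteq> \<zero>\<^bsub>D i (n - i)\<^esub>}" for z w
    by (rule finite_subset[OF _ finite_UnI[OF that]]) auto
  moreover have "finite {i. r \<odot>\<^bsub>D i (n - i)\<^esub> z i \<noteq> \<zero>\<^bsub>D i (n - i)\<^esub>}"
    if "finite {i. z i \<noteq> \<zero>\<^bsub>D i (n - i)\<^esub>}" "r \<in> carrier K" for z r
    by (rule finite_subset[OF _ that(1)]) (use that(2) in auto)
  ultimately show "is_submodule K (obj (tot D dh dv) n) (fin_supp D n)"
    by (auto simp: is_submodule_def fin_supp_def obj_tot)
  show "diff (tot D dh dv) n ` fin_supp D n \<subseteq> fin_supp D (n - 1)"
  proof
    fix w assume "w \<in> diff (tot D dh dv) n ` fin_supp D n"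
    then obtain z where z: "\<forall>i. z i \<in> carrier (D i (n - i))" "finite {i. z i \<noteq> \<zero>\<^bsub>D i (n - i)\<^esub>}" "w = diff (tot D dh dv) n z"
      by (auto simp: fin_supp_def)
    have "w \<in> carrier (obj (tot D dh dv) (n - 1))"
      using mod_homD(1)[OF diff_tot_hom, of z n] z by simp
    \<comment> \<open>Only \<open>z i\<close> and \<open>z (i + 1)\<close> enter the component of
      index i, so the support grows by one shifted copy at most.\<close>
    moreover have "{i. w i \<noteq> \<zero>\<^bsub>D i (n - 1 - i)\<^esub>} \<subseteq> {i. z i \<noteq> \<zero>\<^bsub>D i (n - i)\<^esub>} \<union> (\<lambda>i. i - 1) ` {i. z i \<noteq> \<zero>\<^bsub>D i (n - i)\<^esub>}"
    proof (rule subsetI, rule ccontr)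
      fix i assume "i \<in> {i. w i \<noteq> \<zero>\<^bsub>D i (n - 1 - i)\<^esub>}"
        "i \<notin> {i. z i \<noteq> \<zero>\<^bsub>D i (n - i)\<^esub>} \<union> (\<lambda>i. i - 1) ` {i. z i \<noteq> \<zero>\<^bsub>D i (n - i)\<^esub>}"
      moreover obtain j where n: "n = i + j + 1" by (metis add.commute diff_add_cancel)
      moreover have "i = (i + 1) - 1" by simp
      ultimately have "z i = \<zero>\<^bsub>D i (j + 1)\<^esub>" "z (i + 1) = \<zero>\<^bsub>D (i + 1) j\<^esub>" "w i \<noteq> \<zero>\<^bsub>D i j\<^esub>"
        by (auto simp: image_iff algebra_simps dest: spec[of _ "i + 1"])
      moreover have "w i = dh (i + 1) j (z (i + 1)) \<oplus>\<^bsub>D i j\<^esub> parity_sign (D i j) i (dv i (j + 1) (z i))"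
        unfolding z(3) n by (rule diff_tot_succ)
      ultimately show False by simp
    qed
    ultimately show "w \<in> fin_supp D (n - 1)"
      using finite_subset[of "{i. w i \<noteq> \<zero>\<^bsub>D i (n - 1 - i)\<^esub>}"] z(2) by (simp add: fin_supp_def)
  qed
qed

end

section \<open>Maps of double complexes\<close>

locale double_complex_map =
  C: double_complex K D dh dv + E: double_complex K E eh ev
  for K :: "'k ring" and D :: "int \<Rightarrow> int \<Rightarrow> ('k, 't) module" and dh dv :: "int \<Rightarrow> int \<Rightarrow> 't \<Rightarrow> 't"
    and E :: "int \<Rightarrow> int \<Rightarrow> ('k, 'u) module" and eh ev :: "int \<Rightarrow> int \<Rightarrow> 'u \<Rightarrow> 'u" +
  fixes \<phi> :: "int \<Rightarrow> int \<Rightarrow> 't \<Rightarrow> 'u"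
  assumes \<phi>_hom: "\<phi> i j \<in> mod_hom K (D i j) (E i j)"
    and \<phi>_dh: "x \<in> carrier (D i j) \<Longrightarrow> \<phi> (i - 1) j (dh i j x) = eh i j (\<phi> i j x)"
    and \<phi>_dv: "x \<in> carrier (D i j) \<Longrightarrow> \<phi> i (j - 1) (dv i j x) = ev i j (\<phi> i j x)"
begin

lemmas \<phi>D = mod_homD[OF \<phi>_hom]
lemmas \<phi>_zero [simp] = mod_hom_zero[OF C.left_module E.left_module \<phi>_hom]

lemma \<phi>_dh': "x \<in> carrier (D (i + 1) j) \<Longrightarrow> \<phi> i j (dh (i + 1) j x) = eh (i + 1) j (\<phi> (i + 1) j x)"
  using \<phi>_dh[of x "i + 1" j] by simp

lemma \<phi>_dv': "x \<in> carrier (D i (j + 1)) \<Longrightarrow> \<phi> i j (dv i (j + 1) x) = ev i (j + 1) (\<phi> i (j + 1) x)"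
  using \<phi>_dv[of x i "j + 1"] by simp

lemma tot_map_chain_map: "chain_map K (tot D dh dv) (tot E eh ev) (tot_map \<phi>)"
  unfolding chain_map_def
proof (intro allI conjI ballI)
  fix n
  show "tot_map \<phi> n \<in> mod_hom K (obj (tot D dh dv) n) (obj (tot E eh ev) n)"
    by (auto simp: mod_hom_def tot_map_def obj_tot \<phi>D)
  fix z assume z: "z \<in> carrier (obj (tot D dh dv) n)"
  show "tot_map \<phi> (n - 1) (diff (tot D dh dv) n z) = diff (tot E eh ev) n (tot_map \<phi> n z)"
  proof
    fix i
    obtain j where n: "n = i + j + 1" by (metis add.commute diff_add_cancel)
    have z2: "z (i + 1) \<in> carrier (D (i + 1) j)" "z i \<in> carrier (D i (j + 1))"
      using z[unfolded carrier_tot, rule_format, of "i + 1"] z[unfolded carrier_tot, rule_format, of i]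
      by (simp_all add: n algebra_simps)
    have c: "dh (i + 1) j (z (i + 1)) \<in> carrier (D i j)" "dv i (j + 1) (z i) \<in> carrier (D i j)"
      using C.dhD'(1)[OF z2(1)] C.dvD'(1)[OF z2(2)] .
    have "tot_map \<phi> (n - 1) (diff (tot D dh dv) n z) i = \<phi> i j (diff (tot D dh dv) n z i)"
      by (simp add: tot_map_def n)
    also have "\<dots> = eh (i + 1) j (\<phi> (i + 1) j (z (i + 1))) \<oplus>\<^bsub>E i j\<^esub> parity_sign (E i j) i (ev i (j + 1) (\<phi> i (j + 1) (z i)))"
      unfolding n C.diff_tot_succ using c z2
      by (simp add: \<phi>D(2) \<phi>_dh' \<phi>_dv' mod_hom_parity_sign[OF C.left_module E.left_module \<phi>_hom])
    also have "\<dots> = diff (tot E eh ev) n (tot_map \<phi> n z) i"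
      unfolding n E.diff_tot_succ by (simp add: tot_map_def algebra_simps)
    finally show "tot_map \<phi> (n - 1) (diff (tot D dh dv) n z) i = diff (tot E eh ev) n (tot_map \<phi> n z) i" .
  qed
qed

lemma tot_map_fin_supp:
  assumes "z \<in> fin_supp D n"
  shows "tot_map \<phi> n z \<in> fin_supp E n"
proof -
  have "finite {i. \<phi> i (n - i) (z i) \<noteq> \<zero>\<^bsub>E i (n - i)\<^esub>}"
    by (rule finite_subset[of _ "{i. z i \<noteq> \<zero>\<^bsub>D i (n - i)\<^esub>}"]) (use assms in \<open>auto simp: fin_supp_def\<close>)
  then show ?thesis using assms by (simp add: fin_supp_def tot_map_def \<phi>D)
qed

end

subsection \<open>Homotopies\<close>

text \<open>Raises the index by one. No sign is inserted: the vertical differential changes its sign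
  from i - 1 to i, which makes the mixed terms cancel.\<close>

definition tot_horizontal :: "(int \<Rightarrow> int \<Rightarrow> 't \<Rightarrow> 'u) \<Rightarrow> int \<Rightarrow> (int \<Rightarrow> 't) \<Rightarrow> int \<Rightarrow> 'u" where
  "tot_horizontal s n z = (\<lambda>i. s (i - 1) (n + 1 - i) (z (i - 1)))"

text \<open>Keeps the index. The horizontal differential carries no sign of its own, so the factor
  (-1)^i has to be inserted for the mixed terms to cancel.\<close>

definition tot_vertical ::
    "(int \<Rightarrow> int \<Rightarrow> ('k, 'u) module) \<Rightarrow> (int \<Rightarrow> int \<Rightarrow> 't \<Rightarrow> 'u) \<Rightarrow> int \<Rightarrow> (int \<Rightarrow> 't) \<Rightarrow> int \<Rightarrow> 'u" where
  "tot_vertical E t n z = (\<lambda>i. parity_sign (E i (n + 1 - i)) i (t i (n - i) (z i)))"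

context double_complex_map
begin

lemma tot_horizontal_homotopy:
  assumes s: "\<And>i j. s i j \<in> mod_hom K (D i j) (E (i + 1) j)"
    and comm: "\<And>i j x. x \<in> carrier (D i j) \<Longrightarrow> s i (j - 1) (dv i j x) = ev (i + 1) j (s i j x)"
    and \<psi>: "\<And>i j x. x \<in> carrier (D i j) \<Longrightarrow>
      \<psi> i j x = \<phi> i j x \<oplus>\<^bsub>E i j\<^esub> (eh (i + 1) j (s i j x) \<oplus>\<^bsub>E i j\<^esub> s (i - 1) j (dh i j x))"
  shows "homotopy K (tot D dh dv) (tot E eh ev) (tot_map \<phi>) (tot_map \<psi>) (tot_horizontal s)"
    and "z \<in> fin_supp D n \<Longrightarrow> tot_horizontal s n z \<in> fin_supp E (n + 1)"
proof -
  note sD = mod_homD[OF s]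
  have s': "s (i - 1) j \<in> mod_hom K (D (i - 1) j) (E i j)" for i j using s[of "i - 1" j] by simp
  note sD' = mod_homD[OF s']
  have hom: "tot_horizontal s n \<in> mod_hom K (obj (tot D dh dv) n) (obj (tot E eh ev) (n + 1))" for n
  proof -
    have c: "z (i - 1) \<in> carrier (D (i - 1) (n + 1 - i))" if "\<forall>i. z i \<in> carrier (D i (n - i))" for z i
      using that[rule_format, of "i - 1"] by (simp add: algebra_simps)
    have eq: "n - (i - 1) = n + 1 - i" for i by simp
    show ?thesis unfolding mod_hom_def
      using c by (auto simp: tot_horizontal_def obj_tot sD' eq fun_eq_iff simp del: diff_diff_eq2)
  qed
  show "homotopy K (tot D dh dv) (tot E eh ev) (tot_map \<phi>) (tot_map \<psi>) (tot_horizontal s)"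
    unfolding homotopy_def
  proof (intro allI conjI ballI hom)
    fix n z assume z: "z \<in> carrier (obj (tot D dh dv) n)"
    show "tot_map \<psi> n z = tot_map \<phi> n z \<oplus>\<^bsub>obj (tot E eh ev) n\<^esub>
      (diff (tot E eh ev) (n + 1) (tot_horizontal s n z) \<oplus>\<^bsub>obj (tot E eh ev) n\<^esub>
       tot_horizontal s (n - 1) (diff (tot D dh dv) n z))"
    proof
      fix i
      obtain j where n: "n = i + j" by (metis add.commute diff_add_cancel)
      have z2: "z i \<in> carrier (D i j)" "z (i - 1) \<in> carrier (D (i - 1) (j + 1))"
        using z[unfolded carrier_tot, rule_format, of "i - 1"] z[unfolded carrier_tot, rule_format, of i]
        by (simp_all add: n algebra_simps)
      have "i + j = (i - 1) + j + 1" by simp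
      then have d: "diff (tot D dh dv) (i + j) z (i - 1) = dh i j (z i) \<oplus>\<^bsub>D (i - 1) j\<^esub>
          parity_sign (D (i - 1) j) (i - 1) (dv (i - 1) (j + 1) (z (i - 1)))"
        using C.diff_tot_succ[of "i - 1" j z] by simp
      have c: "dh i j (z i) \<in> carrier (D (i - 1) j)" "dv (i - 1) (j + 1) (z (i - 1)) \<in> carrier (D (i - 1) j)"
        using C.dhD(1)[OF z2(1)] C.dvD'(1)[OF z2(2)] .
      have sc: "s (i - 1) (j + 1) (z (i - 1)) \<in> carrier (E i (j + 1))" "s i j (z i) \<in> carrier (E (i + 1) j)"
        "s (i - 1) j (dh i j (z i)) \<in> carrier (E i j)"
        using sD'(1)[OF z2(2)] sD(1)[OF z2(1)] sD'(1)[OF c(1)] .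
      have ec: "ev i (j + 1) (s (i - 1) (j + 1) (z (i - 1))) \<in> carrier (E i j)" "eh (i + 1) j (s i j (z i)) \<in> carrier (E i j)"
        using E.dvD'(1)[OF sc(1)] E.dhD'(1)[OF sc(2)] .
      have cm: "s (i - 1) j (dv (i - 1) (j + 1) (z (i - 1))) = ev i (j + 1) (s (i - 1) (j + 1) (z (i - 1)))"
        using comm[OF z2(2)] by simp
      have 1: "diff (tot E eh ev) (n + 1) (tot_horizontal s n z) i =
          eh (i + 1) j (s i j (z i)) \<oplus>\<^bsub>E i j\<^esub> parity_sign (E i j) i (ev i (j + 1) (s (i - 1) (j + 1) (z (i - 1))))"
        unfolding n E.diff_tot_succ by (simp add: tot_horizontal_def algebra_simps)
      \<comment> \<open>The vertical term in \<open>d\<close> has the sign of i - 1, opposite to the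
        one in \<open>1\<close>, so the mixed terms of the two cancel.\<close>
      have 2: "tot_horizontal s (n - 1) (diff (tot D dh dv) n z) i =
          s (i - 1) j (dh i j (z i)) \<oplus>\<^bsub>E i j\<^esub> \<ominus>\<^bsub>E i j\<^esub> parity_sign (E i j) i (ev i (j + 1) (s (i - 1) (j + 1) (z (i - 1))))"
        using c ec
        by (simp add: tot_horizontal_def n d sD'(2) mod_hom_parity_sign[OF C.left_module E.left_module s'] cm
            E.D.parity_sign_pred)
      show "tot_map \<psi> n z i = (tot_map \<phi> n z \<oplus>\<^bsub>obj (tot E eh ev) n\<^esub>
        (diff (tot E eh ev) (n + 1) (tot_horizontal s n z) \<oplus>\<^bsub>obj (tot E eh ev) n\<^esub>
         tot_horizontal s (n - 1) (diff (tot D dh dv) n z))) i"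
        using \<psi>[OF z2(1)] ec sc \<phi>D(1)[OF z2(1)]
        by (simp add: obj_tot 1 2) (simp add: tot_map_def n E.D.M.ab_simps)
    qed
  qed
  assume z: "z \<in> fin_supp D n"
  have "tot_horizontal s n z \<in> carrier (obj (tot E eh ev) (n + 1))"
    using mod_homD(1)[OF hom, of z n] z by (simp add: fin_supp_def)
  moreover have "finite {i. tot_horizontal s n z i \<noteq> \<zero>\<^bsub>E i (n + 1 - i)\<^esub>}"
  proof (rule finite_subset)
    show "{i. tot_horizontal s n z i \<noteq> \<zero>\<^bsub>E i (n + 1 - i)\<^esub>} \<subseteq> (\<lambda>i. i + 1) ` {i. z i \<noteq> \<zero>\<^bsub>D i (n - i)\<^esub>}"
    proof (rule subsetI, rule ccontr)
      fix i assume *: "i \<in> {i. tot_horizontal s n z i \<noteq> \<zero>\<^bsub>E i (n + 1 - i)\<^esub>}"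
        "i \<notin> (\<lambda>i. i + 1) ` {i. z i \<noteq> \<zero>\<^bsub>D i (n - i)\<^esub>}"
      have "i = (i - 1) + 1" by simp
      then have "z (i - 1) = \<zero>\<^bsub>D (i - 1) (n - (i - 1))\<^esub>" using *(2) by (metis (mono_tags, lifting) image_eqI mem_Collect_eq)
      then have "z (i - 1) = \<zero>\<^bsub>D (i - 1) (n + 1 - i)\<^esub>" by (simp add: algebra_simps)
      then show False using *(1) mod_hom_zero[OF C.left_module E.left_module s']
        by (simp add: tot_horizontal_def)
    qed
  qed (use z in \<open>simp add: fin_supp_def\<close>)
  ultimately show "tot_horizontal s n z \<in> fin_supp E (n + 1)" by (simp add: fin_supp_def)
qed

lemma tot_vertical_homotopy:
  assumes t: "\<And>i j. t i j \<in> mod_hom K (D i j) (E i (j + 1))"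
    and comm: "\<And>i j x. x \<in> carrier (D i j) \<Longrightarrow> t (i - 1) j (dh i j x) = eh i (j + 1) (t i j x)"
    and \<psi>: "\<And>i j x. x \<in> carrier (D i j) \<Longrightarrow>
      \<psi> i j x = \<phi> i j x \<oplus>\<^bsub>E i j\<^esub> (ev i (j + 1) (t i j x) \<oplus>\<^bsub>E i j\<^esub> t i (j - 1) (dv i j x))"
  shows "homotopy K (tot D dh dv) (tot E eh ev) (tot_map \<phi>) (tot_map \<psi>) (tot_vertical E t)"
    and "z \<in> fin_supp D n \<Longrightarrow> tot_vertical E t n z \<in> fin_supp E (n + 1)"
proof -
  note tD = mod_homD[OF t]
  have t': "t i (j - 1) \<in> mod_hom K (D i (j - 1)) (E i j)" for i j using t[of i "j - 1"] by simp
  note tD' = mod_homD[OF t']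
  have t'': "t i (n - i) \<in> mod_hom K (D i (n - i)) (E i (n + 1 - i))" for i n
    using t[of i "n - i"] by (simp add: algebra_simps)
  note tD'' = mod_homD[OF t'']
  have hom: "tot_vertical E t n \<in> mod_hom K (obj (tot D dh dv) n) (obj (tot E eh ev) (n + 1))" for n
    unfolding mod_hom_def
    by (auto simp: tot_vertical_def obj_tot tD'' E.D.parity_sign_add E.D.parity_sign_smult fun_eq_iff)
  show "homotopy K (tot D dh dv) (tot E eh ev) (tot_map \<phi>) (tot_map \<psi>) (tot_vertical E t)"
    unfolding homotopy_def
  proof (intro allI conjI ballI hom)
    fix n z assume z: "z \<in> carrier (obj (tot D dh dv) n)"
    show "tot_map \<psi> n z = tot_map \<phi> n z \<oplus>\<^bsub>obj (tot E eh ev) n\<^esub>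
      (diff (tot E eh ev) (n + 1) (tot_vertical E t n z) \<oplus>\<^bsub>obj (tot E eh ev) n\<^esub>
       tot_vertical E t (n - 1) (diff (tot D dh dv) n z))"
    proof
      fix i
      obtain j where n: "n = i + j" by (metis add.commute diff_add_cancel)
      have z2: "z i \<in> carrier (D i j)" "z (i + 1) \<in> carrier (D (i + 1) (j - 1))"
        using z[unfolded carrier_tot, rule_format, of "i + 1"] z[unfolded carrier_tot, rule_format, of i]
        by (simp_all add: n algebra_simps)
      have "i + j = i + (j - 1) + 1" by simp
      then have d: "diff (tot D dh dv) (i + j) z i = dh (i + 1) (j - 1) (z (i + 1)) \<oplus>\<^bsub>D i (j - 1)\<^esub>
          parity_sign (D i (j - 1)) i (dv i j (z i))"
        using C.diff_tot_succ[of i "j - 1" z] by simp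
      have c: "dh (i + 1) (j - 1) (z (i + 1)) \<in> carrier (D i (j - 1))" "dv i j (z i) \<in> carrier (D i (j - 1))"
        using C.dhD'(1)[OF z2(2)] C.dvD(1)[OF z2(1)] .
      have tc: "t i j (z i) \<in> carrier (E i (j + 1))" "t (i + 1) (j - 1) (z (i + 1)) \<in> carrier (E (i + 1) j)"
        "t i (j - 1) (dv i j (z i)) \<in> carrier (E i j)"
        using tD(1)[OF z2(1)] tD'(1)[OF z2(2)] tD'(1)[OF c(2)] .
      have ec: "ev i (j + 1) (t i j (z i)) \<in> carrier (E i j)" "eh (i + 1) j (t (i + 1) (j - 1) (z (i + 1))) \<in> carrier (E i j)"
        using E.dvD'(1)[OF tc(1)] E.dhD'(1)[OF tc(2)] .
      have cm: "t i (j - 1) (dh (i + 1) (j - 1) (z (i + 1))) = eh (i + 1) j (t (i + 1) (j - 1) (z (i + 1)))"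
        using comm[OF z2(2)] by simp
      have 1: "diff (tot E eh ev) (n + 1) (tot_vertical E t n z) i =
          \<ominus>\<^bsub>E i j\<^esub> parity_sign (E i j) i (eh (i + 1) j (t (i + 1) (j - 1) (z (i + 1)))) \<oplus>\<^bsub>E i j\<^esub> ev i (j + 1) (t i j (z i))"
      proof -
        have "tot_vertical E t (i + j) z (i + 1) = parity_sign (E (i + 1) j) (i + 1) (t (i + 1) (j - 1) (z (i + 1)))"
          "tot_vertical E t (i + j) z i = parity_sign (E i (j + 1)) i (t i j (z i))"
          by (simp_all add: tot_vertical_def algebra_simps)
        then show ?thesis unfolding n E.diff_tot_succ using tc ec
          by (simp add: mod_hom_parity_sign[OF E.left_module E.left_module E.dh_hom']
              mod_hom_parity_sign[OF E.left_module E.left_module E.dv_hom'] E.D.parity_sign_succ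
              mod_hom_a_inv[OF E.left_module E.left_module E.dh_hom'])
      qed
      have 2: "tot_vertical E t (n - 1) (diff (tot D dh dv) n z) i =
          parity_sign (E i j) i (eh (i + 1) j (t (i + 1) (j - 1) (z (i + 1)))) \<oplus>\<^bsub>E i j\<^esub> t i (j - 1) (dv i j (z i))"
      proof -
        have "tot_vertical E t (n - 1) (diff (tot D dh dv) n z) i =
            parity_sign (E i j) i (t i (j - 1) (diff (tot D dh dv) n z i))"
          by (simp add: tot_vertical_def n algebra_simps)
        then show ?thesis using c ec tc
          by (simp add: n d tD'(2) cm mod_hom_parity_sign[OF C.left_module E.left_module t'] E.D.parity_sign_add)
      qed
      show "tot_map \<psi> n z i = (tot_map \<phi> n z \<oplus>\<^bsub>obj (tot E eh ev) n\<^esub>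
        (diff (tot E eh ev) (n + 1) (tot_vertical E t n z) \<oplus>\<^bsub>obj (tot E eh ev) n\<^esub>
         tot_vertical E t (n - 1) (diff (tot D dh dv) n z))) i"
        using \<psi>[OF z2(1)] ec tc \<phi>D(1)[OF z2(1)]
        by (simp add: obj_tot 1 2) (simp add: tot_map_def n E.D.M.ab_simps)
    qed
  qed
  assume z: "z \<in> fin_supp D n"
  have "tot_vertical E t n z \<in> carrier (obj (tot E eh ev) (n + 1))"
    using mod_homD(1)[OF hom, of z n] z by (simp add: fin_supp_def)
  moreover have "finite {i. tot_vertical E t n z i \<noteq> \<zero>\<^bsub>E i (n + 1 - i)\<^esub>}"
    by (rule finite_subset[of _ "{i. z i \<noteq> \<zero>\<^bsub>D i (n - i)\<^esub>}"])
      (use z mod_hom_zero[OF C.left_module E.left_module t''] in \<open>auto simp: fin_supp_def tot_vertical_def\<close>)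
  ultimately show "tot_vertical E t n z \<in> fin_supp E (n + 1)" by (simp add: fin_supp_def)
qed

end

subsection \<open>Acyclicity from acyclic rows\<close>

text \<open>Dependent choice along the integers: the sequence is prescribed up to m and chosen step
  by step above. P is the condition that keeps the next step possible, Q the relation between
  neighbours.\<close>

lemma dependent_int_choice:
  fixes d :: "int \<Rightarrow> 'x"
  assumes P: "\<And>i. i \<le> m \<Longrightarrow> P i (d i)" and Q: "\<And>i. i < m \<Longrightarrow> Q i (d i) (d (i + 1))"
    and step: "\<And>i x. i \<ge> m \<Longrightarrow> P i x \<Longrightarrow> \<exists>y. P (i + 1) y \<and> Q i x y"
  shows "\<exists>f. (\<forall>i\<le>m. f i = d i) \<and> (\<forall>i. P i (f i)) \<and> (\<forall>i. Q i (f i) (f (i + 1)))"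
proof -
  \<comment> \<open>The clause for n = 0 fixes the starting value, so that the chosen part continues
    the prescribed one.\<close>
  have "\<exists>g. \<forall>n. (P (m + int n) (g n) \<and> (n = 0 \<longrightarrow> g n = d m)) \<and> Q (m + int n) (g n) (g (Suc n))"
  proof (rule dependent_nat_choice)
    show "\<exists>x. P (m + int 0) x \<and> ((0::nat) = 0 \<longrightarrow> x = d m)" using P[of m] by auto
    fix x and n :: nat assume "P (m + int n) x \<and> (n = 0 \<longrightarrow> x = d m)"
    then obtain y where "P (m + int n + 1) y" "Q (m + int n) x y" using step[of "m + int n" x] by auto
    then show "\<exists>y. (P (m + int (Suc n)) y \<and> (Suc n = 0 \<longrightarrow> y = d m)) \<and> Q (m + int n) x y"
      by (auto simp: algebra_simps)
  qed
  then obtain g where g: "\<And>n. P (m + int n) (g n)" "g 0 = d m" "\<And>n. Q (m + int n) (g n) (g (Suc n))" by blast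
  define f where "f i = (if i \<le> m then d i else g (nat (i - m)))" for i
  have fg: "f i = g (nat (i - m))" if "i \<ge> m" for i using that g(2) by (auto simp: f_def)
  have "P i (f i)" for i
    using P[of i] g(1)[of "nat (i - m)"] fg[of i] by (cases "i \<le> m") (auto simp: f_def)
  moreover have "Q i (f i) (f (i + 1))" for i
  proof (cases "i < m")
    case True then show ?thesis using Q[of i] by (simp add: f_def)
  next
    case False
    then have "nat (i + 1 - m) = Suc (nat (i - m))" by simp
    then show ?thesis using g(3)[of "nat (i - m)"] fg[of i] fg[of "i + 1"] False by simp
  qed
  ultimately show ?thesis by (intro exI[of _ f]) (simp add: f_def)
qed

context double_complex_map
begin

text \<open>The totalized equations are solved by recursion on the row index \<open>i\<close>. For finitely supported
  data the solution stops: in the last nontrivial step the vertical differentials of the data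
  vanish, so those of the solution can be made to vanish as well.\<close>

lemma tot_cone_acyclic:
  assumes zero: "\<And>i j. i < 0 \<Longrightarrow> carrier (D i j) = {\<zero>\<^bsub>D i j\<^esub>}" "\<And>i j. i < 0 \<Longrightarrow> carrier (E i j) = {\<zero>\<^bsub>E i j\<^esub>}"
    and row: "\<And>i j a b. a \<in> carrier (D i j) \<Longrightarrow> b \<in> carrier (E (i + 1) j) \<Longrightarrow> dh i j a = \<zero>\<^bsub>D (i - 1) j\<^esub> \<Longrightarrow>
      \<phi> i j a = eh (i + 1) j b \<Longrightarrow>
      \<exists>a'\<in>carrier (D (i + 1) j). \<exists>b'\<in>carrier (E (i + 2) j). dh (i + 1) j a' = a \<and>
        \<phi> (i + 1) j a' = b \<oplus>\<^bsub>E (i + 1) j\<^esub> eh (i + 2) j b' \<and>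
        (dv i j a = \<zero>\<^bsub>D i (j - 1)\<^esub> \<and> ev (i + 1) j b = \<zero>\<^bsub>E (i + 1) (j - 1)\<^esub> \<longrightarrow>
         dv (i + 1) j a' = \<zero>\<^bsub>D (i + 1) (j - 1)\<^esub> \<and> ev (i + 2) j b' = \<zero>\<^bsub>E (i + 2) (j - 1)\<^esub>)"
    and a: "a \<in> carrier (obj (tot D dh dv) n)" and b: "b \<in> carrier (obj (tot E eh ev) (n + 1))"
    and da: "diff (tot D dh dv) n a = \<zero>\<^bsub>obj (tot D dh dv) (n - 1)\<^esub>"
    and fa: "tot_map \<phi> n a = diff (tot E eh ev) (n + 1) b"
  shows "\<exists>a'\<in>carrier (obj (tot D dh dv) (n + 1)). \<exists>b'\<in>carrier (obj (tot E eh ev) (n + 2)).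
    diff (tot D dh dv) (n + 1) a' = a \<and>
    tot_map \<phi> (n + 1) a' = b \<oplus>\<^bsub>obj (tot E eh ev) (n + 1)\<^esub> diff (tot E eh ev) (n + 2) b' \<and>
    (a \<in> fin_supp D n \<and> b \<in> fin_supp E (n + 1) \<longrightarrow> a' \<in> fin_supp D (n + 1) \<and> b' \<in> fin_supp E (n + 2))"
proof -
  \<comment> \<open>The equations are read row by row, with vertical terms moved to the side of the
    data. Index i of d a' = a becomes: dh of \<open>a' (i + 1)\<close> equals
    \<open>A i (a' i)\<close>. Index i + 1 of \<phi> a' = b + d b' becomes: \<phi> of
    \<open>a' (i + 1)\<close> equals \<open>B i (b' (i + 1))\<close> plus eh of
    \<open>b' (i + 2)\<close>.\<close>
  define A where "A i x = a i \<ominus>\<^bsub>D i (n - i)\<^esub> parity_sign (D i (n - i)) i (dv i (n - i + 1) x)" for i x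
  define B where "B i y = b (i + 1) \<ominus>\<^bsub>E (i + 1) (n - i)\<^esub>
      parity_sign (E (i + 1) (n - i)) i (ev (i + 1) (n - i + 1) y)" for i y
  have aD: "a i \<in> carrier (D i (n - i))" and bE: "b (i + 1) \<in> carrier (E (i + 1) (n - i))" for i
    using a b[unfolded carrier_tot, rule_format, of "i + 1"] by (simp_all add: algebra_simps)
  have AD: "A i x \<in> carrier (D i (n - i))" if "x \<in> carrier (D i (n - i + 1))" for i x
    using aD C.dvD'(1)[OF that] by (simp add: A_def)
  have BE: "B i y \<in> carrier (E (i + 1) (n - i))" if "y \<in> carrier (E (i + 1) (n - i + 1))" for i y
    using bE E.dvD'(1)[OF that] by (simp add: B_def)
  \<comment> \<open>The pair p stands for \<open>a' i\<close> and \<open>b' (i + 1)\<close>, which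
    are found in the same step. P says that the data they leave for row i satisfy the assumptions of
    \<open>row\<close>.\<close>
  define P where "P i p \<longleftrightarrow> fst p \<in> carrier (D i (n - i + 1)) \<and> snd p \<in> carrier (E (i + 1) (n - i + 1)) \<and>
    dh i (n - i) (A i (fst p)) = \<zero>\<^bsub>D (i - 1) (n - i)\<^esub> \<and> \<phi> i (n - i) (A i (fst p)) = eh (i + 1) (n - i) (B i (snd p))"
    for i p
  \<comment> \<open>The third clause gives zero data the zero solution, the last one hands on
    vanishing vertical differentials; both serve the finitely supported case.\<close>
  define Q where "Q i p q \<longleftrightarrow> dh (i + 1) (n - i) (fst q) = A i (fst p) \<and>
    \<phi> (i + 1) (n - i) (fst q) = B i (snd p) \<oplus>\<^bsub>E (i + 1) (n - i)\<^esub> eh (i + 2) (n - i) (snd q) \<and>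
    (A i (fst p) = \<zero>\<^bsub>D i (n - i)\<^esub> \<and> B i (snd p) = \<zero>\<^bsub>E (i + 1) (n - i)\<^esub> \<longrightarrow>
      fst q = \<zero>\<^bsub>D (i + 1) (n - i)\<^esub> \<and> snd q = \<zero>\<^bsub>E (i + 2) (n - i)\<^esub>) \<and>
    (dv i (n - i) (A i (fst p)) = \<zero>\<^bsub>D i (n - i - 1)\<^esub> \<and> ev (i + 1) (n - i) (B i (snd p)) = \<zero>\<^bsub>E (i + 1) (n - i - 1)\<^esub> \<longrightarrow>
      dv (i + 1) (n - i) (fst q) = \<zero>\<^bsub>D (i + 1) (n - i - 1)\<^esub> \<and> ev (i + 2) (n - i) (snd q) = \<zero>\<^bsub>E (i + 2) (n - i - 1)\<^esub>)"
    for i p q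
  define z where "z i = (\<zero>\<^bsub>D i (n - i + 1)\<^esub>, \<zero>\<^bsub>E (i + 1) (n - i + 1)\<^esub>)" for i
  have D0: "x = \<zero>\<^bsub>D i j\<^esub>" if "x \<in> carrier (D i j)" "i < 0" for x i j using zero(1)[OF that(2), of j] that(1) by auto
  have E0: "x = \<zero>\<^bsub>E i j\<^esub>" if "x \<in> carrier (E i j)" "i < 0" for x i j using zero(2)[OF that(2), of j] that(1) by auto
  \<comment> \<open>At i = -1 the second entry lies in E of index 0, which need not vanish. The
    equations in P take place in modules of negative index, however, and so hold trivially.\<close>
  have Pz: "P i (z i)" if "i \<le> -1" for i
  proof -
    have "A i (fst (z i)) = \<zero>\<^bsub>D i (n - i)\<^esub>" using AD[of "fst (z i)" i] D0 that by (simp add: z_def)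
    moreover have "eh (i + 1) (n - i) (B i (snd (z i))) = \<zero>\<^bsub>E i (n - i)\<^esub>"
      using E0[OF E.dhD'(1)[OF BE]] that by (simp add: z_def)
    ultimately show ?thesis by (simp add: P_def) (simp add: z_def)
  qed
  have Qz: "Q i (z i) (z (i + 1))" if "i < -1" for i
  proof -
    have "A i (fst (z i)) = \<zero>\<^bsub>D i (n - i)\<^esub>" using AD[of "fst (z i)" i] D0 that by (simp add: z_def)
    moreover have "B i (snd (z i)) = \<zero>\<^bsub>E (i + 1) (n - i)\<^esub>" using BE[of "snd (z i)" i] E0 that by (simp add: z_def)
    moreover have "z (i + 1) = (\<zero>\<^bsub>D (i + 1) (n - i)\<^esub>, \<zero>\<^bsub>E (i + 2) (n - i)\<^esub>)" by (simp add: z_def algebra_simps)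
    moreover have "eh (i + 2) (n - i) \<zero>\<^bsub>E (i + 2) (n - i)\<^esub> = \<zero>\<^bsub>E (i + 1) (n - i)\<^esub>"
      using E.dh_zero'[of "i + 1"] by (simp add: add.assoc)
    ultimately show ?thesis by (simp add: Q_def)
  qed
  have e2: "eh (i + 2) j y \<in> carrier (E (i + 1) j)" if "y \<in> carrier (E (i + 2) j)" for i j y
    using E.dhD'(1)[of y "i + 1" j] that by (simp add: add.assoc)
  \<comment> \<open>The correction in A is a vertical boundary and does not affect the vertical
    differential.\<close>
  have dvA: "dv i (n - i) (A i x) = dv i (n - i) (a i)" if "x \<in> carrier (D i (n - i + 1))" for i x
    using aD[of i] C.dvD'(1)[OF that] C.dv_dv[OF that] C.dvD(1)[OF aD[of i]]
    by (simp add: A_def C.D.M.minus_eq C.dvD(2) mod_hom_a_inv[OF C.left_module C.left_module C.dv_hom]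
        mod_hom_parity_sign[OF C.left_module C.left_module C.dv_hom] C.D.M.a_inv_zero)
  have evB: "ev (i + 1) (n - i) (B i y) = ev (i + 1) (n - i) (b (i + 1))"
    if "y \<in> carrier (E (i + 1) (n - i + 1))" for i y
    using bE[of i] E.dvD'(1)[OF that] E.dv_dv[OF that] E.dvD(1)[OF bE[of i]]
    by (simp add: B_def E.D.M.minus_eq E.dvD(2) mod_hom_a_inv[OF E.left_module E.left_module E.dv_hom]
        mod_hom_parity_sign[OF E.left_module E.left_module E.dv_hom] E.D.M.a_inv_zero)
  have daI: "dh (i + 1) (n - i - 1) (a (i + 1)) \<oplus>\<^bsub>D i (n - i - 1)\<^esub>
      parity_sign (D i (n - i - 1)) i (dv i (n - i) (a i)) = \<zero>\<^bsub>D i (n - i - 1)\<^esub>" for i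
  proof -
    have eq: "n - 1 - i = n - i - 1" by simp
    have "diff (tot D dh dv) n a i = \<zero>\<^bsub>D i (n - i - 1)\<^esub>" using fun_cong[OF da, of i] unfolding obj_tot prod_module_simps eq .
    then show ?thesis unfolding diff_tot eq .
  qed
  have step: "\<exists>q. P (i + 1) q \<and> Q i p q" if p: "P i p" for i p
  proof -
    obtain j where n: "n = i + j" by (metis add.commute diff_add_cancel)
    obtain x y where xy: "p = (x, y)" by (cases p)
    let ?A = "A i x" and ?B = "B i y"
    have x: "x \<in> carrier (D i (j + 1))" and y: "y \<in> carrier (E (i + 1) (j + 1))"
      and dA: "dh i j ?A = \<zero>\<^bsub>D (i - 1) j\<^esub>" and fA: "\<phi> i j ?A = eh (i + 1) j ?B"
      using p by (simp_all add: P_def xy n)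
    have Ac: "?A \<in> carrier (D i j)" and Bc: "?B \<in> carrier (E (i + 1) j)"
      using AD[of x i] BE[of y i] x y by (simp_all add: n)
    have "\<exists>x'\<in>carrier (D (i + 1) j). \<exists>y'\<in>carrier (E (i + 2) j). dh (i + 1) j x' = ?A \<and>
        \<phi> (i + 1) j x' = ?B \<oplus>\<^bsub>E (i + 1) j\<^esub> eh (i + 2) j y' \<and>
        (?A = \<zero>\<^bsub>D i j\<^esub> \<and> ?B = \<zero>\<^bsub>E (i + 1) j\<^esub> \<longrightarrow> x' = \<zero>\<^bsub>D (i + 1) j\<^esub> \<and> y' = \<zero>\<^bsub>E (i + 2) j\<^esub>) \<and>
        (dv i j ?A = \<zero>\<^bsub>D i (j - 1)\<^esub> \<and> ev (i + 1) j ?B = \<zero>\<^bsub>E (i + 1) (j - 1)\<^esub> \<longrightarrow>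
         dv (i + 1) j x' = \<zero>\<^bsub>D (i + 1) (j - 1)\<^esub> \<and> ev (i + 2) j y' = \<zero>\<^bsub>E (i + 2) (j - 1)\<^esub>)"
    \<comment> \<open>For zero data the zero solution is chosen by hand; \<open>row\<close> promises
      no more than some solution.\<close>
    proof (cases "?A = \<zero>\<^bsub>D i j\<^esub> \<and> ?B = \<zero>\<^bsub>E (i + 1) j\<^esub>")
      case True
      have "eh (i + 2) j \<zero>\<^bsub>E (i + 2) j\<^esub> = \<zero>\<^bsub>E (i + 1) j\<^esub>" using E.dh_zero'[of "i + 1"] by (simp add: add.assoc)
      then show ?thesis using True
        by (intro bexI[of _ "\<zero>\<^bsub>D (i + 1) j\<^esub>"] bexI[of _ "\<zero>\<^bsub>E (i + 2) j\<^esub>"]) auto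
    next
      case False
      then show ?thesis using row[OF Ac Bc dA fA] by blast
    qed
    then obtain x' y' where x': "x' \<in> carrier (D (i + 1) j)" and y': "y' \<in> carrier (E (i + 2) j)"
      and q: "dh (i + 1) j x' = ?A" "\<phi> (i + 1) j x' = ?B \<oplus>\<^bsub>E (i + 1) j\<^esub> eh (i + 2) j y'"
        "?A = \<zero>\<^bsub>D i j\<^esub> \<and> ?B = \<zero>\<^bsub>E (i + 1) j\<^esub> \<longrightarrow> x' = \<zero>\<^bsub>D (i + 1) j\<^esub> \<and> y' = \<zero>\<^bsub>E (i + 2) j\<^esub>"
        "dv i j ?A = \<zero>\<^bsub>D i (j - 1)\<^esub> \<and> ev (i + 1) j ?B = \<zero>\<^bsub>E (i + 1) (j - 1)\<^esub> \<longrightarrow>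
         dv (i + 1) j x' = \<zero>\<^bsub>D (i + 1) (j - 1)\<^esub> \<and> ev (i + 2) j y' = \<zero>\<^bsub>E (i + 2) (j - 1)\<^esub>"
      by blast
    have Q': "Q i p (x', y')" unfolding Q_def xy using q by (simp add: n)
    have y'E: "ev (i + 2) j y' \<in> carrier (E (i + 2) (j - 1))" by (rule E.dvD(1)[OF y'])
    have a1: "a (i + 1) \<in> carrier (D (i + 1) (j - 1))" "b (i + 1) \<in> carrier (E (i + 1) j)" "a i \<in> carrier (D i j)"
        "b (i + 2) \<in> carrier (E (i + 2) (j - 1))"
      using aD[of "i + 1"] bE[of i] aD[of i] bE[of "i + 1"] by (simp_all add: n add.assoc)
    have x'D: "dv (i + 1) j x' \<in> carrier (D (i + 1) (j - 1))" by (rule C.dvD(1)[OF x'])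
    have A': "A (i + 1) x' = a (i + 1) \<oplus>\<^bsub>D (i + 1) (j - 1)\<^esub> parity_sign (D (i + 1) (j - 1)) i (dv (i + 1) j x')"
      using a1 x'D by (simp add: A_def n C.D.parity_sign_succ C.D.M.minus_eq)
    have B': "B (i + 1) y' = b (i + 2) \<oplus>\<^bsub>E (i + 2) (j - 1)\<^esub> parity_sign (E (i + 2) (j - 1)) i (ev (i + 2) j y')"
      using a1 y'E by (simp add: B_def n E.D.parity_sign_succ E.D.M.minus_eq add.assoc)
    have dvA: "dv i j ?A = dv i j (a i)" and evB: "ev (i + 1) j ?B = ev (i + 1) j (b (i + 1))"
      using dvA[of x i] evB[of y i] x y by (simp_all add: n)
    note daI = daI[of i, unfolded n, simplified]
    have faI: "\<phi> (i + 1) (j - 1) (a (i + 1)) = eh (i + 2) (j - 1) (b (i + 2)) \<ominus>\<^bsub>E (i + 1) (j - 1)\<^esub>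
        parity_sign (E (i + 1) (j - 1)) i (ev (i + 1) j (b (i + 1)))"
    proof -
      have "\<phi> (i + 1) (j - 1) (a (i + 1)) = diff (tot E eh ev) (n + 1) b (i + 1)"
        using fun_cong[OF fa, of "i + 1"] by (simp add: tot_map_def n)
      then show ?thesis using E.dvD(1)[OF a1(2)]
        by (simp add: diff_tot n E.D.parity_sign_succ E.D.M.minus_eq add.assoc)
    qed
    \<comment> \<open>As dh x' is \<open>A i x\<close>, the correction contributes the signed
      vertical differential of \<open>a i\<close>; it cancels against dh of \<open>a (i + 1)\<close>
      by index i of d a = 0.\<close>
    have "dh (i + 1) (j - 1) (A (i + 1) x') = \<zero>\<^bsub>D i (j - 1)\<^esub>"
      unfolding A' using a1 x'D C.dh_dv[OF x'] q(1) dvA daI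
      by (simp add: C.dhD'(2) mod_hom_parity_sign[OF C.left_module C.left_module C.dh_hom'])
    \<comment> \<open>Index i + 1 of \<phi> a = d b enters through \<open>faI\<close>; the two
      contributions of the vertical differential of \<open>b (i + 1)\<close> cancel.\<close>
    moreover have "\<phi> (i + 1) (j - 1) (A (i + 1) x') = eh (i + 2) (j - 1) (B (i + 1) y')"
    proof -
      have h2: "eh (i + 2) (j - 1) \<in> mod_hom K (E (i + 2) (j - 1)) (E (i + 1) (j - 1))"
        using E.dh_hom'[of "i + 1" "j - 1"] by (simp add: add.assoc)
      have yy: "ev (i + 1) j (eh (i + 2) j y') = eh (i + 2) (j - 1) (ev (i + 2) j y')"
        using E.dh_dv[OF y'] by (simp add: algebra_simps)
      have c: "eh (i + 2) (j - 1) (b (i + 2)) \<in> carrier (E (i + 1) (j - 1))"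
        "ev (i + 1) j (b (i + 1)) \<in> carrier (E (i + 1) (j - 1))"
        "eh (i + 2) (j - 1) (ev (i + 2) j y') \<in> carrier (E (i + 1) (j - 1))"
        using mod_homD(1)[OF h2 a1(4)] E.dvD(1)[OF a1(2)] mod_homD(1)[OF h2 y'E] .
      have "\<phi> (i + 1) (j - 1) (A (i + 1) x') = \<phi> (i + 1) (j - 1) (a (i + 1)) \<oplus>\<^bsub>E (i + 1) (j - 1)\<^esub>
          parity_sign (E (i + 1) (j - 1)) i (ev (i + 1) j (\<phi> (i + 1) j x'))"
        unfolding A' using a1 x'D \<phi>_dv[OF x']
        by (simp add: \<phi>D(2) mod_hom_parity_sign[OF C.left_module E.left_module \<phi>_hom])
      also have "ev (i + 1) j (\<phi> (i + 1) j x') = ev (i + 1) j (b (i + 1)) \<oplus>\<^bsub>E (i + 1) (j - 1)\<^esub> eh (i + 2) (j - 1) (ev (i + 2) j y')"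
        unfolding q(2) using Bc e2[OF y'] by (simp add: E.dvD(2) evB yy)
      also have "\<phi> (i + 1) (j - 1) (a (i + 1)) \<oplus>\<^bsub>E (i + 1) (j - 1)\<^esub> parity_sign (E (i + 1) (j - 1)) i
          (ev (i + 1) j (b (i + 1)) \<oplus>\<^bsub>E (i + 1) (j - 1)\<^esub> eh (i + 2) (j - 1) (ev (i + 2) j y')) =
          eh (i + 2) (j - 1) (b (i + 2)) \<oplus>\<^bsub>E (i + 1) (j - 1)\<^esub>
          parity_sign (E (i + 1) (j - 1)) i (eh (i + 2) (j - 1) (ev (i + 2) j y'))"
        unfolding faI using c by (simp add: E.D.parity_sign_add E.D.M.ab_simps)
      also have "\<dots> = eh (i + 2) (j - 1) (B (i + 1) y')"
        unfolding B' using a1(4) y'E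
        by (simp add: mod_homD(2)[OF h2] mod_hom_parity_sign[OF E.left_module E.left_module h2])
      finally show ?thesis .
    qed
    ultimately have "P (i + 1) (x', y')"
      unfolding P_def using x' y' by (simp add: n add.assoc)
    then show ?thesis using Q' by blast
  qed
  obtain f where f: "\<And>i. i \<le> -1 \<Longrightarrow> f i = z i" "\<And>i. P i (f i)" "\<And>i. Q i (f i) (f (i + 1))"
    using dependent_int_choice[of "-1" P z Q] Pz Qz step by blast
  define a' where "a' i = fst (f i)" for i
  \<comment> \<open>The second entries were found together with first entries of index one lower,
    hence the shift.\<close>
  define b' where "b' i = snd (f (i - 1))" for i
  have fc: "fst (f i) \<in> carrier (D i (n - i + 1))" "snd (f i) \<in> carrier (E (i + 1) (n - i + 1))" for i
    using f(2)[of i] by (auto simp: P_def)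
  have a'c: "a' i \<in> carrier (D i (n + 1 - i))" and b'c: "b' i \<in> carrier (E i (n + 2 - i))" for i
    using fc(1)[of i] fc(2)[of "i - 1"] by (simp_all add: a'_def b'_def algebra_simps)
  have 1: "diff (tot D dh dv) (n + 1) a' = a"
  proof
    fix i
    have "diff (tot D dh dv) (n + 1) a' i = A i (fst (f i)) \<oplus>\<^bsub>D i (n - i)\<^esub>
        parity_sign (D i (n - i)) i (dv i (n - i + 1) (fst (f i)))"
      using f(3)[of i] by (simp add: diff_tot a'_def Q_def algebra_simps)
    also have "\<dots> = a i" using aD[of i] C.dvD'(1)[OF fc(1)[of i]] by (simp add: A_def C.D.M.minus_add_cancel)
    finally show "diff (tot D dh dv) (n + 1) a' i = a i" .
  qed
  have 2: "tot_map \<phi> (n + 1) a' = b \<oplus>\<^bsub>obj (tot E eh ev) (n + 1)\<^esub> diff (tot E eh ev) (n + 2) b'"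
  proof
    fix i' :: int
    define i where "i = i' - 1"
    have i': "i' = i + 1" by (simp add: i_def)
    obtain j where n: "n = i + j" by (metis add.commute diff_add_cancel)
    have c: "fst (f (i + 1)) \<in> carrier (D (i + 1) j)" "snd (f i) \<in> carrier (E (i + 1) (j + 1))"
      "snd (f (i + 1)) \<in> carrier (E (i + 2) j)" "b (i + 1) \<in> carrier (E (i + 1) j)"
      using fc(1)[of "i + 1"] fc(2)[of i] fc(2)[of "i + 1"] bE[of i] by (simp_all add: n add.assoc)
    have ec: "eh (i + 2) j (snd (f (i + 1))) \<in> carrier (E (i + 1) j)" "ev (i + 1) (j + 1) (snd (f i)) \<in> carrier (E (i + 1) j)"
      using e2[OF c(3)] E.dvD'(1)[OF c(2)] .
    have "diff (tot E eh ev) (n + 2) b' (i + 1) = eh (i + 2) j (snd (f (i + 1))) \<oplus>\<^bsub>E (i + 1) j\<^esub>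
        \<ominus>\<^bsub>E (i + 1) j\<^esub> parity_sign (E (i + 1) j) i (ev (i + 1) (j + 1) (snd (f i)))"
    proof -
      have "n + 2 = (i + 1) + j + 1" by (simp add: n)
      then have "diff (tot E eh ev) (n + 2) b' (i + 1) = eh (i + 1 + 1) j (b' (i + 1 + 1)) \<oplus>\<^bsub>E (i + 1) j\<^esub>
          parity_sign (E (i + 1) j) (i + 1) (ev (i + 1) (j + 1) (b' (i + 1)))" by (simp only: E.diff_tot_succ)
      then show ?thesis using ec by (simp add: b'_def E.D.parity_sign_succ add.assoc add.commute[of 1 i])
    qed
    moreover have "\<phi> (i + 1) j (fst (f (i + 1))) = B i (snd (f i)) \<oplus>\<^bsub>E (i + 1) j\<^esub> eh (i + 2) j (snd (f (i + 1)))"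
      using f(3)[of i] by (simp add: Q_def n)
    moreover have "B i (snd (f i)) = b (i + 1) \<ominus>\<^bsub>E (i + 1) j\<^esub> parity_sign (E (i + 1) j) i (ev (i + 1) (j + 1) (snd (f i)))"
      by (simp add: B_def n)
    moreover have "tot_map \<phi> (n + 1) a' (i + 1) = \<phi> (i + 1) j (fst (f (i + 1)))"
      by (simp add: tot_map_def a'_def n)
    ultimately show "tot_map \<phi> (n + 1) a' i' = (b \<oplus>\<^bsub>obj (tot E eh ev) (n + 1)\<^esub> diff (tot E eh ev) (n + 2) b') i'"
      unfolding i' using ec c by (simp add: obj_tot n E.D.M.ab_simps)
  qed
  have 3: "a' \<in> fin_supp D (n + 1) \<and> b' \<in> fin_supp E (n + 2)" if fin: "a \<in> fin_supp D n" "b \<in> fin_supp E (n + 1)"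
  proof -
    have "finite ({i. a i \<noteq> \<zero>\<^bsub>D i (n - i)\<^esub>} \<union> {i. b i \<noteq> \<zero>\<^bsub>E i (n + 1 - i)\<^esub>})"
      using fin by (simp add: fin_supp_def)
    then obtain m where "\<forall>i\<in>{i. a i \<noteq> \<zero>\<^bsub>D i (n - i)\<^esub>} \<union> {i. b i \<noteq> \<zero>\<^bsub>E i (n + 1 - i)\<^esub>}. i \<le> m"
      by (meson bdd_above.E bdd_above_finite)
    then have m: "a i = \<zero>\<^bsub>D i (n - i)\<^esub>" "b i = \<zero>\<^bsub>E i (n + 1 - i)\<^esub>" if "i > m" for i using that by force+
    have m': "b (i + 1) = \<zero>\<^bsub>E (i + 1) (n - i)\<^esub>" if "i \<ge> m" for i using m(2)[of "i + 1"] that by (simp add: algebra_simps)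
    \<comment> \<open>Index m of d a = 0, where \<open>a (m + 1)\<close> is zero: the last component
      of a is a vertical cycle.\<close>
    have "parity_sign (D m (n - m - 1)) m (dv m (n - m) (a m)) = \<zero>\<^bsub>D m (n - m - 1)\<^esub>"
    proof -
      have "a (m + 1) = \<zero>\<^bsub>D (m + 1) (n - m - 1)\<^esub>" using m(1)[of "m + 1"] by (simp add: algebra_simps)
      then show ?thesis using daI[of m] C.dvD(1)[OF aD[of m]] by simp
    qed
    then have dva: "dv m (n - m) (a m) = \<zero>\<^bsub>D m (n - m - 1)\<^esub>"
      using C.dvD(1)[OF aD[of m]] C.D.parity_sign_parity_sign C.D.parity_sign_zero by metis
    have "dv m (n - m) (A m (fst (f m))) = \<zero>\<^bsub>D m (n - m - 1)\<^esub>"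
      "ev (m + 1) (n - m) (B m (snd (f m))) = \<zero>\<^bsub>E (m + 1) (n - m - 1)\<^esub>"
      using dvA[OF fc(1)[of m]] evB[OF fc(2)[of m]] dva m'[of m] by simp_all
    then have v: "dv (m + 1) (n - m) (fst (f (m + 1))) = \<zero>\<^bsub>D (m + 1) (n - m - 1)\<^esub>"
      "ev (m + 2) (n - m) (snd (f (m + 1))) = \<zero>\<^bsub>E (m + 2) (n - m - 1)\<^esub>"
      using f(3)[of m] by (simp_all add: Q_def)
    have Az: "A i x = \<zero>\<^bsub>D i (n - i)\<^esub>" if "i > m" "dv i (n - i + 1) x = \<zero>\<^bsub>D i (n - i)\<^esub>" for i x
      using that m(1)[of i] by (simp add: A_def C.D.M.minus_zero)
    have Bz: "B i y = \<zero>\<^bsub>E (i + 1) (n - i)\<^esub>" if "i > m" "ev (i + 1) (n - i + 1) y = \<zero>\<^bsub>E (i + 1) (n - i)\<^esub>" for i y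
      using that m'[of i] by (simp add: B_def E.D.M.minus_zero)
    \<comment> \<open>By \<open>v\<close> the corrections in row m + 1 are zero, and so are a and b
      there. All data vanish from this row on, and the third clause of Q makes the solution zero
      from index m + 2.\<close>
    have f0: "f i = z i" if "i \<ge> m + 2" for i
      using that
    proof (induction i rule: int_ge_induct)
      case base
      have "A (m + 1) (fst (f (m + 1))) = \<zero>\<^bsub>D (m + 1) (n - (m + 1))\<^esub>"
        using v(1) by (intro Az) (simp_all add: algebra_simps)
      moreover have "B (m + 1) (snd (f (m + 1))) = \<zero>\<^bsub>E (m + 1 + 1) (n - (m + 1))\<^esub>"
        using v(2) by (intro Bz) (simp_all add: algebra_simps)
      ultimately have "fst (f (m + 1 + 1)) = \<zero>\<^bsub>D (m + 1 + 1) (n - (m + 1))\<^esub>"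
        "snd (f (m + 1 + 1)) = \<zero>\<^bsub>E (m + 1 + 2) (n - (m + 1))\<^esub>"
        using f(3)[of "m + 1"] by (simp_all add: Q_def)
      then show ?case by (intro prod_eqI) (simp_all add: z_def algebra_simps)
    next
      case (step i)
      have "A i (fst (f i)) = \<zero>\<^bsub>D i (n - i)\<^esub>"
        using step by (intro Az) (simp_all add: z_def)
      moreover have "B i (snd (f i)) = \<zero>\<^bsub>E (i + 1) (n - i)\<^esub>"
        using step by (intro Bz) (simp_all add: z_def)
      ultimately have "fst (f (i + 1)) = \<zero>\<^bsub>D (i + 1) (n - i)\<^esub>" "snd (f (i + 1)) = \<zero>\<^bsub>E (i + 2) (n - i)\<^esub>"
        using f(3)[of i] by (simp_all add: Q_def)
      then show ?case by (intro prod_eqI) (simp_all add: z_def algebra_simps)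
    qed
    have az: "a' i = \<zero>\<^bsub>D i (n + 1 - i)\<^esub>" if "i \<notin> {0..m + 2}" for i
      using that f0[of i] f(1)[of i] by (cases "i < 0") (simp_all add: a'_def z_def algebra_simps)
    \<comment> \<open>The shift in b' moves the upper end of the support by one.\<close>
    have bz: "b' i = \<zero>\<^bsub>E i (n + 2 - i)\<^esub>" if "i \<notin> {0..m + 3}" for i
      using that f0[of "i - 1"] f(1)[of "i - 1"] by (cases "i < 0") (simp_all add: b'_def z_def algebra_simps)
    have "finite {i. a' i \<noteq> \<zero>\<^bsub>D i (n + 1 - i)\<^esub>}" "finite {i. b' i \<noteq> \<zero>\<^bsub>E i (n + 2 - i)\<^esub>}"
      by (rule finite_subset[of _ "{0..m + 2}"], use az in blast, simp)
        (rule finite_subset[of _ "{0..m + 3}"], use bz in blast, simp)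
    then show ?thesis using a'c b'c by (simp add: fin_supp_def)
  qed
  show ?thesis using a'c b'c 1 2 3 by (intro bexI[of _ a'] bexI[of _ b']) auto
qed

end

section \<open>Tensor products of complexes\<close>

text \<open>Names the coset of a formal sum, so that computations in \<open>tensor\<close> become
  congruences modulo \<open>tensor_kernel\<close>.\<close>

definition tensor_class ::
    "'r ring \<Rightarrow> ('r, 'a) module \<Rightarrow> ('r, 'b) module \<Rightarrow> ('a \<times> 'b \<Rightarrow>\<^sub>0 int) \<Rightarrow> ('a \<times> 'b \<Rightarrow>\<^sub>0 int) set" where
  "tensor_class R A B x = tensor_kernel R A B #>\<^bsub>tensor_pairs A B\<^esub> x"

lemma tensor_pairs_simps [simp]:
  "carrier (tensor_pairs A B) = tensor_chains A B" "x \<otimes>\<^bsub>tensor_pairs A B\<^esub> y = x + y" "\<one>\<^bsub>tensor_pairs A B\<^esub> = 0"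
  by (auto simp: tensor_pairs_def tensor_chains_def)

lemma inv_tensor_pairs [simp]: "x \<in> tensor_chains A B \<Longrightarrow> inv\<^bsub>tensor_pairs A B\<^esub> x = - x"
  by (simp add: tensor_pairs_def tensor_chains_def)

lemma comm_group_tensor_pairs: "comm_group (tensor_pairs A B)"
  unfolding tensor_pairs_def by (rule abelian_free_Abelian_group)

section \<open>Addition and maps on classes of tensors\<close>

lemma carrier_tensor: "carrier (tensor \<eta> R A B) = tensor_class R A B ` tensor_chains A B"
  by (auto simp: tensor_def tensor_group_def FactGroup_def RCOSETS_def tensor_class_def)

lemma tensor_kernel_subgroup_pairs:
  assumes A: "left_module (opp_ring R) A" and B: "left_module R B"
  shows "subgroup (tensor_kernel R A B) (tensor_pairs A B)"
  using tensor_kernel_subgroup[OF A B] by (simp add: tensor_pairs_def)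

lemma tensor_kernel_normal:
  assumes A: "left_module (opp_ring R) A" and B: "left_module R B"
  shows "normal (tensor_kernel R A B) (tensor_pairs A B)"
  using comm_group.subgroup_imp_normal[OF comm_group_tensor_pairs tensor_kernel_subgroup_pairs[OF A B]] .

lemma tensor_class_eq_iff:
  assumes A: "left_module (opp_ring R) A" and B: "left_module R B"
    and "x \<in> tensor_chains A B" "y \<in> tensor_chains A B"
  shows "tensor_class R A B x = tensor_class R A B y \<longleftrightarrow> x - y \<in> tensor_kernel R A B"
  unfolding tensor_class_def
  using rcos_eq_iff[OF _ tensor_kernel_subgroup_pairs[OF A B], of x y] assms comm_group_tensor_pairs[of A B]
  by (simp add: comm_group_def)

lemma tensor_zero:
  assumes A: "left_module (opp_ring R) A" and B: "left_module R B"
  shows "\<zero>\<^bsub>tensor \<eta> R A B\<^esub> = tensor_class R A B 0"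
proof -
  interpret G: comm_group "tensor_pairs A B" by (rule comm_group_tensor_pairs)
  show ?thesis
    using G.coset_mult_one[of "tensor_kernel R A B"] subgroup.subset[OF tensor_kernel_subgroup_pairs[OF A B]]
    by (simp add: tensor_def tensor_group_def tensor_class_def)
qed

lemma tensor_add:
  assumes A: "left_module (opp_ring R) A" and B: "left_module R B"
    and "x \<in> tensor_chains A B" "y \<in> tensor_chains A B"
  shows "tensor_class R A B x \<oplus>\<^bsub>tensor \<eta> R A B\<^esub> tensor_class R A B y = tensor_class R A B (x + y)"
  using normal.rcos_sum[OF tensor_kernel_normal[OF A B], of x y] assms
  by (simp add: tensor_def tensor_group_def tensor_class_def FactGroup_def)

lemma tensor_class_zero_iff:
  assumes A: "left_module (opp_ring R) A" and B: "left_module R B"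
    and "x \<in> tensor_chains A B"
  shows "tensor_class R A B x = \<zero>\<^bsub>tensor \<eta> R A B\<^esub> \<longleftrightarrow> x \<in> tensor_kernel R A B"
  using tensor_class_eq_iff[OF assms, of 0] by (simp add: tensor_zero[OF A B])

text \<open>\<open>tensor_map\<close> is a union over all representatives; these differ by
  relations, which f and g preserve, so the union is a single class.\<close>

lemma tensor_map_class:
  assumes A: "left_module (opp_ring R) A" and B: "left_module R B"
    and A': "left_module (opp_ring R) A'" and B': "left_module R B'"
    and f: "f \<in> mod_hom (opp_ring R) A A'" and g: "g \<in> mod_hom R B B'" and x: "x \<in> tensor_chains A B"
  shows "tensor_map R A' B' f g (tensor_class R A B x) = tensor_class R A' B' (bi_map f g x)"
proof -
  note fc = mod_homD(1)[OF f] and gc = mod_homD(1)[OF g]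
  have "tensor_kernel R A' B' #>\<^bsub>tensor_pairs A' B'\<^esub> bi_map f g y = tensor_class R A' B' (bi_map f g x)"
    if y: "y \<in> tensor_class R A B x" for y
  proof -
    obtain k where k: "k \<in> tensor_kernel R A B" "y = k + x" using y by (auto simp: tensor_class_def r_coset_def)
    have kc: "k \<in> tensor_chains A B" by (rule tensor_kernel_chains[OF A B k(1)])
    have "bi_map f g y - bi_map f g x \<in> tensor_kernel R A' B'"
      using tensor_kernel_bi_map[OF A A' B B' f g k(1)] k(2) by simp
    moreover have "bi_map f g x \<in> tensor_chains A' B'" "bi_map f g y \<in> tensor_chains A' B'"
      using k kc by (auto intro!: tensor_chains_add bi_map_chains[OF x] bi_map_chains[OF kc] fc gc)
    ultimately have "bi_map f g y - bi_map f g x \<in> tensor_kernel R A' B' \<Longrightarrow>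
        tensor_class R A' B' (bi_map f g y) = tensor_class R A' B' (bi_map f g x)"
      unfolding tensor_class_def
      using rcos_eq_iff[of "tensor_pairs A' B'" "tensor_kernel R A' B'" "bi_map f g y" "bi_map f g x"]
        comm_group_tensor_pairs[of A' B'] tensor_kernel_subgroup[OF A' B']
      by (simp add: comm_group_def tensor_pairs_def[symmetric])
    then show ?thesis
      using \<open>bi_map f g y - bi_map f g x \<in> _\<close> by (simp add: tensor_class_def)
  qed
  moreover have "x \<in> tensor_class R A B x"
    unfolding tensor_class_def
    using group.rcos_self[OF _ _ tensor_kernel_subgroup_pairs[OF A B], of x] x comm_group_tensor_pairs[of A B]
    by (simp add: comm_group_def)
  ultimately show ?thesis unfolding tensor_map_def bi_map_def[symmetric] by blast
qed

lemma tensor_map_closed: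
  assumes A: "left_module (opp_ring R) A" and B: "left_module R B"
    and A': "left_module (opp_ring R) A'" and B': "left_module R B'"
    and f: "f \<in> mod_hom (opp_ring R) A A'" and g: "g \<in> mod_hom R B B'" and t: "t \<in> carrier (tensor \<eta> R A B)"
  shows "tensor_map R A' B' f g t \<in> carrier (tensor \<eta> R A' B')"
proof -
  obtain x where x: "x \<in> tensor_chains A B" "t = tensor_class R A B x" using t by (auto simp: carrier_tensor)
  have "bi_map f g x \<in> tensor_chains A' B'"
    using mod_homD(1)[OF f] mod_homD(1)[OF g] by (intro bi_map_chains[OF x(1)]) blast+
  then show ?thesis using x tensor_map_class[OF A B A' B' f g x(1)] by (simp add: carrier_tensor)
qed

text \<open>Homomorphisms are total functions constrained on carriers only, so a commuting square
  yields agreement on the carrier and not equality of functions.\<close>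

lemma tensor_map_cong:
  assumes A: "left_module (opp_ring R) A" and B: "left_module R B"
    and A': "left_module (opp_ring R) A'" and B': "left_module R B'"
    and f: "f \<in> mod_hom (opp_ring R) A A'" and g: "g \<in> mod_hom R B B'" and t: "t \<in> carrier (tensor \<eta> R A B)"
    and f': "\<And>a. a \<in> carrier A \<Longrightarrow> f' a = f a" and g': "\<And>b. b \<in> carrier B \<Longrightarrow> g' b = g b"
  shows "tensor_map R A' B' f' g' t = tensor_map R A' B' f g t"
proof -
  interpret A: left_module "opp_ring R" A by (rule A)
  interpret B: left_module R B by (rule B)
  obtain x where x: "x \<in> tensor_chains A B" "t = tensor_class R A B x" using t by (auto simp: carrier_tensor)
  have "f' \<in> mod_hom (opp_ring R) A A'" "g' \<in> mod_hom R B B'"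
    using f g by (auto simp: mod_hom_def f' g' A.smult_closed[simplified])
  then show ?thesis
    using x tensor_map_class[OF A B A' B' f g x(1)] tensor_map_class[OF A B A' B' _ _ x(1), of f' g']
      bi_map_cong[OF x(1), of f' f g' g] f' g' by simp
qed

lemma tensor_map_comp:
  assumes A: "left_module (opp_ring R) A" and B: "left_module R B"
    and A': "left_module (opp_ring R) A'" and B': "left_module R B'"
    and A'': "left_module (opp_ring R) A''" and B'': "left_module R B''"
    and f: "f \<in> mod_hom (opp_ring R) A A'" and g: "g \<in> mod_hom R B B'"
    and f': "f' \<in> mod_hom (opp_ring R) A' A''" and g': "g' \<in> mod_hom R B' B''"
    and t: "t \<in> carrier (tensor \<eta> R A B)"
  shows "tensor_map R A'' B'' f' g' (tensor_map R A' B' f g t) =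
    tensor_map R A'' B'' (\<lambda>a. f' (f a)) (\<lambda>b. g' (g b)) t"
proof -
  obtain x where x: "x \<in> tensor_chains A B" "t = tensor_class R A B x" using t by (auto simp: carrier_tensor)
  have c: "bi_map f g x \<in> tensor_chains A' B'"
    using mod_homD(1)[OF f] mod_homD(1)[OF g] by (intro bi_map_chains[OF x(1)]) blast+
  show ?thesis
    using x tensor_map_class[OF A B A' B' f g x(1)]
      tensor_map_class[OF A B A'' B'' mod_hom_comp[OF f f'] mod_hom_comp[OF g g'] x(1)]
      tensor_map_class[OF A' B' A'' B'' f' g' c] by simp
qed

lemma tensor_map_add_left:
  assumes A: "left_module (opp_ring R) A" and B: "left_module R B"
    and A': "left_module (opp_ring R) A'" and B': "left_module R B'"
    and f: "f \<in> mod_hom (opp_ring R) A A'" and f': "f' \<in> mod_hom (opp_ring R) A A'"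
    and h: "h \<in> mod_hom (opp_ring R) A A'" and g: "g \<in> mod_hom R B B'" and t: "t \<in> carrier (tensor \<eta> R A B)"
    and eq: "\<And>a. a \<in> carrier A \<Longrightarrow> h a = f a \<oplus>\<^bsub>A'\<^esub> f' a"
  shows "tensor_map R A' B' h g t = tensor_map R A' B' f g t \<oplus>\<^bsub>tensor \<eta> R A' B'\<^esub> tensor_map R A' B' f' g t"
proof -
  obtain x where x: "x \<in> tensor_chains A B" "t = tensor_class R A B x" using t by (auto simp: carrier_tensor)
  have c: "bi_map k g x \<in> tensor_chains A' B'" if "k \<in> mod_hom (opp_ring R) A A'" for k
    using mod_homD(1)[OF that] mod_homD(1)[OF g] by (intro bi_map_chains[OF x(1)]) blast+
  have "bi_map h g x - bi_map f g x - bi_map f' g x \<in> tensor_kernel R A' B'"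
    by (rule tensor_kernel_add_left[OF A' B' _ _ eq _ x(1)])
      (auto simp: mod_homD(1)[OF f] mod_homD(1)[OF f'] mod_homD(1)[OF g])
  then have "tensor_class R A' B' (bi_map h g x) = tensor_class R A' B' (bi_map f g x + bi_map f' g x)"
    using tensor_class_eq_iff[OF A' B' c[OF h], of "bi_map f g x + bi_map f' g x"] c[OF f] c[OF f']
    by (simp add: algebra_simps)
  then show ?thesis
    using x tensor_map_class[OF A B A' B' f g x(1)] tensor_map_class[OF A B A' B' f' g x(1)]
      tensor_map_class[OF A B A' B' h g x(1)] tensor_add[where \<eta> = \<eta>, OF A' B' c[OF f] c[OF f']] by simp
qed

lemma tensor_map_add_right:
  assumes A: "left_module (opp_ring R) A" and B: "left_module R B"
    and A': "left_module (opp_ring R) A'" and B': "left_module R B'"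
    and f: "f \<in> mod_hom R B B'" and f': "f' \<in> mod_hom R B B'"
    and h: "h \<in> mod_hom R B B'" and g: "g \<in> mod_hom (opp_ring R) A A'" and t: "t \<in> carrier (tensor \<eta> R A B)"
    and eq: "\<And>a. a \<in> carrier B \<Longrightarrow> h a = f a \<oplus>\<^bsub>B'\<^esub> f' a"
  shows "tensor_map R A' B' g h t = tensor_map R A' B' g f t \<oplus>\<^bsub>tensor \<eta> R A' B'\<^esub> tensor_map R A' B' g f' t"
proof -
  obtain x where x: "x \<in> tensor_chains A B" "t = tensor_class R A B x" using t by (auto simp: carrier_tensor)
  have c: "bi_map g k x \<in> tensor_chains A' B'" if "k \<in> mod_hom R B B'" for k
    using mod_homD(1)[OF that] mod_homD(1)[OF g] by (intro bi_map_chains[OF x(1)]) blast+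
  have "bi_map g h x - bi_map g f x - bi_map g f' x \<in> tensor_kernel R A' B'"
    by (rule tensor_kernel_add_right[OF A' B' _ _ eq _ x(1)])
      (auto simp: mod_homD(1)[OF f] mod_homD(1)[OF f'] mod_homD(1)[OF g])
  then have "tensor_class R A' B' (bi_map g h x) = tensor_class R A' B' (bi_map g f x + bi_map g f' x)"
    using tensor_class_eq_iff[OF A' B' c[OF h], of "bi_map g f x + bi_map g f' x"] c[OF f] c[OF f']
    by (simp add: algebra_simps)
  then show ?thesis
    using x tensor_map_class[OF A B A' B' g f x(1)] tensor_map_class[OF A B A' B' g f' x(1)]
      tensor_map_class[OF A B A' B' g h x(1)] tensor_add[where \<eta> = \<eta>, OF A' B' c[OF f] c[OF f']] by simp
qed

lemma tensor_map_zero: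
  assumes A: "left_module (opp_ring R) A" and B: "left_module R B"
    and A': "left_module (opp_ring R) A'" and B': "left_module R B'"
    and f: "f \<in> mod_hom (opp_ring R) A A'" and g: "g \<in> mod_hom R B B'" and t: "t \<in> carrier (tensor \<eta> R A B)"
    and zero: "(\<forall>a\<in>carrier A. f a = \<zero>\<^bsub>A'\<^esub>) \<or> (\<forall>b\<in>carrier B. g b = \<zero>\<^bsub>B'\<^esub>)"
  shows "tensor_map R A' B' f g t = \<zero>\<^bsub>tensor \<eta> R A' B'\<^esub>"
proof -
  obtain x where x: "x \<in> tensor_chains A B" "t = tensor_class R A B x" using t by (auto simp: carrier_tensor)
  have c: "bi_map f g x \<in> tensor_chains A' B'"
    using mod_homD(1)[OF f] mod_homD(1)[OF g] by (intro bi_map_chains[OF x(1)]) blast+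
  have "bi_map f g x \<in> tensor_kernel R A' B'"
    using zero
  proof
    assume *: "\<forall>a\<in>carrier A. f a = \<zero>\<^bsub>A'\<^esub>"
    have "bi_map f g x = bi_map (\<lambda>a. \<zero>\<^bsub>A'\<^esub>) g x" by (rule bi_map_cong[OF x(1)]) (use * in auto)
    also have "\<dots> \<in> tensor_kernel R A' B'"
      by (rule tensor_kernel_zero_left[OF A' B' _ x(1)]) (rule mod_homD(1)[OF g])
    finally show ?thesis .
  next
    assume *: "\<forall>b\<in>carrier B. g b = \<zero>\<^bsub>B'\<^esub>"
    have "bi_map f g x = bi_map f (\<lambda>a. \<zero>\<^bsub>B'\<^esub>) x" by (rule bi_map_cong[OF x(1)]) (use * in auto)
    also have "\<dots> \<in> tensor_kernel R A' B'"
      by (rule tensor_kernel_zero_right[OF A' B' _ x(1)]) (rule mod_homD(1)[OF f])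
    finally show ?thesis .
  qed
  then show ?thesis
    using x tensor_map_class[OF A B A' B' f g x(1)] tensor_class_zero_iff[OF A' B' c] by simp
qed

lemma tensor_map_ident:
  assumes A: "left_module (opp_ring R) A" and B: "left_module R B"
    and t: "t \<in> carrier (tensor \<eta> R A B)"
  shows "tensor_map R A B (\<lambda>a. a) (\<lambda>b. b) t = t"
  using t tensor_map_class[OF A B A B mod_hom_ident mod_hom_ident] by (auto simp: carrier_tensor)

section \<open>The action of the ground ring on tensor products\<close>

lemma k_algebraD:
  assumes "k_algebra K \<eta> R"
  shows "cring K" "ring R" "c \<in> carrier K \<Longrightarrow> \<eta> c \<in> carrier R"
    "c \<in> carrier K \<Longrightarrow> d \<in> carrier K \<Longrightarrow> \<eta> (c \<oplus>\<^bsub>K\<^esub> d) = \<eta> c \<oplus>\<^bsub>R\<^esub> \<eta> d"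
    "c \<in> carrier K \<Longrightarrow> d \<in> carrier K \<Longrightarrow> \<eta> (c \<otimes>\<^bsub>K\<^esub> d) = \<eta> c \<otimes>\<^bsub>R\<^esub> \<eta> d" "\<eta> \<one>\<^bsub>K\<^esub> = \<one>\<^bsub>R\<^esub>"
    "c \<in> carrier K \<Longrightarrow> r \<in> carrier R \<Longrightarrow> \<eta> c \<otimes>\<^bsub>R\<^esub> r = r \<otimes>\<^bsub>R\<^esub> \<eta> c"
  using assms by (auto simp: k_algebra_def ring_hom_def)

text \<open>Multiplication by \<eta> c commutes with the action of R because \<eta> c is
  central.\<close>

lemma scalar_mod_hom:
  assumes K: "k_algebra K \<eta> R" and A: "left_module (opp_ring R) A" and c: "c \<in> carrier K"
  shows "(\<lambda>a. \<eta> c \<odot>\<^bsub>A\<^esub> a) \<in> mod_hom (opp_ring R) A A"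
proof -
  interpret A: left_module "opp_ring R" A by fact
  note k = k_algebraD[OF K]
  show ?thesis unfolding mod_hom_def
    using c k(3)[OF c] A.smult_closed A.smult_r_distr A.smult_assoc1[symmetric] k(7)
    by (auto simp: k)
qed

lemma tensor_smult:
  assumes K: "k_algebra K \<eta> R" and A: "left_module (opp_ring R) A" and B: "left_module R B"
    and c: "c \<in> carrier K" and x: "x \<in> tensor_chains A B"
  shows "c \<odot>\<^bsub>tensor \<eta> R A B\<^esub> tensor_class R A B x = tensor_class R A B (bi_map (\<lambda>a. \<eta> c \<odot>\<^bsub>A\<^esub> a) (\<lambda>b. b) x)"
  using tensor_map_class[OF A B A B scalar_mod_hom[OF K A c] mod_hom_ident x] by (simp add: tensor_def id_def)

lemma tensor_left_module:
  assumes K: "k_algebra K \<eta> R" and A: "left_module (opp_ring R) A" and B: "left_module R B"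
  shows "left_module K (tensor \<eta> R A B)"
proof -
  interpret A: left_module "opp_ring R" A by fact
  interpret B: left_module R B by fact
  note k = k_algebraD[OF K]
  let ?c = "tensor_class R A B" and ?T = "tensor \<eta> R A B"
  note add = tensor_add[OF A B, where \<eta> = \<eta>] and zero = tensor_zero[OF A B, where \<eta> = \<eta>] and sm = tensor_smult[OF K A B]
  have sc: "bi_map (\<lambda>a. \<eta> c \<odot>\<^bsub>A\<^esub> a) (\<lambda>b. b) x \<in> tensor_chains A B" if "c \<in> carrier K" "x \<in> tensor_chains A B" for c x
    using mod_homD(1)[OF scalar_mod_hom[OF K A that(1)]] by (intro bi_map_chains[OF that(2)]) blast+
  have ring: "ring K" using k(1) by (simp add: cring_def)
  show ?thesis
  proof (intro left_module.intro left_module_axioms.intro abelian_groupI ring)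
    fix t assume "t \<in> carrier ?T"
    then obtain x where x: "x \<in> tensor_chains A B" "t = ?c x" by (auto simp: carrier_tensor)
    then show "\<exists>s\<in>carrier ?T. s \<oplus>\<^bsub>?T\<^esub> t = \<zero>\<^bsub>?T\<^esub>"
      by (intro bexI[of _ "?c (- x)"]) (auto simp: add zero carrier_tensor)
    have "bi_map (\<lambda>a. \<eta> \<one>\<^bsub>K\<^esub> \<odot>\<^bsub>A\<^esub> a) (\<lambda>b. b) x = bi_map (\<lambda>a. a) (\<lambda>b. b) x"
      by (rule bi_map_cong[OF x(1)]) (use A.smult_one in \<open>auto simp: k\<close>)
    then show "\<one>\<^bsub>K\<^esub> \<odot>\<^bsub>?T\<^esub> t = t" using x sm[OF ring.ring_simprules(6)[OF ring] x(1)] by simp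
    show "\<zero>\<^bsub>?T\<^esub> \<oplus>\<^bsub>?T\<^esub> t = t" using x by (simp add: add zero)
    fix c assume c: "c \<in> carrier K"
    show "c \<odot>\<^bsub>?T\<^esub> t \<in> carrier ?T" using x c sm sc by (auto simp: carrier_tensor)
    fix d assume d: "d \<in> carrier K"
    have cd: "c \<oplus>\<^bsub>K\<^esub> d \<in> carrier K" "c \<otimes>\<^bsub>K\<^esub> d \<in> carrier K" using c d ring by (auto simp: ring.ring_simprules)
    have "bi_map (\<lambda>a. \<eta> (c \<oplus>\<^bsub>K\<^esub> d) \<odot>\<^bsub>A\<^esub> a) (\<lambda>b. b) x - bi_map (\<lambda>a. \<eta> c \<odot>\<^bsub>A\<^esub> a) (\<lambda>b. b) x
        - bi_map (\<lambda>a. \<eta> d \<odot>\<^bsub>A\<^esub> a) (\<lambda>b. b) x \<in> tensor_kernel R A B"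
      by (rule tensor_kernel_add_left[OF A B _ _ _ _ x(1)])
        (use c d A.smult_closed A.smult_l_distr in \<open>auto simp: k\<close>)
    then have "?c (bi_map (\<lambda>a. \<eta> (c \<oplus>\<^bsub>K\<^esub> d) \<odot>\<^bsub>A\<^esub> a) (\<lambda>b. b) x) =
        ?c (bi_map (\<lambda>a. \<eta> c \<odot>\<^bsub>A\<^esub> a) (\<lambda>b. b) x + bi_map (\<lambda>a. \<eta> d \<odot>\<^bsub>A\<^esub> a) (\<lambda>b. b) x)"
      using sc[OF cd(1) x(1)] sc[OF c x(1)] sc[OF d x(1)]
      by (subst tensor_class_eq_iff[OF A B]) (auto simp: algebra_simps)
    then show "(c \<oplus>\<^bsub>K\<^esub> d) \<odot>\<^bsub>?T\<^esub> t = c \<odot>\<^bsub>?T\<^esub> t \<oplus>\<^bsub>?T\<^esub> d \<odot>\<^bsub>?T\<^esub> t"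
      using x c d cd by (simp add: sm add sc)
    have "bi_map (\<lambda>a. \<eta> (c \<otimes>\<^bsub>K\<^esub> d) \<odot>\<^bsub>A\<^esub> a) (\<lambda>b. b) x = bi_map (\<lambda>a. \<eta> c \<odot>\<^bsub>A\<^esub> (\<eta> d \<odot>\<^bsub>A\<^esub> a)) (\<lambda>b. b) x"
    proof (rule bi_map_cong[OF x(1)])
      fix a assume a: "a \<in> carrier A"
      \<comment> \<open>A is a module over the opposite ring, which reverses the product; centrality
        of \<eta> c reverses it back.\<close>
      have "\<eta> (c \<otimes>\<^bsub>K\<^esub> d) = \<eta> c \<otimes>\<^bsub>opp_ring R\<^esub> \<eta> d" using k(5)[OF c d] k(7)[OF c k(3)[OF d]] by simp
      then show "\<eta> (c \<otimes>\<^bsub>K\<^esub> d) \<odot>\<^bsub>A\<^esub> a = \<eta> c \<odot>\<^bsub>A\<^esub> (\<eta> d \<odot>\<^bsub>A\<^esub> a)"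
        using A.smult_assoc1[of "\<eta> c" "\<eta> d" a] k(3) c d a by simp
    qed simp
    then show "(c \<otimes>\<^bsub>K\<^esub> d) \<odot>\<^bsub>?T\<^esub> t = c \<odot>\<^bsub>?T\<^esub> (d \<odot>\<^bsub>?T\<^esub> t)"
      using x c d cd by (simp add: sm sc)
  next
    fix c t s assume c: "c \<in> carrier K" and "t \<in> carrier ?T" "s \<in> carrier ?T"
    then obtain x y where x: "x \<in> tensor_chains A B" "t = ?c x" and y: "y \<in> tensor_chains A B" "s = ?c y"
      by (auto simp: carrier_tensor)
    then show "c \<odot>\<^bsub>?T\<^esub> (t \<oplus>\<^bsub>?T\<^esub> s) = c \<odot>\<^bsub>?T\<^esub> t \<oplus>\<^bsub>?T\<^esub> c \<odot>\<^bsub>?T\<^esub> s"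
      using c by (simp add: sm add sc)
  qed (auto simp: carrier_tensor add zero ac_simps)
qed

lemma tensor_map_mod_hom:
  assumes K: "k_algebra K \<eta> R" and A: "left_module (opp_ring R) A" and B: "left_module R B"
    and A': "left_module (opp_ring R) A'" and B': "left_module R B'"
    and f: "f \<in> mod_hom (opp_ring R) A A'" and g: "g \<in> mod_hom R B B'"
  shows "tensor_map R A' B' f g \<in> mod_hom K (tensor \<eta> R A B) (tensor \<eta> R A' B')"
  unfolding mod_hom_def
proof (intro CollectI conjI ballI Pi_I)
  have c: "bi_map f g x \<in> tensor_chains A' B'" if "x \<in> tensor_chains A B" for x
    using mod_homD(1)[OF f] mod_homD(1)[OF g] by (intro bi_map_chains[OF that]) blast+
  note m = tensor_map_class[OF A B A' B' f g]
  fix t assume t: "t \<in> carrier (tensor \<eta> R A B)"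
  then show "tensor_map R A' B' f g t \<in> carrier (tensor \<eta> R A' B')"
    by (rule tensor_map_closed[OF A B A' B' f g])
  from t obtain x where x: "x \<in> tensor_chains A B" "t = tensor_class R A B x" by (auto simp: carrier_tensor)
  {
    fix s assume "s \<in> carrier (tensor \<eta> R A B)"
    then obtain y where y: "y \<in> tensor_chains A B" "s = tensor_class R A B y" by (auto simp: carrier_tensor)
    show "tensor_map R A' B' f g (t \<oplus>\<^bsub>tensor \<eta> R A B\<^esub> s) =
        tensor_map R A' B' f g t \<oplus>\<^bsub>tensor \<eta> R A' B'\<^esub> tensor_map R A' B' f g s"
      using x y c by (simp add: m tensor_add[OF A B] tensor_add[OF A' B'])
  }
  fix k assume k: "k \<in> carrier K"
  interpret A: left_module "opp_ring R" A by fact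
  have kc: "bi_map (\<lambda>a. \<eta> k \<odot>\<^bsub>A\<^esub> a) (\<lambda>b. b) x \<in> tensor_chains A B"
    using mod_homD(1)[OF scalar_mod_hom[OF K A k]] by (intro bi_map_chains[OF x(1)]) blast+
  have "bi_map (\<lambda>a. f (\<eta> k \<odot>\<^bsub>A\<^esub> a)) g x = bi_map (\<lambda>a. \<eta> k \<odot>\<^bsub>A'\<^esub> f a) g x"
    using k_algebraD(3)[OF K k] mod_homD(3)[OF f] by (intro bi_map_cong[OF x(1)]) auto
  then show "tensor_map R A' B' f g (k \<odot>\<^bsub>tensor \<eta> R A B\<^esub> t) = k \<odot>\<^bsub>tensor \<eta> R A' B'\<^esub> tensor_map R A' B' f g t"
    using x c kc by (simp add: m tensor_smult[OF K A B k] tensor_smult[OF K A' B' k])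
qed

subsection \<open>The double complex of a tensor product\<close>

definition tensor_dbl ::
    "('k \<Rightarrow> 'r) \<Rightarrow> 'r ring \<Rightarrow> ('r, 'a) cplx \<Rightarrow> ('r, 'b) cplx \<Rightarrow> int \<Rightarrow> int \<Rightarrow> ('k, ('a \<times> 'b \<Rightarrow>\<^sub>0 int) set) module" where
  "tensor_dbl \<eta> R X Y i j = tensor \<eta> R (obj X i) (obj Y j)"

definition tensor_dh ::
    "'r ring \<Rightarrow> ('r, 'a) cplx \<Rightarrow> ('r, 'b) cplx \<Rightarrow> int \<Rightarrow> int \<Rightarrow> ('a \<times> 'b \<Rightarrow>\<^sub>0 int) set \<Rightarrow> ('a \<times> 'b \<Rightarrow>\<^sub>0 int) set" where
  "tensor_dh R X Y i j = tensor_map R (obj X (i - 1)) (obj Y j) (diff X i) (\<lambda>b. b)"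

definition tensor_dv ::
    "'r ring \<Rightarrow> ('r, 'a) cplx \<Rightarrow> ('r, 'b) cplx \<Rightarrow> int \<Rightarrow> int \<Rightarrow> ('a \<times> 'b \<Rightarrow>\<^sub>0 int) set \<Rightarrow> ('a \<times> 'b \<Rightarrow>\<^sub>0 int) set" where
  "tensor_dv R X Y i j = tensor_map R (obj X i) (obj Y (j - 1)) (\<lambda>a. a) (diff Y j)"

definition tensor_dbl_map ::
    "'r ring \<Rightarrow> ('r, 'c) cplx \<Rightarrow> ('r, 'd) cplx \<Rightarrow> (int \<Rightarrow> 'a \<Rightarrow> 'c) \<Rightarrow> (int \<Rightarrow> 'b \<Rightarrow> 'd) \<Rightarrow> int \<Rightarrow> int \<Rightarrow>
      ('a \<times> 'b \<Rightarrow>\<^sub>0 int) set \<Rightarrow> ('c \<times> 'd \<Rightarrow>\<^sub>0 int) set" where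
  "tensor_dbl_map R X' Y' f g i j = tensor_map R (obj X' i) (obj Y' j) (f i) (g j)"

text \<open>Both sides unfold to the same complex, up to the way in which indices are written. This
  makes all results on \<open>tot\<close> available for tensor products.\<close>

lemma unbounded_tensor_tot:
  "unbounded_tensor \<eta> R X Y = tot (tensor_dbl \<eta> R X Y) (tensor_dh R X Y) (tensor_dv R X Y)"
proof -
  have eq: "n - i - 1 = n - 1 - i" "i + 1 - 1 = i" for n i :: int by simp_all
  show ?thesis
    unfolding unbounded_tensor_def tot_def tensor_dbl_def tensor_dh_def tensor_dv_def id_def
      parity_sign_def Let_def eq ..
qed

lemma unbounded_tensor_map_tot:
  "unbounded_tensor_map R X' Y' f g = tot_map (tensor_dbl_map R X' Y' f g)"
  by (simp add: unbounded_tensor_map_def tot_map_def tensor_dbl_map_def fun_eq_iff)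

lemma carrier_tensor_complex: "carrier (obj (tensor_complex \<eta> R X Y) n) = fin_supp (tensor_dbl \<eta> R X Y) n"
  by (simp add: tensor_complex_def fin_supp_def unbounded_tensor_def tensor_dbl_def)

lemma stable_tensor_quot:
  "stable_tensor \<eta> R X Y = quot_complex (unbounded_tensor \<eta> R X Y) (fin_supp (tensor_dbl \<eta> R X Y))"
  by (simp add: stable_tensor_def quot_complex_def carrier_tensor_complex)

lemma stable_tensor_map_quot:
  "stable_tensor_map \<eta> R X' Y' f g =
    quot_map (unbounded_tensor \<eta> R X' Y') (fin_supp (tensor_dbl \<eta> R X' Y')) (unbounded_tensor_map R X' Y' f g)"
  by (simp add: stable_tensor_map_def quot_map_def carrier_tensor_complex fun_eq_iff)

lemma tensor_double_complex:
  assumes K: "k_algebra K \<eta> R" and X: "is_complex (opp_ring R) X" and Y: "is_complex R Y"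
  shows "double_complex K (tensor_dbl \<eta> R X Y) (tensor_dh R X Y) (tensor_dv R X Y)"
proof (rule double_complex.intro)
  note LX = is_complexD(1)[OF X] and LY = is_complexD(1)[OF Y] and DX = is_complexD(2)[OF X] and DY = is_complexD(2)[OF Y]
  fix i j
  show "left_module K (tensor_dbl \<eta> R X Y i j)" unfolding tensor_dbl_def by (rule tensor_left_module[OF K LX LY])
  show "tensor_dh R X Y i j \<in> mod_hom K (tensor_dbl \<eta> R X Y i j) (tensor_dbl \<eta> R X Y (i - 1) j)"
    unfolding tensor_dbl_def tensor_dh_def by (rule tensor_map_mod_hom[OF K LX LY LX LY DX mod_hom_ident])
  show "tensor_dv R X Y i j \<in> mod_hom K (tensor_dbl \<eta> R X Y i j) (tensor_dbl \<eta> R X Y i (j - 1))"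
    unfolding tensor_dbl_def tensor_dv_def by (rule tensor_map_mod_hom[OF K LX LY LX LY mod_hom_ident DY])
  fix t assume t: "t \<in> carrier (tensor_dbl \<eta> R X Y i j)"
  note t' = t[unfolded tensor_dbl_def]
  have i2: "i - 1 - 1 = i - 2" "j - 1 - 1 = j - 2" by simp_all
  show "tensor_dh R X Y (i - 1) j (tensor_dh R X Y i j t) = \<zero>\<^bsub>tensor_dbl \<eta> R X Y (i - 2) j\<^esub>"
    unfolding tensor_dh_def tensor_dbl_def i2
      tensor_map_comp[OF LX LY LX LY LX LY DX mod_hom_ident DX[of "i - 1", unfolded i2] mod_hom_ident t']
    by (rule tensor_map_zero[OF LX LY LX LY mod_hom_comp[OF DX DX[of "i - 1", unfolded i2]] mod_hom_ident t'])
      (use is_complexD(3)[OF X] in blast)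
  show "tensor_dv R X Y i (j - 1) (tensor_dv R X Y i j t) = \<zero>\<^bsub>tensor_dbl \<eta> R X Y i (j - 2)\<^esub>"
    unfolding tensor_dv_def tensor_dbl_def i2
      tensor_map_comp[OF LX LY LX LY LX LY mod_hom_ident DY mod_hom_ident DY[of "j - 1", unfolded i2] t']
    by (rule tensor_map_zero[OF LX LY LX LY mod_hom_ident mod_hom_comp[OF DY DY[of "j - 1", unfolded i2]] t'])
      (use is_complexD(3)[OF Y] in blast)
  show "tensor_dh R X Y i (j - 1) (tensor_dv R X Y i j t) = tensor_dv R X Y (i - 1) j (tensor_dh R X Y i j t)"
    unfolding tensor_dv_def tensor_dh_def
      tensor_map_comp[OF LX LY LX LY LX LY mod_hom_ident DY DX mod_hom_ident t']
      tensor_map_comp[OF LX LY LX LY LX LY DX mod_hom_ident mod_hom_ident DY t'] ..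
qed

lemma tensor_double_complex_map:
  assumes K: "k_algebra K \<eta> R" and X: "is_complex (opp_ring R) X" and Y: "is_complex R Y"
    and X': "is_complex (opp_ring R) X'" and Y': "is_complex R Y'"
    and f: "chain_map (opp_ring R) X X' f" and g: "chain_map R Y Y' g"
  shows "double_complex_map K (tensor_dbl \<eta> R X Y) (tensor_dh R X Y) (tensor_dv R X Y)
    (tensor_dbl \<eta> R X' Y') (tensor_dh R X' Y') (tensor_dv R X' Y') (tensor_dbl_map R X' Y' f g)"
proof (intro double_complex_map.intro tensor_double_complex[OF K] double_complex_map_axioms.intro X Y X' Y')
  note LX = is_complexD(1)[OF X] and LY = is_complexD(1)[OF Y] and DX = is_complexD(2)[OF X] and DY = is_complexD(2)[OF Y]
    and LX' = is_complexD(1)[OF X'] and LY' = is_complexD(1)[OF Y'] and DX' = is_complexD(2)[OF X'] and DY' = is_complexD(2)[OF Y']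
    and F = chain_mapD(1)[OF f] and G = chain_mapD(1)[OF g]
  fix i j
  show "tensor_dbl_map R X' Y' f g i j \<in> mod_hom K (tensor_dbl \<eta> R X Y i j) (tensor_dbl \<eta> R X' Y' i j)"
    unfolding tensor_dbl_def tensor_dbl_map_def by (rule tensor_map_mod_hom[OF K LX LY LX' LY' F G])
  fix t assume t: "t \<in> carrier (tensor_dbl \<eta> R X Y i j)"
  note t' = t[unfolded tensor_dbl_def]
  show "tensor_dbl_map R X' Y' f g (i - 1) j (tensor_dh R X Y i j t) = tensor_dh R X' Y' i j (tensor_dbl_map R X' Y' f g i j t)"
    unfolding tensor_dh_def tensor_dbl_map_def
      tensor_map_comp[OF LX LY LX LY LX' LY' DX mod_hom_ident F G t']
      tensor_map_comp[OF LX LY LX' LY' LX' LY' F G DX' mod_hom_ident t']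
    by (rule tensor_map_cong[OF LX LY LX' LY' mod_hom_comp[OF F DX'] G t']) (auto simp: chain_mapD(2)[OF f])
  show "tensor_dbl_map R X' Y' f g i (j - 1) (tensor_dv R X Y i j t) = tensor_dv R X' Y' i j (tensor_dbl_map R X' Y' f g i j t)"
    unfolding tensor_dv_def tensor_dbl_map_def
      tensor_map_comp[OF LX LY LX LY LX' LY' mod_hom_ident DY F G t']
      tensor_map_comp[OF LX LY LX' LY' LX' LY' F G mod_hom_ident DY' t']
    by (rule tensor_map_cong[OF LX LY LX' LY' F mod_hom_comp[OF G DY'] t']) (auto simp: chain_mapD(2)[OF g])
qed

section \<open>Chain maps and homotopies between tensor products of complexes\<close>

lemma unbounded_tensor_is_complex:
  assumes "k_algebra K \<eta> R" "is_complex (opp_ring R) X" "is_complex R Y"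
  shows "is_complex K (unbounded_tensor \<eta> R X Y)"
  unfolding unbounded_tensor_tot by (rule double_complex.tot_is_complex[OF tensor_double_complex[OF assms]])

lemma tensor_fin_supp_subcomplex:
  assumes "k_algebra K \<eta> R" "is_complex (opp_ring R) X" "is_complex R Y"
  shows "subcomplex K (unbounded_tensor \<eta> R X Y) (fin_supp (tensor_dbl \<eta> R X Y))"
  unfolding unbounded_tensor_tot by (rule double_complex.fin_supp_subcomplex[OF tensor_double_complex[OF assms]])

lemma stable_tensor_is_complex:
  assumes "k_algebra K \<eta> R" "is_complex (opp_ring R) X" "is_complex R Y"
  shows "is_complex K (stable_tensor \<eta> R X Y)"
  unfolding stable_tensor_quot
  by (rule quot_complex_is_complex[OF unbounded_tensor_is_complex[OF assms] tensor_fin_supp_subcomplex[OF assms]])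

lemma tensor_chain_maps:
  assumes K: "k_algebra K \<eta> R" and X: "is_complex (opp_ring R) X" and Y: "is_complex R Y"
    and X': "is_complex (opp_ring R) X'" and Y': "is_complex R Y'"
    and f: "chain_map (opp_ring R) X X' f" and g: "chain_map R Y Y' g"
  shows "chain_map K (unbounded_tensor \<eta> R X Y) (unbounded_tensor \<eta> R X' Y') (unbounded_tensor_map R X' Y' f g)"
    and "z \<in> fin_supp (tensor_dbl \<eta> R X Y) n \<Longrightarrow> unbounded_tensor_map R X' Y' f g n z \<in> fin_supp (tensor_dbl \<eta> R X' Y') n"
    and "chain_map K (stable_tensor \<eta> R X Y) (stable_tensor \<eta> R X' Y') (stable_tensor_map \<eta> R X' Y' f g)"
proof -
  note dm = tensor_double_complex_map[OF assms]
  show 1: "chain_map K (unbounded_tensor \<eta> R X Y) (unbounded_tensor \<eta> R X' Y') (unbounded_tensor_map R X' Y' f g)"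
    unfolding unbounded_tensor_tot unbounded_tensor_map_tot by (rule double_complex_map.tot_map_chain_map[OF dm])
  show 2: "z \<in> fin_supp (tensor_dbl \<eta> R X Y) n \<Longrightarrow> unbounded_tensor_map R X' Y' f g n z \<in> fin_supp (tensor_dbl \<eta> R X' Y') n"
    for z n unfolding unbounded_tensor_map_tot by (rule double_complex_map.tot_map_fin_supp[OF dm])
  show "chain_map K (stable_tensor \<eta> R X Y) (stable_tensor \<eta> R X' Y') (stable_tensor_map \<eta> R X' Y' f g)"
    unfolding stable_tensor_quot stable_tensor_map_quot
    by (rule quot_map_chain_map[OF unbounded_tensor_is_complex[OF K X Y] unbounded_tensor_is_complex[OF K X' Y']
          tensor_fin_supp_subcomplex[OF K X Y] tensor_fin_supp_subcomplex[OF K X' Y'] 1 2])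
qed

text \<open>The maps \<open>s i\<close> \<otimes> \<open>g j\<close> form a horizontal homotopy:
  they commute with the vertical differentials since g is a chain map, and additivity of the tensor
  product turns f' = f + d s + s d into the required identity. The clause on finite support is what
  lets the homotopy descend to the stable tensor product.\<close>

lemma tensor_homotopy_left:
  assumes K: "k_algebra K \<eta> R" and X: "is_complex (opp_ring R) X" and Y: "is_complex R Y"
    and X': "is_complex (opp_ring R) X'" and Y': "is_complex R Y'"
    and f: "chain_map (opp_ring R) X X' f" and f': "chain_map (opp_ring R) X X' f'" and g: "chain_map R Y Y' g"
    and s: "homotopy (opp_ring R) X X' f f' s"
  shows "\<exists>S. homotopy K (unbounded_tensor \<eta> R X Y) (unbounded_tensor \<eta> R X' Y')
      (unbounded_tensor_map R X' Y' f g) (unbounded_tensor_map R X' Y' f' g) S \<and>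
    (\<forall>n. \<forall>z\<in>fin_supp (tensor_dbl \<eta> R X Y) n. S n z \<in> fin_supp (tensor_dbl \<eta> R X' Y') (n + 1))"
proof -
  note dm = tensor_double_complex_map[OF K X Y X' Y' f g]
  note LX = is_complexD(1)[OF X] and LY = is_complexD(1)[OF Y] and DX = is_complexD(2)[OF X] and DY = is_complexD(2)[OF Y]
    and LX' = is_complexD(1)[OF X'] and LY' = is_complexD(1)[OF Y'] and DX' = is_complexD(2)[OF X'] and DY' = is_complexD(2)[OF Y']
    and F = chain_mapD(1)[OF f] and F' = chain_mapD(1)[OF f'] and G = chain_mapD(1)[OF g]
  have sh: "s n \<in> mod_hom (opp_ring R) (obj X n) (obj X' (n + 1))" for n using s by (auto simp: homotopy_def)
  have sh': "s (n - 1) \<in> mod_hom (opp_ring R) (obj X (n - 1)) (obj X' n)" for n using sh[of "n - 1"] by simp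
  have seq: "f' n x = f n x \<oplus>\<^bsub>obj X' n\<^esub> (diff X' (n + 1) (s n x) \<oplus>\<^bsub>obj X' n\<^esub> s (n - 1) (diff X n x))"
    if "x \<in> carrier (obj X n)" for n x using s that by (auto simp: homotopy_def)
  define S where "S i j = tensor_map R (obj X' (i + 1)) (obj Y' j) (s i) (g j)" for i j
  have Sh: "S i j \<in> mod_hom K (tensor_dbl \<eta> R X Y i j) (tensor_dbl \<eta> R X' Y' (i + 1) j)" for i j
    unfolding S_def tensor_dbl_def by (rule tensor_map_mod_hom[OF K LX LY LX' LY' sh G])
  have comm: "S i (j - 1) (tensor_dv R X Y i j t) = tensor_dv R X' Y' (i + 1) j (S i j t)"
    if "t \<in> carrier (tensor_dbl \<eta> R X Y i j)" for i j t
    unfolding S_def tensor_dv_def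
      tensor_map_comp[OF LX LY LX LY LX' LY' mod_hom_ident DY sh G that[unfolded tensor_dbl_def]]
      tensor_map_comp[OF LX LY LX' LY' LX' LY' sh G mod_hom_ident DY' that[unfolded tensor_dbl_def]]
    by (rule tensor_map_cong[OF LX LY LX' LY' sh mod_hom_comp[OF G DY'] that[unfolded tensor_dbl_def]])
      (auto simp: chain_mapD(2)[OF g])
  have psi: "tensor_dbl_map R X' Y' f' g i j t = tensor_dbl_map R X' Y' f g i j t \<oplus>\<^bsub>tensor_dbl \<eta> R X' Y' i j\<^esub>
      (tensor_dh R X' Y' (i + 1) j (S i j t) \<oplus>\<^bsub>tensor_dbl \<eta> R X' Y' i j\<^esub> S (i - 1) j (tensor_dh R X Y i j t))"
    if "t \<in> carrier (tensor_dbl \<eta> R X Y i j)" for i j t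
  proof -
    note t = that[unfolded tensor_dbl_def]
    interpret X'm: left_module "opp_ring R" "obj X' i" by (rule LX')
    note h1 = mod_hom_comp[OF sh diff_succ_mod_hom[OF X']] and h2 = mod_hom_comp[OF DX sh']
    have h: "(\<lambda>x. diff X' (i + 1) (s i x) \<oplus>\<^bsub>obj X' i\<^esub> s (i - 1) (diff X i x)) \<in> mod_hom (opp_ring R) (obj X i) (obj X' i)"
      using mod_homD[OF h1[of i]] mod_homD[OF h2[of i]] X'm.smult_r_distr
      by (auto simp: mod_hom_def X'm.M.a_ac)
    have i: "i + 1 - 1 = i" "i - 1 + 1 = i" by simp_all
    have "tensor_dh R X' Y' (i + 1) j (S i j t) = tensor_map R (obj X' i) (obj Y' j) (\<lambda>x. diff X' (i + 1) (s i x)) (g j) t"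
      unfolding S_def tensor_dh_def i
      by (rule tensor_map_comp[OF LX LY LX' LY' LX' LY' sh G diff_succ_mod_hom[OF X'] mod_hom_ident t])
    moreover have "S (i - 1) j (tensor_dh R X Y i j t) = tensor_map R (obj X' i) (obj Y' j) (\<lambda>x. s (i - 1) (diff X i x)) (g j) t"
      unfolding S_def tensor_dh_def i
      by (rule tensor_map_comp[OF LX LY LX LY LX' LY' DX mod_hom_ident sh' G t])
    moreover have "tensor_map R (obj X' i) (obj Y' j) (f' i) (g j) t =
        tensor_map R (obj X' i) (obj Y' j) (f i) (g j) t \<oplus>\<^bsub>tensor \<eta> R (obj X' i) (obj Y' j)\<^esub>
        tensor_map R (obj X' i) (obj Y' j) (\<lambda>x. diff X' (i + 1) (s i x) \<oplus>\<^bsub>obj X' i\<^esub> s (i - 1) (diff X i x)) (g j) t"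
      by (rule tensor_map_add_left[OF LX LY LX' LY' F h F' G t]) (rule seq)
    moreover have "tensor_map R (obj X' i) (obj Y' j) (\<lambda>x. diff X' (i + 1) (s i x) \<oplus>\<^bsub>obj X' i\<^esub> s (i - 1) (diff X i x)) (g j) t =
        tensor_map R (obj X' i) (obj Y' j) (\<lambda>x. diff X' (i + 1) (s i x)) (g j) t \<oplus>\<^bsub>tensor \<eta> R (obj X' i) (obj Y' j)\<^esub>
        tensor_map R (obj X' i) (obj Y' j) (\<lambda>x. s (i - 1) (diff X i x)) (g j) t"
      by (rule tensor_map_add_left[OF LX LY LX' LY' h1 h2 h G t]) (rule refl)
    ultimately show ?thesis unfolding tensor_dbl_map_def tensor_dbl_def by simp
  qed
  show ?thesis
    unfolding unbounded_tensor_tot unbounded_tensor_map_tot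
  proof (intro exI[of _ "tot_horizontal S"] conjI allI ballI)
    note h = double_complex_map.tot_horizontal_homotopy[OF dm, where s = S and \<psi> = "tensor_dbl_map R X' Y' f' g"]
    show "homotopy K (tot (tensor_dbl \<eta> R X Y) (tensor_dh R X Y) (tensor_dv R X Y))
        (tot (tensor_dbl \<eta> R X' Y') (tensor_dh R X' Y') (tensor_dv R X' Y'))
        (tot_map (tensor_dbl_map R X' Y' f g)) (tot_map (tensor_dbl_map R X' Y' f' g)) (tot_horizontal S)"
      by (rule h(1)) (rule Sh, rule comm, assumption, rule psi, assumption)
    show "tot_horizontal S n z \<in> fin_supp (tensor_dbl \<eta> R X' Y') (n + 1)" if "z \<in> fin_supp (tensor_dbl \<eta> R X Y) n" for n z
      by (rule h(2)) (rule Sh, rule comm, assumption, rule psi, assumption, rule that)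
  qed
qed

text \<open>The maps \<open>f i\<close> \<otimes> \<open>s j\<close> form a vertical homotopy; they
  commute with the horizontal differentials since f is a chain map.\<close>

lemma tensor_homotopy_right:
  assumes K: "k_algebra K \<eta> R" and X: "is_complex (opp_ring R) X" and Y: "is_complex R Y"
    and X': "is_complex (opp_ring R) X'" and Y': "is_complex R Y'"
    and f: "chain_map (opp_ring R) X X' f" and g: "chain_map R Y Y' g" and g': "chain_map R Y Y' g'"
    and s: "homotopy R Y Y' g g' s"
  shows "\<exists>S. homotopy K (unbounded_tensor \<eta> R X Y) (unbounded_tensor \<eta> R X' Y')
      (unbounded_tensor_map R X' Y' f g) (unbounded_tensor_map R X' Y' f g') S \<and>
    (\<forall>n. \<forall>z\<in>fin_supp (tensor_dbl \<eta> R X Y) n. S n z \<in> fin_supp (tensor_dbl \<eta> R X' Y') (n + 1))"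
proof -
  note dm = tensor_double_complex_map[OF K X Y X' Y' f g]
  note LX = is_complexD(1)[OF X] and LY = is_complexD(1)[OF Y] and DX = is_complexD(2)[OF X] and DY = is_complexD(2)[OF Y]
    and LX' = is_complexD(1)[OF X'] and LY' = is_complexD(1)[OF Y'] and DX' = is_complexD(2)[OF X'] and DY' = is_complexD(2)[OF Y']
    and F = chain_mapD(1)[OF f] and G' = chain_mapD(1)[OF g'] and G = chain_mapD(1)[OF g]
  have sh: "s n \<in> mod_hom R (obj Y n) (obj Y' (n + 1))" for n using s by (auto simp: homotopy_def)
  have sh': "s (n - 1) \<in> mod_hom R (obj Y (n - 1)) (obj Y' n)" for n using sh[of "n - 1"] by simp
  have seq: "g' n x = g n x \<oplus>\<^bsub>obj Y' n\<^esub> (diff Y' (n + 1) (s n x) \<oplus>\<^bsub>obj Y' n\<^esub> s (n - 1) (diff Y n x))"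
    if "x \<in> carrier (obj Y n)" for n x using s that by (auto simp: homotopy_def)
  define S where "S i j = tensor_map R (obj X' i) (obj Y' (j + 1)) (f i) (s j)" for i j
  have Sh: "S i j \<in> mod_hom K (tensor_dbl \<eta> R X Y i j) (tensor_dbl \<eta> R X' Y' i (j + 1))" for i j
    unfolding S_def tensor_dbl_def by (rule tensor_map_mod_hom[OF K LX LY LX' LY' F sh])
  have comm: "S (i - 1) j (tensor_dh R X Y i j t) = tensor_dh R X' Y' i (j + 1) (S i j t)"
    if "t \<in> carrier (tensor_dbl \<eta> R X Y i j)" for i j t
    unfolding S_def tensor_dh_def
      tensor_map_comp[OF LX LY LX LY LX' LY' DX mod_hom_ident F sh that[unfolded tensor_dbl_def]]
      tensor_map_comp[OF LX LY LX' LY' LX' LY' F sh DX' mod_hom_ident that[unfolded tensor_dbl_def]]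
    by (rule tensor_map_cong[OF LX LY LX' LY' mod_hom_comp[OF F DX'] sh that[unfolded tensor_dbl_def]])
      (auto simp: chain_mapD(2)[OF f])
  have psi: "tensor_dbl_map R X' Y' f g' i j t = tensor_dbl_map R X' Y' f g i j t \<oplus>\<^bsub>tensor_dbl \<eta> R X' Y' i j\<^esub>
      (tensor_dv R X' Y' i (j + 1) (S i j t) \<oplus>\<^bsub>tensor_dbl \<eta> R X' Y' i j\<^esub> S i (j - 1) (tensor_dv R X Y i j t))"
    if "t \<in> carrier (tensor_dbl \<eta> R X Y i j)" for i j t
  proof -
    note t = that[unfolded tensor_dbl_def]
    interpret Y'm: left_module R "obj Y' j" by (rule LY')
    note h1 = mod_hom_comp[OF sh diff_succ_mod_hom[OF Y']] and h2 = mod_hom_comp[OF DY sh']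
    have h: "(\<lambda>x. diff Y' (j + 1) (s j x) \<oplus>\<^bsub>obj Y' j\<^esub> s (j - 1) (diff Y j x)) \<in> mod_hom R (obj Y j) (obj Y' j)"
      using mod_homD[OF h1[of j]] mod_homD[OF h2[of j]] Y'm.smult_r_distr
      by (auto simp: mod_hom_def Y'm.M.a_ac)
    have j: "j + 1 - 1 = j" "j - 1 + 1 = j" by simp_all
    have "tensor_dv R X' Y' i (j + 1) (S i j t) = tensor_map R (obj X' i) (obj Y' j) (f i) (\<lambda>x. diff Y' (j + 1) (s j x)) t"
      unfolding S_def tensor_dv_def j
      by (rule tensor_map_comp[OF LX LY LX' LY' LX' LY' F sh mod_hom_ident diff_succ_mod_hom[OF Y'] t])
    moreover have "S i (j - 1) (tensor_dv R X Y i j t) = tensor_map R (obj X' i) (obj Y' j) (f i) (\<lambda>x. s (j - 1) (diff Y j x)) t"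
      unfolding S_def tensor_dv_def j
      by (rule tensor_map_comp[OF LX LY LX LY LX' LY' mod_hom_ident DY F sh' t])
    moreover have "tensor_map R (obj X' i) (obj Y' j) (f i) (g' j) t =
        tensor_map R (obj X' i) (obj Y' j) (f i) (g j) t \<oplus>\<^bsub>tensor \<eta> R (obj X' i) (obj Y' j)\<^esub>
        tensor_map R (obj X' i) (obj Y' j) (f i) (\<lambda>x. diff Y' (j + 1) (s j x) \<oplus>\<^bsub>obj Y' j\<^esub> s (j - 1) (diff Y j x)) t"
      by (rule tensor_map_add_right[OF LX LY LX' LY' G h G' F t]) (rule seq)
    moreover have "tensor_map R (obj X' i) (obj Y' j) (f i) (\<lambda>x. diff Y' (j + 1) (s j x) \<oplus>\<^bsub>obj Y' j\<^esub> s (j - 1) (diff Y j x)) t =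
        tensor_map R (obj X' i) (obj Y' j) (f i) (\<lambda>x. diff Y' (j + 1) (s j x)) t \<oplus>\<^bsub>tensor \<eta> R (obj X' i) (obj Y' j)\<^esub>
        tensor_map R (obj X' i) (obj Y' j) (f i) (\<lambda>x. s (j - 1) (diff Y j x)) t"
      by (rule tensor_map_add_right[OF LX LY LX' LY' h1 h2 h F t]) (rule refl)
    ultimately show ?thesis unfolding tensor_dbl_map_def tensor_dbl_def by simp
  qed
  show ?thesis
    unfolding unbounded_tensor_tot unbounded_tensor_map_tot
  proof (intro exI[of _ "tot_vertical (tensor_dbl \<eta> R X' Y') S"] conjI allI ballI)
    note h = double_complex_map.tot_vertical_homotopy[OF dm, where t = S and \<psi> = "tensor_dbl_map R X' Y' f g'"]
    show "homotopy K (tot (tensor_dbl \<eta> R X Y) (tensor_dh R X Y) (tensor_dv R X Y))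
        (tot (tensor_dbl \<eta> R X' Y') (tensor_dh R X' Y') (tensor_dv R X' Y'))
        (tot_map (tensor_dbl_map R X' Y' f g)) (tot_map (tensor_dbl_map R X' Y' f g')) (tot_vertical (tensor_dbl \<eta> R X' Y') S)"
      by (rule h(1)) (rule Sh, rule comm, assumption, rule psi, assumption)
    show "tot_vertical (tensor_dbl \<eta> R X' Y') S n z \<in> fin_supp (tensor_dbl \<eta> R X' Y') (n + 1)" if "z \<in> fin_supp (tensor_dbl \<eta> R X Y) n" for n z
      by (rule h(2)) (rule Sh, rule comm, assumption, rule psi, assumption, rule that)
  qed
qed

section \<open>Composites, identities and homotopic maps\<close>

lemma unbounded_tensor_map_comp:
  assumes X: "is_complex (opp_ring R) X" and Y: "is_complex R Y"
    and X': "is_complex (opp_ring R) X'" and Y': "is_complex R Y'"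
    and X'': "is_complex (opp_ring R) X''" and Y'': "is_complex R Y''"
    and f: "chain_map (opp_ring R) X X' f" and g: "chain_map R Y Y' g"
    and f': "chain_map (opp_ring R) X' X'' f'" and g': "chain_map R Y' Y'' g'"
    and z: "z \<in> carrier (obj (unbounded_tensor \<eta> R X Y) n)"
  shows "unbounded_tensor_map R X'' Y'' f' g' n (unbounded_tensor_map R X' Y' f g n z) =
    unbounded_tensor_map R X'' Y'' (\<lambda>n x. f' n (f n x)) (\<lambda>n x. g' n (g n x)) n z"
proof
  fix i
  have "z i \<in> carrier (tensor \<eta> R (obj X i) (obj Y (n - i)))"
    using z by (simp add: unbounded_tensor_def)
  then show "unbounded_tensor_map R X'' Y'' f' g' n (unbounded_tensor_map R X' Y' f g n z) i =
    unbounded_tensor_map R X'' Y'' (\<lambda>n x. f' n (f n x)) (\<lambda>n x. g' n (g n x)) n z i"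
    unfolding unbounded_tensor_map_def
    by (rule tensor_map_comp[OF is_complexD(1)[OF X] is_complexD(1)[OF Y] is_complexD(1)[OF X'] is_complexD(1)[OF Y']
        is_complexD(1)[OF X''] is_complexD(1)[OF Y''] chain_mapD(1)[OF f] chain_mapD(1)[OF g]
        chain_mapD(1)[OF f'] chain_mapD(1)[OF g']])
qed

lemma unbounded_tensor_map_ident:
  assumes X: "is_complex (opp_ring R) X" and Y: "is_complex R Y"
    and z: "z \<in> carrier (obj (unbounded_tensor \<eta> R X Y) n)"
  shows "unbounded_tensor_map R X Y (\<lambda>n x. x) (\<lambda>n x. x) n z = z"
proof
  fix i
  have "z i \<in> carrier (tensor \<eta> R (obj X i) (obj Y (n - i)))"
    using z by (simp add: unbounded_tensor_def)
  then show "unbounded_tensor_map R X Y (\<lambda>n x. x) (\<lambda>n x. x) n z i = z i"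
    unfolding unbounded_tensor_map_def
    by (rule tensor_map_ident[OF is_complexD(1)[OF X] is_complexD(1)[OF Y]])
qed

lemma stable_tensor_map_coset:
  assumes K: "k_algebra K \<eta> R" and X: "is_complex (opp_ring R) X" and Y: "is_complex R Y"
    and X': "is_complex (opp_ring R) X'" and Y': "is_complex R Y'"
    and f: "chain_map (opp_ring R) X X' f" and g: "chain_map R Y Y' g"
    and z: "z \<in> carrier (obj (unbounded_tensor \<eta> R X Y) n)"
  shows "stable_tensor_map \<eta> R X' Y' f g n (fin_supp (tensor_dbl \<eta> R X Y) n +>\<^bsub>obj (unbounded_tensor \<eta> R X Y) n\<^esub> z) =
    fin_supp (tensor_dbl \<eta> R X' Y') n +>\<^bsub>obj (unbounded_tensor \<eta> R X' Y') n\<^esub> unbounded_tensor_map R X' Y' f g n z"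
  unfolding stable_tensor_map_quot
  by (rule quot_map_coset[OF unbounded_tensor_is_complex[OF K X Y] unbounded_tensor_is_complex[OF K X' Y']
        tensor_fin_supp_subcomplex[OF K X Y] tensor_fin_supp_subcomplex[OF K X' Y']
        tensor_chain_maps(1,2)[OF K X Y X' Y' f g] z])

lemma carrier_stable_tensor:
  "carrier (obj (stable_tensor \<eta> R X Y) n) =
    (\<lambda>z. fin_supp (tensor_dbl \<eta> R X Y) n +>\<^bsub>obj (unbounded_tensor \<eta> R X Y) n\<^esub> z) `
      carrier (obj (unbounded_tensor \<eta> R X Y) n)"
  unfolding stable_tensor_quot obj_quot_complex by (rule carrier_quot_module)

lemma chain_map_comp:
  assumes "chain_map R X Y f" "chain_map R Y Z g"
  shows "chain_map R X Z (\<lambda>n x. g n (f n x))"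
  unfolding chain_map_def
  using mod_hom_comp[OF chain_mapD(1)[OF assms(1)] chain_mapD(1)[OF assms(2)]]
    chain_mapD(2)[OF assms(1)] chain_mapD(2)[OF assms(2)] mod_homD(1)[OF chain_mapD(1)[OF assms(1)]]
  by simp

lemma chain_map_ident [simp]: "chain_map R X X (\<lambda>n x. x)"
  by (simp add: chain_map_def)

lemma stable_tensor_map_comp:
  assumes K: "k_algebra K \<eta> R" and X: "is_complex (opp_ring R) X" and Y: "is_complex R Y"
    and X': "is_complex (opp_ring R) X'" and Y': "is_complex R Y'"
    and X'': "is_complex (opp_ring R) X''" and Y'': "is_complex R Y''"
    and f: "chain_map (opp_ring R) X X' f" and g: "chain_map R Y Y' g"
    and f': "chain_map (opp_ring R) X' X'' f'" and g': "chain_map R Y' Y'' g'"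
    and C: "C \<in> carrier (obj (stable_tensor \<eta> R X Y) n)"
  shows "stable_tensor_map \<eta> R X'' Y'' f' g' n (stable_tensor_map \<eta> R X' Y' f g n C) =
    stable_tensor_map \<eta> R X'' Y'' (\<lambda>n x. f' n (f n x)) (\<lambda>n x. g' n (g n x)) n C"
proof -
  obtain z where z: "z \<in> carrier (obj (unbounded_tensor \<eta> R X Y) n)"
    "C = fin_supp (tensor_dbl \<eta> R X Y) n +>\<^bsub>obj (unbounded_tensor \<eta> R X Y) n\<^esub> z"
    using C unfolding carrier_stable_tensor by blast
  have z': "unbounded_tensor_map R X' Y' f g n z \<in> carrier (obj (unbounded_tensor \<eta> R X' Y') n)"
    by (rule mod_homD(1)[OF chain_mapD(1)[OF tensor_chain_maps(1)[OF K X Y X' Y' f g]] z(1)])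
  show ?thesis
    unfolding z(2) stable_tensor_map_coset[OF K X Y X' Y' f g z(1)] stable_tensor_map_coset[OF K X' Y' X'' Y'' f' g' z']
      stable_tensor_map_coset[OF K X Y X'' Y'' chain_map_comp[OF f f'] chain_map_comp[OF g g'] z(1)]
      unbounded_tensor_map_comp[OF X Y X' Y' X'' Y'' f g f' g' z(1)] ..
qed

lemma stable_tensor_map_ident:
  assumes K: "k_algebra K \<eta> R" and X: "is_complex (opp_ring R) X" and Y: "is_complex R Y"
    and C: "C \<in> carrier (obj (stable_tensor \<eta> R X Y) n)"
  shows "stable_tensor_map \<eta> R X Y (\<lambda>n x. x) (\<lambda>n x. x) n C = C"
proof -
  obtain z where z: "z \<in> carrier (obj (unbounded_tensor \<eta> R X Y) n)"
    "C = fin_supp (tensor_dbl \<eta> R X Y) n +>\<^bsub>obj (unbounded_tensor \<eta> R X Y) n\<^esub> z"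
    using C unfolding carrier_stable_tensor by blast
  show ?thesis
    unfolding z(2) stable_tensor_map_coset[OF K X Y X Y chain_map_ident chain_map_ident z(1)]
      unbounded_tensor_map_ident[OF X Y z(1)] ..
qed

text \<open>The factors are changed one at a time, through f' \<otimes> g; in the stable case both
  homotopies are first passed to the quotients.\<close>

lemma tensor_map_homotopic_hclass:
  assumes K: "k_algebra K \<eta> R" and X: "is_complex (opp_ring R) X" and Y: "is_complex R Y"
    and X': "is_complex (opp_ring R) X'" and Y': "is_complex R Y'"
    and f: "chain_map (opp_ring R) X X' f" and f': "chain_map (opp_ring R) X X' f'"
    and g: "chain_map R Y Y' g" and g': "chain_map R Y Y' g'"
    and s: "homotopy (opp_ring R) X X' f f' s" and t: "homotopy R Y Y' g g' t"
  shows "z \<in> cycles (unbounded_tensor \<eta> R X Y) n \<Longrightarrow>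
      hclass (unbounded_tensor \<eta> R X' Y') n (unbounded_tensor_map R X' Y' f' g' n z) =
      hclass (unbounded_tensor \<eta> R X' Y') n (unbounded_tensor_map R X' Y' f g n z)"
    and "C \<in> cycles (stable_tensor \<eta> R X Y) n \<Longrightarrow>
      hclass (stable_tensor \<eta> R X' Y') n (stable_tensor_map \<eta> R X' Y' f' g' n C) =
      hclass (stable_tensor \<eta> R X' Y') n (stable_tensor_map \<eta> R X' Y' f g n C)"
proof -
  let ?U = "unbounded_tensor \<eta> R X Y" and ?U' = "unbounded_tensor \<eta> R X' Y'"
  note c = unbounded_tensor_is_complex[OF K X Y] unbounded_tensor_is_complex[OF K X' Y']
  note sc = stable_tensor_is_complex[OF K X Y] stable_tensor_is_complex[OF K X' Y']
  note sub = tensor_fin_supp_subcomplex[OF K X Y] tensor_fin_supp_subcomplex[OF K X' Y']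
  note m = tensor_chain_maps[OF K X Y X' Y' f g] and m1 = tensor_chain_maps[OF K X Y X' Y' f' g]
    and m2 = tensor_chain_maps[OF K X Y X' Y' f' g']
  obtain S where S: "homotopy K ?U ?U' (unbounded_tensor_map R X' Y' f g) (unbounded_tensor_map R X' Y' f' g) S"
    "\<And>n z. z \<in> fin_supp (tensor_dbl \<eta> R X Y) n \<Longrightarrow> S n z \<in> fin_supp (tensor_dbl \<eta> R X' Y') (n + 1)"
    using tensor_homotopy_left[OF K X Y X' Y' f f' g s] by blast
  obtain T where T: "homotopy K ?U ?U' (unbounded_tensor_map R X' Y' f' g) (unbounded_tensor_map R X' Y' f' g') T"
    "\<And>n z. z \<in> fin_supp (tensor_dbl \<eta> R X Y) n \<Longrightarrow> T n z \<in> fin_supp (tensor_dbl \<eta> R X' Y') (n + 1)"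
    using tensor_homotopy_right[OF K X Y X' Y' f' g g' t] by blast
  show "hclass ?U' n (unbounded_tensor_map R X' Y' f' g' n z) = hclass ?U' n (unbounded_tensor_map R X' Y' f g n z)"
    if "z \<in> cycles ?U n"
    using homotopy_hclass[OF c m(1) S(1) that] homotopy_hclass[OF c m1(1) T(1) that] by simp
  obtain S' where S': "homotopy K (stable_tensor \<eta> R X Y) (stable_tensor \<eta> R X' Y')
      (stable_tensor_map \<eta> R X' Y' f g) (stable_tensor_map \<eta> R X' Y' f' g) S'"
    using quot_homotopy[OF c sub m(1,2) m1(1,2) S] unfolding stable_tensor_quot stable_tensor_map_quot by blast
  obtain T' where T': "homotopy K (stable_tensor \<eta> R X Y) (stable_tensor \<eta> R X' Y')
      (stable_tensor_map \<eta> R X' Y' f' g) (stable_tensor_map \<eta> R X' Y' f' g') T'"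
    using quot_homotopy[OF c sub m1(1,2) m2(1,2) T] unfolding stable_tensor_quot stable_tensor_map_quot by blast
  show "hclass (stable_tensor \<eta> R X' Y') n (stable_tensor_map \<eta> R X' Y' f' g' n C) =
      hclass (stable_tensor \<eta> R X' Y') n (stable_tensor_map \<eta> R X' Y' f g n C)"
    if "C \<in> cycles (stable_tensor \<eta> R X Y) n"
    using homotopy_hclass[OF sc m(3) S' that] homotopy_hclass[OF sc m1(3) T' that] by simp
qed

subsection \<open>Quasi-isomorphisms of bounded below complexes of flat modules\<close>

text \<open>\<open>tensor_row_acyclic\<close> for classes, in the shape of the assumption
  \<open>row\<close> of \<open>tot_cone_acyclic\<close>. There the vertical condition is an
  implication under the quantifiers, so a' and b' have to exist whether or not its premise
  holds.\<close>

lemma tensor_class_row_acyclic: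
  assumes X: "is_complex (opp_ring R) X" and Y: "is_complex (opp_ring R) Y" and f: "chain_map (opp_ring R) X Y f"
    and ac: "cone_acyclic X Y f (\<lambda>n. carrier (obj X n)) (\<lambda>n. carrier (obj Y n))"
    and flat: "\<And>n. flat_module R (obj X n)" "\<And>n. flat_module R (obj Y n)"
    and bounded: "\<And>n. n < 0 \<Longrightarrow> carrier (obj X n) = {\<zero>\<^bsub>obj X n\<^esub>}" "\<And>n. n < 0 \<Longrightarrow> carrier (obj Y n) = {\<zero>\<^bsub>obj Y n\<^esub>}"
    and B: "left_module R B" and B': "left_module R B'" and d: "d \<in> mod_hom R B B'"
    and a: "a \<in> carrier (tensor \<eta> R (obj X n) B)" and b: "b \<in> carrier (tensor \<eta> R (obj Y (n + 1)) B)"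
    and da: "tensor_map R (obj X (n - 1)) B (diff X n) (\<lambda>b. b) a = \<zero>\<^bsub>tensor \<eta> R (obj X (n - 1)) B\<^esub>"
    and fa: "tensor_map R (obj Y n) B (f n) (\<lambda>b. b) a = tensor_map R (obj Y n) B (diff Y (n + 1)) (\<lambda>b. b) b"
  shows "\<exists>a'\<in>carrier (tensor \<eta> R (obj X (n + 1)) B). \<exists>b'\<in>carrier (tensor \<eta> R (obj Y (n + 2)) B).
    tensor_map R (obj X n) B (diff X (n + 1)) (\<lambda>b. b) a' = a \<and>
    tensor_map R (obj Y (n + 1)) B (f (n + 1)) (\<lambda>b. b) a' =
      b \<oplus>\<^bsub>tensor \<eta> R (obj Y (n + 1)) B\<^esub> tensor_map R (obj Y (n + 1)) B (diff Y (n + 2)) (\<lambda>b. b) b' \<and>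
    (tensor_map R (obj X n) B' (\<lambda>a. a) d a = \<zero>\<^bsub>tensor \<eta> R (obj X n) B'\<^esub> \<and>
     tensor_map R (obj Y (n + 1)) B' (\<lambda>a. a) d b = \<zero>\<^bsub>tensor \<eta> R (obj Y (n + 1)) B'\<^esub> \<longrightarrow>
     tensor_map R (obj X (n + 1)) B' (\<lambda>a. a) d a' = \<zero>\<^bsub>tensor \<eta> R (obj X (n + 1)) B'\<^esub> \<and>
     tensor_map R (obj Y (n + 2)) B' (\<lambda>a. a) d b' = \<zero>\<^bsub>tensor \<eta> R (obj Y (n + 2)) B'\<^esub>)"
proof -
  note LX = is_complexD(1)[OF X] and LY = is_complexD(1)[OF Y] and DX = is_complexD(2)[OF X] and DY = is_complexD(2)[OF Y]
    and F = chain_mapD(1)[OF f] and DX1 = diff_succ_mod_hom[OF X] and DY1 = diff_succ_mod_hom[OF Y]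
  have DY2: "diff Y (n + 2) \<in> mod_hom (opp_ring R) (obj Y (n + 2)) (obj Y (n + 1))"
    using DY1[of "n + 1"] by (simp add: add.assoc)
  interpret B: left_module R B by (rule B)
  interpret B': left_module R B' by (rule B')
  obtain x where x: "x \<in> tensor_chains (obj X n) B" "a = tensor_class R (obj X n) B x" using a by (auto simp: carrier_tensor)
  obtain y where y: "y \<in> tensor_chains (obj Y (n + 1)) B" "b = tensor_class R (obj Y (n + 1)) B y" using b by (auto simp: carrier_tensor)
  have ch: "bi_map u v w \<in> tensor_chains C' D'" if "u \<in> mod_hom S C C'" "v \<in> mod_hom T D D'" "w \<in> tensor_chains C D"
    for u v w C C' D D' S T
    using mod_homD(1)[OF that(1)] mod_homD(1)[OF that(2)] by (intro bi_map_chains[OF that(3)]) blast+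
  have dx: "bi_map (diff X n) (\<lambda>b. b) x \<in> tensor_kernel R (obj X (n - 1)) B"
    using da tensor_map_class[OF LX B LX B DX mod_hom_ident x(1)]
      tensor_class_zero_iff[OF LX B ch[OF DX mod_hom_ident x(1)], where \<eta> = \<eta>] x(2) by simp
  have fx: "bi_map (f n) (\<lambda>b. b) x - bi_map (diff Y (n + 1)) (\<lambda>b. b) y \<in> tensor_kernel R (obj Y n) B"
    using fa tensor_map_class[OF LX B LY B F mod_hom_ident x(1)] tensor_map_class[OF LY B LY B DY1 mod_hom_ident y(1)]
      tensor_class_eq_iff[OF LY B ch[OF F mod_hom_ident x(1)] ch[OF DY1 mod_hom_ident y(1)]] x(2) y(2) by simp
  \<comment> \<open>The case without vertical condition is the case of the zero homomorphism.\<close>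
  have main: "\<exists>a'\<in>carrier (tensor \<eta> R (obj X (n + 1)) B). \<exists>b'\<in>carrier (tensor \<eta> R (obj Y (n + 2)) B).
    tensor_map R (obj X n) B (diff X (n + 1)) (\<lambda>b. b) a' = a \<and>
    tensor_map R (obj Y (n + 1)) B (f (n + 1)) (\<lambda>b. b) a' =
      b \<oplus>\<^bsub>tensor \<eta> R (obj Y (n + 1)) B\<^esub> tensor_map R (obj Y (n + 1)) B (diff Y (n + 2)) (\<lambda>b. b) b' \<and>
     tensor_map R (obj X (n + 1)) B' (\<lambda>a. a) e a' = \<zero>\<^bsub>tensor \<eta> R (obj X (n + 1)) B'\<^esub> \<and>
     tensor_map R (obj Y (n + 2)) B' (\<lambda>a. a) e b' = \<zero>\<^bsub>tensor \<eta> R (obj Y (n + 2)) B'\<^esub>"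
    if e: "e \<in> mod_hom R B B'" and va: "tensor_map R (obj X n) B' (\<lambda>a. a) e a = \<zero>\<^bsub>tensor \<eta> R (obj X n) B'\<^esub>"
      and vb: "tensor_map R (obj Y (n + 1)) B' (\<lambda>a. a) e b = \<zero>\<^bsub>tensor \<eta> R (obj Y (n + 1)) B'\<^esub>" for e
  proof -
    have ex: "bi_map (\<lambda>a. a) e x \<in> tensor_kernel R (obj X n) B'"
      using va tensor_map_class[OF LX B LX B' mod_hom_ident e x(1)]
        tensor_class_zero_iff[OF LX B' ch[OF mod_hom_ident e x(1)], where \<eta> = \<eta>] x(2) by simp
    have ey: "bi_map (\<lambda>a. a) e y \<in> tensor_kernel R (obj Y (n + 1)) B'"
      using vb tensor_map_class[OF LY B LY B' mod_hom_ident e y(1)]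
        tensor_class_zero_iff[OF LY B' ch[OF mod_hom_ident e y(1)], where \<eta> = \<eta>] y(2) by simp
    obtain x' y' where x': "x' \<in> tensor_chains (obj X (n + 1)) B" and y': "y' \<in> tensor_chains (obj Y (n + 2)) B"
      and 1: "bi_map (diff X (n + 1)) (\<lambda>b. b) x' - x \<in> tensor_kernel R (obj X n) B"
      and 2: "bi_map (f (n + 1)) (\<lambda>b. b) x' - (y + bi_map (diff Y (n + 2)) (\<lambda>b. b) y') \<in> tensor_kernel R (obj Y (n + 1)) B"
      and 3: "bi_map (\<lambda>a. a) e x' \<in> tensor_kernel R (obj X (n + 1)) B'"
      and 4: "bi_map (\<lambda>a. a) e y' \<in> tensor_kernel R (obj Y (n + 2)) B'"
      using tensor_row_acyclic[OF X Y f ac flat bounded B B' e x(1) y(1) dx fx ex ey] by blast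
    let ?a = "tensor_class R (obj X (n + 1)) B x'" and ?b = "tensor_class R (obj Y (n + 2)) B y'"
    have "tensor_map R (obj X n) B (diff X (n + 1)) (\<lambda>b. b) ?a = a"
      unfolding tensor_map_class[OF LX B LX B DX1 mod_hom_ident x'] x(2)
      using tensor_class_eq_iff[OF LX B ch[OF DX1 mod_hom_ident x'] x(1)] 1 by simp
    moreover have "tensor_map R (obj Y (n + 1)) B (f (n + 1)) (\<lambda>b. b) ?a =
      b \<oplus>\<^bsub>tensor \<eta> R (obj Y (n + 1)) B\<^esub> tensor_map R (obj Y (n + 1)) B (diff Y (n + 2)) (\<lambda>b. b) ?b"
      unfolding tensor_map_class[OF LX B LY B F mod_hom_ident x'] tensor_map_class[OF LY B LY B DY2 mod_hom_ident y'] y(2)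
        tensor_add[OF LY B y(1) ch[OF DY2 mod_hom_ident y']]
      using tensor_class_eq_iff[OF LY B ch[OF F mod_hom_ident x'] tensor_chains_add[OF y(1) ch[OF DY2 mod_hom_ident y']]] 2
      by simp
    moreover have "tensor_map R (obj X (n + 1)) B' (\<lambda>a. a) e ?a = \<zero>\<^bsub>tensor \<eta> R (obj X (n + 1)) B'\<^esub>"
      unfolding tensor_map_class[OF LX B LX B' mod_hom_ident e x']
      using tensor_class_zero_iff[OF LX B' ch[OF mod_hom_ident e x']] 3 by blast
    moreover have "tensor_map R (obj Y (n + 2)) B' (\<lambda>a. a) e ?b = \<zero>\<^bsub>tensor \<eta> R (obj Y (n + 2)) B'\<^esub>"
      unfolding tensor_map_class[OF LY B LY B' mod_hom_ident e y']
      using tensor_class_zero_iff[OF LY B' ch[OF mod_hom_ident e y']] 4 by blast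
    moreover have "?a \<in> carrier (tensor \<eta> R (obj X (n + 1)) B)" "?b \<in> carrier (tensor \<eta> R (obj Y (n + 2)) B)"
      using x' y' by (auto simp: carrier_tensor)
    ultimately show ?thesis by blast
  qed
  show ?thesis
  proof (cases "tensor_map R (obj X n) B' (\<lambda>a. a) d a = \<zero>\<^bsub>tensor \<eta> R (obj X n) B'\<^esub> \<and>
     tensor_map R (obj Y (n + 1)) B' (\<lambda>a. a) d b = \<zero>\<^bsub>tensor \<eta> R (obj Y (n + 1)) B'\<^esub>")
    case True
    then show ?thesis using main[OF d] by blast
  next
    case False
    have z: "(\<lambda>b. \<zero>\<^bsub>B'\<^esub>) \<in> mod_hom R B B'" by (auto simp: mod_hom_def)
    have "tensor_map R (obj X n) B' (\<lambda>a. a) (\<lambda>b. \<zero>\<^bsub>B'\<^esub>) a = \<zero>\<^bsub>tensor \<eta> R (obj X n) B'\<^esub>"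
      by (rule tensor_map_zero[OF LX B LX B' mod_hom_ident z a]) blast
    moreover have "tensor_map R (obj Y (n + 1)) B' (\<lambda>a. a) (\<lambda>b. \<zero>\<^bsub>B'\<^esub>) b = \<zero>\<^bsub>tensor \<eta> R (obj Y (n + 1)) B'\<^esub>"
      by (rule tensor_map_zero[OF LY B LY B' mod_hom_ident z b]) blast
    ultimately show ?thesis using main[OF z] False by blast
  qed
qed

text \<open>\<open>tot_cone_acyclic\<close> gives acyclicity of the cone for all families and, by
  its last clause, for the finitely supported ones. The passage to the stable quotient requires
  both.\<close>

lemma tensor_flat_quasi_iso:
  assumes K: "k_algebra K \<eta> R"
    and X: "is_complex (opp_ring R) X" and Y: "is_complex (opp_ring R) Y" and f: "chain_map (opp_ring R) X Y f"
    and ac: "cone_acyclic X Y f (\<lambda>n. carrier (obj X n)) (\<lambda>n. carrier (obj Y n))"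
    and flat: "\<And>n. flat_module R (obj X n)" "\<And>n. flat_module R (obj Y n)"
    and bounded: "\<And>n. n < 0 \<Longrightarrow> carrier (obj X n) = {\<zero>\<^bsub>obj X n\<^esub>}" "\<And>n. n < 0 \<Longrightarrow> carrier (obj Y n) = {\<zero>\<^bsub>obj Y n\<^esub>}"
    and B: "is_complex R B"
  shows "quasi_iso (unbounded_tensor \<eta> R X B) (unbounded_tensor \<eta> R Y B) (unbounded_tensor_map R Y B f (\<lambda>n x. x))"
    and "quasi_iso (stable_tensor \<eta> R X B) (stable_tensor \<eta> R Y B) (stable_tensor_map \<eta> R Y B f (\<lambda>n x. x))"
proof -
  note LX = is_complexD(1)[OF X] and LY = is_complexD(1)[OF Y] and LB = is_complexD(1)[OF B]
  note dm = tensor_double_complex_map[OF K X B Y B f chain_map_ident]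
  note c = unbounded_tensor_is_complex[OF K X B] unbounded_tensor_is_complex[OF K Y B]
  note m = tensor_chain_maps[OF K X B Y B f chain_map_ident]
  have zero: "carrier (tensor_dbl \<eta> R Z B i j) = {\<zero>\<^bsub>tensor_dbl \<eta> R Z B i j\<^esub>}"
    if Z: "is_complex (opp_ring R) Z" and z: "carrier (obj Z i) = {\<zero>\<^bsub>obj Z i\<^esub>}" for Z :: "('b, 'z) cplx" and i j
  proof -
    note LZ = is_complexD(1)[OF Z]
    interpret T: left_module K "tensor \<eta> R (obj Z i) (obj B j)" by (rule tensor_left_module[OF K LZ LB])
    \<comment> \<open>On the tensor product with a zero module the identity is also the zero
      map.\<close>
    have "t = \<zero>\<^bsub>tensor \<eta> R (obj Z i) (obj B j)\<^esub>" if t: "t \<in> carrier (tensor \<eta> R (obj Z i) (obj B j))" for t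
      using tensor_map_ident[OF LZ LB t] tensor_map_zero[OF LZ LB LZ LB mod_hom_ident mod_hom_ident t] z by simp
    then show ?thesis using T.M.zero_closed unfolding tensor_dbl_def by blast
  qed
  have row: "\<exists>a'\<in>carrier (tensor_dbl \<eta> R X B (i + 1) j). \<exists>b'\<in>carrier (tensor_dbl \<eta> R Y B (i + 2) j).
      tensor_dh R X B (i + 1) j a' = a \<and>
      tensor_dbl_map R Y B f (\<lambda>n x. x) (i + 1) j a' = b \<oplus>\<^bsub>tensor_dbl \<eta> R Y B (i + 1) j\<^esub> tensor_dh R Y B (i + 2) j b' \<and>
      (tensor_dv R X B i j a = \<zero>\<^bsub>tensor_dbl \<eta> R X B i (j - 1)\<^esub> \<and>
       tensor_dv R Y B (i + 1) j b = \<zero>\<^bsub>tensor_dbl \<eta> R Y B (i + 1) (j - 1)\<^esub> \<longrightarrow>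
       tensor_dv R X B (i + 1) j a' = \<zero>\<^bsub>tensor_dbl \<eta> R X B (i + 1) (j - 1)\<^esub> \<and>
       tensor_dv R Y B (i + 2) j b' = \<zero>\<^bsub>tensor_dbl \<eta> R Y B (i + 2) (j - 1)\<^esub>)"
    if a: "a \<in> carrier (tensor_dbl \<eta> R X B i j)" and b: "b \<in> carrier (tensor_dbl \<eta> R Y B (i + 1) j)"
      and da: "tensor_dh R X B i j a = \<zero>\<^bsub>tensor_dbl \<eta> R X B (i - 1) j\<^esub>"
      and fa: "tensor_dbl_map R Y B f (\<lambda>n x. x) i j a = tensor_dh R Y B (i + 1) j b" for i j a b
  proof -
    have e: "i + 1 - 1 = i" "i + 2 - 1 = i + 1" by simp_all
    show ?thesis
      using tensor_class_row_acyclic[OF X Y f ac flat bounded LB LB is_complexD(2)[OF B, of j]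
          a[unfolded tensor_dbl_def] b[unfolded tensor_dbl_def] da[unfolded tensor_dbl_def tensor_dh_def]
          fa[unfolded tensor_dbl_map_def tensor_dh_def e]]
      unfolding tensor_dbl_def tensor_dh_def tensor_dv_def tensor_dbl_map_def e .
  qed
  note tc = double_complex_map.tot_cone_acyclic[OF dm, OF zero[OF X bounded(1)] zero[OF Y bounded(2)] row,
      folded unbounded_tensor_tot unbounded_tensor_map_tot]
  have 1: "cone_acyclic (unbounded_tensor \<eta> R X B) (unbounded_tensor \<eta> R Y B) (unbounded_tensor_map R Y B f (\<lambda>n x. x))
      (\<lambda>n. carrier (obj (unbounded_tensor \<eta> R X B) n)) (\<lambda>n. carrier (obj (unbounded_tensor \<eta> R Y B) n))"
    unfolding cone_acyclic_def
  proof (intro allI ballI impI, elim conjE)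
    fix n a b assume "a \<in> carrier (obj (unbounded_tensor \<eta> R X B) n)" "b \<in> carrier (obj (unbounded_tensor \<eta> R Y B) (n + 1))"
      "diff (unbounded_tensor \<eta> R X B) n a = \<zero>\<^bsub>obj (unbounded_tensor \<eta> R X B) (n - 1)\<^esub>"
      "unbounded_tensor_map R Y B f (\<lambda>n x. x) n a = diff (unbounded_tensor \<eta> R Y B) (n + 1) b"
    from tc[OF _ _ _ _ _ _ this] show "\<exists>a'\<in>carrier (obj (unbounded_tensor \<eta> R X B) (n + 1)).
        \<exists>b'\<in>carrier (obj (unbounded_tensor \<eta> R Y B) (n + 2)). diff (unbounded_tensor \<eta> R X B) (n + 1) a' = a \<and>
          unbounded_tensor_map R Y B f (\<lambda>n x. x) (n + 1) a' =
          b \<oplus>\<^bsub>obj (unbounded_tensor \<eta> R Y B) (n + 1)\<^esub> diff (unbounded_tensor \<eta> R Y B) (n + 2) b'" by blast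
  qed
  have fs: "fin_supp (tensor_dbl \<eta> R Z B) n \<subseteq> carrier (obj (unbounded_tensor \<eta> R Z B) n)" for Z :: "('b, 'z) cplx" and n
    by (auto simp: fin_supp_def unbounded_tensor_tot)
  have 2: "cone_acyclic (unbounded_tensor \<eta> R X B) (unbounded_tensor \<eta> R Y B) (unbounded_tensor_map R Y B f (\<lambda>n x. x))
      (fin_supp (tensor_dbl \<eta> R X B)) (fin_supp (tensor_dbl \<eta> R Y B))"
    unfolding cone_acyclic_def
  proof (intro allI ballI impI, elim conjE)
    fix n a b assume *: "a \<in> fin_supp (tensor_dbl \<eta> R X B) n" "b \<in> fin_supp (tensor_dbl \<eta> R Y B) (n + 1)"
      and d: "diff (unbounded_tensor \<eta> R X B) n a = \<zero>\<^bsub>obj (unbounded_tensor \<eta> R X B) (n - 1)\<^esub>"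
      "unbounded_tensor_map R Y B f (\<lambda>n x. x) n a = diff (unbounded_tensor \<eta> R Y B) (n + 1) b"
    from tc[OF _ _ _ _ _ _ subsetD[OF fs *(1)] subsetD[OF fs *(2)] d] * show "\<exists>a'\<in>fin_supp (tensor_dbl \<eta> R X B) (n + 1).
        \<exists>b'\<in>fin_supp (tensor_dbl \<eta> R Y B) (n + 2). diff (unbounded_tensor \<eta> R X B) (n + 1) a' = a \<and>
          unbounded_tensor_map R Y B f (\<lambda>n x. x) (n + 1) a' =
          b \<oplus>\<^bsub>obj (unbounded_tensor \<eta> R Y B) (n + 1)\<^esub> diff (unbounded_tensor \<eta> R Y B) (n + 2) b'" by blast
  qed
  show "quasi_iso (unbounded_tensor \<eta> R X B) (unbounded_tensor \<eta> R Y B) (unbounded_tensor_map R Y B f (\<lambda>n x. x))"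
    by (rule cone_acyclic_quasi_iso[OF c m(1) 1])
  show "quasi_iso (stable_tensor \<eta> R X B) (stable_tensor \<eta> R Y B) (stable_tensor_map \<eta> R Y B f (\<lambda>n x. x))"
    by (rule cone_acyclic_quasi_iso[OF stable_tensor_is_complex[OF K X B] stable_tensor_is_complex[OF K Y B] m(3)])
      (unfold stable_tensor_quot stable_tensor_map_quot,
       rule quot_cone_acyclic[OF c tensor_fin_supp_subcomplex[OF K X B] tensor_fin_supp_subcomplex[OF K Y B] m(1,2) 1 2])
qed

section \<open>The comparison theorem\<close>

lemma mod_hom_diff:
  assumes "left_module R A" "left_module R B" "f \<in> mod_hom R A B" "g \<in> mod_hom R A B"
  shows "(\<lambda>x. f x \<ominus>\<^bsub>B\<^esub> g x) \<in> mod_hom R A B"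
proof -
  interpret B: left_module R B by fact
  show ?thesis
    using mod_homD[OF assms(3)] mod_homD[OF assms(4)] B.smult_r_distr B.smult_r_minus
    by (auto simp: mod_hom_def B.M.ab_simps)
qed

lemma mod_hom_zero_map: "left_module R A \<Longrightarrow> left_module R B \<Longrightarrow> (\<lambda>x. \<zero>\<^bsub>B\<^esub>) \<in> mod_hom R A B"
proof -
  assume "left_module R B"
  then interpret B: left_module R B .
  show ?thesis by (auto simp: mod_hom_def)
qed

text \<open>The differential is a surjection onto its boundaries, so projectivity applies once the
  target is cut down to them.\<close>

lemma projective_lift_boundaries:
  assumes P: "projective_module R P" and Y: "is_complex R Y" and h: "h \<in> mod_hom R P (obj Y n)"
    and im: "\<And>x. x \<in> carrier P \<Longrightarrow> h x \<in> boundaries Y n"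
  shows "\<exists>k\<in>mod_hom R P (obj Y (n + 1)). \<forall>x\<in>carrier P. diff Y (n + 1) (k x) = h x"
proof (rule projective_module_lift[OF P is_complexD(1)[OF Y]])
  show "left_module R (obj Y n\<lparr>carrier := boundaries Y n\<rparr>)"
    unfolding boundaries_def
    by (rule mod_hom_image_module[OF is_complexD(1)[OF Y] is_complexD(1)[OF Y] diff_succ_mod_hom[OF Y]])
  show "diff Y (n + 1) \<in> mod_hom R (obj Y (n + 1)) (obj Y n\<lparr>carrier := boundaries Y n\<rparr>)"
    using diff_succ_mod_hom[OF Y, of n] by (auto simp: mod_hom_def boundaries_def)
  show "h \<in> mod_hom R P (obj Y n\<lparr>carrier := boundaries Y n\<rparr>)"
    using h im by (auto simp: mod_hom_def)
qed (simp add: boundaries_def)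

lemma left_resolutionD:
  assumes "left_resolution R M X \<epsilon>"
  shows "left_module R M" "is_complex R X" "n < 0 \<Longrightarrow> carrier (obj X n) = {\<zero>\<^bsub>obj X n\<^esub>}"
    "\<epsilon> \<in> mod_hom R (obj X 0) M" "\<epsilon> ` carrier (obj X 0) = carrier M"
    "x \<in> carrier (obj X 0) \<Longrightarrow> \<epsilon> x = \<zero>\<^bsub>M\<^esub> \<longleftrightarrow> x \<in> boundaries X 0"
    "n > 0 \<Longrightarrow> cycles X n = boundaries X n"
proof -
  show 1: "left_module R M" "is_complex R X" "n < 0 \<Longrightarrow> carrier (obj X n) = {\<zero>\<^bsub>obj X n\<^esub>}"
    "\<epsilon> \<in> mod_hom R (obj X 0) M" "\<epsilon> ` carrier (obj X 0) = carrier M"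
    "n > 0 \<Longrightarrow> cycles X n = boundaries X n"
    using assms by (auto simp: left_resolution_def)
  show "x \<in> carrier (obj X 0) \<Longrightarrow> \<epsilon> x = \<zero>\<^bsub>M\<^esub> \<longleftrightarrow> x \<in> boundaries X 0"
    using assms unfolding left_resolution_def by blast
qed

lemma complex_zero_closed: "is_complex R X \<Longrightarrow> \<zero>\<^bsub>obj X n\<^esub> \<in> carrier (obj X n)"
  using is_complexD(1)[of R X n] by (simp add: left_module_def abelian_group_def abelian_monoid.zero_closed)

text \<open>Built upwards from zero in negative degrees. \<open>S\<close> carries along that
  boundaries go to boundaries, which is what makes the next lift possible. Projectivity is asked of
  P alone, since the target is to be a flat resolution.\<close>

lemma left_lift_exists:
  assumes P: "projective_resolution R M P \<pi>" and F: "left_resolution R M' F \<epsilon>" and \<alpha>: "\<alpha> \<in> mod_hom R M M'"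
  shows "\<exists>f. left_lift R P \<pi> F \<epsilon> \<alpha> f"
proof -
  have Pl: "left_resolution R M P \<pi>" and Pp: "\<And>n. projective_module R (obj P n)"
    using P by (auto simp: projective_resolution_def)
  note p = left_resolutionD[OF Pl] and q = left_resolutionD[OF F]
  note LP = is_complexD(1)[OF p(2)] and LF = is_complexD(1)[OF q(2)] and DP = is_complexD(2)[OF p(2)]
  define S where "S n h \<longleftrightarrow> h \<in> mod_hom R (obj P n) (obj F n) \<and> (\<forall>a\<in>boundaries P n. h a \<in> boundaries F n) \<and>
    (n = 0 \<longrightarrow> (\<forall>a\<in>carrier (obj P 0). \<epsilon> (h a) = \<alpha> (\<pi> a)))" for n h
  define T where "T n h k \<longleftrightarrow> (\<forall>a\<in>carrier (obj P (n + 1)). h (diff P (n + 1) a) = diff F (n + 1) (k a))" for n h k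
  have triv: "x = \<zero>\<^bsub>obj F n\<^esub>" if "x \<in> carrier (obj F n)" "n < 0" for x n using q(3)[OF that(2)] that(1) by simp
  have "\<exists>f. (\<forall>n\<le>-1. f n = (\<lambda>a. \<zero>\<^bsub>obj F n\<^esub>)) \<and> (\<forall>n. S n (f n)) \<and> (\<forall>n. T n (f n) (f (n + 1)))"
  proof (rule dependent_int_choice)
    fix n :: int assume n: "n \<le> -1"
    have "\<zero>\<^bsub>obj F n\<^esub> \<in> boundaries F n" using is_submoduleD(2)[OF LF boundaries_submodule(1)[OF q(2)]] .
    then show "S n (\<lambda>a. \<zero>\<^bsub>obj F n\<^esub>)" using n mod_hom_zero_map[OF LP LF] by (simp add: S_def)
  next
    fix n :: int assume n: "n < -1"
    show "T n (\<lambda>a. \<zero>\<^bsub>obj F n\<^esub>) (\<lambda>a. \<zero>\<^bsub>obj F (n + 1)\<^esub>)"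
      using mod_hom_zero[OF LF LF diff_succ_mod_hom[OF q(2)], of n] by (simp add: T_def)
  next
    fix n :: int and h assume n: "-1 \<le> n" and h: "S n h"
    have hm: "h \<in> mod_hom R (obj P n) (obj F n)" and hb: "\<And>a. a \<in> boundaries P n \<Longrightarrow> h a \<in> boundaries F n"
      using h by (auto simp: S_def)
    show "\<exists>k. S (n + 1) k \<and> T n h k"
    proof (cases "n = -1")
      case True
      \<comment> \<open>Degree 0 is lifted along the augmentation, all higher degrees along the
        differential.\<close>
      have "(\<lambda>a. \<alpha> (\<pi> a)) \<in> mod_hom R (obj P 0) M'" by (rule mod_hom_comp[OF p(4) \<alpha>])
      then obtain k where k: "k \<in> mod_hom R (obj P 0) (obj F 0)" "\<forall>a\<in>carrier (obj P 0). \<epsilon> (k a) = \<alpha> (\<pi> a)"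
        using projective_module_lift[OF Pp LF q(1) q(4) q(5)] by blast
      have "k a \<in> boundaries F 0" if a: "a \<in> boundaries P 0" for a
      proof -
        have ac: "a \<in> carrier (obj P 0)" by (rule is_submoduleD(1)[OF LP boundaries_submodule(1)[OF p(2)] a])
        then have "\<epsilon> (k a) = \<zero>\<^bsub>M'\<^esub>" using k(2) p(6)[OF ac] a mod_hom_zero[OF p(1) q(1) \<alpha>] by simp
        then show ?thesis using q(6) mod_homD(1)[OF k(1) ac] by blast
      qed
      moreover have "T n h k"
        unfolding T_def
      proof
        fix a assume a: "a \<in> carrier (obj P (n + 1))"
        have "h (diff P (n + 1) a) \<in> carrier (obj F n)"
          by (rule mod_homD(1)[OF hm mod_homD(1)[OF diff_succ_mod_hom[OF p(2)] a]])
        moreover have "diff F (n + 1) (k a) \<in> carrier (obj F n)"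
          using mod_homD(1)[OF diff_succ_mod_hom[OF q(2), of n], of "k a"] mod_homD(1)[OF k(1)] a True by simp
        ultimately show "h (diff P (n + 1) a) = diff F (n + 1) (k a)" using triv[of "h (diff P (n + 1) a)" n] triv[of "diff F (n + 1) (k a)" n] True by simp
      qed
      ultimately show ?thesis using k True by (auto simp: S_def)
    next
      case False
      then have n0: "n + 1 > 0" using n by simp
      obtain k where k: "k \<in> mod_hom R (obj P (n + 1)) (obj F (n + 1))"
        "\<And>a. a \<in> carrier (obj P (n + 1)) \<Longrightarrow> diff F (n + 1) (k a) = h (diff P (n + 1) a)"
        using projective_lift_boundaries[OF Pp q(2) mod_hom_comp[OF diff_succ_mod_hom[OF p(2)] hm]] hb
        by (force simp: boundaries_def)
      have "k a \<in> boundaries F (n + 1)" if a: "a \<in> boundaries P (n + 1)" for a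
      proof -
        have "a \<in> cycles P (n + 1)" using boundaries_subset_cycles[OF p(2)] a by blast
        then have ac: "a \<in> carrier (obj P (n + 1))" "diff P (n + 1) a = \<zero>\<^bsub>obj P n\<^esub>" by (auto simp: cycles_def)
        have "k a \<in> cycles F (n + 1)"
          using k(2)[OF ac(1)] ac mod_homD(1)[OF k(1)] mod_hom_zero[OF LP LF hm] by (simp add: cycles_def)
        then show ?thesis using q(7)[OF n0] by simp
      qed
      then show ?thesis using k False by (auto simp: S_def T_def)
    qed
  qed
  then obtain f where f: "\<And>n. S n (f n)" "\<And>n. T n (f n) (f (n + 1))" by blast
  have "chain_map R P F f"
    unfolding chain_map_def
  proof (intro allI conjI ballI)
    fix n show "f n \<in> mod_hom R (obj P n) (obj F n)" using f(1)[of n] by (simp add: S_def)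
    fix x assume "x \<in> carrier (obj P n)"
    then show "f (n - 1) (diff P n x) = diff F n (f n x)" using f(2)[of "n - 1"] by (simp add: T_def)
  qed
  then show ?thesis using f(1)[of 0] by (auto simp: left_lift_def S_def)
qed

text \<open>The difference e of g and f is contracted degree by degree: the part that the homotopy
  found so far leaves over takes values in boundaries, and is lifted along the differential.\<close>

lemma left_lift_homotopic:
  assumes P: "projective_resolution R M P \<pi>" and F: "left_resolution R M' F \<epsilon>"
    and f: "left_lift R P \<pi> F \<epsilon> \<alpha> f" and g: "left_lift R P \<pi> F \<epsilon> \<alpha> g"
  shows "\<exists>s. homotopy R P F f g s"
proof -
  have Pl: "left_resolution R M P \<pi>" and Pp: "\<And>n. projective_module R (obj P n)"
    using P by (auto simp: projective_resolution_def)
  note p = left_resolutionD[OF Pl] and q = left_resolutionD[OF F]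
  note LP = is_complexD(1)[OF p(2)] and LF = is_complexD(1)[OF q(2)] and DP = is_complexD(2)[OF p(2)]
    and DF = is_complexD(2)[OF q(2)] and DP1 = diff_succ_mod_hom[OF p(2)] and DF1 = diff_succ_mod_hom[OF q(2)]
  have fc: "chain_map R P F f" and gc: "chain_map R P F g"
    and fg0: "\<And>x. x \<in> carrier (obj P 0) \<Longrightarrow> \<epsilon> (f 0 x) = \<epsilon> (g 0 x)"
    using f g by (auto simp: left_lift_def)
  note FF = chain_mapD(1)[OF fc] and GG = chain_mapD(1)[OF gc]
  define e where "e n x = g n x \<ominus>\<^bsub>obj F n\<^esub> f n x" for n x
  have eh: "e n \<in> mod_hom R (obj P n) (obj F n)" for n
    unfolding e_def by (rule mod_hom_diff[OF LP LF GG FF])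
  have ed: "e n (diff P (n + 1) x) = diff F (n + 1) (e (n + 1) x)" if "x \<in> carrier (obj P (n + 1))" for n x
    unfolding e_def
    using chain_mapD(3)[OF fc that] chain_mapD(3)[OF gc that]
      mod_hom_minus[OF LF LF DF1 mod_homD(1)[OF GG that] mod_homD(1)[OF FF that]] by simp
  \<comment> \<open>On boundaries the term with \<open>diff P\<close> is zero, so the homotopy
    identity reduces to this condition; it ensures that \<open>?h\<close> below is killed by the
    differential.\<close>
  define S where "S n h \<longleftrightarrow> h \<in> mod_hom R (obj P n) (obj F (n + 1)) \<and>
    (\<forall>a\<in>boundaries P n. diff F (n + 1) (h a) = e n a)" for n h
  define T where "T n h k \<longleftrightarrow> (\<forall>a\<in>carrier (obj P (n + 1)).
    e (n + 1) a = diff F (n + 2) (k a) \<oplus>\<^bsub>obj F (n + 1)\<^esub> h (diff P (n + 1) a))" for n h k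
  have triv: "x = y" if "x \<in> carrier (obj F n)" "y \<in> carrier (obj F n)" "n < 0" for x y n
    using q(3)[OF that(3)] that(1,2) by simp
  have "\<exists>s. (\<forall>n\<le>-1. s n = (\<lambda>a. \<zero>\<^bsub>obj F (n + 1)\<^esub>)) \<and> (\<forall>n. S n (s n)) \<and> (\<forall>n. T n (s n) (s (n + 1)))"
  proof (rule dependent_int_choice)
    fix n :: int assume n: "n \<le> -1"
    have "diff F (n + 1) \<zero>\<^bsub>obj F (n + 1)\<^esub> = e n a" if a: "a \<in> boundaries P n" for a
    proof (rule triv[of _ n])
      show "diff F (n + 1) \<zero>\<^bsub>obj F (n + 1)\<^esub> \<in> carrier (obj F n)"
        by (rule mod_homD(1)[OF DF1 complex_zero_closed[OF q(2)]])
      show "e n a \<in> carrier (obj F n)"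
        by (rule mod_homD(1)[OF eh is_submoduleD(1)[OF LP boundaries_submodule(1)[OF p(2)] a]])
    qed (use n in simp)
    then show "S n (\<lambda>a. \<zero>\<^bsub>obj F (n + 1)\<^esub>)" using mod_hom_zero_map[OF LP LF] by (simp add: S_def)
  next
    fix n :: int assume n: "n < -1"
    have n2: "n + 2 - 1 = n + 1" by simp
    have "e (n + 1) a = diff F (n + 2) \<zero>\<^bsub>obj F (n + 2)\<^esub> \<oplus>\<^bsub>obj F (n + 1)\<^esub> \<zero>\<^bsub>obj F (n + 1)\<^esub>"
      if a: "a \<in> carrier (obj P (n + 1))" for a
    proof -
      interpret Fm: left_module R "obj F (n + 1)" by (rule LF)
      have "e (n + 1) a = \<zero>\<^bsub>obj F (n + 1)\<^esub>"
        by (rule triv[OF mod_homD(1)[OF eh a]]) (use n in auto)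
      moreover have "diff F (n + 2) \<zero>\<^bsub>obj F (n + 2)\<^esub> = \<zero>\<^bsub>obj F (n + 1)\<^esub>"
        using mod_hom_zero[OF LF LF DF, of "n + 2"] unfolding n2 .
      ultimately show ?thesis by simp
    qed
    then show "T n (\<lambda>a. \<zero>\<^bsub>obj F (n + 1)\<^esub>) (\<lambda>a. \<zero>\<^bsub>obj F (n + 1 + 1)\<^esub>)" by (simp add: T_def add.assoc)
  next
    fix n :: int and h assume n: "-1 \<le> n" and h: "S n h"
    have hm: "h \<in> mod_hom R (obj P n) (obj F (n + 1))" and hb: "\<And>a. a \<in> boundaries P n \<Longrightarrow> diff F (n + 1) (h a) = e n a"
      using h by (auto simp: S_def)
    interpret Fm: left_module R "obj F (n + 1)" by (rule LF)
    interpret F0: left_module R "obj F n" by (rule LF)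
    let ?h = "\<lambda>a. e (n + 1) a \<ominus>\<^bsub>obj F (n + 1)\<^esub> h (diff P (n + 1) a)"
    have h': "?h \<in> mod_hom R (obj P (n + 1)) (obj F (n + 1))"
      by (rule mod_hom_diff[OF LP LF eh mod_hom_comp[OF DP1 hm]])
    have "?h a \<in> boundaries F (n + 1)" if a: "a \<in> carrier (obj P (n + 1))" for a
    proof -
      have da: "diff P (n + 1) a \<in> boundaries P n" using a by (simp add: boundaries_def)
      have dac: "diff P (n + 1) a \<in> carrier (obj P n)" by (rule mod_homD(1)[OF DP1 a])
      have ec: "e (n + 1) a \<in> carrier (obj F (n + 1))" "h (diff P (n + 1) a) \<in> carrier (obj F (n + 1))"
        using mod_homD(1)[OF eh a] mod_homD(1)[OF hm dac] .
      have hc: "?h a \<in> carrier (obj F (n + 1))" using ec by simp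
      show ?thesis
      proof (cases "n = -1")
        case True
        have b: "h (diff P (n + 1) a) = \<zero>\<^bsub>obj F (n + 1)\<^esub>"
        proof -
          have "diff P (n + 1) a = \<zero>\<^bsub>obj P n\<^esub>" using dac p(3)[of n] True by simp
          then show ?thesis using mod_hom_zero[OF LP LF hm] by simp
        qed
        interpret M': left_module R M' by (rule q(1))
        have a0: "a \<in> carrier (obj P 0)" using a True by simp
        \<comment> \<open>In degree 0, equality of the augmentations of f and g puts e into the
          kernel of \<epsilon>, which consists of boundaries.\<close>
        have "\<epsilon> (e 0 a) = \<epsilon> (g 0 a) \<ominus>\<^bsub>M'\<^esub> \<epsilon> (f 0 a)"
          unfolding e_def by (rule mod_hom_minus[OF LF q(1) q(4) mod_homD(1)[OF GG a0] mod_homD(1)[OF FF a0]])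
        also have "\<dots> = \<zero>\<^bsub>M'\<^esub>" using fg0[OF a0] mod_homD(1)[OF q(4) mod_homD(1)[OF GG a0]] by (simp add: M'.M.minus_self)
        finally have "e 0 a \<in> boundaries F 0" using q(6) mod_homD(1)[OF eh a0] by blast
        moreover have "?h a = e (n + 1) a" using b ec by (simp add: Fm.M.minus_zero)
        ultimately show ?thesis using True by simp
      next
        case False
        have "diff F (n + 1) (?h a) = diff F (n + 1) (e (n + 1) a) \<ominus>\<^bsub>obj F n\<^esub> diff F (n + 1) (h (diff P (n + 1) a))"
          by (rule mod_hom_minus[OF LF LF DF1 ec])
        also have "\<dots> = \<zero>\<^bsub>obj F n\<^esub>"
          unfolding hb[OF da] ed[OF a] using mod_homD(1)[OF DF1 ec(1)] by (rule F0.M.minus_self)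
        finally have "?h a \<in> cycles F (n + 1)" using hc by (simp add: cycles_def)
        then show ?thesis using q(7)[of "n + 1"] n False by simp
      qed
    qed
    then obtain k where k: "k \<in> mod_hom R (obj P (n + 1)) (obj F (n + 1 + 1))"
      "\<And>a. a \<in> carrier (obj P (n + 1)) \<Longrightarrow> diff F (n + 1 + 1) (k a) = ?h a"
      using projective_lift_boundaries[OF Pp q(2) h'] by blast
    have "T n h k"
      unfolding T_def
    proof
      fix a assume a: "a \<in> carrier (obj P (n + 1))"
      have "e (n + 1) a \<in> carrier (obj F (n + 1))" "h (diff P (n + 1) a) \<in> carrier (obj F (n + 1))"
        using mod_homD(1)[OF eh a] mod_homD(1)[OF hm mod_homD(1)[OF DP1 a]] .
      then show "e (n + 1) a = diff F (n + 2) (k a) \<oplus>\<^bsub>obj F (n + 1)\<^esub> h (diff P (n + 1) a)"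
        using k(2)[OF a] by (simp add: add.assoc Fm.M.minus_add_cancel)
    qed
    moreover have "S (n + 1) k"
      unfolding S_def
    proof (intro conjI ballI k(1))
      fix a assume "a \<in> boundaries P (n + 1)"
      then have "a \<in> cycles P (n + 1)" using boundaries_subset_cycles[OF p(2)] by blast
      then have a: "a \<in> carrier (obj P (n + 1))" "diff P (n + 1) a = \<zero>\<^bsub>obj P n\<^esub>" by (auto simp: cycles_def)
      show "diff F (n + 1 + 1) (k a) = e (n + 1) a"
        using k(2)[OF a(1)] a(2) mod_hom_zero[OF LP LF hm] mod_homD(1)[OF eh a(1)] by (simp add: Fm.M.minus_zero)
    qed
    ultimately show "\<exists>k. S (n + 1) k \<and> T n h k" by blast
  qed
  then obtain s where s: "\<And>n. S n (s n)" "\<And>n. T n (s n) (s (n + 1))" by blast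
  have "homotopy R P F f g s"
    unfolding homotopy_def
  proof (intro allI conjI ballI)
    fix n show "s n \<in> mod_hom R (obj P n) (obj F (n + 1))" using s(1)[of n] by (simp add: S_def)
    fix a assume a: "a \<in> carrier (obj P n)"
    interpret Fn: left_module R "obj F n" by (rule LF)
    have n: "n - 1 + 1 = n" "n - 1 + 2 = n + 1" by simp_all
    have "e n a = diff F (n + 1) (s n a) \<oplus>\<^bsub>obj F n\<^esub> s (n - 1) (diff P n a)"
      using s(2)[of "n - 1", unfolded T_def n] a by blast
    moreover have "g n a = f n a \<oplus>\<^bsub>obj F n\<^esub> e n a"
      using mod_homD(1)[OF GG a] mod_homD(1)[OF FF a] unfolding e_def by (simp add: Fn.M.ab_simps)
    ultimately show "g n a = f n a \<oplus>\<^bsub>obj F n\<^esub> (diff F (n + 1) (s n a) \<oplus>\<^bsub>obj F n\<^esub> s (n - 1) (diff P n a))" by simp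
  qed
  then show ?thesis by blast
qed

subsection \<open>Injective resolutions\<close>

text \<open>Dual to lifting along a differential: h is carried over to the image of d, where the
  kernel condition makes it well defined, and is extended from there by injectivity.\<close>

lemma injective_factor:
  assumes E: "injective_module R E" and A: "left_module R A" and B: "left_module R B"
    and d: "d \<in> mod_hom R A B" and h: "h \<in> mod_hom R A E"
    and ker: "\<And>x. x \<in> carrier A \<Longrightarrow> d x = \<zero>\<^bsub>B\<^esub> \<Longrightarrow> h x = \<zero>\<^bsub>E\<^esub>"
  shows "\<exists>k\<in>mod_hom R B E. \<forall>x\<in>carrier A. k (d x) = h x"
proof -
  have LE: "left_module R E" using E by (simp add: injective_module_def)
  interpret A: left_module R A by fact
  interpret B: left_module R B by fact
  interpret E: left_module R E by fact
  note dD = mod_homD[OF d] and hD = mod_homD[OF h]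
  let ?D = "B\<lparr>carrier := d ` carrier A\<rparr>"
  have D: "left_module R ?D" by (rule mod_hom_image_module[OF A B d])
  define s where "s = inv_into (carrier A) d"
  have s: "s y \<in> carrier A" "d (s y) = y" if "y \<in> d ` carrier A" for y
    using that by (auto simp: s_def inv_into_into f_inv_into_f)
  have eq: "h x = h y" if "x \<in> carrier A" "y \<in> carrier A" "d x = d y" for x y
  proof -
    have "d (x \<ominus>\<^bsub>A\<^esub> y) = \<zero>\<^bsub>B\<^esub>" using mod_hom_minus[OF A B d that(1,2)] that dD(1) by (simp add: B.M.minus_self)
    then have "h (x \<ominus>\<^bsub>A\<^esub> y) = \<zero>\<^bsub>E\<^esub>" using ker that by simp
    then show ?thesis using mod_hom_minus[OF A LE h that(1,2)] E.M.minus_eq_zero_iff hD(1) that by simp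
  qed
  have hs: "(\<lambda>y. h (s y)) \<in> mod_hom R ?D E"
    unfolding mod_hom_def
  proof (intro CollectI conjI ballI Pi_I)
    fix y assume "y \<in> carrier ?D"
    then have y: "y \<in> d ` carrier A" by simp
    show "h (s y) \<in> carrier E" using hD(1) s(1)[OF y] .
    {
      fix z assume "z \<in> carrier ?D"
      then have z: "z \<in> d ` carrier A" by simp
      have "y \<oplus>\<^bsub>B\<^esub> z = d (s y \<oplus>\<^bsub>A\<^esub> s z)" using s[OF y] s[OF z] dD(2) by simp
      then have yz: "y \<oplus>\<^bsub>B\<^esub> z \<in> d ` carrier A" using s[OF y] s[OF z] by auto
      have "h (s (y \<oplus>\<^bsub>B\<^esub> z)) = h (s y \<oplus>\<^bsub>A\<^esub> s z)"
        by (rule eq) (use s[OF y] s[OF z] s[OF yz] dD(2) in auto)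
      then show "h (s (y \<oplus>\<^bsub>?D\<^esub> z)) = h (s y) \<oplus>\<^bsub>E\<^esub> h (s z)" using hD(2) s[OF y] s[OF z] by simp
    }
    fix r assume r: "r \<in> carrier R"
    have "r \<odot>\<^bsub>B\<^esub> y = d (r \<odot>\<^bsub>A\<^esub> s y)" using s[OF y] dD(3) r by simp
    then have ry: "r \<odot>\<^bsub>B\<^esub> y \<in> d ` carrier A" using s[OF y] r by auto
    have "h (s (r \<odot>\<^bsub>B\<^esub> y)) = h (r \<odot>\<^bsub>A\<^esub> s y)"
      by (rule eq) (use s[OF y] s[OF ry] dD(3) r in auto)
    then show "h (s (r \<odot>\<^bsub>?D\<^esub> y)) = r \<odot>\<^bsub>E\<^esub> h (s y)" using hD(3) s[OF y] r by simp
  qed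
  have i: "(\<lambda>x. x) \<in> mod_hom R ?D B" by (rule incl_mod_hom) (use dD(1) in auto)
  obtain k where k: "k \<in> mod_hom R B E" "\<forall>y\<in>carrier ?D. k y = h (s y)"
    using injective_module_extend[OF E D B i inj_on_id2 hs] by blast
  have "k (d x) = h x" if "x \<in> carrier A" for x
    using k(2) that s[of "d x"] by (auto intro!: eq)
  then show ?thesis using k(1) by blast
qed

lemma injective_resolutionD:
  assumes "injective_resolution R N I \<iota>"
  shows "left_module R N" "is_complex R I" "n > 0 \<Longrightarrow> carrier (obj I n) = {\<zero>\<^bsub>obj I n\<^esub>}"
    "\<iota> \<in> mod_hom R N (obj I 0)" "inj_on \<iota> (carrier N)" "\<iota> ` carrier N = cycles I 0"
    "n < 0 \<Longrightarrow> cycles I n = boundaries I n" "injective_module R (obj I n)"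
  using assms by (auto simp: injective_resolution_def)

text \<open>Injective resolutions extend towards negative degrees, so the recursion is reflected by
  negating the index.\<close>

lemma dependent_int_choice_down:
  fixes d :: "int \<Rightarrow> 'x"
  assumes P: "\<And>i. i \<ge> m \<Longrightarrow> P i (d i)" and Q: "\<And>i. i > m \<Longrightarrow> Q i (d i) (d (i - 1))"
    and step: "\<And>i x. i \<le> m \<Longrightarrow> P i x \<Longrightarrow> \<exists>y. P (i - 1) y \<and> Q i x y"
  shows "\<exists>f. (\<forall>i. P i (f i)) \<and> (\<forall>i. Q i (f i) (f (i - 1)))"
proof -
  have "\<exists>f. (\<forall>i\<le>-m. f i = d (- i)) \<and> (\<forall>i. P (- i) (f i)) \<and> (\<forall>i. Q (- i) (f i) (f (i + 1)))"
  proof (rule dependent_int_choice)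
    fix i assume "i < -m"
    then show "Q (- i) (d (- i)) (d (- (i + 1)))" using Q[of "- i"] by simp
  next
    fix i x assume "- m \<le> i" "P (- i) x"
    then show "\<exists>y. P (- (i + 1)) y \<and> Q (- i) x y" using step[of "- i" x] by simp
  qed (use P in simp)
  then obtain f where f: "\<And>i. P (- i) (f i)" "\<And>i. Q (- i) (f i) (f (i + 1))" by blast
  show ?thesis
  proof (intro exI[of _ "\<lambda>i. f (- i)"] conjI allI)
    fix i show "P i (f (- i))" using f(1)[of "- i"] by simp
    show "Q i (f (- i)) (f (- (i - 1)))" using f(2)[of "- i"] by (simp add: algebra_simps)
  qed
qed

text \<open>Dual to \<open>left_lift_exists\<close>: now cycles have to go to cycles, so that a
  component followed by the differential vanishes on the kernel of \<open>diff J\<close> and can be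
  factored through it.\<close>

lemma right_lift_exists:
  assumes J: "injective_resolution R N J \<kappa>" and I: "injective_resolution R N' I \<iota>" and \<beta>: "\<beta> \<in> mod_hom R N N'"
  shows "\<exists>f. right_lift R N J \<kappa> I \<iota> \<beta> f"
proof -
  note p = injective_resolutionD[OF J] and q = injective_resolutionD[OF I]
  note LJ = is_complexD(1)[OF p(2)] and LI = is_complexD(1)[OF q(2)]
    and DJ = is_complexD(2)[OF p(2)] and DI = is_complexD(2)[OF q(2)]
  define S where "S n h \<longleftrightarrow> h \<in> mod_hom R (obj J n) (obj I n) \<and> (\<forall>a\<in>cycles J n. h a \<in> cycles I n) \<and>
    (n = 0 \<longrightarrow> (\<forall>x\<in>carrier N. h (\<kappa> x) = \<iota> (\<beta> x)))" for n h
  define T where "T n h k \<longleftrightarrow> (\<forall>a\<in>carrier (obj J n). k (diff J n a) = diff I n (h a))" for n h k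
  have zc: "\<zero>\<^bsub>obj I n\<^esub> \<in> cycles I n" for n
    using complex_zero_closed[OF q(2)] mod_hom_zero[OF LI LI DI] by (simp add: cycles_def)
  \<comment> \<open>Degree 0 extends \<iota> after \<beta> along the injection \<kappa>.\<close>
  obtain h0 where h0: "h0 \<in> mod_hom R (obj J 0) (obj I 0)" "\<And>x. x \<in> carrier N \<Longrightarrow> h0 (\<kappa> x) = \<iota> (\<beta> x)"
    using injective_module_extend[OF q(8) p(1) LJ p(4) p(5) mod_hom_comp[OF \<beta> q(4)]] by blast
  have "\<exists>f. (\<forall>n. S n (f n)) \<and> (\<forall>n. T n (f n) (f (n - 1)))"
  proof (rule dependent_int_choice_down[of 0 S "\<lambda>n. if n = 0 then h0 else (\<lambda>a. \<zero>\<^bsub>obj I n\<^esub>)"])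
    fix n :: int assume n: "n \<ge> 0"
    have "h0 a \<in> cycles I 0" if "a \<in> cycles J 0" for a
    proof -
      from that p(6) obtain x where "x \<in> carrier N" "a = \<kappa> x" by blast
      then have "h0 a = \<iota> (\<beta> x)" "\<beta> x \<in> carrier N'" using h0(2) mod_homD(1)[OF \<beta>] by auto
      then show ?thesis using q(6) by blast
    qed
    then show "S n (if n = 0 then h0 else (\<lambda>a. \<zero>\<^bsub>obj I n\<^esub>))"
      using n h0 zc mod_hom_zero_map[OF LJ LI] by (auto simp: S_def)
  next
    fix n :: int assume n: "n > 0"
    have "(if n - 1 = 0 then h0 else (\<lambda>a. \<zero>\<^bsub>obj I (n - 1)\<^esub>)) (diff J n a) = diff I n \<zero>\<^bsub>obj I n\<^esub>"
      if a: "a \<in> carrier (obj J n)" for a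
    proof -
      have "diff J n a = \<zero>\<^bsub>obj J (n - 1)\<^esub>" using p(3)[OF n] a mod_hom_zero[OF LJ LJ DJ] by auto
      moreover have "diff I n \<zero>\<^bsub>obj I n\<^esub> = \<zero>\<^bsub>obj I (n - 1)\<^esub>" by (rule mod_hom_zero[OF LI LI DI])
      moreover have "h0 \<zero>\<^bsub>obj J 0\<^esub> = \<zero>\<^bsub>obj I 0\<^esub>" by (rule mod_hom_zero[OF LJ LI h0(1)])
      ultimately show ?thesis by auto
    qed
    then show "T n (if n = 0 then h0 else (\<lambda>a. \<zero>\<^bsub>obj I n\<^esub>)) (if n - 1 = 0 then h0 else (\<lambda>a. \<zero>\<^bsub>obj I (n - 1)\<^esub>))"
      using n by (simp add: T_def)
  next
    fix n :: int and h assume n: "n \<le> 0" and h: "S n h"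
    have hm: "h \<in> mod_hom R (obj J n) (obj I n)" and hb: "\<And>a. a \<in> cycles J n \<Longrightarrow> h a \<in> cycles I n"
      using h by (auto simp: S_def)
    have "diff I n (h a) = \<zero>\<^bsub>obj I (n - 1)\<^esub>" if "a \<in> carrier (obj J n)" "diff J n a = \<zero>\<^bsub>obj J (n - 1)\<^esub>" for a
      using hb[of a] that by (simp add: cycles_def)
    then obtain k where k: "k \<in> mod_hom R (obj J (n - 1)) (obj I (n - 1))"
      "\<And>a. a \<in> carrier (obj J n) \<Longrightarrow> k (diff J n a) = diff I n (h a)"
      using injective_factor[OF q(8) LJ LJ DJ mod_hom_comp[OF hm DI]] by blast
    have "k b \<in> cycles I (n - 1)" if b: "b \<in> cycles J (n - 1)" for b
    proof -
      from b obtain a where a: "a \<in> carrier (obj J n)" "b = diff J n a"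
        using p(7)[of "n - 1"] n by (auto simp: boundaries_def)
      have "diff I n (h a) \<in> boundaries I (n - 1)" using mod_homD(1)[OF hm a(1)] by (simp add: boundaries_def)
      then show ?thesis using k(2)[OF a(1)] a(2) boundaries_subset_cycles[OF q(2)] by auto
    qed
    then show "\<exists>k. S (n - 1) k \<and> T n h k" using k n by (auto simp: S_def T_def)
  qed
  then obtain f where f: "\<And>n. S n (f n)" "\<And>n. T n (f n) (f (n - 1))" by blast
  have "chain_map R J I f" using f by (auto simp: chain_map_def S_def T_def)
  then show ?thesis using f(1)[of 0] by (auto simp: right_lift_def S_def)
qed

lemma right_lift_homotopic:
  assumes J: "injective_resolution R N J \<kappa>" and I: "injective_resolution R N' I \<iota>"
    and f: "right_lift R N J \<kappa> I \<iota> \<beta> f" and g: "right_lift R N J \<kappa> I \<iota> \<beta> g"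
  shows "\<exists>s. homotopy R J I f g s"
proof -
  note p = injective_resolutionD[OF J] and q = injective_resolutionD[OF I]
  note LJ = is_complexD(1)[OF p(2)] and LI = is_complexD(1)[OF q(2)]
    and DJ = is_complexD(2)[OF p(2)] and DI = is_complexD(2)[OF q(2)] and DI1 = diff_succ_mod_hom[OF q(2)]
  have fc: "chain_map R J I f" and gc: "chain_map R J I g"
    and fg0: "\<And>x. x \<in> carrier N \<Longrightarrow> f 0 (\<kappa> x) = g 0 (\<kappa> x)"
    using f g by (auto simp: right_lift_def)
  note FF = chain_mapD(1)[OF fc] and GG = chain_mapD(1)[OF gc]
  define e where "e n x = g n x \<ominus>\<^bsub>obj I n\<^esub> f n x" for n x
  have eh: "e n \<in> mod_hom R (obj J n) (obj I n)" for n
    unfolding e_def by (rule mod_hom_diff[OF LJ LI GG FF])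
  have ed: "e (n - 1) (diff J n x) = diff I n (e n x)" if "x \<in> carrier (obj J n)" for n x
    unfolding e_def
    using chain_mapD(2)[OF fc that] chain_mapD(2)[OF gc that]
      mod_hom_minus[OF LI LI DI mod_homD(1)[OF GG that] mod_homD(1)[OF FF that]] by simp
  define S where "S n h \<longleftrightarrow> h \<in> mod_hom R (obj J n) (obj I (n + 1)) \<and>
    (\<forall>a\<in>cycles J n. diff I (n + 1) (h a) = e n a)" for n h
  define T where "T n h k \<longleftrightarrow> (\<forall>a\<in>carrier (obj J n).
    e n a = diff I (n + 1) (h a) \<oplus>\<^bsub>obj I n\<^esub> k (diff J n a))" for n h k
  have "\<exists>s. (\<forall>n. S n (s n)) \<and> (\<forall>n. T n (s n) (s (n - 1)))"
  \<comment> \<open>The homotopy starts with zero: for n \<ge> 0 its target is the zero module in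
    degree n + 1.\<close>
  proof (rule dependent_int_choice_down[of 0 S "\<lambda>n a. \<zero>\<^bsub>obj I (n + 1)\<^esub>"])
    fix n :: int assume n: "n \<ge> 0"
    have "e n a = \<zero>\<^bsub>obj I n\<^esub>" if a: "a \<in> cycles J n" for a
    proof (cases "n = 0")
      case True
      interpret In: left_module R "obj I 0" by (rule LI)
      obtain x where "x \<in> carrier N" "a = \<kappa> x" using a p(6) True by blast
      then show ?thesis
        using fg0[of x] mod_homD(1)[OF GG[of 0], of a] cyclesD(1)[OF a] True by (simp add: e_def In.M.minus_self)
    next
      case False
      then show ?thesis using q(3)[of n] n mod_homD(1)[OF eh cyclesD(1)[OF a]] by simp
    qed
    then show "S n (\<lambda>a. \<zero>\<^bsub>obj I (n + 1)\<^esub>)"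
      using mod_hom_zero[OF LI LI DI1] mod_hom_zero_map[OF LJ LI] by (simp add: S_def)
  next
    fix n :: int assume n: "n > 0"
    have n1: "n - 1 + 1 = n" by simp
    interpret In: left_module R "obj I n" by (rule LI)
    have "e n a = diff I (n + 1) \<zero>\<^bsub>obj I (n + 1)\<^esub> \<oplus>\<^bsub>obj I n\<^esub> \<zero>\<^bsub>obj I n\<^esub>" if "a \<in> carrier (obj J n)" for a
      using mod_homD(1)[OF eh that] q(3)[OF n] mod_hom_zero[OF LI LI DI1] by simp
    then show "T n (\<lambda>a. \<zero>\<^bsub>obj I (n + 1)\<^esub>) (\<lambda>a. \<zero>\<^bsub>obj I (n - 1 + 1)\<^esub>)" unfolding T_def n1 by blast
  next
    fix n :: int and h assume n: "n \<le> 0" and h: "S n h"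
    have hm: "h \<in> mod_hom R (obj J n) (obj I (n + 1))" and hb: "\<And>a. a \<in> cycles J n \<Longrightarrow> diff I (n + 1) (h a) = e n a"
      using h by (auto simp: S_def)
    interpret In: left_module R "obj I n" by (rule LI)
    interpret I1: left_module R "obj I (n - 1)" by (rule LI)
    \<comment> \<open>What the homotopy found so far leaves over of e; by \<open>S\<close> it
      vanishes on cycles, so it factors through \<open>diff J\<close>.\<close>
    let ?h = "\<lambda>a. e n a \<ominus>\<^bsub>obj I n\<^esub> diff I (n + 1) (h a)"
    have h': "?h \<in> mod_hom R (obj J n) (obj I n)"
      by (rule mod_hom_diff[OF LJ LI eh mod_hom_comp[OF hm DI1]])
    have "?h a = \<zero>\<^bsub>obj I n\<^esub>" if "a \<in> carrier (obj J n)" "diff J n a = \<zero>\<^bsub>obj J (n - 1)\<^esub>" for a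
      using hb[of a] that mod_homD(1)[OF eh that(1)] by (simp add: cycles_def In.M.minus_self)
    then obtain k where k: "k \<in> mod_hom R (obj J (n - 1)) (obj I n)"
      "\<And>a. a \<in> carrier (obj J n) \<Longrightarrow> k (diff J n a) = ?h a"
      using injective_factor[OF q(8) LJ LJ DJ h'] by blast
    have "T n h k"
      unfolding T_def
    proof
      fix a assume a: "a \<in> carrier (obj J n)"
      have "e n a \<in> carrier (obj I n)" "diff I (n + 1) (h a) \<in> carrier (obj I n)"
        using mod_homD(1)[OF eh a] mod_homD(1)[OF DI1 mod_homD(1)[OF hm a]] .
      then show "e n a = diff I (n + 1) (h a) \<oplus>\<^bsub>obj I n\<^esub> k (diff J n a)"
        unfolding k(2)[OF a] by (simp add: In.M.ab_simps)
    qed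
    moreover have "S (n - 1) k"
      unfolding S_def
    proof (intro conjI ballI)
      show "k \<in> mod_hom R (obj J (n - 1)) (obj I (n - 1 + 1))" using k(1) by simp
      fix b assume b: "b \<in> cycles J (n - 1)"
      then obtain a where a: "a \<in> carrier (obj J n)" "b = diff J n a"
        using p(7)[of "n - 1"] n by (auto simp: boundaries_def)
      have c: "e n a \<in> carrier (obj I n)" "h a \<in> carrier (obj I (n + 1))" "diff I (n + 1) (h a) \<in> carrier (obj I n)"
        using mod_homD(1)[OF eh a(1)] mod_homD(1)[OF hm a(1)] mod_homD(1)[OF DI1 mod_homD(1)[OF hm a(1)]] .
      have "diff I n (k b) = diff I n (e n a) \<ominus>\<^bsub>obj I (n - 1)\<^esub> diff I n (diff I (n + 1) (h a))"
        unfolding a(2) k(2)[OF a(1)] by (rule mod_hom_minus[OF LI LI DI c(1,3)])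
      also have "\<dots> = e (n - 1) b"
        using is_complexD(4)[OF q(2) c(2)] mod_homD(1)[OF DI c(1)] ed[OF a(1)] a(2) by (simp add: I1.M.minus_zero)
      finally show "diff I (n - 1 + 1) (k b) = e (n - 1) b" by simp
    qed
    ultimately show "\<exists>k. S (n - 1) k \<and> T n h k" by blast
  qed
  then obtain s where s: "\<And>n. S n (s n)" "\<And>n. T n (s n) (s (n - 1))" by blast
  have "homotopy R J I f g s"
    unfolding homotopy_def
  proof (intro allI conjI ballI)
    fix n show "s n \<in> mod_hom R (obj J n) (obj I (n + 1))" using s(1)[of n] by (simp add: S_def)
    fix a assume a: "a \<in> carrier (obj J n)"
    interpret In: left_module R "obj I n" by (rule LI)
    have "e n a = diff I (n + 1) (s n a) \<oplus>\<^bsub>obj I n\<^esub> s (n - 1) (diff J n a)"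
      using s(2)[of n] a by (simp add: T_def)
    moreover have "g n a = f n a \<oplus>\<^bsub>obj I n\<^esub> e n a"
      using mod_homD(1)[OF GG a] mod_homD(1)[OF FF a] unfolding e_def by (simp add: In.M.ab_simps)
    ultimately show "g n a = f n a \<oplus>\<^bsub>obj I n\<^esub> (diff I (n + 1) (s n a) \<oplus>\<^bsub>obj I n\<^esub> s (n - 1) (diff J n a))" by simp
  qed
  then show ?thesis by blast
qed

section \<open>Comparison of projective and flat resolutions\<close>

text \<open>Used where only one factor of a tensor product is deformed.\<close>

lemma homotopy_refl:
  assumes X: "is_complex R X" and Y: "is_complex R Y" and f: "chain_map R X Y f"
  shows "homotopy R X Y f f (\<lambda>n x. \<zero>\<^bsub>obj Y (n + 1)\<^esub>)"
  unfolding homotopy_def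
proof (intro allI conjI ballI)
  fix n show "(\<lambda>x. \<zero>\<^bsub>obj Y (n + 1)\<^esub>) \<in> mod_hom R (obj X n) (obj Y (n + 1))"
    by (rule mod_hom_zero_map[OF is_complexD(1)[OF X] is_complexD(1)[OF Y]])
  interpret Yn: left_module R "obj Y n" by (rule is_complexD(1)[OF Y])
  fix x assume "x \<in> carrier (obj X n)"
  then show "f n x = f n x \<oplus>\<^bsub>obj Y n\<^esub> (diff Y (n + 1) \<zero>\<^bsub>obj Y (n + 1)\<^esub> \<oplus>\<^bsub>obj Y n\<^esub> \<zero>\<^bsub>obj Y (n - 1 + 1)\<^esub>)"
    using mod_homD(1)[OF chain_mapD(1)[OF f]] mod_hom_zero[OF is_complexD(1)[OF Y] is_complexD(1)[OF Y] diff_succ_mod_hom[OF Y]]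
    by simp
qed

text \<open>The maps induced by u and v are inverse to each other on homology classes, because their
  composites are induced by maps homotopic to the identity.\<close>

lemma tensor_homotopy_equivalence_quasi_iso:
  assumes K: "k_algebra K \<eta> R" and X: "is_complex (opp_ring R) X" and Y: "is_complex R Y" and Y': "is_complex R Y'"
    and u: "chain_map R Y Y' u" and v: "chain_map R Y' Y v"
    and vu: "homotopy R Y Y (\<lambda>n x. v n (u n x)) (\<lambda>n x. x) s" and uv: "homotopy R Y' Y' (\<lambda>n x. u n (v n x)) (\<lambda>n x. x) t"
  shows "quasi_iso (unbounded_tensor \<eta> R X Y) (unbounded_tensor \<eta> R X Y') (unbounded_tensor_map R X Y' (\<lambda>n x. x) u)"
    and "quasi_iso (stable_tensor \<eta> R X Y) (stable_tensor \<eta> R X Y') (stable_tensor_map \<eta> R X Y' (\<lambda>n x. x) u)"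
proof -
  note i = chain_map_ident[of "opp_ring R" X] and r = homotopy_refl[OF X X chain_map_ident]
  note mu = tensor_chain_maps[OF K X Y X Y' i u] and mv = tensor_chain_maps[OF K X Y' X Y i v]
  note hvu = tensor_map_homotopic_hclass[OF K X Y X Y i i chain_map_comp[OF u v] chain_map_ident r vu]
    and huv = tensor_map_homotopic_hclass[OF K X Y' X Y' i i chain_map_comp[OF v u] chain_map_ident r uv]
  show "quasi_iso (unbounded_tensor \<eta> R X Y) (unbounded_tensor \<eta> R X Y') (unbounded_tensor_map R X Y' (\<lambda>n x. x) u)"
  proof (rule homotopy_inverse_quasi_iso[OF unbounded_tensor_is_complex[OF K X Y] unbounded_tensor_is_complex[OF K X Y'] mu(1) mv(1)])
    fix n z assume z: "z \<in> cycles (unbounded_tensor \<eta> R X Y) n"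
    show "hclass (unbounded_tensor \<eta> R X Y) n (unbounded_tensor_map R X Y (\<lambda>n x. x) v n (unbounded_tensor_map R X Y' (\<lambda>n x. x) u n z)) =
        hclass (unbounded_tensor \<eta> R X Y) n z"
      using hvu(1)[OF z] unbounded_tensor_map_comp[OF X Y X Y' X Y i u i v cyclesD(1)[OF z]]
        unbounded_tensor_map_ident[OF X Y cyclesD(1)[OF z]] by simp
  next
    fix n z assume z: "z \<in> cycles (unbounded_tensor \<eta> R X Y') n"
    show "hclass (unbounded_tensor \<eta> R X Y') n (unbounded_tensor_map R X Y' (\<lambda>n x. x) u n (unbounded_tensor_map R X Y (\<lambda>n x. x) v n z)) =
        hclass (unbounded_tensor \<eta> R X Y') n z"
      using huv(1)[OF z] unbounded_tensor_map_comp[OF X Y' X Y X Y' i v i u cyclesD(1)[OF z]]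
        unbounded_tensor_map_ident[OF X Y' cyclesD(1)[OF z]] by simp
  qed
  show "quasi_iso (stable_tensor \<eta> R X Y) (stable_tensor \<eta> R X Y') (stable_tensor_map \<eta> R X Y' (\<lambda>n x. x) u)"
  proof (rule homotopy_inverse_quasi_iso[OF stable_tensor_is_complex[OF K X Y] stable_tensor_is_complex[OF K X Y'] mu(3) mv(3)])
    fix n z assume z: "z \<in> cycles (stable_tensor \<eta> R X Y) n"
    show "hclass (stable_tensor \<eta> R X Y) n (stable_tensor_map \<eta> R X Y (\<lambda>n x. x) v n (stable_tensor_map \<eta> R X Y' (\<lambda>n x. x) u n z)) =
        hclass (stable_tensor \<eta> R X Y) n z"
      using hvu(2)[OF z] stable_tensor_map_comp[OF K X Y X Y' X Y i u i v cyclesD(1)[OF z]]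
        stable_tensor_map_ident[OF K X Y cyclesD(1)[OF z]] by simp
  next
    fix n z assume z: "z \<in> cycles (stable_tensor \<eta> R X Y') n"
    show "hclass (stable_tensor \<eta> R X Y') n (stable_tensor_map \<eta> R X Y' (\<lambda>n x. x) u n (stable_tensor_map \<eta> R X Y (\<lambda>n x. x) v n z)) =
        hclass (stable_tensor \<eta> R X Y') n z"
      using huv(2)[OF z] stable_tensor_map_comp[OF K X Y' X Y X Y' i v i u cyclesD(1)[OF z]]
        stable_tensor_map_ident[OF K X Y' cyclesD(1)[OF z]] by simp
  qed
qed

lemma left_lift_comp:
  assumes "left_lift R X \<epsilon> X' \<epsilon>' \<alpha> f" "left_lift R X' \<epsilon>' X'' \<epsilon>'' \<alpha>' g"
  shows "left_lift R X \<epsilon> X'' \<epsilon>'' (\<lambda>x. \<alpha>' (\<alpha> x)) (\<lambda>n x. g n (f n x))"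
  using assms chain_map_comp[of R X X' f X'' g] mod_homD(1)[OF chain_mapD(1)[of R X X' f]]
  by (auto simp: left_lift_def)

lemma right_lift_comp:
  assumes "right_lift R N I \<iota> I' \<iota>' \<beta> f" "right_lift R N' I' \<iota>' I'' \<iota>'' \<beta>' g" "\<beta> \<in> mod_hom R N N'"
  shows "right_lift R N I \<iota> I'' \<iota>'' (\<lambda>x. \<beta>' (\<beta> x)) (\<lambda>n x. g n (f n x))"
  using assms chain_map_comp[of R I I' f I'' g] mod_homD(1)[OF assms(3)]
  by (auto simp: right_lift_def)

text \<open>The map q \<otimes> u is factored through F \<otimes> J. Flatness covers the step from P
  to F, where P counts as a complex of flat modules since projective modules are flat; the step from
  J to I is covered by a homotopy inverse of u, a lift of the identity of N in the other
  direction.\<close>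

lemma comparison_quasi_iso:
  assumes K: "k_algebra K \<eta> R" and P: "projective_resolution (opp_ring R) M P \<pi>" and F: "flat_resolution R M F \<epsilon>"
    and J: "injective_resolution R N J \<kappa>" and I: "injective_resolution R N I \<iota>"
    and q: "left_lift (opp_ring R) P \<pi> F \<epsilon> (\<lambda>x. x) q" and u: "right_lift R N J \<kappa> I \<iota> (\<lambda>x. x) u"
  shows "quasi_iso (unbounded_tensor \<eta> R P J) (unbounded_tensor \<eta> R F I) (unbounded_tensor_map R F I q u)"
    and "quasi_iso (stable_tensor \<eta> R P J) (stable_tensor \<eta> R F I) (stable_tensor_map \<eta> R F I q u)"
proof -
  have Pl: "left_resolution (opp_ring R) M P \<pi>" and Pf: "\<And>n. flat_module R (obj P n)"
    using P projective_module_flat by (auto simp: projective_resolution_def)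
  have Fl: "left_resolution (opp_ring R) M F \<epsilon>" and Ff: "\<And>n. flat_module R (obj F n)"
    using F by (auto simp: flat_resolution_def)
  note cP = left_resolutionD(2)[OF Pl] and cF = left_resolutionD(2)[OF Fl]
    and cJ = injective_resolutionD(2)[OF J] and cI = injective_resolutionD(2)[OF I]
  have qc: "chain_map (opp_ring R) P F q" using q by (simp add: left_lift_def)
  have uc: "chain_map R J I u" using u by (simp add: right_lift_def)
  obtain v where v: "right_lift R N I \<iota> J \<kappa> (\<lambda>x. x) v" using right_lift_exists[OF I J mod_hom_ident] by blast
  have vc: "chain_map R I J v" using v by (simp add: right_lift_def)
  have id: "right_lift R N J \<kappa> J \<kappa> (\<lambda>x. x) (\<lambda>n x. x)" "right_lift R N I \<iota> I \<iota> (\<lambda>x. x) (\<lambda>n x. x)"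
    by (simp_all add: right_lift_def)
  obtain s where s: "homotopy R J J (\<lambda>n x. v n (u n x)) (\<lambda>n x. x) s"
    using right_lift_homotopic[OF J J right_lift_comp[OF u v mod_hom_ident] id(1)] by blast
  obtain t where t: "homotopy R I I (\<lambda>n x. u n (v n x)) (\<lambda>n x. x) t"
    using right_lift_homotopic[OF I I right_lift_comp[OF v u mod_hom_ident] id(2)] by blast
  note q1 = tensor_flat_quasi_iso[OF K cP cF qc left_lift_cone_acyclic[OF Pl Fl q] Pf Ff
      left_resolutionD(3)[OF Pl] left_resolutionD(3)[OF Fl] cJ]
  note q2 = tensor_homotopy_equivalence_quasi_iso[OF K cF cJ cI uc vc s t]
  note m1 = tensor_chain_maps[OF K cP cJ cF cJ qc chain_map_ident] and m2 = tensor_chain_maps[OF K cF cJ cF cI chain_map_ident uc]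
  show "quasi_iso (unbounded_tensor \<eta> R P J) (unbounded_tensor \<eta> R F I) (unbounded_tensor_map R F I q u)"
    by (rule quasi_iso_comp[OF unbounded_tensor_is_complex[OF K cP cJ] unbounded_tensor_is_complex[OF K cF cJ]
          unbounded_tensor_is_complex[OF K cF cI] m1(1) m2(1) q1(1) q2(1)])
      (assumption, assumption, rule unbounded_tensor_map_comp[OF cP cJ cF cJ cF cI qc chain_map_ident chain_map_ident uc, symmetric])
  show "quasi_iso (stable_tensor \<eta> R P J) (stable_tensor \<eta> R F I) (stable_tensor_map \<eta> R F I q u)"
    by (rule quasi_iso_comp[OF stable_tensor_is_complex[OF K cP cJ] stable_tensor_is_complex[OF K cF cJ]
          stable_tensor_is_complex[OF K cF cI] m1(3) m2(3) q1(2) q2(2)])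
      (assumption, assumption, rule stable_tensor_map_comp[OF K cP cJ cF cJ cF cI qc chain_map_ident chain_map_ident uc, symmetric])
qed

lemma homology_map_homology_map:
  assumes X: "is_complex R X" and Y: "is_complex R Y" and Z: "is_complex R Z"
    and f: "chain_map R X Y f" and g: "chain_map R Y Z g" and z: "z \<in> cycles X n"
  shows "homology_map Z n (g n) (homology_map Y n (f n) (hclass X n z)) = hclass Z n (g n (f n z))"
  using homology_map_hclass[OF X Y f cyclesD(1)[OF z]]
    homology_map_hclass[OF Y Z g cyclesD(1)[OF chain_map_cycles[OF X Y f z]]] by simp

text \<open>Both ways around the square are induced by tensor products of composites, and the
  homotopies s and t identify these on homology classes.\<close>

lemma tensor_square_commutes:
  assumes K: "k_algebra K \<eta> R"
    and X: "is_complex (opp_ring R) X" and X': "is_complex (opp_ring R) X'"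
    and Y: "is_complex (opp_ring R) Y" and Y': "is_complex (opp_ring R) Y'"
    and A: "is_complex R A" and A': "is_complex R A'" and B: "is_complex R B" and B': "is_complex R B'"
    and p: "chain_map (opp_ring R) X X' p" and q: "chain_map (opp_ring R) X Y q"
    and q': "chain_map (opp_ring R) X' Y' q'" and f: "chain_map (opp_ring R) Y Y' f"
    and j: "chain_map R A A' j" and u: "chain_map R A B u" and u': "chain_map R A' B' u'" and g: "chain_map R B B' g"
    and s: "homotopy (opp_ring R) X Y' (\<lambda>n x. f n (q n x)) (\<lambda>n x. q' n (p n x)) s"
    and t: "homotopy R A B' (\<lambda>n x. g n (u n x)) (\<lambda>n x. u' n (j n x)) t"
  shows "x \<in> carrier (homology (unbounded_tensor \<eta> R X A) n) \<Longrightarrow>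
      homology_map (unbounded_tensor \<eta> R Y' B') n (unbounded_tensor_map R Y' B' q' u' n)
        (homology_map (unbounded_tensor \<eta> R X' A') n (unbounded_tensor_map R X' A' p j n) x) =
      homology_map (unbounded_tensor \<eta> R Y' B') n (unbounded_tensor_map R Y' B' f g n)
        (homology_map (unbounded_tensor \<eta> R Y B) n (unbounded_tensor_map R Y B q u n) x)"
    and "y \<in> carrier (homology (stable_tensor \<eta> R X A) n) \<Longrightarrow>
      homology_map (stable_tensor \<eta> R Y' B') n (stable_tensor_map \<eta> R Y' B' q' u' n)
        (homology_map (stable_tensor \<eta> R X' A') n (stable_tensor_map \<eta> R X' A' p j n) y) =
      homology_map (stable_tensor \<eta> R Y' B') n (stable_tensor_map \<eta> R Y' B' f g n)
        (homology_map (stable_tensor \<eta> R Y B) n (stable_tensor_map \<eta> R Y B q u n) y)"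
proof -
  note h = tensor_map_homotopic_hclass[OF K X A Y' B' chain_map_comp[OF q f] chain_map_comp[OF p q']
      chain_map_comp[OF u g] chain_map_comp[OF j u'] s t]
  note c = unbounded_tensor_is_complex[OF K] and sc = stable_tensor_is_complex[OF K]
  note mp = tensor_chain_maps[OF K X A X' A' p j] and mq = tensor_chain_maps[OF K X A Y B q u]
    and mq' = tensor_chain_maps[OF K X' A' Y' B' q' u'] and mf = tensor_chain_maps[OF K Y B Y' B' f g]
  {
    assume "x \<in> carrier (homology (unbounded_tensor \<eta> R X A) n)"
    then obtain z where z: "z \<in> cycles (unbounded_tensor \<eta> R X A) n" "x = hclass (unbounded_tensor \<eta> R X A) n z"
      by (auto simp: carrier_homology)
    show "homology_map (unbounded_tensor \<eta> R Y' B') n (unbounded_tensor_map R Y' B' q' u' n)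
        (homology_map (unbounded_tensor \<eta> R X' A') n (unbounded_tensor_map R X' A' p j n) x) =
      homology_map (unbounded_tensor \<eta> R Y' B') n (unbounded_tensor_map R Y' B' f g n)
        (homology_map (unbounded_tensor \<eta> R Y B) n (unbounded_tensor_map R Y B q u n) x)"
      unfolding z(2) homology_map_homology_map[OF c[OF X A] c[OF X' A'] c[OF Y' B'] mp(1) mq'(1) z(1)]
        homology_map_homology_map[OF c[OF X A] c[OF Y B] c[OF Y' B'] mq(1) mf(1) z(1)]
        unbounded_tensor_map_comp[OF X A X' A' Y' B' p j q' u' cyclesD(1)[OF z(1)]]
        unbounded_tensor_map_comp[OF X A Y B Y' B' q u f g cyclesD(1)[OF z(1)]]
      by (rule h(1)[OF z(1)])
  }
  assume "y \<in> carrier (homology (stable_tensor \<eta> R X A) n)"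
  then obtain z where z: "z \<in> cycles (stable_tensor \<eta> R X A) n" "y = hclass (stable_tensor \<eta> R X A) n z"
    by (auto simp: carrier_homology)
  show "homology_map (stable_tensor \<eta> R Y' B') n (stable_tensor_map \<eta> R Y' B' q' u' n)
      (homology_map (stable_tensor \<eta> R X' A') n (stable_tensor_map \<eta> R X' A' p j n) y) =
    homology_map (stable_tensor \<eta> R Y' B') n (stable_tensor_map \<eta> R Y' B' f g n)
      (homology_map (stable_tensor \<eta> R Y B) n (stable_tensor_map \<eta> R Y B q u n) y)"
    unfolding z(2) homology_map_homology_map[OF sc[OF X A] sc[OF X' A'] sc[OF Y' B'] mp(3) mq'(3) z(1)]
      homology_map_homology_map[OF sc[OF X A] sc[OF Y B] sc[OF Y' B'] mq(3) mf(3) z(1)]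
      stable_tensor_map_comp[OF K X A X' A' Y' B' p j q' u' cyclesD(1)[OF z(1)]]
      stable_tensor_map_comp[OF K X A Y B Y' B' q u f g cyclesD(1)[OF z(1)]]
    by (rule h(2)[OF z(1)])
qed

text \<open>A fixed choice of lift makes the comparison isomorphisms depend on the modules and
  resolutions alone, so that naturality can be stated for a single family; another choice would
  differ by a homotopy.\<close>

definition left_comparison ::
    "'r ring \<Rightarrow> ('r, 'p) cplx \<Rightarrow> ('p \<Rightarrow> 'm) \<Rightarrow> ('r, 'f) cplx \<Rightarrow> ('f \<Rightarrow> 'm) \<Rightarrow> int \<Rightarrow> 'p \<Rightarrow> 'f" where
  "left_comparison R P \<pi> F \<epsilon> = (SOME q. left_lift R P \<pi> F \<epsilon> (\<lambda>x. x) q)"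

definition right_comparison ::
    "'r ring \<Rightarrow> ('r, 'n) module \<Rightarrow> ('r, 'j) cplx \<Rightarrow> ('n \<Rightarrow> 'j) \<Rightarrow> ('r, 'i) cplx \<Rightarrow> ('n \<Rightarrow> 'i) \<Rightarrow> int \<Rightarrow> 'j \<Rightarrow> 'i" where
  "right_comparison R N J \<kappa> I \<iota> = (SOME u. right_lift R N J \<kappa> I \<iota> (\<lambda>x. x) u)"

lemma left_lift_comparison:
  assumes "projective_resolution R M P \<pi>" "left_resolution R M F \<epsilon>"
  shows "left_lift R P \<pi> F \<epsilon> (\<lambda>x. x) (left_comparison R P \<pi> F \<epsilon>)"
  unfolding left_comparison_def by (rule someI_ex[OF left_lift_exists[OF assms mod_hom_ident]])

lemma right_lift_comparison:
  assumes "injective_resolution R N J \<kappa>" "injective_resolution R N I \<iota>"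
  shows "right_lift R N J \<kappa> I \<iota> (\<lambda>x. x) (right_comparison R N J \<kappa> I \<iota>)"
  unfolding right_comparison_def by (rule someI_ex[OF right_lift_exists[OF assms mod_hom_ident]])

text \<open>\<Phi> and \<Psi> are chosen before the modules and resolutions, so that the naturality
  squares speak of the same isomorphisms as the first part. The derived modules are computed from P
  and J while I is the injective resolution of the claim, so the change from J to I is covered as
  well.\<close>

theorem proposition2p6:
  fixes K :: "'k ring" and \<eta> :: "'k \<Rightarrow> 'r" and R :: "'r ring"
  assumes "k_algebra K \<eta> R"
  shows "\<exists>(\<Phi> :: ('r, 'm) module \<Rightarrow> ('r, 'p) cplx \<Rightarrow> ('p \<Rightarrow> 'm) \<Rightarrow> ('r, 'f) cplx \<Rightarrow> ('f \<Rightarrow> 'm) \<Rightarrow>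
             ('r, 'n) module \<Rightarrow> ('r, 'j) cplx \<Rightarrow> ('n \<Rightarrow> 'j) \<Rightarrow> ('r, 'i) cplx \<Rightarrow> ('n \<Rightarrow> 'i) \<Rightarrow> int \<Rightarrow>
             (int \<Rightarrow> ('p \<times> 'j \<Rightarrow>\<^sub>0 int) set) set \<Rightarrow> (int \<Rightarrow> ('f \<times> 'i \<Rightarrow>\<^sub>0 int) set) set)
          (\<Psi> :: ('r, 'm) module \<Rightarrow> ('r, 'p) cplx \<Rightarrow> ('p \<Rightarrow> 'm) \<Rightarrow> ('r, 'f) cplx \<Rightarrow> ('f \<Rightarrow> 'm) \<Rightarrow>
             ('r, 'n) module \<Rightarrow> ('r, 'j) cplx \<Rightarrow> ('n \<Rightarrow> 'j) \<Rightarrow> ('r, 'i) cplx \<Rightarrow> ('n \<Rightarrow> 'i) \<Rightarrow> int \<Rightarrow>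
             (int \<Rightarrow> ('p \<times> 'j \<Rightarrow>\<^sub>0 int) set) set set \<Rightarrow> (int \<Rightarrow> ('f \<times> 'i \<Rightarrow>\<^sub>0 int) set) set set).
    (\<forall>M P \<pi> F \<epsilon> N J \<kappa> I \<iota>.
       projective_resolution (opp_ring R) M P \<pi> \<and> flat_resolution R M F \<epsilon> \<and>
       injective_resolution R N J \<kappa> \<and> injective_resolution R N I \<iota> \<longrightarrow>
       (\<forall>i. \<Phi> M P \<pi> F \<epsilon> N J \<kappa> I \<iota> i
              \<in> mod_iso K (unbounded_Tor \<eta> R P J i) (homology (unbounded_tensor \<eta> R F I) i) \<and>
            \<Psi> M P \<pi> F \<epsilon> N J \<kappa> I \<iota> i
              \<in> mod_iso K (stable_Tor \<eta> R P J i) (homology (stable_tensor \<eta> R F I) (i + 1)))) \<and>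
    (\<forall>M P \<pi> F \<epsilon> N J \<kappa> I \<iota> M' P' \<pi>' F' \<epsilon>' N' J' \<kappa>' I' \<iota>' \<alpha> p f \<beta> j g.
       projective_resolution (opp_ring R) M P \<pi> \<and> flat_resolution R M F \<epsilon> \<and>
       injective_resolution R N J \<kappa> \<and> injective_resolution R N I \<iota> \<and>
       projective_resolution (opp_ring R) M' P' \<pi>' \<and> flat_resolution R M' F' \<epsilon>' \<and>
       injective_resolution R N' J' \<kappa>' \<and> injective_resolution R N' I' \<iota>' \<and>
       \<alpha> \<in> mod_hom (opp_ring R) M M' \<and>
       left_lift (opp_ring R) P \<pi> P' \<pi>' \<alpha> p \<and> left_lift (opp_ring R) F \<epsilon> F' \<epsilon>' \<alpha> f \<and>
       \<beta> \<in> mod_hom R N N' \<and>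
       right_lift R N J \<kappa> J' \<kappa>' \<beta> j \<and> right_lift R N I \<iota> I' \<iota>' \<beta> g \<longrightarrow>
       (\<forall>i. (\<forall>x\<in>carrier (unbounded_Tor \<eta> R P J i).
               \<Phi> M' P' \<pi>' F' \<epsilon>' N' J' \<kappa>' I' \<iota>' i (unbounded_Tor_map \<eta> R P' J' p j i x) =
               homology_map (unbounded_tensor \<eta> R F' I') i (unbounded_tensor_map R F' I' f g i)
                 (\<Phi> M P \<pi> F \<epsilon> N J \<kappa> I \<iota> i x)) \<and>
            (\<forall>x\<in>carrier (stable_Tor \<eta> R P J i).
               \<Psi> M' P' \<pi>' F' \<epsilon>' N' J' \<kappa>' I' \<iota>' i (stable_Tor_map \<eta> R P' J' p j i x) =
               homology_map (stable_tensor \<eta> R F' I') (i + 1)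
                 (stable_tensor_map \<eta> R F' I' f g (i + 1))
                 (\<Psi> M P \<pi> F \<epsilon> N J \<kappa> I \<iota> i x))))"
proof (intro exI conjI allI impI ballI)
  let ?q = "\<lambda>P \<pi> F \<epsilon>. left_comparison (opp_ring R) P \<pi> F \<epsilon>" and ?u = "\<lambda>N J \<kappa> I \<iota>. right_comparison R N J \<kappa> I \<iota>"
  note K = assms
  let ?\<Phi> = "\<lambda>M P \<pi> F \<epsilon> N J \<kappa> I \<iota> i. homology_map (unbounded_tensor \<eta> R F I) i
    (unbounded_tensor_map R F I (left_comparison (opp_ring R) P \<pi> F \<epsilon>) (right_comparison R N J \<kappa> I \<iota>) i)"
  let ?\<Psi> = "\<lambda>M P \<pi> F \<epsilon> N J \<kappa> I \<iota> i. homology_map (stable_tensor \<eta> R F I) (i + 1)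
    (stable_tensor_map \<eta> R F I (left_comparison (opp_ring R) P \<pi> F \<epsilon>) (right_comparison R N J \<kappa> I \<iota>) (i + 1))"
  {
    fix M :: "('r, 'm) module" and P :: "('r, 'p) cplx" and \<pi> and F :: "('r, 'f) cplx" and \<epsilon>
      and N :: "('r, 'n) module" and J :: "('r, 'j) cplx" and \<kappa> and I :: "('r, 'i) cplx" and \<iota> i
    assume "projective_resolution (opp_ring R) M P \<pi> \<and> flat_resolution R M F \<epsilon> \<and>
       injective_resolution R N J \<kappa> \<and> injective_resolution R N I \<iota>"
    then have P: "projective_resolution (opp_ring R) M P \<pi>" and F: "flat_resolution R M F \<epsilon>"
      and J: "injective_resolution R N J \<kappa>" and I: "injective_resolution R N I \<iota>" by auto
    have Fl: "left_resolution (opp_ring R) M F \<epsilon>" using F by (simp add: flat_resolution_def)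
    have Pl: "left_resolution (opp_ring R) M P \<pi>" using P by (simp add: projective_resolution_def)
    note q = left_lift_comparison[OF P Fl] and u = right_lift_comparison[OF J I]
    note cP = left_resolutionD(2)[OF Pl] and cF = left_resolutionD(2)[OF Fl]
      and cJ = injective_resolutionD(2)[OF J] and cI = injective_resolutionD(2)[OF I]
    note m = tensor_chain_maps[OF K cP cJ cF cI conjunct1[OF q[unfolded left_lift_def]] conjunct1[OF u[unfolded right_lift_def]]]
    note qi = comparison_quasi_iso[OF K P F J I q u]
    show "?\<Phi> M P \<pi> F \<epsilon> N J \<kappa> I \<iota> i \<in> mod_iso K (unbounded_Tor \<eta> R P J i) (homology (unbounded_tensor \<eta> R F I) i)"
      unfolding unbounded_Tor_def
      by (rule quasi_iso_mod_iso[OF unbounded_tensor_is_complex[OF K cP cJ] unbounded_tensor_is_complex[OF K cF cI] m(1) qi(1)])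
    show "?\<Psi> M P \<pi> F \<epsilon> N J \<kappa> I \<iota> i \<in> mod_iso K (stable_Tor \<eta> R P J i) (homology (stable_tensor \<eta> R F I) (i + 1))"
      unfolding stable_Tor_def
      by (rule quasi_iso_mod_iso[OF stable_tensor_is_complex[OF K cP cJ] stable_tensor_is_complex[OF K cF cI] m(3) qi(2)])
  }
  fix M :: "('r, 'm) module" and P :: "('r, 'p) cplx" and \<pi> and F :: "('r, 'f) cplx" and \<epsilon>
    and N :: "('r, 'n) module" and J :: "('r, 'j) cplx" and \<kappa> and I :: "('r, 'i) cplx" and \<iota>
    and M' :: "('r, 'm) module" and P' :: "('r, 'p) cplx" and \<pi>' and F' :: "('r, 'f) cplx" and \<epsilon>'
    and N' :: "('r, 'n) module" and J' :: "('r, 'j) cplx" and \<kappa>' and I' :: "('r, 'i) cplx" and \<iota>' \<alpha> p f \<beta> j g i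
  assume *: "projective_resolution (opp_ring R) M P \<pi> \<and> flat_resolution R M F \<epsilon> \<and>
       injective_resolution R N J \<kappa> \<and> injective_resolution R N I \<iota> \<and>
       projective_resolution (opp_ring R) M' P' \<pi>' \<and> flat_resolution R M' F' \<epsilon>' \<and>
       injective_resolution R N' J' \<kappa>' \<and> injective_resolution R N' I' \<iota>' \<and>
       \<alpha> \<in> mod_hom (opp_ring R) M M' \<and>
       left_lift (opp_ring R) P \<pi> P' \<pi>' \<alpha> p \<and> left_lift (opp_ring R) F \<epsilon> F' \<epsilon>' \<alpha> f \<and>
       \<beta> \<in> mod_hom R N N' \<and>
       right_lift R N J \<kappa> J' \<kappa>' \<beta> j \<and> right_lift R N I \<iota> I' \<iota>' \<beta> g"
  then have P: "projective_resolution (opp_ring R) M P \<pi>" and P': "projective_resolution (opp_ring R) M' P' \<pi>'"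
    and J: "injective_resolution R N J \<kappa>" and I: "injective_resolution R N I \<iota>"
    and J': "injective_resolution R N' J' \<kappa>'" and I': "injective_resolution R N' I' \<iota>'"
    and p: "left_lift (opp_ring R) P \<pi> P' \<pi>' \<alpha> p" and f: "left_lift (opp_ring R) F \<epsilon> F' \<epsilon>' \<alpha> f"
    and \<beta>: "\<beta> \<in> mod_hom R N N'"
    and j: "right_lift R N J \<kappa> J' \<kappa>' \<beta> j" and g: "right_lift R N I \<iota> I' \<iota>' \<beta> g" by auto
  have Fl: "left_resolution (opp_ring R) M F \<epsilon>" "left_resolution (opp_ring R) M' F' \<epsilon>'"
    using * by (auto simp: flat_resolution_def)
  have Pl: "left_resolution (opp_ring R) M P \<pi>" "left_resolution (opp_ring R) M' P' \<pi>'"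
    using P P' by (auto simp: projective_resolution_def)
  note q = left_lift_comparison[OF P Fl(1)] and q' = left_lift_comparison[OF P' Fl(2)]
    and u = right_lift_comparison[OF J I] and u' = right_lift_comparison[OF J' I']
  \<comment> \<open>Both composites lift \<alpha> from P to F', one through F and one through P';
    lifts from a projective resolution are unique up to homotopy.\<close>
  obtain s where s: "homotopy (opp_ring R) P F' (\<lambda>n x. f n (?q P \<pi> F \<epsilon> n x)) (\<lambda>n x. ?q P' \<pi>' F' \<epsilon>' n (p n x)) s"
    using left_lift_homotopic[OF P Fl(2) left_lift_comp[OF q f] left_lift_comp[OF p q']] by blast
  \<comment> \<open>Likewise both composites lift \<beta> from J to I', through I and through
    J'.\<close>
  obtain t where t: "homotopy R J I' (\<lambda>n x. g n (?u N J \<kappa> I \<iota> n x)) (\<lambda>n x. ?u N' J' \<kappa>' I' \<iota>' n (j n x)) t"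
    using right_lift_homotopic[OF J I' right_lift_comp[OF u g mod_hom_ident] right_lift_comp[OF j u' \<beta>]] by blast
  note sq = tensor_square_commutes[OF K left_resolutionD(2)[OF Pl(1)] left_resolutionD(2)[OF Pl(2)]
      left_resolutionD(2)[OF Fl(1)] left_resolutionD(2)[OF Fl(2)]
      injective_resolutionD(2)[OF J] injective_resolutionD(2)[OF J'] injective_resolutionD(2)[OF I] injective_resolutionD(2)[OF I']
      conjunct1[OF p[unfolded left_lift_def]] conjunct1[OF q[unfolded left_lift_def]]
      conjunct1[OF q'[unfolded left_lift_def]] conjunct1[OF f[unfolded left_lift_def]]
      conjunct1[OF j[unfolded right_lift_def]] conjunct1[OF u[unfolded right_lift_def]]
      conjunct1[OF u'[unfolded right_lift_def]] conjunct1[OF g[unfolded right_lift_def]] s t]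
  show "?\<Phi> M' P' \<pi>' F' \<epsilon>' N' J' \<kappa>' I' \<iota>' i (unbounded_Tor_map \<eta> R P' J' p j i x) =
      homology_map (unbounded_tensor \<eta> R F' I') i (unbounded_tensor_map R F' I' f g i) (?\<Phi> M P \<pi> F \<epsilon> N J \<kappa> I \<iota> i x)"
    if "x \<in> carrier (unbounded_Tor \<eta> R P J i)" for x
    using sq(1)[OF that[unfolded unbounded_Tor_def]] unfolding unbounded_Tor_map_def .
  show "?\<Psi> M' P' \<pi>' F' \<epsilon>' N' J' \<kappa>' I' \<iota>' i (stable_Tor_map \<eta> R P' J' p j i x) =
      homology_map (stable_tensor \<eta> R F' I') (i + 1) (stable_tensor_map \<eta> R F' I' f g (i + 1)) (?\<Psi> M P \<pi> F \<epsilon> N J \<kappa> I \<iota> i x)"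
    if "x \<in> carrier (stable_Tor \<eta> R P J i)" for x
    using sq(2)[OF that[unfolded stable_Tor_def]] unfolding stable_Tor_map_def .
qed

end
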